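(* In the fixed setting described in the context, let $\pi:=\pi_0^\infty:X_\infty\to X_0=[0,1]$. For every Banach space $B$ with the Radon-Nikod\'ym property and every Lipschitz map $f:X_\infty\to B$, for $\mu_\infty$-almost every $x\in X_\infty$, $f$ is differentiable at $x$ with respect to $\pi$ along the sequence of scales $(r_i(x))_{i=0}^\infty$. More specifically, for almost every $x\in D$ and any $R\ge1$, $$\limsup_{i\to\infty}\ \sup_{y\in B_{Rr_i(x)}(x)}\frac{\|f(y)-f(x)-f'(x)(\pi(y)-\pi(x))\|}{r_i(x)}=0,$$ where $f'$ is the derivative of $f$ defined in the context and $B_r(x)$ denotes a ball in $(X_\infty,d)$.
   Context: Thick families. A $p$-$q$ geodesic is an isometric embedding of a compact interval sending the left endpoint to $p$ and the right endpoint to $q$. A nonempty family $\Gamma$ of $p$-$q$ geodesics with common domain $[a,b]$ is concatenation closed if whenever $\gamma_1,\gamma_2\in\Gamma$, $c\in[a,b]$, $\gamma_1(c)=\gamma_2(c)$, the curve equal to $\gamma_1$ on $[a,c]$ and $\gamma_2$ on $[c,b]$ is in $\Gamma$. It is a thick family of geodesics if moreover there is $\alpha'>0$ such that for every $\gamma\in\Gamma$ and $a=t_0<\dots<t_k=b$ there exist $a=q_0<s_1<q_1<\dots<s_j<q_j=b$ and $\tilde\gamma\in\Gamma$ with $\{t_i\}\subseteq\{q_i\}$, $\gamma(q_i)=\tilde\gamma(q_i)$ for all $i$, and $\sum_{i=1}^jd(\gamma(s_i),\tilde\gamma(s_i))\ge\alpha'$. Graphs. A finite metric graph is a metric space $X$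 with a finite vertex set $V(X)\subseteq X$ and a finite set $E(X)$ of subsets (edges) covering $X$, each edge isometric to a compact interval whose endpoints (and no interior points) correspond to vertices, two distinct edges being disjoint or meeting in one or two vertices. It is directed if each edge has a chosen order (source, sink) of its two vertices. $|A|$ denotes length measure of $A$. Thick inverse system. A sequence $X_0\subseteq X_1\subseteq\cdots$ of finite directed metric graphs, all carrying restrictions of one metric $d$, with maps $\pi_i^{i+1}:X_{i+1}\to X_i$, such that for all $i\ge0$: (A1) $X_0$ has two vertices $0,1$ and one edge, of length $1$, directed from $0$ to $1$; it is identified with $[0,1]$. (A2) There is a directed subdivision $X_i'$ of $X_i$ such that for each $e'\in E(X_i')$, $(\pi_i^{i+1})^{-1}(e')=e'\cup e'_{\rm op}$, where $e'$ and $e'_{\rm op}$ are edges of $X_{i+1}$ and either $e'_{\rm op}=e'$ (the preimage is then called an interval) or $e'_{\rm op}$ has the same source and sink as $e'$ and its interior is disjoint from the rest of $X_{i+1}$ (the preimage is then called a circle). A subedge $e'\in E(X_i')$ of $e\in E(X_i)$ sharing a vertex with $e$ is called terminal, and the preimage of a terminal subedge is an interval, called a terminal interval of $X_{i+1}$. (A3) Every directed edge path of $X_i$ is isometric (for $d$) to a compact interval. (A4) $\pi_i^{i+1}$ is the identity on each $e'\in E(X_i')$ and maps $e'_{\rm op}$ isometrically onto $e'$. For $p\in e'$, $p^{\rm op}$ is the unique point of $e'_{\rm op}$ with $\pi_i^{i+1}(p^{\rm op})=p$. (A5) There is $\alpha>0$ independent of $i$ with $\max_{p\in e'}d(p,p^{\rm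 op})\ge\alpha|e'|$ for every $e'\in E(X_i')$ whose preimage is a circle. (A6) There is $\beta>0$ independent of $i$ such that for every directed edge path $P$ from $0$ to $1$ in $X_i'$, the edges $e'\subseteq P$ whose preimage is a circle have total length at least $\beta$. The system carries probability measures $\mu_i$: $\mu_0$ is length measure; $\mu_{i+1}$ is a constant multiple of length measure on each edge, with $\mu_{i+1}(e')=\mu_i(e')$ if $e'_{\rm op}=e'$ and $\mu_{i+1}(e')=\mu_{i+1}(e'_{\rm op})=\frac12\mu_i(e')$ otherwise. Parameters. $\Delta_i^E=\min_{e\in E(X_i)}|e|$, $\delta_i^E=\max_{e'\in E(X_i')}|e'|/\Delta_i^E$. $\Delta_i^d$ is the minimum of $d(e',X_i\setminus e)$ over $e\in E(X_i)$ and nonterminal subedges $e'\in E(X_i')$ of $e$ (distance to $\emptyset$ being $+\infty$), and $\delta_i^d=\max|e'|/\Delta_i^d$ over nonterminal $e'\in E(X_i')$. Fixed setting. $(M,d)$ is a complete metric space containing a thick family of geodesics; $(\delta_i')$ is a positive sequence decreasing to $0$ with $\delta_0'<\frac12$ and $\prod_{i=0}^\infty\frac1{1-2\delta_i'}\le L<\infty$; and a thick inverse system contained in $M$ (all $X_i\subseteq M$, with the metric $d$) with $\delta_i^E,\delta_i^d\le\delta_i'$ for all $i$ is fixed. $\pi_i^j:X_j\to X_i$ are the compositions; they are $L$-Lipschitz. $X_\infty$ is the closure of $\bigcup_iX_i$ in $M$ (a compact set), $\pi_i^\infty:X_\infty\to X_i$ are the continuous ($L$-Lipschitz) extensions of the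 $\pi_i^j$, and $\mu_\infty$ is the unique Borel probability measure on $X_\infty$ with $(\pi_i^\infty)_\#\mu_\infty=\mu_i$ for all $i$. The basepoint of $X_\infty$ and of each $X_i$ is $0\in X_0$. Deep points and scales. $D$ is the set of $x\in X_\infty$ such that for all sufficiently large $i$, $\pi_{i+1}^\infty(x)$ does not belong to a terminal interval of $X_{i+1}$; $D$ has full $\mu_\infty$-measure. For $x\in D$, $\pi_i^\infty(x)$ is never a vertex of $X_i$, $e_i(x)$ is the unique edge of $X_i$ containing it, and $r_i(x)=|e_i(x)|$. RNP and derivative. $B$ has the Radon-Nikod\'ym property (RNP) if every Lipschitz map $\mathbb R\to B$ is differentiable a.e. The conditional expectation $\mathbb E_i^\infty:L^1(\mu_\infty;B)\to L^1(\mu_i;B)$ is characterized by $\int\phi\,\mathbb E_i^\infty(h)\,d\mu_i=\int(\phi\circ\pi_i^\infty)h\,d\mu_\infty$ for $\phi\in L^\infty(\mu_i)$; it sends Lipschitz functions to Lipschitz functions. A Lipschitz $h_i:X_i\to B$ has, $\mu_i$-a.e., the derivative $h_i'(x)=\lim_{t\to0}\frac{h_i(x+t)-h_i(x)}t$, computed by identifying the directed edge containing $x$ with an interval. For Lipschitz $f:X_\infty\to B$ with $f(0)=0$, $f'\in L^\infty(\mu_\infty;B)$ is the $\mu_\infty$-a.e. limit of $(\mathbb E_i^\infty(f))'\circ\pi_i^\infty$ as $i\to\infty$ (which exists); in general $f':=(f-f(0))'$. Vectors $b\in B$ are identified with linear maps $t\mapsto tb$. Differentiability at $x$ with respect to $\pi$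 along $(r_i(x))$ means that the displayed limsup vanishes for every $R\ge1$. *)

theory Defs
  imports "HOL-Analysis.Analysis" "HOL-Probability.Probability"
begin

section \<open>Geodesics and thick families\<close>

definition geodesic :: "'m::metric_space \<Rightarrow> 'm \<Rightarrow> real \<Rightarrow> real \<Rightarrow> (real \<Rightarrow> 'm) \<Rightarrow> bool" where
  "geodesic p q a b \<gamma> \<longleftrightarrow> a \<le> b \<and> \<gamma> a = p \<and> \<gamma> b = q \<and>
     (\<forall>s\<in>{a..b}. \<forall>t\<in>{a..b}. dist (\<gamma> s) (\<gamma> t) = \<bar>s - t\<bar>)"

text \<open>A curve with domain \<open>{a..b}\<close> is represented by a function on the reals whose values outside
  \<open>{a..b}\<close> carry no meaning. A family contains a curve if one of its members agrees with
  the curve on \<open>{a..b}\<close>.\<close>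

definition concatenation_closed :: "real \<Rightarrow> real \<Rightarrow> (real \<Rightarrow> 'm) set \<Rightarrow> bool" where
  "concatenation_closed a b \<Gamma> \<longleftrightarrow>
     (\<forall>\<gamma>1\<in>\<Gamma>. \<forall>\<gamma>2\<in>\<Gamma>. \<forall>c\<in>{a..b}. \<gamma>1 c = \<gamma>2 c \<longrightarrow>
        (\<exists>\<gamma>\<in>\<Gamma>. (\<forall>t\<in>{a..c}. \<gamma> t = \<gamma>1 t) \<and> (\<forall>t\<in>{c..b}. \<gamma> t = \<gamma>2 t)))"

definition thick_family ::
  "'m::metric_space \<Rightarrow> 'm \<Rightarrow> real \<Rightarrow> real \<Rightarrow> (real \<Rightarrow> 'm) set \<Rightarrow> bool" where
  "thick_family p q a b \<Gamma> \<longleftrightarrow>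
     \<Gamma> \<noteq> {} \<and> (\<forall>\<gamma>\<in>\<Gamma>. geodesic p q a b \<gamma>) \<and> concatenation_closed a b \<Gamma> \<and>
     (\<exists>\<alpha>>0. \<forall>\<gamma>\<in>\<Gamma>. \<forall>k (t :: nat \<Rightarrow> real).
        t 0 = a \<and> t k = b \<and> (\<forall>i<k. t i < t (Suc i)) \<longrightarrow>
        (\<exists>j (s :: nat \<Rightarrow> real) (q :: nat \<Rightarrow> real). \<exists>\<eta>\<in>\<Gamma>.
           q 0 = a \<and> q j = b \<and> (\<forall>i\<in>{1..j}. q (i - 1) < s i \<and> s i < q i) \<and>
           t ` {..k} \<subseteq> q ` {..j} \<and>
           (\<forall>i\<le>j. \<gamma> (q i) = \<eta> (q i)) \<and>
           (\<Sum>i=1..j. dist (\<gamma> (s i)) (\<eta> (s i))) \<ge> \<alpha>))"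


section \<open>Finite directed metric graphs inside a metric space\<close>

record 'm dgraph =
  points :: "'m set"
  verts :: "'m set"
  edges :: "'m set set"
  src :: "'m set \<Rightarrow> 'm"
  snk :: "'m set \<Rightarrow> 'm"

text \<open>Edges have positive length because their two ends correspond to two vertices. Distinct edges
  meet only in vertices, and an edge contains just two of these.\<close>

definition directed_metric_graph :: "'m::metric_space dgraph \<Rightarrow> bool" where
  "directed_metric_graph G \<longleftrightarrow>
     finite (verts G) \<and> verts G \<subseteq> points G \<and> finite (edges G) \<and> \<Union>(edges G) = points G \<and>
     (\<forall>e\<in>edges G.
        (\<exists>l>0. \<exists>\<gamma>. geodesic (src G e) (snk G e) 0 l \<gamma> \<and> \<gamma> ` {0..l} = e) \<and>
        e \<inter> verts G = {src G e, snk G e}) \<and>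
     (\<forall>e1\<in>edges G. \<forall>e2\<in>edges G. e1 \<noteq> e2 \<longrightarrow> e1 \<inter> e2 \<subseteq> verts G)"

text \<open>The isometry of an edge \<open>e\<close> with the interval \<open>{0..elen G e}\<close> that respects the direction is
  \<open>ecoord G e\<close>; its inverse is \<open>epoint G e\<close>.\<close>

definition ecoord :: "'m::metric_space dgraph \<Rightarrow> 'm set \<Rightarrow> 'm \<Rightarrow> real" where
  "ecoord G e x = dist (src G e) x"

definition epoint :: "'m::metric_space dgraph \<Rightarrow> 'm set \<Rightarrow> real \<Rightarrow> 'm" where
  "epoint G e t = (THE x. x \<in> e \<and> ecoord G e x = t)"

definition elen :: "'m::metric_space dgraph \<Rightarrow> 'm set \<Rightarrow> real" where
  "elen G e = dist (src G e) (snk G e)"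

text \<open>Length measure: Lebesgue measure transported to the edges.\<close>

definition glength :: "'m::metric_space dgraph \<Rightarrow> 'm set \<Rightarrow> ennreal" where
  "glength G A = (\<Sum>e\<in>edges G. emeasure lborel (ecoord G e ` (A \<inter> e)))"

lemma ecoord_image:
  assumes "directed_metric_graph G" "e \<in> edges G"
  shows "ecoord G e ` e = {0..elen G e}"
proof -
  obtain l \<gamma> where l: "l > 0" and g: "geodesic (src G e) (snk G e) 0 l \<gamma>"
    and im: "\<gamma> ` {0..l} = e"
    using assms unfolding directed_metric_graph_def by meson
  have ends: "\<gamma> 0 = src G e" "\<gamma> l = snk G e"
    and iso: "\<And>s t. s \<in> {0..l} \<Longrightarrow> t \<in> {0..l} \<Longrightarrow> dist (\<gamma> s) (\<gamma> t) = \<bar>s - t\<bar>"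
    using g unfolding geodesic_def by blast+
  have c: "ecoord G e (\<gamma> t) = t" if t: "t \<in> {0..l}" for t
    unfolding ecoord_def ends(1)[symmetric] using iso[of 0 t] t l by simp
  have len: "elen G e = l"
    unfolding elen_def ends[symmetric] using iso[of 0 l] l by simp
  have "ecoord G e ` \<gamma> ` {0..l} = (\<lambda>t. t) ` {0..l}"
    unfolding image_image by (rule image_cong[OF refl c])
  then show ?thesis
    by (simp only: im image_ident len)
qed

lemma glength_edge:
  assumes G: "directed_metric_graph G" and e: "e \<in> edges G"
  shows "glength G e = ennreal (elen G e)"
proof -
  have fin: "finite (edges G)" using G unfolding directed_metric_graph_def by blast
  have "emeasure lborel (ecoord G e' ` (e \<inter> e')) = 0" if "e' \<in> edges G - {e}" for e'
  proof -
    have "e \<inter> e' \<subseteq> verts G" and "finite (verts G)"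
      using G e that unfolding directed_metric_graph_def by blast+
    then have "finite (ecoord G e' ` (e \<inter> e'))" by (meson finite_imageI finite_subset)
    then show ?thesis by (simp add: emeasure_lborel_countable countable_finite)
  qed
  then have "glength G e = emeasure lborel (ecoord G e ` (e \<inter> e))"
    unfolding glength_def by (simp add: sum.remove[OF fin e])
  then show ?thesis
    using ecoord_image[OF G e] by (simp add: elen_def)
qed

definition directed_subdivision :: "'m::metric_space dgraph \<Rightarrow> 'm dgraph \<Rightarrow> bool" where
  "directed_subdivision G' G \<longleftrightarrow>
     directed_metric_graph G' \<and> points G' = points G \<and> verts G \<subseteq> verts G' \<and>
     (\<forall>e'\<in>edges G'. \<exists>e\<in>edges G. e' \<subseteq> e \<and> ecoord G e (src G' e') < ecoord G e (snk G' e'))"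

definition directed_path :: "'m dgraph \<Rightarrow> 'm set list \<Rightarrow> bool" where
  "directed_path G es \<longleftrightarrow>
     es \<noteq> [] \<and> set es \<subseteq> edges G \<and> successively (\<lambda>e e'. snk G e = src G e') es"

definition isometric_to_interval :: "'m::metric_space set \<Rightarrow> bool" where
  "isometric_to_interval A \<longleftrightarrow> (\<exists>p q a b \<gamma>. geodesic p q a b \<gamma> \<and> \<gamma> ` {a..b} = A)"


section \<open>Thick inverse systems\<close>

text \<open>\<open>gr i\<close> is the graph $X_i$, \<open>sub i\<close> its subdivision $X_i'$, \<open>bond i\<close> the map
  $\pi_i^{i+1} : X_{i+1} \to X_i$, and \<open>opp i\<close> sends an edge $e'$ of $X_i'$ to $e'_{op}$.\<close>

record 'm inv_system =
  zero_pt :: 'm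
  one_pt :: 'm
  gr :: "nat \<Rightarrow> 'm dgraph"
  sub :: "nat \<Rightarrow> 'm dgraph"
  bond :: "nat \<Rightarrow> 'm \<Rightarrow> 'm"
  opp :: "nat \<Rightarrow> 'm set \<Rightarrow> 'm set"

definition terminal :: "'m inv_system \<Rightarrow> nat \<Rightarrow> 'm set \<Rightarrow> bool" where
  "terminal S i e' \<longleftrightarrow> e' \<in> edges (sub S i) \<and>
     (\<exists>e\<in>edges (gr S i). e' \<subseteq> e \<and> (src (gr S i) e \<in> e' \<or> snk (gr S i) e \<in> e'))"

definition bond_preimage :: "'m inv_system \<Rightarrow> nat \<Rightarrow> 'm set \<Rightarrow> 'm set" where
  "bond_preimage S i A = {x \<in> points (gr S (Suc i)). bond S i x \<in> A}"

text \<open>The edges of $X_i'$ whose preimage is a circle.\<close>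

definition circle_edge :: "'m inv_system \<Rightarrow> nat \<Rightarrow> 'm set \<Rightarrow> bool" where
  "circle_edge S i e' \<longleftrightarrow> e' \<in> edges (sub S i) \<and> opp S i e' \<noteq> e'"

definition op_point :: "'m inv_system \<Rightarrow> nat \<Rightarrow> 'm set \<Rightarrow> 'm \<Rightarrow> 'm" where
  "op_point S i e' p = (THE x. x \<in> opp S i e' \<and> bond S i x = p)"

definition A1 :: "'m::metric_space inv_system \<Rightarrow> bool" where
  "A1 S \<longleftrightarrow> zero_pt S \<noteq> one_pt S \<and> verts (gr S 0) = {zero_pt S, one_pt S} \<and>
     (\<exists>e. edges (gr S 0) = {e} \<and> src (gr S 0) e = zero_pt S \<and> snk (gr S 0) e = one_pt S \<and>
          elen (gr S 0) e = 1)"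

definition A2 :: "'m::metric_space inv_system \<Rightarrow> bool" where
  "A2 S \<longleftrightarrow> (\<forall>i. directed_subdivision (sub S i) (gr S i) \<and>
     (\<forall>e'\<in>edges (sub S i).
        let H = gr S (Suc i); f' = opp S i e' in
        bond_preimage S i e' = e' \<union> f' \<and>
        e' \<in> edges H \<and> f' \<in> edges H \<and>
        src H e' = src (sub S i) e' \<and> snk H e' = snk (sub S i) e' \<and>
        (f' = e' \<or>
         src H f' = src H e' \<and> snk H f' = snk H e' \<and>
         (f' - {src H f', snk H f'}) \<inter> \<Union>(edges H - {f'}) = {}) \<and>
        (terminal S i e' \<longrightarrow> f' = e')))"

definition A3 :: "'m::metric_space inv_system \<Rightarrow> bool" where
  "A3 S \<longleftrightarrow> (\<forall>i es. directed_path (gr S i) es \<longrightarrow> isometric_to_interval (\<Union>(set es)))"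

definition A4 :: "'m::metric_space inv_system \<Rightarrow> bool" where
  "A4 S \<longleftrightarrow> (\<forall>i. \<forall>e'\<in>edges (sub S i).
     (\<forall>x\<in>e'. bond S i x = x) \<and>
     bond S i ` opp S i e' = e' \<and>
     (\<forall>x\<in>opp S i e'. \<forall>y\<in>opp S i e'. dist (bond S i x) (bond S i y) = dist x y))"

text \<open>Edges are compact and $p \mapsto p^{op}$ is continuous, so the maximum of $d(p,p^{op})$ is attained:
  that it is at least some bound says that some \<open>p\<close> reaches the bound.\<close>

definition A5 :: "'m::metric_space inv_system \<Rightarrow> bool" where
  "A5 S \<longleftrightarrow> (\<exists>\<alpha>>0. \<forall>i e'. circle_edge S i e' \<longrightarrow>
     (\<exists>p\<in>e'. dist p (op_point S i e' p) \<ge> \<alpha> * elen (sub S i) e'))"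

definition A6 :: "'m::metric_space inv_system \<Rightarrow> bool" where
  "A6 S \<longleftrightarrow> (\<exists>\<beta>>0. \<forall>i es.
     directed_path (sub S i) es \<and>
     src (sub S i) (hd es) = zero_pt S \<and> snk (sub S i) (last es) = one_pt S \<longrightarrow>
     (\<Sum>e' | e' \<in> set es \<and> circle_edge S i e'. elen (sub S i) e') \<ge> \<beta>)"

definition thick_inverse_system :: "'m::metric_space inv_system \<Rightarrow> bool" where
  "thick_inverse_system S \<longleftrightarrow>
     (\<forall>i. directed_metric_graph (gr S i)) \<and>
     (\<forall>i. points (gr S i) \<subseteq> points (gr S (Suc i))) \<and>
     (\<forall>i. bond S i \<in> points (gr S (Suc i)) \<rightarrow> points (gr S i)) \<and>
     A1 S \<and> A2 S \<and> A3 S \<and> A4 S \<and> A5 S \<and> A6 S"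

text \<open>The measure \<open>\<mu> i\<close> lives on the Borel sets of the subspace $X_i$.\<close>

definition system_measures :: "'m::metric_space inv_system \<Rightarrow> (nat \<Rightarrow> 'm measure) \<Rightarrow> bool" where
  "system_measures S \<mu> \<longleftrightarrow>
     (\<forall>i. prob_space (\<mu> i) \<and> sets (\<mu> i) = sets (restrict_space borel (points (gr S i)))) \<and>
     (\<forall>A\<in>sets (\<mu> 0). emeasure (\<mu> 0) A = glength (gr S 0) A) \<and>
     (\<forall>i. \<forall>e\<in>edges (gr S (Suc i)). \<exists>c. \<forall>A\<in>sets (\<mu> (Suc i)). A \<subseteq> e \<longrightarrow>
        emeasure (\<mu> (Suc i)) A = c * glength (gr S (Suc i)) A) \<and>
     (\<forall>i. \<forall>e'\<in>edges (sub S i).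
        if opp S i e' = e' then measure (\<mu> (Suc i)) e' = measure (\<mu> i) e'
        else measure (\<mu> (Suc i)) e' = measure (\<mu> i) e' / 2 \<and>
             measure (\<mu> (Suc i)) (opp S i e') = measure (\<mu> i) e' / 2)"


section \<open>Parameters\<close>

definition Delta_E :: "'m::metric_space inv_system \<Rightarrow> nat \<Rightarrow> real" where
  "Delta_E S i = Min (elen (gr S i) ` edges (gr S i))"

definition delta_E :: "'m::metric_space inv_system \<Rightarrow> nat \<Rightarrow> real" where
  "delta_E S i = Max (elen (sub S i) ` edges (sub S i)) / Delta_E S i"

text \<open>In \<open>ennreal\<close> the infimum of the empty set is \<open>\<infinity>\<close>, its supremum is \<open>0\<close>, and division
  by \<open>\<infinity>\<close> gives \<open>0\<close>. This yields the convention on the distance to the empty set and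
  makes \<open>delta_d\<close> vanish if there are no nonterminal subedges.\<close>

definition set_distance :: "'m::metric_space set \<Rightarrow> 'm set \<Rightarrow> ennreal" where
  "set_distance A B = (INF x\<in>A. INF y\<in>B. ennreal (dist x y))"

definition nonterminal_edges :: "'m inv_system \<Rightarrow> nat \<Rightarrow> 'm set set" where
  "nonterminal_edges S i = {e' \<in> edges (sub S i). \<not> terminal S i e'}"

definition Delta_d :: "'m::metric_space inv_system \<Rightarrow> nat \<Rightarrow> ennreal" where
  "Delta_d S i = (INF e\<in>edges (gr S i). INF e'\<in>{e' \<in> nonterminal_edges S i. e' \<subseteq> e}.
     set_distance e' (points (gr S i) - e))"

definition delta_d :: "'m::metric_space inv_system \<Rightarrow> nat \<Rightarrow> ennreal" where
  "delta_d S i = (SUP e'\<in>nonterminal_edges S i. ennreal (elen (sub S i) e') / Delta_d S i)"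


section \<open>The limit space\<close>

text \<open>\<open>bonds S i k\<close> is $\pi_i^{i+k}$.\<close>

primrec bonds :: "'m inv_system \<Rightarrow> nat \<Rightarrow> nat \<Rightarrow> 'm \<Rightarrow> 'm" where
  "bonds S i 0 = (\<lambda>x. x)"
| "bonds S i (Suc k) = bonds S i k \<circ> bond S (i + k)"

definition X_inf :: "'m::metric_space inv_system \<Rightarrow> 'm set" where
  "X_inf S = closure (\<Union>i. points (gr S i))"

text \<open>The maps \<open>\<pi> i\<close> are the continuous extensions $\pi_i^\infty : X_\infty \to X_i$; they are
  determined on $X_\infty$ by density.\<close>

definition limit_projections :: "'m::metric_space inv_system \<Rightarrow> (nat \<Rightarrow> 'm \<Rightarrow> 'm) \<Rightarrow> bool" where
  "limit_projections S \<pi> \<longleftrightarrow> (\<forall>i.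
     \<pi> i \<in> X_inf S \<rightarrow> points (gr S i) \<and> continuous_on (X_inf S) (\<pi> i) \<and>
     (\<forall>k. \<forall>x\<in>points (gr S (i + k)). \<pi> i x = bonds S i k x))"

definition limit_measure ::
  "'m::metric_space inv_system \<Rightarrow> (nat \<Rightarrow> 'm measure) \<Rightarrow> (nat \<Rightarrow> 'm \<Rightarrow> 'm) \<Rightarrow> 'm measure \<Rightarrow> bool" where
  "limit_measure S \<mu> \<pi> \<nu> \<longleftrightarrow>
     prob_space \<nu> \<and> sets \<nu> = sets (restrict_space borel (X_inf S)) \<and>
     (\<forall>i. distr \<nu> (\<mu> i) (\<pi> i) = \<mu> i)"

text \<open>The identification of $X_0$ with $[0,1]$.\<close>

definition unit_coord :: "'m::metric_space inv_system \<Rightarrow> 'm \<Rightarrow> real" where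
  "unit_coord S x = dist (zero_pt S) x"

definition deep_points :: "'m::metric_space inv_system \<Rightarrow> (nat \<Rightarrow> 'm \<Rightarrow> 'm) \<Rightarrow> 'm set" where
  "deep_points S \<pi> = {x \<in> X_inf S. \<forall>\<^sub>F i in sequentially.
     \<forall>e'. terminal S i e' \<longrightarrow> \<pi> (Suc i) x \<notin> bond_preimage S i e'}"

definition containing_edge :: "'m dgraph \<Rightarrow> 'm \<Rightarrow> 'm set" where
  "containing_edge G x = (THE a. a \<in> edges G \<and> x \<in> a)"

definition scale :: "'m::metric_space inv_system \<Rightarrow> (nat \<Rightarrow> 'm \<Rightarrow> 'm) \<Rightarrow> nat \<Rightarrow> 'm \<Rightarrow> real" where
  "scale S \<pi> i x = elen (gr S i) (containing_edge (gr S i) (\<pi> i x))"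


section \<open>Banach space valued functions\<close>

definition has_RNP :: "'b::banach itself \<Rightarrow> bool" where
  "has_RNP _ \<longleftrightarrow> (\<forall>g :: real \<Rightarrow> 'b. (\<exists>C. C-lipschitz_on UNIV g) \<longrightarrow>
     (AE t in lborel. g differentiable (at t)))"

text \<open>The library's Bochner integral is restricted to second countable target spaces. The following
  is its definition without that restriction.\<close>

definition bochner_has_integral ::
  "'a measure \<Rightarrow> ('a \<Rightarrow> 'b::real_normed_vector) \<Rightarrow> 'b \<Rightarrow> bool" where
  "bochner_has_integral M f v \<longleftrightarrow> f \<in> borel_measurable M \<and>
     (\<exists>s. (\<forall>i. Bochner_Integration.simple_bochner_integrable M (s i)) \<and>
          (\<lambda>i. \<integral>\<^sup>+x. ennreal (norm (f x - s i x)) \<partial>M) \<longlonglongrightarrow> 0 \<and>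
          (\<lambda>i. Bochner_Integration.simple_bochner_integral M (s i)) \<longlonglongrightarrow> v)"

lemma bochner_has_integral_iff:
  fixes f :: "'a \<Rightarrow> 'b::{real_normed_vector, second_countable_topology}"
  shows "bochner_has_integral M f v \<longleftrightarrow> has_bochner_integral M f v"
  unfolding bochner_has_integral_def has_bochner_integral.simps by auto

text \<open>\<open>g\<close> is a version of the conditional expectation of \<open>h\<close> under \<open>p\<close>, a map from the
  space of \<open>\<nu>\<close> to the space of \<open>\<mu>\<close>.\<close>

definition is_cond_exp ::
  "'m measure \<Rightarrow> 'm measure \<Rightarrow> ('m \<Rightarrow> 'm) \<Rightarrow> ('m \<Rightarrow> 'b::banach) \<Rightarrow> ('m \<Rightarrow> 'b) \<Rightarrow> bool" where
  "is_cond_exp \<nu> \<mu> p h g \<longleftrightarrow> (\<exists>v. bochner_has_integral \<mu> g v) \<and>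
     (\<forall>\<phi> :: 'm \<Rightarrow> real. \<phi> \<in> borel_measurable \<mu> \<and> bounded (\<phi> ` space \<mu>) \<longrightarrow>
        (\<exists>v. bochner_has_integral \<mu> (\<lambda>x. \<phi> x *\<^sub>R g x) v \<and>
             bochner_has_integral \<nu> (\<lambda>x. \<phi> (p x) *\<^sub>R h x) v))"

text \<open>The Lipschitz version of $E_i^\infty(h)$ for Lipschitz \<open>h\<close>. It is unique on $X_i$, since
  \<open>\<mu> i\<close> charges every nonempty relatively open subset of $X_i$.\<close>

definition lipschitz_cond_exp :: "'m::metric_space inv_system \<Rightarrow> (nat \<Rightarrow> 'm measure) \<Rightarrow>
    (nat \<Rightarrow> 'm \<Rightarrow> 'm) \<Rightarrow> 'm measure \<Rightarrow> nat \<Rightarrow> ('m \<Rightarrow> 'b::banach) \<Rightarrow> ('m \<Rightarrow> 'b)" where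
  "lipschitz_cond_exp S \<mu> \<pi> \<nu> i h =
     (SOME g. (\<exists>C. C-lipschitz_on (points (gr S i)) g) \<and> is_cond_exp \<nu> (\<mu> i) (\<pi> i) h g)"

definition edge_derivative ::
  "'m::metric_space dgraph \<Rightarrow> ('m \<Rightarrow> 'b::real_normed_vector) \<Rightarrow> 'm \<Rightarrow> 'b" where
  "edge_derivative G h x = (let e = containing_edge G x in
     vector_derivative (\<lambda>t. h (epoint G e t)) (at (ecoord G e x)))"

text \<open>\<open>deriv_inf \<dots> f\<close> is $f' = (f - f(0))'$.\<close>

definition deriv_inf :: "'m::metric_space inv_system \<Rightarrow> (nat \<Rightarrow> 'm measure) \<Rightarrow>
    (nat \<Rightarrow> 'm \<Rightarrow> 'm) \<Rightarrow> 'm measure \<Rightarrow> ('m \<Rightarrow> 'b::banach) \<Rightarrow> 'm \<Rightarrow> 'b" where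
  "deriv_inf S \<mu> \<pi> \<nu> f x =
     lim (\<lambda>i. edge_derivative (gr S i)
                (lipschitz_cond_exp S \<mu> \<pi> \<nu> i (\<lambda>y. f y - f (zero_pt S))) (\<pi> i x))"

text \<open>Differentiability at \<open>x\<close> of \<open>f\<close> on the metric space \<open>X\<close> with respect to \<open>\<rho>\<close> along the
  scales \<open>r\<close>, with derivative \<open>t \<mapsto> t b\<close>.\<close>

definition has_derivative_along :: "'m::metric_space set \<Rightarrow> ('m \<Rightarrow> real) \<Rightarrow> (nat \<Rightarrow> real) \<Rightarrow>
    ('m \<Rightarrow> 'b::real_normed_vector) \<Rightarrow> 'b \<Rightarrow> 'm \<Rightarrow> bool" where
  "has_derivative_along X \<rho> r f b x \<longleftrightarrow> (\<forall>R\<ge>1.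
     limsup (\<lambda>i. SUP y\<in>X \<inter> ball x (R * r i).
       ereal (norm (f y - f x - (\<rho> y - \<rho> x) *\<^sub>R b) / r i)) = 0)"

end

theory Submission
  imports Defs
begin

text \<open>Flipping a coin at every stage of the system selects a random monotone geodesic from \<open>0\<close> to \<open>1\<close>.
  Together with a uniform parameter \<open>t\<close> in \<open>[0,1]\<close> it yields a random point of $X_\infty$ with law $\mu_\infty$
  whose projections have the laws $\mu_i$. By the Radon-Nikodym property, \<open>f\<close> is differentiable at \<open>t\<close> along
  almost every such curve. Levy's zero-one law, applied to the event that the difference quotients
  at \<open>t\<close> are close to a fixed vector \<open>q\<close> at small scales, shows that from some stage on most
  continuations of a given coin sequence belong to this event, and in particular one for each value of the
  next coin. Averaging over the continuations, the derivatives of the conditional expectations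
  converge to the derivative along the curve. A point within $R r_{i+1}$ of \<open>x\<close> projects into the edge
  $e_i(x)$, so for a suitable value of the next coin it is at distance $O(\delta_{i+1} r_{i+1})$ from a good curve;
  the curves for both values meet in a vertex near \<open>x\<close>, where their increments are compared.\<close>

section \<open>Bochner integrals without separability\<close>

text \<open>A curve through \<open>x\<close> meets only a thin part of a ball around
  \<open>x\<close>, so differentiability along curves does not by itself control the other points.
  What makes them accessible is the ratio bound: each edge of the subdivision of stage
  \<open>Suc i\<close> is at most \<open>\<delta> (Suc i)\<close> times each edge of that stage, so
  at the scale of stage \<open>Suc i\<close> all coins after the next one contribute a negligible
  error and only the two values of one coin matter. A conditional probability above 1/2 therefore
  yields a good continuation for either value. The distance bound, which concerns nonterminal
  subedges only, excludes points of the ball lying over other edges; this is where deep points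
  enter. Two obstacles shape the statements. The target need not be separable: integrals are taken
  of uniform limits of simple functions, and the vectors \<open>q\<close> come from a countable set
  approximating the difference quotients of \<open>f\<close>. And the limit measure is known only
  through its projections, so the random point is compared with it on closed sets. Conditional
  probabilities are defined at every sequence by resampling, which permits statements about
  individual continuations.\<close>

abbreviation "sb_integrable \<equiv> Bochner_Integration.simple_bochner_integrable"
abbreviation "sb_integral \<equiv> Bochner_Integration.simple_bochner_integral"

text \<open>On a probability space such functions are Bochner integrable for any Banach target, and
  continuous functions on compact sets are among them because their range is totally bounded. All
  vector-valued integrands below are of this kind, so the target may be nonseparable.\<close>

definition unif_approx :: "'a measure \<Rightarrow> ('a \<Rightarrow> 'b::real_normed_vector) \<Rightarrow> bool" where
  "unif_approx M F \<longleftrightarrow>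
     (\<forall>\<epsilon>>0. \<exists>s. simple_function M s \<and> (\<forall>x\<in>space M. norm (F x - s x) \<le> \<epsilon>))"

definition bint :: "'a measure \<Rightarrow> ('a \<Rightarrow> 'b::real_normed_vector) \<Rightarrow> 'b" where
  "bint M F = (THE v. bochner_has_integral M F v)"

lemma unif_approxI:
  assumes "\<And>\<epsilon>. \<epsilon> > 0 \<Longrightarrow> \<exists>G. unif_approx M G \<and> (\<forall>x\<in>space M. norm (F x - G x) \<le> \<epsilon>)"
  shows "unif_approx M F"
  unfolding unif_approx_def
proof (intro allI impI)
  fix \<epsilon> :: real assume e: "\<epsilon> > 0"
  then obtain G where G: "unif_approx M G" "\<And>x. x \<in> space M \<Longrightarrow> norm (F x - G x) \<le> \<epsilon>/2"
    using assms[of "\<epsilon>/2"] by auto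
  then obtain s where s: "simple_function M s" "\<And>x. x \<in> space M \<Longrightarrow> norm (G x - s x) \<le> \<epsilon>/2"
    using e unfolding unif_approx_def by (metis half_gt_zero)
  have "norm (F x - s x) \<le> \<epsilon>" if "x \<in> space M" for x
    using G(2)[OF that] s(2)[OF that] norm_triangle_ineq[of "F x - G x" "G x - s x"] by simp
  with s show "\<exists>s. simple_function M s \<and> (\<forall>x\<in>space M. norm (F x - s x) \<le> \<epsilon>)" by blast
qed

lemma unif_approx_simple: "simple_function M s \<Longrightarrow> unif_approx M s"
  unfolding unif_approx_def by (metis diff_self norm_zero order_less_imp_le)

lemma unif_approx_const: "unif_approx M (\<lambda>_. c)"
  by (simp add: unif_approx_simple)

lemma unif_approx_add:
  assumes "unif_approx M F" "unif_approx M G"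
  shows "unif_approx M (\<lambda>x. F x + G x)"
proof (rule unif_approxI)
  fix \<epsilon> :: real assume e: "\<epsilon> > 0"
  obtain s t where s: "simple_function M s" "\<And>x. x \<in> space M \<Longrightarrow> norm (F x - s x) \<le> \<epsilon>/2"
    and t: "simple_function M t" "\<And>x. x \<in> space M \<Longrightarrow> norm (G x - t x) \<le> \<epsilon>/2"
    using assms e unfolding unif_approx_def by (metis half_gt_zero)
  have "norm ((F x + G x) - (s x + t x)) \<le> \<epsilon>" if "x \<in> space M" for x
    using s(2)[OF that] t(2)[OF that] norm_triangle_ineq[of "F x - s x" "G x - t x"]
    by (simp add: algebra_simps)
  moreover have "simple_function M (\<lambda>x. s x + t x)"
    by (rule simple_function_compose2[where h="(+)", OF s(1) t(1)])
  ultimately show "\<exists>H. unif_approx M H \<and> (\<forall>x\<in>space M. norm ((F x + G x) - H x) \<le> \<epsilon>)"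
    by (meson unif_approx_simple)
qed

text \<open>Both factors are bounded, so they can be approximated separately: \<open>\<phi>\<close>
  is rounded down to the grid of mesh 1/n, which leaves finitely many values, and \<open>n\<close>
  is large compared with the bound \<open>D\<close> of the simple function replacing
  \<open>F\<close>.\<close>

lemma unif_approx_scaleR:
  fixes \<phi> :: "'a \<Rightarrow> real"
  assumes \<phi>: "\<phi> \<in> borel_measurable M" "bounded (\<phi> ` space M)" and F: "unif_approx M F"
  shows "unif_approx M (\<lambda>x. \<phi> x *\<^sub>R F x)"
proof (rule unif_approxI)
  fix \<epsilon> :: real assume e: "\<epsilon> > 0"
  obtain C where C: "C > 0" "\<And>x. x \<in> space M \<Longrightarrow> \<bar>\<phi> x\<bar> \<le> C"
    using \<phi>(2) unfolding bounded_pos by auto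
  obtain s where s: "simple_function M s" "\<And>x. x \<in> space M \<Longrightarrow> norm (F x - s x) \<le> \<epsilon>/(2*C)"
    using F e C(1) unfolding unif_approx_def by (metis divide_pos_pos mult_pos_pos zero_less_numeral)
  have "finite (s ` space M)" using s(1) by (simp add: simple_function_def)
  then obtain D where D: "D > 0" "\<And>x. x \<in> space M \<Longrightarrow> norm (s x) \<le> D"
    by (metis finite_imp_bounded bounded_pos imageI)
  obtain n :: nat where n: "n > 0" "D / n \<le> \<epsilon>/2"
  proof -
    obtain n :: nat where "real n > 2 * D / \<epsilon>" using reals_Archimedean2 by blast
    moreover have "n > 0" using calculation D e
      by (metis divide_pos_pos mult_pos_pos not_gr_zero of_nat_0 order_less_asym zero_less_numeral)
    ultimately show thesis using that[of n] e by (simp add: field_simps)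
  qed
  define p where "p = (\<lambda>x. real_of_int \<lfloor>real n * \<phi> x\<rfloor> / n)"
  have p_meas: "p \<in> borel_measurable M" unfolding p_def using \<phi>(1) by measurable
  have p_fin: "finite (p ` space M)"
  proof -
    have "p ` space M \<subseteq> (\<lambda>k. real_of_int k / n) ` {- \<lceil>n*C\<rceil> - 1 .. \<lceil>n*C\<rceil>}"
    proof
      fix y assume "y \<in> p ` space M"
      then obtain x where x: "x \<in> space M" "y = p x" by auto
      have "\<bar>n * \<phi> x\<bar> \<le> n * C" using C(2)[OF x(1)] by (simp add: abs_mult mult_left_mono)
      then have "\<lfloor>n * \<phi> x\<rfloor> \<in> {- \<lceil>n*C\<rceil> - 1 .. \<lceil>n*C\<rceil>}" by (simp; linarith)
      then show "y \<in> (\<lambda>k. real_of_int k / n) ` {- \<lceil>n*C\<rceil> - 1 .. \<lceil>n*C\<rceil>}"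
        using x unfolding p_def by blast
    qed
    then show ?thesis by (rule finite_subset) simp
  qed
  have p_simple: "simple_function M p"
    by (rule simple_function_borel_measurable[OF p_meas p_fin])
  have p_close: "\<bar>\<phi> x - p x\<bar> \<le> 1 / n" for x
  proof -
    have "\<phi> x - p x = (n * \<phi> x - \<lfloor>n * \<phi> x\<rfloor>) / n" using n(1) by (simp add: p_def field_simps)
    moreover have "\<bar>n * \<phi> x - \<lfloor>n * \<phi> x\<rfloor>\<bar> \<le> 1" by linarith
    ultimately show ?thesis by (simp add: divide_right_mono)
  qed
  have "norm (\<phi> x *\<^sub>R F x - p x *\<^sub>R s x) \<le> \<epsilon>" if x: "x \<in> space M" for x
  proof -
    have "\<phi> x *\<^sub>R F x - p x *\<^sub>R s x = \<phi> x *\<^sub>R (F x - s x) + (\<phi> x - p x) *\<^sub>R s x"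
      by (simp add: algebra_simps)
    then have "norm (\<phi> x *\<^sub>R F x - p x *\<^sub>R s x) \<le> \<bar>\<phi> x\<bar> * norm (F x - s x) + \<bar>\<phi> x - p x\<bar> * norm (s x)"
      by (metis norm_scaleR norm_triangle_ineq)
    also have "\<dots> \<le> C * (\<epsilon>/(2*C)) + (1/n) * D"
      using C s(2)[OF x] D p_close[of x] x by (intro add_mono mult_mono) auto
    also have "\<dots> \<le> \<epsilon>" using C(1) n by (simp add: field_simps)
    finally show ?thesis .
  qed
  moreover have "simple_function M (\<lambda>x. p x *\<^sub>R s x)"
    by (rule simple_function_compose2[where h="(*\<^sub>R)", OF p_simple s(1)])
  ultimately show "\<exists>H. unif_approx M H \<and> (\<forall>x\<in>space M. norm (\<phi> x *\<^sub>R F x - H x) \<le> \<epsilon>)"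
    by (meson unif_approx_simple)
qed

lemma unif_approx_cmult: "unif_approx M F \<Longrightarrow> unif_approx M (\<lambda>x. c *\<^sub>R F x)"
  by (rule unif_approx_scaleR) (auto simp: bounded_iff)

lemma unif_approx_diff:
  assumes "unif_approx M F" "unif_approx M G"
  shows "unif_approx M (\<lambda>x. F x - G x)"
  using unif_approx_add[OF assms(1) unif_approx_cmult[OF assms(2), of "-1"]] by simp

lemma unif_approx_comp:
  assumes "unif_approx N F" and p: "p \<in> measurable M N"
  shows "unif_approx M (\<lambda>x. F (p x))"
  unfolding unif_approx_def
proof (intro allI impI)
  fix \<epsilon> :: real assume "\<epsilon> > 0"
  then have "\<exists>s. simple_function N s \<and> (\<forall>x\<in>space N. norm (F x - s x) \<le> \<epsilon>)"
    using assms(1) by (simp add: unif_approx_def)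
  then obtain s where s: "simple_function N s" "\<And>x. x \<in> space N \<Longrightarrow> norm (F x - s x) \<le> \<epsilon>"
    by auto
  have "simple_function M (\<lambda>x. s (p x))" using simple_function_comp[OF p s(1)] by (simp add: comp_def)
  then show "\<exists>s. simple_function M s \<and> (\<forall>x\<in>space M. norm (F (p x) - s x) \<le> \<epsilon>)"
    using s(2)[OF measurable_space[OF p]] by (intro exI[of _ "\<lambda>x. s (p x)"]) auto
qed

text \<open>Each point is sent to the first ball of a finite cover that contains it, and
  \<open>h\<close> is replaced by its value at the centre. Taking the first ball makes the level
  sets measurable.\<close>

lemma unif_approx_continuous_on_compact:
  fixes h :: "'a::metric_space \<Rightarrow> 'b::real_normed_vector"
  assumes K: "compact K" and h: "continuous_on K h" and N: "sets N = sets (restrict_space borel K)"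
  shows "unif_approx N h"
  unfolding unif_approx_def
proof (intro allI impI)
  fix \<epsilon> :: real assume e: "\<epsilon> > 0"
  have sp: "space N = K" using sets_eq_imp_space_eq[OF N] by (simp add: space_restrict_space)
  obtain d where d: "d > 0" "\<And>x y. x \<in> K \<Longrightarrow> y \<in> K \<Longrightarrow> dist y x < d \<Longrightarrow> dist (h y) (h x) < \<epsilon>"
    using compact_uniformly_continuous[OF h K] e unfolding uniformly_continuous_on_def by metis
  obtain k where k: "finite k" "k \<subseteq> K" "K \<subseteq> (\<Union>x\<in>k. ball x d)"
    using compact_imp_seq_compact[OF K] seq_compact_imp_totally_bounded d(1) by metis
  obtain xs where xs: "set xs = k" using k(1) finite_list by blast
  define j where "j = (\<lambda>x. LEAST i. i < length xs \<and> x \<in> ball (xs ! i) d)"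
  have ex: "\<exists>i. i < length xs \<and> x \<in> ball (xs ! i) d" if "x \<in> K" for x
    using that k(3) xs by (metis UN_E in_set_conv_nth subsetD)
  have j: "j x < length xs \<and> x \<in> ball (xs ! (j x)) d" if "x \<in> K" for x
    unfolding j_def using LeastI_ex[OF ex[OF that]] .
  have "j -` {i} \<inter> K \<in> sets N" for i
  proof -
    have "j -` {i} \<inter> K = (if i < length xs then (ball (xs ! i) d - (\<Union>l<i. ball (xs ! l) d)) \<inter> K else {})"
    proof (cases "i < length xs")
      case True
      have "j x = i \<longleftrightarrow> x \<in> ball (xs ! i) d \<and> (\<forall>l<i. x \<notin> ball (xs ! l) d)" if x: "x \<in> K" for x
      proof
        assume "j x = i"
        then show "x \<in> ball (xs ! i) d \<and> (\<forall>l<i. x \<notin> ball (xs ! l) d)"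
          using j[OF x] not_less_Least[of _ "\<lambda>i. i < length xs \<and> x \<in> ball (xs ! i) d"] unfolding j_def
          by (metis order.strict_trans)
      next
        assume a: "x \<in> ball (xs ! i) d \<and> (\<forall>l<i. x \<notin> ball (xs ! l) d)"
        show "j x = i" unfolding j_def
          using a True by (intro Least_equality) (auto simp: not_less[symmetric])
      qed
      then show ?thesis using True by (simp add: set_eq_iff vimage_def) blast
    next
      case False
      then show ?thesis using j by fastforce
    qed
    moreover have "(ball (xs ! i) d - (\<Union>l<i. ball (xs ! l) d)) \<inter> K \<in> sets N"
      unfolding N sets_restrict_space by (subst Int_commute) (intro imageI sets.Diff sets.finite_UN, auto)
    ultimately show ?thesis by simp
  qed
  moreover have "finite (j ` K)" using j by (meson finite_lessThan finite_subset image_subsetI lessThan_iff)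
  ultimately have "simple_function N j" by (simp add: simple_function_def sp)
  then have 1: "simple_function N (\<lambda>x. h (xs ! j x))"
    by (rule simple_function_compose1)
  have 2: "norm (h x - h (xs ! j x)) \<le> \<epsilon>" if "x \<in> K" for x
  proof -
    have "xs ! j x \<in> K" using j[OF that] k(2) xs nth_mem by blast
    then show ?thesis using d(2)[of "xs ! j x" x] j[OF that] that
      by (simp add: dist_norm dist_commute order_less_imp_le)
  qed
  show "\<exists>s. simple_function N s \<and> (\<forall>x\<in>space N. norm (h x - s x) \<le> \<epsilon>)"
    using 1 2 sp by (intro exI[of _ "\<lambda>x. h (xs ! j x)"]) auto
qed

lemma unif_approx_measurable:
  assumes "unif_approx M F"
  shows "F \<in> borel_measurable M"
proof -
  have "\<forall>n::nat. \<exists>s. simple_function M s \<and> (\<forall>x\<in>space M. norm (F x - s x) \<le> 1 / Suc n)"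
    using assms unfolding unif_approx_def by simp
  then obtain s where s: "\<And>n. simple_function M (s n)"
    "\<And>n x. x \<in> space M \<Longrightarrow> norm (F x - s n x) \<le> 1 / Suc n"
    by metis
  show ?thesis
  proof (rule borel_measurable_LIMSEQ_metric)
    show "s n \<in> borel_measurable M" for n
      by (rule borel_measurable_simple_function[OF s(1)])
    show "(\<lambda>n. s n x) \<longlonglongrightarrow> F x" if "x \<in> space M" for x
    proof -
      have "(\<lambda>n. s n x - F x) \<longlonglongrightarrow> 0"
        by (rule Lim_null_comparison[where g="\<lambda>n. 1 / Suc n"])
           (use s(2)[OF that] LIMSEQ_Suc[OF lim_inverse_n'] in \<open>auto simp: norm_minus_commute\<close>)
      then show ?thesis by (simp add: LIM_zero_iff)
    qed
  qed
qed

text \<open>In a nonseparable space the difference of two Borel functions need not be Borel. Here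
  the second one takes finitely many values, and on each of its level sets the difference is a
  translate of \<open>F\<close>.\<close>

lemma borel_measurable_diff_simple:
  fixes F :: "'a \<Rightarrow> 'b::real_normed_vector"
  assumes F: "F \<in> borel_measurable M" and s: "simple_function M s"
  shows "(\<lambda>x. F x - s x) \<in> borel_measurable M"
proof -
  have 1: "s \<in> measurable M (count_space (s ` space M))"
    using s by (intro measurableI) (auto simp: simple_function_def intro: measurable_sets[OF measurable_simple_function[OF s]])
  have "(\<lambda>y. y - c) \<in> borel_measurable (borel :: 'b measure)" for c
    by (intro borel_measurable_continuous_onI continuous_intros)
  then have "(\<lambda>x. F x - i) \<in> borel_measurable M" for i
    using measurable_compose[OF F] by blast
  then show ?thesis
    using s by (intro measurable_compose_countable'[where f="\<lambda>i x. F x - i" and I="s ` space M", OF _ 1])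
      (auto simp: simple_function_def intro: countable_finite)
qed

lemma bochner_has_integral_norm_bound:
  assumes "bochner_has_integral M F v"
  shows "ennreal (norm v) \<le> (\<integral>\<^sup>+x. ennreal (norm (F x)) \<partial>M)"
proof -
  obtain s where F: "F \<in> borel_measurable M" and s: "\<And>i. sb_integrable M (s i)"
    and lim: "(\<lambda>i. \<integral>\<^sup>+x. ennreal (norm (F x - s i x)) \<partial>M) \<longlonglongrightarrow> 0"
    and I: "(\<lambda>i. sb_integral M (s i)) \<longlonglongrightarrow> v"
    using assms unfolding bochner_has_integral_def by auto
  let ?S = "\<lambda>i. sb_integral M (s i)"
  have le: "ennreal (norm (?S i)) \<le> (\<integral>\<^sup>+x. ennreal (norm (F x - s i x)) \<partial>M) + (\<integral>\<^sup>+x. ennreal (norm (F x)) \<partial>M)" for i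
  proof -
    have sf: "simple_function M (s i)" using s[of i] by (auto elim: Bochner_Integration.simple_bochner_integrable.cases)
    have [measurable]: "(\<lambda>x. F x - s i x) \<in> borel_measurable M" "F \<in> borel_measurable M"
      using borel_measurable_diff_simple[OF F sf] F by auto
    have n: "(\<lambda>x. norm (F x - s i x)) \<in> borel_measurable M" by simp
    have "ennreal (norm (?S i)) \<le> ennreal (sb_integral M (\<lambda>x. norm (s i x)))"
      by (intro ennreal_leI simple_bochner_integral_norm_bound s)
    also have "\<dots> = (\<integral>\<^sup>+x. ennreal (norm (s i x)) \<partial>M)"
      using simple_bochner_integrable_compose2[of "\<lambda>x y. norm x" M "s i" "s i"] s
      by (auto intro!: simple_bochner_integral_eq_nn_integral)
    also have "\<dots> \<le> (\<integral>\<^sup>+x. ennreal (norm (F x - s i x)) + ennreal (norm (F x)) \<partial>M)"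
    proof (rule nn_integral_mono)
      fix x
      have "norm (s i x) \<le> norm (F x - s i x) + norm (F x)"
        by (metis norm_minus_commute norm_triangle_sub add.commute)
      then show "ennreal (norm (s i x)) \<le> ennreal (norm (F x - s i x)) + ennreal (norm (F x))"
        by (metis ennreal_leI ennreal_plus norm_ge_zero)
    qed
    also have "\<dots> = (\<integral>\<^sup>+x. ennreal (norm (F x - s i x)) \<partial>M) + (\<integral>\<^sup>+x. ennreal (norm (F x)) \<partial>M)"
      by (rule nn_integral_add) auto
    finally show ?thesis .
  qed
  have 1: "(\<lambda>i. ennreal (norm (?S i))) \<longlonglongrightarrow> ennreal (norm v)"
    by (intro tendsto_ennrealI tendsto_norm I)
  have 2: "(\<lambda>i. (\<integral>\<^sup>+x. ennreal (norm (F x - s i x)) \<partial>M) + (\<integral>\<^sup>+x. ennreal (norm (F x)) \<partial>M)) \<longlonglongrightarrow> 0 + (\<integral>\<^sup>+x. ennreal (norm (F x)) \<partial>M)"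
    by (intro tendsto_add lim tendsto_const)
  show ?thesis
    using LIMSEQ_le[OF 1 2] le by auto
qed

lemma bochner_has_integral_unique:
  fixes v w :: "'b::real_normed_vector"
  assumes v: "bochner_has_integral M F v" and w: "bochner_has_integral M F w"
  shows "v = w"
proof -
  obtain s where F: "F \<in> borel_measurable M" and s: "\<And>i. sb_integrable M (s i)"
    and lim: "(\<lambda>i. \<integral>\<^sup>+x. ennreal (norm (F x - s i x)) \<partial>M) \<longlonglongrightarrow> 0"
    and I: "(\<lambda>i. sb_integral M (s i)) \<longlonglongrightarrow> v"
    using v unfolding bochner_has_integral_def by auto
  obtain t where t: "\<And>i. sb_integrable M (t i)"
    and limt: "(\<lambda>i. \<integral>\<^sup>+x. ennreal (norm (F x - t i x)) \<partial>M) \<longlonglongrightarrow> 0"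
    and It: "(\<lambda>i. sb_integral M (t i)) \<longlonglongrightarrow> w"
    using w unfolding bochner_has_integral_def by auto
  let ?I = "sb_integral M"
  have le: "ennreal (norm (?I (s i) - ?I (t i))) \<le>
     (\<integral>\<^sup>+x. ennreal (norm (F x - s i x)) \<partial>M) + (\<integral>\<^sup>+x. ennreal (norm (F x - t i x)) \<partial>M)" for i
  proof -
    have sf: "simple_function M (s i)" "simple_function M (t i)"
      using s[of i] t[of i] by (auto elim: Bochner_Integration.simple_bochner_integrable.cases)
    have [measurable]: "(\<lambda>x. F x - s i x) \<in> borel_measurable M" "(\<lambda>x. F x - t i x) \<in> borel_measurable M"
      using borel_measurable_diff_simple[OF F] sf by auto
    have st: "sb_integrable M (\<lambda>x. s i x - t i x)"
      using simple_bochner_integrable_compose2[of "(-)" M "s i" "t i"] s t by auto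
    have "ennreal (norm (?I (s i) - ?I (t i))) = norm (?I (\<lambda>x. s i x - t i x))"
      using s t by (subst simple_bochner_integral_diff) auto
    also have "\<dots> \<le> ?I (\<lambda>x. norm (s i x - t i x))"
      by (intro ennreal_leI simple_bochner_integral_norm_bound st)
    also have "\<dots> = (\<integral>\<^sup>+x. norm (s i x - t i x) \<partial>M)"
      using simple_bochner_integrable_compose2[of "\<lambda>x y. norm (x - y)" M "s i" "t i"] s t
      by (auto intro!: simple_bochner_integral_eq_nn_integral)
    also have "\<dots> \<le> (\<integral>\<^sup>+x. ennreal (norm (F x - s i x)) + ennreal (norm (F x - t i x)) \<partial>M)"
    proof (rule nn_integral_mono)
      fix x
      have "norm (s i x - t i x) \<le> norm (F x - s i x) + norm (F x - t i x)"
        by (metis dual_order.refl norm_diff_triangle_le norm_minus_commute)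
      then show "ennreal (norm (s i x - t i x)) \<le> ennreal (norm (F x - s i x)) + ennreal (norm (F x - t i x))"
        by (metis ennreal_leI ennreal_plus norm_ge_zero)
    qed
    also have "\<dots> = (\<integral>\<^sup>+x. ennreal (norm (F x - s i x)) \<partial>M) + (\<integral>\<^sup>+x. ennreal (norm (F x - t i x)) \<partial>M)"
      by (rule nn_integral_add) auto
    finally show ?thesis .
  qed
  have 1: "(\<lambda>i. ennreal (norm (?I (s i) - ?I (t i)))) \<longlonglongrightarrow> ennreal (norm (v - w))"
    by (intro tendsto_ennrealI tendsto_norm tendsto_diff I It)
  have 2: "(\<lambda>i. (\<integral>\<^sup>+x. ennreal (norm (F x - s i x)) \<partial>M) + (\<integral>\<^sup>+x. ennreal (norm (F x - t i x)) \<partial>M)) \<longlonglongrightarrow> 0 + 0"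
    by (intro tendsto_add lim limt)
  have "ennreal (norm (v - w)) \<le> 0 + 0" by (rule LIMSEQ_le[OF 1 2]) (use le in auto)
  then show ?thesis by simp
qed

lemma bint_eqI: "bochner_has_integral M F v \<Longrightarrow> bint M F = v"
  unfolding bint_def using bochner_has_integral_unique by (metis the_equality)

context prob_space
begin

lemma simple_bochner_integrable_simple_function:
  "simple_function M s \<Longrightarrow> sb_integrable M s"
  by (rule Bochner_Integration.simple_bochner_integrable.intros) (auto simp: emeasure_eq_measure)

lemma simple_bochner_integral_close:
  assumes "simple_function M s" "simple_function M t" "c \<ge> 0" "\<And>x. x \<in> space M \<Longrightarrow> norm (s x - t x) \<le> c"
  shows "norm (sb_integral M s - sb_integral M t) \<le> c"
proof -
  let ?I = "sb_integral M"
  have st: "sb_integrable M s" "sb_integrable M t"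
    using assms by (auto intro: simple_bochner_integrable_simple_function)
  have "ennreal (norm (?I s - ?I t)) = norm (?I (\<lambda>x. s x - t x))"
    using st by (subst simple_bochner_integral_diff) auto
  also have "\<dots> \<le> ?I (\<lambda>x. norm (s x - t x))"
    using st by (intro ennreal_leI simple_bochner_integral_norm_bound simple_bochner_integrable_compose2[of "(-)" M s t]) auto
  also have "\<dots> = (\<integral>\<^sup>+x. norm (s x - t x) \<partial>M)"
    using simple_bochner_integrable_compose2[of "\<lambda>x y. norm (x - y)" M s t] st
    by (auto intro!: simple_bochner_integral_eq_nn_integral)
  also have "\<dots> \<le> (\<integral>\<^sup>+x. ennreal c \<partial>M)"
    by (intro nn_integral_mono ennreal_leI assms)
  also have "\<dots> = ennreal c" by (simp add: emeasure_space_1)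
  finally show ?thesis using assms(3) by simp
qed

text \<open>Any sequence of simple functions with error 1/(n+1) computes the integral. Linearity and
  change of variables are then inherited from simple functions by choosing such sequences
  compatibly.\<close>

lemma unif_approx_seq_integral:
  fixes F :: "'a \<Rightarrow> 'b::banach"
  assumes s: "\<And>n. simple_function M (s n)" "\<And>n x. x \<in> space M \<Longrightarrow> norm (F x - s n x) \<le> 1 / Suc n"
  obtains v where "bochner_has_integral M F v" "(\<lambda>n. sb_integral M (s n)) \<longlonglongrightarrow> v"
proof -
  let ?I = "sb_integral M"
  have UA: "unif_approx M F" unfolding unif_approx_def
  proof (intro allI impI)
    fix \<epsilon> :: real assume "\<epsilon> > 0"
    then obtain n where "1 / real (Suc n) < \<epsilon>" by (metis nat_approx_posE)
    then show "\<exists>s. simple_function M s \<and> (\<forall>x\<in>space M. norm (F x - s x) \<le> \<epsilon>)"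
      using s by (meson order_less_imp_le order_trans)
  qed
  have lim1: "(\<lambda>n. 1 / real (Suc n)) \<longlonglongrightarrow> 0" using LIMSEQ_Suc[OF lim_inverse_n'] by simp
  have close: "norm (?I (s n) - ?I (s m)) \<le> 1 / Suc n + 1 / Suc m" for n m
  proof (rule simple_bochner_integral_close[OF s(1) s(1)])
    fix x assume x: "x \<in> space M"
    show "norm (s n x - s m x) \<le> 1 / Suc n + 1 / Suc m"
      using s(2)[OF x, of n] s(2)[OF x, of m] norm_triangle_ineq4[of "F x - s m x" "F x - s n x"] by simp
  qed simp
  have "Cauchy (\<lambda>n. ?I (s n))"
  proof (rule metric_CauchyI)
    fix e :: real assume "e > 0"
    then obtain K where K: "1 / real (Suc K) < e / 2" by (metis nat_approx_posE half_gt_zero)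
    have K': "1 / real (Suc n) < e / 2" if "n \<ge> K" for n
    proof -
      have "1 / real (Suc n) \<le> 1 / real (Suc K)" using that by (intro divide_left_mono) auto
      then show ?thesis using K by linarith
    qed
    show "\<exists>K. \<forall>m\<ge>K. \<forall>n\<ge>K. dist (?I (s m)) (?I (s n)) < e"
    proof (intro exI allI impI)
      fix m n assume "m \<ge> K" "n \<ge> K"
      then show "dist (?I (s m)) (?I (s n)) < e"
        using K'[of m] K'[of n] close[of m n] by (simp add: dist_norm)
    qed
  qed
  then obtain v where v: "(\<lambda>n. ?I (s n)) \<longlonglongrightarrow> v" by (metis Cauchy_convergent convergent_def)
  have "(\<lambda>n. \<integral>\<^sup>+x. ennreal (norm (F x - s n x)) \<partial>M) \<longlonglongrightarrow> 0"
  proof (rule tendsto_sandwich[OF _ _ tendsto_const])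
    show "\<forall>\<^sub>F n in sequentially. (\<integral>\<^sup>+x. ennreal (norm (F x - s n x)) \<partial>M) \<le> ennreal (1 / Suc n)"
    proof (intro always_eventually allI)
      fix n
      have "(\<integral>\<^sup>+x. ennreal (norm (F x - s n x)) \<partial>M) \<le> (\<integral>\<^sup>+x. ennreal (1 / Suc n) \<partial>M)"
        by (intro nn_integral_mono ennreal_leI s)
      also have "\<dots> = ennreal (1 / Suc n)" by (simp add: emeasure_space_1)
      finally show "(\<integral>\<^sup>+x. ennreal (norm (F x - s n x)) \<partial>M) \<le> ennreal (1 / Suc n)" .
    qed
    show "(\<lambda>n. ennreal (1 / real (Suc n))) \<longlonglongrightarrow> 0"
      using tendsto_ennrealI[OF lim1] by simp
  qed simp
  then have "bochner_has_integral M F v"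
    unfolding bochner_has_integral_def
    using v unif_approx_measurable[OF UA] simple_bochner_integrable_simple_function[OF s(1)] by blast
  with v show thesis using that by blast
qed

lemma has_bint:
  fixes F :: "'a \<Rightarrow> 'b::banach"
  assumes "unif_approx M F"
  shows "bochner_has_integral M F (bint M F)"
proof -
  have "\<forall>n::nat. \<exists>s. simple_function M s \<and> (\<forall>x\<in>space M. norm (F x - s x) \<le> 1 / Suc n)"
    using assms unfolding unif_approx_def by simp
  then obtain s where s: "\<And>n. simple_function M (s n)"
    "\<And>n x. x \<in> space M \<Longrightarrow> norm (F x - s n x) \<le> 1 / Suc n"
    by metis
  obtain v where "bochner_has_integral M F v"
    by (rule unif_approx_seq_integral[of s F, OF s])
  then show ?thesis by (simp add: bint_eqI)
qed

lemma bint_add: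
  fixes F G :: "'a \<Rightarrow> 'b::banach"
  assumes "unif_approx M F" "unif_approx M G"
  shows "bint M (\<lambda>x. F x + G x) = bint M F + bint M G"
proof -
  let ?I = "sb_integral M"
  \<comment> \<open>Accuracy 1/(2n+2) for each summand leaves 1/(n+1) for the sum.\<close>
  have "\<forall>n::nat. \<exists>s. simple_function M s \<and> (\<forall>x\<in>space M. norm (F x - s x) \<le> 1 / Suc (Suc (2*n)))"
    using assms(1) unfolding unif_approx_def by simp
  then obtain s where s: "\<And>n. simple_function M (s n)"
    "\<And>n x. x \<in> space M \<Longrightarrow> norm (F x - s n x) \<le> 1 / Suc (Suc (2*n))"
    by metis
  have "\<forall>n::nat. \<exists>s. simple_function M s \<and> (\<forall>x\<in>space M. norm (G x - s x) \<le> 1 / Suc (Suc (2*n)))"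
    using assms(2) unfolding unif_approx_def by simp
  then obtain t where t: "\<And>n. simple_function M (t n)"
    "\<And>n x. x \<in> space M \<Longrightarrow> norm (G x - t n x) \<le> 1 / Suc (Suc (2*n))"
    by metis
  have half: "1 / real (Suc (Suc (2*n))) \<le> 1 / real (Suc n)"  "1 / real (Suc (Suc (2*n))) + 1 / real (Suc (Suc (2*n))) = 1 / real (Suc n)" for n
    by (auto simp: field_simps)
  obtain v where v: "bochner_has_integral M F v" "(\<lambda>n. ?I (s n)) \<longlonglongrightarrow> v"
    by (rule unif_approx_seq_integral[of s F, OF s(1) order_trans[OF s(2) half(1)]])
  obtain w where w: "bochner_has_integral M G w" "(\<lambda>n. ?I (t n)) \<longlonglongrightarrow> w"
    by (rule unif_approx_seq_integral[of t G, OF t(1) order_trans[OF t(2) half(1)]])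
  have st: "simple_function M (\<lambda>x. s n x + t n x)" for n
    by (rule simple_function_compose2[where h="(+)", OF s(1) t(1)])
  have st2: "norm ((F x + G x) - (s n x + t n x)) \<le> 1 / Suc n" if "x \<in> space M" for n x
  proof -
    have "(F x + G x) - (s n x + t n x) = (F x - s n x) + (G x - t n x)" by simp
    then show ?thesis unfolding \<open>(F x + G x) - (s n x + t n x) = (F x - s n x) + (G x - t n x)\<close>
      using s(2)[OF that, of n] t(2)[OF that, of n] norm_triangle_ineq[of "F x - s n x" "G x - t n x"] half(2)[of n]
      by linarith
  qed
  obtain u where u: "bochner_has_integral M (\<lambda>x. F x + G x) u" "(\<lambda>n. ?I (\<lambda>x. s n x + t n x)) \<longlonglongrightarrow> u"
    by (rule unif_approx_seq_integral[of "\<lambda>n x. s n x + t n x" "\<lambda>x. F x + G x", OF st st2])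
  have "(\<lambda>n. ?I (\<lambda>x. s n x + t n x)) = (\<lambda>n. ?I (s n) + ?I (t n))"
    by (intro ext simple_bochner_integral_add simple_bochner_integrable_simple_function s t)
  then have "u = v + w" using u(2) tendsto_add[OF v(2) w(2)] LIMSEQ_unique by metis
  then show ?thesis using u v w by (simp add: bint_eqI)
qed

lemma bint_cmult:
  fixes F :: "'a \<Rightarrow> 'b::banach"
  assumes "unif_approx M F"
  shows "bint M (\<lambda>x. c *\<^sub>R F x) = c *\<^sub>R bint M F"
proof -
  let ?I = "sb_integral M"
  have cpos: "1 / ((\<bar>c\<bar>+1) * Suc n) > 0" for n by simp
  have "\<forall>n::nat. \<exists>s. simple_function M s \<and> (\<forall>x\<in>space M. norm (F x - s x) \<le> 1 / ((\<bar>c\<bar>+1) * Suc n))"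
    using assms cpos unfolding unif_approx_def by blast
  then obtain s where s: "\<And>n. simple_function M (s n)"
    "\<And>n x. x \<in> space M \<Longrightarrow> norm (F x - s n x) \<le> 1 / ((\<bar>c\<bar>+1) * Suc n)"
    by metis
  have le: "1 / ((\<bar>c\<bar>+1) * real (Suc n)) \<le> 1 / Suc n" for n
    by (intro divide_left_mono) (auto simp: mult_le_cancel_right1)
  obtain v where v: "bochner_has_integral M F v" "(\<lambda>n. ?I (s n)) \<longlonglongrightarrow> v"
    by (rule unif_approx_seq_integral[of s F, OF s(1) order_trans[OF s(2) le]])
  have cs: "simple_function M (\<lambda>x. c *\<^sub>R s n x)" for n
    by (rule simple_function_compose1[OF s(1)])
  have cs2: "norm (c *\<^sub>R F x - c *\<^sub>R s n x) \<le> 1 / Suc n" if "x \<in> space M" for n x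
  proof -
    have "norm (c *\<^sub>R F x - c *\<^sub>R s n x) = \<bar>c\<bar> * norm (F x - s n x)"
      by (metis norm_scaleR scaleR_diff_right)
    also have "\<dots> \<le> (\<bar>c\<bar>+1) * (1 / ((\<bar>c\<bar>+1) * Suc n))"
      by (intro mult_mono s that) auto
    also have "\<dots> = 1 / Suc n"
      by (simp add: divide_simps)
    finally show ?thesis .
  qed
  obtain u where u: "bochner_has_integral M (\<lambda>x. c *\<^sub>R F x) u" "(\<lambda>n. ?I (\<lambda>x. c *\<^sub>R s n x)) \<longlonglongrightarrow> u"
    by (rule unif_approx_seq_integral[of "\<lambda>n x. c *\<^sub>R s n x" "\<lambda>x. c *\<^sub>R F x", OF cs cs2])
  have "(\<lambda>n. ?I (\<lambda>x. c *\<^sub>R s n x)) = (\<lambda>n. c *\<^sub>R ?I (s n))"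
    by (intro ext simple_bochner_integral_linear simple_bochner_integrable_simple_function s linear_scaleR)
  then have "u = c *\<^sub>R v" using u(2) tendsto_scaleR[OF tendsto_const v(2)] LIMSEQ_unique by metis
  then show ?thesis using u v by (simp add: bint_eqI)
qed

lemma bint_diff:
  fixes F G :: "'a \<Rightarrow> 'b::banach"
  assumes "unif_approx M F" "unif_approx M G"
  shows "bint M (\<lambda>x. F x - G x) = bint M F - bint M G"
  using bint_add[OF assms(1) unif_approx_cmult[OF assms(2), of "-1"]] bint_cmult[OF assms(2), of "-1"] by simp

lemma bint_const: "bint M (\<lambda>_. c::'b::banach) = c"
proof -
  have 1: "simple_function M (\<lambda>_. c)" by simp
  have 2: "sb_integral M (\<lambda>_. c) = c"
    using not_empty by (simp add: Bochner_Integration.simple_bochner_integral_def image_constant_conv prob_space)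
  obtain v where "bochner_has_integral M (\<lambda>_. c) v" "(\<lambda>n. sb_integral M (\<lambda>_. c)) \<longlonglongrightarrow> v"
    using unif_approx_seq_integral[of "\<lambda>_ _. c" "\<lambda>_. c"] 1 by auto
  then show ?thesis using 2 bint_eqI LIMSEQ_const_iff by metis
qed

lemma bint_norm_le:
  fixes F :: "'a \<Rightarrow> 'b::banach"
  assumes F: "unif_approx M F" and h: "integrable M h" and le: "\<And>x. x \<in> space M \<Longrightarrow> norm (F x) \<le> h x"
  shows "norm (bint M F) \<le> (\<integral>x. h x \<partial>M)"
proof -
  have "ennreal (norm (bint M F)) \<le> (\<integral>\<^sup>+x. ennreal (norm (F x)) \<partial>M)"
    by (rule bochner_has_integral_norm_bound[OF has_bint[OF F]])
  also have "\<dots> \<le> (\<integral>\<^sup>+x. ennreal (h x) \<partial>M)"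
    by (intro nn_integral_mono ennreal_leI le)
  also have "\<dots> = ennreal (\<integral>x. h x \<partial>M)"
    by (intro nn_integral_eq_integral h AE_I2) (use le norm_ge_zero order_trans in blast)
  finally have 1: "ennreal (norm (bint M F)) \<le> ennreal (\<integral>x. h x \<partial>M)" .
  have "0 \<le> h x" if "x \<in> space M" for x using le[OF that] norm_ge_zero[of "F x"] by linarith
  then have "0 \<le> (\<integral>x. h x \<partial>M)" by (rule Bochner_Integration.integral_nonneg)
  then show ?thesis using 1 by simp
qed

lemma bint_close:
  fixes F G :: "'a \<Rightarrow> 'b::banach"
  assumes "unif_approx M F" "unif_approx M G" "\<And>x. x \<in> space M \<Longrightarrow> norm (F x - G x) \<le> c"
  shows "norm (bint M F - bint M G) \<le> c"
proof -
  have "norm (bint M (\<lambda>x. F x - G x)) \<le> (\<integral>x. c \<partial>M)"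
    by (rule bint_norm_le) (use assms in \<open>auto intro: unif_approx_diff\<close>)
  then show ?thesis using assms by (simp add: bint_diff prob_space)
qed

lemma bint_distr:
  fixes F :: "'c \<Rightarrow> 'b::banach"
  assumes p: "p \<in> measurable M N" and d: "distr M N p = N" and F: "unif_approx N F"
  shows "bint M (\<lambda>x. F (p x)) = bint N F"
proof -
  interpret N: prob_space N using prob_space_distr[OF p] d by simp
  have "\<forall>n::nat. \<exists>s. simple_function N s \<and> (\<forall>x\<in>space N. norm (F x - s x) \<le> 1 / Suc n)"
    using F unfolding unif_approx_def by simp
  then obtain s where s: "\<And>n. simple_function N (s n)"
    "\<And>n x. x \<in> space N \<Longrightarrow> norm (F x - s n x) \<le> 1 / Suc n"
    by metis
  obtain v where v: "bochner_has_integral N F v" "(\<lambda>n. sb_integral N (s n)) \<longlonglongrightarrow> v"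
    by (rule N.unif_approx_seq_integral[of s F, OF s])
  have sp: "simple_function M (\<lambda>x. s n (p x))" for n
    using simple_function_comp[OF p s(1)] by (simp add: comp_def)
  obtain u where u: "bochner_has_integral M (\<lambda>x. F (p x)) u"
    "(\<lambda>n. sb_integral M (\<lambda>x. s n (p x))) \<longlonglongrightarrow> u"
    by (rule unif_approx_seq_integral[of "\<lambda>n x. s n (p x)" "\<lambda>x. F (p x)", OF sp s(2)[OF measurable_space[OF p]]])
  have "sb_integral M (\<lambda>x. s n (p x)) = sb_integral N (s n)" for n
  proof -
    have sub: "(\<lambda>x. s n (p x)) ` space M \<subseteq> s n ` space N" using measurable_space[OF p] by auto
    have m: "measure N {x \<in> space N. s n x = y} = measure M {x \<in> space M. s n (p x) = y}" for y
    proof -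
      have "{x \<in> space N. s n x = y} \<in> sets N"
        using simple_functionD(2)[OF s(1), of n "{y}"] by (simp add: vimage_def Int_def conj_commute)
      then have "measure (distr M N p) {x \<in> space N. s n x = y} = measure M (p -` {x \<in> space N. s n x = y} \<inter> space M)"
        by (intro measure_distr p)
      also have "p -` {x \<in> space N. s n x = y} \<inter> space M = {x \<in> space M. s n (p x) = y}"
        using measurable_space[OF p] by auto
      finally show ?thesis by (simp add: d)
    qed
    \<comment> \<open>The first sum also runs over values of \<open>s n\<close> that are not
      attained on the range of \<open>p\<close>; their fibres in \<open>M\<close> are empty.\<close>
    have "(\<Sum>y\<in>s n ` space N. measure M {x \<in> space M. s n (p x) = y} *\<^sub>R y) =
       (\<Sum>y\<in>(\<lambda>x. s n (p x)) ` space M. measure M {x \<in> space M. s n (p x) = y} *\<^sub>R y)"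
    proof (rule sum.mono_neutral_right)
      show "finite (s n ` space N)" using s(1)[of n] by (simp add: simple_function_def)
      have "{x \<in> space M. s n (p x) = y} = {}" if "y \<notin> (\<lambda>x. s n (p x)) ` space M" for y
        using that by auto
      then show "\<forall>y\<in>s n ` space N - (\<lambda>x. s n (p x)) ` space M. measure M {x \<in> space M. s n (p x) = y} *\<^sub>R y = 0"
        by (metis DiffD2 measure_empty scaleR_zero_left)
    qed (rule sub)
    then show ?thesis unfolding Bochner_Integration.simple_bochner_integral_def m by simp
  qed
  then have "u = v" using u v LIMSEQ_unique by auto
  then show ?thesis using u v by (simp add: bint_eqI)
qed

end

section \<open>Sequences of independent variables\<close>

text \<open>Keeps the past below \<open>i\<close> and resamples the future. With
  \<open>\<omega>'\<close> distributed as the whole sequence, the probability of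
  \<open>mix i \<omega> \<omega>' \<in> A\<close> is a version, defined at every
  \<open>\<omega>\<close>, of the conditional probability of \<open>A\<close> given the first
  \<open>i\<close> coordinates.\<close>

definition mix :: "nat \<Rightarrow> (nat \<Rightarrow> 'a) \<Rightarrow> (nat \<Rightarrow> 'a) \<Rightarrow> nat \<Rightarrow> 'a" where
  "mix i \<omega> \<omega>' = (\<lambda>j. if j < i then \<omega> j else \<omega>' j)"

lemma mix_mix: "j \<le> i \<Longrightarrow> mix j (mix i \<omega> \<omega>') \<omega>'' = mix j \<omega> \<omega>''"
  by (auto simp: mix_def)

locale seq_prob_space = product_prob_space M "UNIV :: nat set" for M :: "nat \<Rightarrow> 'a measure"
begin

abbreviation "\<P> \<equiv> Pi\<^sub>M UNIV M"

lemma in_space_iff: "\<omega> \<in> space \<P> \<longleftrightarrow> (\<forall>j. \<omega> j \<in> space (M j))"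
  by (auto simp: space_PiM)

lemma mix_in_space: "\<omega> \<in> space \<P> \<Longrightarrow> \<omega>' \<in> space \<P> \<Longrightarrow> mix i \<omega> \<omega>' \<in> space \<P>"
  by (auto simp: in_space_iff mix_def)

lemma measurable_mix: "(\<lambda>(\<omega>, \<omega>'). mix i \<omega> \<omega>') \<in> measurable (\<P> \<Otimes>\<^sub>M \<P>) \<P>"
proof (rule measurable_PiM_single')
  fix j :: nat
  show "(\<lambda>x. (case x of (\<omega>, \<omega>') \<Rightarrow> mix i \<omega> \<omega>') j) \<in> measurable (\<P> \<Otimes>\<^sub>M \<P>) (M j)"
    unfolding mix_def by (cases "j < i") (simp_all add: split_beta')
qed (auto simp: space_pair_measure mix_def in_space_iff)

text \<open>A finite-dimensional set pulls back to the product of its part below \<open>i\<close>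
  and its part from \<open>i\<close> on, so its probability factors as in the product
  measure.\<close>

lemma distr_mix: "distr (\<P> \<Otimes>\<^sub>M \<P>) \<P> (\<lambda>(\<omega>, \<omega>'). mix i \<omega> \<omega>') = \<P>" (is "?D = _")
proof (rule PiM_eq)
  let ?I = "UNIV :: nat set"
  let "distr _ _ ?f" = "?D"
  fix J E assume J: "finite J" "J \<subseteq> ?I" "\<And>j. j \<in> J \<Longrightarrow> E j \<in> sets (M j)"
  let ?X = "prod_emb ?I M J (\<Pi>\<^sub>E j\<in>J. E j)"
  have "\<And>j x. j \<in> J \<Longrightarrow> x \<in> E j \<Longrightarrow> x \<in> space (M j)"
    using J(3)[THEN sets.sets_into_space] by (auto simp: space_PiM Pi_iff subset_eq)
  with J have "?f -` ?X \<inter> space (\<P> \<Otimes>\<^sub>M \<P>) =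
    (prod_emb ?I M (J \<inter> {..<i}) (\<Pi>\<^sub>E j\<in>J \<inter> {..<i}. E j)) \<times>
    (prod_emb ?I M (J - {..<i}) (\<Pi>\<^sub>E j\<in>J - {..<i}. E j))" (is "_ = ?E \<times> ?F")
    by (auto simp: space_pair_measure in_space_iff prod_emb_def PiE_iff mix_def split: if_splits)
  then have "emeasure ?D ?X = emeasure (\<P> \<Otimes>\<^sub>M \<P>) (?E \<times> ?F)"
    by (subst emeasure_distr[OF measurable_mix])
       (auto intro!: sets_PiM_I simp: split_beta' J)
  also have "\<dots> = emeasure \<P> ?E * emeasure \<P> ?F"
    using J by (intro P.emeasure_pair_measure_Times) (auto intro!: sets_PiM_I)
  also have "emeasure \<P> ?F = (\<Prod>j\<in>J - {..<i}. emeasure (M j) (E j))"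
    using J by (intro emeasure_PiM_emb) auto
  also have "emeasure \<P> ?E = (\<Prod>j\<in>J \<inter> {..<i}. emeasure (M j) (E j))"
    using J by (intro emeasure_PiM_emb) auto
  also have "(\<Prod>j\<in>J \<inter> {..<i}. emeasure (M j) (E j)) * (\<Prod>j\<in>J - {..<i}. emeasure (M j) (E j)) = (\<Prod>j\<in>J. emeasure (M j) (E j))"
    using prod.Int_Diff[OF J(1), of "\<lambda>j. emeasure (M j) (E j)" "{..<i}"] by simp
  finally show "emeasure ?D ?X = (\<Prod>j\<in>J. emeasure (M j) (E j))" .
qed simp_all

lemma measurable_upd:
  assumes h: "h \<in> measurable (M k) (M k)"
  shows "(\<lambda>\<omega>. fun_upd \<omega> k (h (\<omega> k))) \<in> measurable \<P> \<P>"
proof (rule measurable_PiM_single')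
  fix j :: nat
  show "(\<lambda>\<omega>. (fun_upd \<omega> k (h (\<omega> k))) j) \<in> measurable \<P> (M j)"
    using h by (cases "j = k") (auto intro: measurable_compose[OF measurable_component_singleton])
qed (use measurable_space[OF h] in \<open>auto simp: in_space_iff\<close>)

lemma distr_upd:
  assumes h: "h \<in> measurable (M k) (M k)" and d: "distr (M k) (M k) h = M k"
  shows "distr \<P> \<P> (\<lambda>\<omega>. fun_upd \<omega> k (h (\<omega> k))) = \<P>" (is "?D = _")
proof (rule PiM_eq)
  let ?I = "UNIV :: nat set"
  let "distr _ _ ?f" = "?D"
  fix J E assume J: "finite J" "J \<subseteq> ?I" "\<And>j. j \<in> J \<Longrightarrow> E j \<in> sets (M j)"
  let ?X = "prod_emb ?I M J (\<Pi>\<^sub>E j\<in>J. E j)"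
  define E' where "E' = fun_upd E k (h -` E k \<inter> space (M k))"
  have E': "E' j \<in> sets (M j)" if "j \<in> J" for j
    using J(3)[OF that] measurable_sets[OF h] by (auto simp: E'_def)
  have em: "emeasure (M j) (E' j) = emeasure (M j) (E j)" if "j \<in> J" for j
  proof (cases "j = k")
    case True
    have "emeasure (distr (M k) (M k) h) (E k) = emeasure (M k) (h -` E k \<inter> space (M k))"
      using J(3)[OF that] True by (intro emeasure_distr h) auto
    then show ?thesis using True d by (simp add: E'_def)
  qed (simp add: E'_def)
  have "\<And>j x. j \<in> J \<Longrightarrow> x \<in> E j \<Longrightarrow> x \<in> space (M j)"
    using J(3)[THEN sets.sets_into_space] by (auto simp: space_PiM Pi_iff subset_eq)
  with J have "?f -` ?X \<inter> space \<P> = prod_emb ?I M J (\<Pi>\<^sub>E j\<in>J. E' j)"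
    using measurable_space[OF h]
    by (auto simp: in_space_iff prod_emb_def PiE_iff E'_def split: if_splits)
  then have "emeasure ?D ?X = emeasure \<P> (prod_emb ?I M J (\<Pi>\<^sub>E j\<in>J. E' j))"
    by (subst emeasure_distr[OF measurable_upd[OF h]])
       (auto intro!: sets_PiM_I simp: J)
  also have "\<dots> = (\<Prod>j\<in>J. emeasure (M j) (E' j))"
    using J E' by (intro emeasure_PiM_emb) auto
  also have "\<dots> = (\<Prod>j\<in>J. emeasure (M j) (E j))"
    by (intro prod.cong refl em)
  finally show "emeasure ?D ?X = (\<Prod>j\<in>J. emeasure (M j) (E j))" .
qed simp_all

lemma mix_section_sets:
  assumes "A \<in> sets \<P>" "\<omega> \<in> space \<P>"
  shows "{\<omega>'\<in>space \<P>. mix i \<omega> \<omega>' \<in> A} \<in> sets \<P>"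
proof -
  have "(\<lambda>\<omega>'. mix i \<omega> \<omega>') \<in> measurable \<P> \<P>"
    using measurable_compose[OF measurable_Pair1'[OF assms(2)] measurable_mix[of i]] by simp
  from measurable_sets[OF this assms(1)] show ?thesis by (simp add: vimage_def Int_def conj_commute)
qed

lemma borel_measurable_mix_section:
  assumes A: "A \<in> sets \<P>"
  shows "(\<lambda>\<omega>. P.prob {\<omega>'\<in>space \<P>. mix i \<omega> \<omega>' \<in> A}) \<in> borel_measurable \<P>"
proof -
  have Q: "(\<lambda>(\<omega>, \<omega>'). mix i \<omega> \<omega>') -` A \<inter> space (\<P> \<Otimes>\<^sub>M \<P>) \<in> sets (\<P> \<Otimes>\<^sub>M \<P>)"
    by (rule measurable_sets[OF measurable_mix A])
  have eq: "Pair \<omega> -` ((\<lambda>(\<omega>, \<omega>'). mix i \<omega> \<omega>') -` A \<inter> space (\<P> \<Otimes>\<^sub>M \<P>)) = {\<omega>'\<in>space \<P>. mix i \<omega> \<omega>' \<in> A}"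
    if "\<omega> \<in> space \<P>" for \<omega>
    using that by (auto simp: space_pair_measure)
  have "(\<lambda>\<omega>. enn2real (emeasure \<P> (Pair \<omega> -` ((\<lambda>(\<omega>, \<omega>'). mix i \<omega> \<omega>') -` A \<inter> space (\<P> \<Otimes>\<^sub>M \<P>))))) \<in> borel_measurable \<P>"
    using P.measurable_emeasure_Pair[OF Q] by measurable
  then show ?thesis
    by (rule measurable_cong[THEN iffD1, rotated]) (simp only: eq measure_def)
qed

text \<open>Tower property: Fubini applied to the invariance of the law under
  \<open>mix\<close>.\<close>

lemma emeasure_mix:
  assumes A: "A \<in> sets \<P>"
  shows "emeasure \<P> A = (\<integral>\<^sup>+\<omega>. ennreal (P.prob {\<omega>'\<in>space \<P>. mix i \<omega> \<omega>' \<in> A}) \<partial>\<P>)"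
proof -
  have Q: "(\<lambda>(\<omega>, \<omega>'). mix i \<omega> \<omega>') -` A \<inter> space (\<P> \<Otimes>\<^sub>M \<P>) \<in> sets (\<P> \<Otimes>\<^sub>M \<P>)"
    by (rule measurable_sets[OF measurable_mix A])
  have "emeasure \<P> A = emeasure (distr (\<P> \<Otimes>\<^sub>M \<P>) \<P> (\<lambda>(\<omega>, \<omega>'). mix i \<omega> \<omega>')) A"
    by (simp add: distr_mix)
  also have "\<dots> = emeasure (\<P> \<Otimes>\<^sub>M \<P>) ((\<lambda>(\<omega>, \<omega>'). mix i \<omega> \<omega>') -` A \<inter> space (\<P> \<Otimes>\<^sub>M \<P>))"
    by (rule emeasure_distr[OF measurable_mix A])
  also have "\<dots> = (\<integral>\<^sup>+\<omega>. emeasure \<P> (Pair \<omega> -` ((\<lambda>(\<omega>, \<omega>'). mix i \<omega> \<omega>') -` A \<inter> space (\<P> \<Otimes>\<^sub>M \<P>))) \<partial>\<P>)"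
    by (rule P.emeasure_pair_measure_alt[OF Q])
  also have "\<dots> = (\<integral>\<^sup>+\<omega>. ennreal (P.prob {\<omega>'\<in>space \<P>. mix i \<omega> \<omega>' \<in> A}) \<partial>\<P>)"
  proof (rule nn_integral_cong)
    fix \<omega> assume "\<omega> \<in> space \<P>"
    then have "Pair \<omega> -` ((\<lambda>(\<omega>, \<omega>'). mix i \<omega> \<omega>') -` A \<inter> space (\<P> \<Otimes>\<^sub>M \<P>)) = {\<omega>'\<in>space \<P>. mix i \<omega> \<omega>' \<in> A}"
      by (auto simp: space_pair_measure)
    then show "emeasure \<P> (Pair \<omega> -` ((\<lambda>(\<omega>, \<omega>'). mix i \<omega> \<omega>') -` A \<inter> space (\<P> \<Otimes>\<^sub>M \<P>))) = ennreal (P.prob {\<omega>'\<in>space \<P>. mix i \<omega> \<omega>' \<in> A})"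
      by (simp add: P.emeasure_eq_measure)
  qed
  finally show ?thesis .
qed

section \<open>Approximation by events of finitely many coordinates, and the zero-one law\<close>

definition cylinder :: "nat \<Rightarrow> (nat \<Rightarrow> 'a) set \<Rightarrow> bool" where
  "cylinder k A \<longleftrightarrow> A \<in> sets \<P> \<and>
     (\<forall>\<omega>\<in>space \<P>. \<forall>\<omega>'\<in>space \<P>. (\<forall>j<k. \<omega> j = \<omega>' j) \<longrightarrow> (\<omega> \<in> A \<longleftrightarrow> \<omega>' \<in> A))"

lemma cylinder_mono: "cylinder k A \<Longrightarrow> k \<le> l \<Longrightarrow> cylinder l A"
  unfolding cylinder_def by (meson order_less_le_trans)

lemma cylinder_Un:
  assumes "cylinder k A" "cylinder k B"
  shows "cylinder k (A \<union> B)"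
  unfolding cylinder_def
proof (intro conjI ballI impI)
  show "A \<union> B \<in> sets \<P>" using assms by (auto simp: cylinder_def)
  fix \<omega> \<omega>' assume "\<omega> \<in> space \<P>" "\<omega>' \<in> space \<P>" "\<forall>j<k. \<omega> j = \<omega>' j"
  then have "\<omega> \<in> A \<longleftrightarrow> \<omega>' \<in> A" "\<omega> \<in> B \<longleftrightarrow> \<omega>' \<in> B"
    using assms unfolding cylinder_def by blast+
  then show "\<omega> \<in> A \<union> B \<longleftrightarrow> \<omega>' \<in> A \<union> B" by simp
qed

lemma cylinder_compl:
  assumes "cylinder k A"
  shows "cylinder k (space \<P> - A)"
  unfolding cylinder_def
proof (intro conjI ballI impI)
  show "space \<P> - A \<in> sets \<P>" using assms by (auto simp: cylinder_def)
  fix \<omega> \<omega>' assume w: "\<omega> \<in> space \<P>" "\<omega>' \<in> space \<P>" "\<forall>j<k. \<omega> j = \<omega>' j"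
  then have "\<omega> \<in> A \<longleftrightarrow> \<omega>' \<in> A"
    using assms unfolding cylinder_def by blast
  then show "\<omega> \<in> space \<P> - A \<longleftrightarrow> \<omega>' \<in> space \<P> - A" using w by simp
qed

lemma cylinder_UN:
  assumes "\<And>i::nat. \<exists>k. cylinder k (A i)"
  shows "\<exists>k. cylinder k (\<Union>i<n. A i)"
proof (induction n)
  case 0 show ?case by (auto simp: cylinder_def)
next
  case (Suc n)
  obtain k l where k: "cylinder k (\<Union>i<n. A i)" and l: "cylinder l (A n)"
    using Suc assms by blast
  have "cylinder (max k l) (\<Union>i<n. A i)" "cylinder (max k l) (A n)"
    using cylinder_mono[OF k] cylinder_mono[OF l] by auto
  then have "cylinder (max k l) ((\<Union>i<n. A i) \<union> A n)"
    by (rule cylinder_Un)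
  then show ?case by (metis UN_Un UN_insert Un_commute lessThan_Suc image_insert)
qed

text \<open>The approximable sets form a sigma-algebra containing the generators. For a countable
  union the tail is cut off and the remaining error is shared among the first \<open>n\<close>
  sets.\<close>

lemma cylinder_approx:
  assumes "G \<in> sets \<P>" "\<epsilon> > 0"
  shows "\<exists>k A. cylinder k A \<and> P.prob (sym_diff A G) < \<epsilon>"
proof -
  have "G \<in> sigma_sets (\<Pi>\<^sub>E i\<in>UNIV. space (M i)) {{f\<in>\<Pi>\<^sub>E i\<in>UNIV. space (M i). f i \<in> A} | i A. i \<in> UNIV \<and> A \<in> sets (M i)}"
    using assms(1) unfolding sets_PiM_single .
  then have "G \<in> sets \<P> \<and> (\<forall>\<epsilon>>0. \<exists>k A. cylinder k A \<and> P.prob (sym_diff A G) < \<epsilon>)"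
  proof (induction rule: sigma_sets.induct)
    case (Basic a)
    then obtain i A where a: "a = {f\<in>\<Pi>\<^sub>E i\<in>UNIV. space (M i). f i \<in> A}" "A \<in> sets (M i)" by auto
    have "a \<in> sets \<P>" unfolding sets_PiM_single using Basic by auto
    then have "cylinder (Suc i) a" unfolding cylinder_def a by (auto simp: space_PiM)
    then show ?case using \<open>a \<in> sets \<P>\<close> by (intro conjI allI impI exI[of _ "Suc i"] exI[of _ a]) auto
  next
    case Empty
    have "cylinder 0 {}" by (simp add: cylinder_def)
    then show ?case by (intro conjI allI impI exI[of _ 0] exI[of _ "{}"]) auto
  next
    case (Compl a)
    show ?case
    proof (intro conjI allI impI)
      show "(\<Pi>\<^sub>E i\<in>UNIV. space (M i)) - a \<in> sets \<P>"
        using Compl by (metis space_PiM sets.compl_sets)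
      fix \<epsilon> :: real assume "\<epsilon> > 0"
      then obtain k A where A: "cylinder k A" "P.prob (sym_diff A a) < \<epsilon>" using Compl by blast
      have "A \<subseteq> space \<P>" "a \<subseteq> space \<P>" using A(1) Compl.IH by (auto dest: sets.sets_into_space simp: cylinder_def)
      then have "(space \<P> - A) - (space \<P> - a) = a - A" "(space \<P> - a) - (space \<P> - A) = A - a" by auto
      then have "sym_diff (space \<P> - A) (space \<P> - a) = sym_diff A a" by (simp add: Un_commute)
      moreover have "cylinder k (space \<P> - A)" by (rule cylinder_compl[OF A(1)])
      ultimately have "cylinder k (space \<P> - A) \<and> P.prob (sym_diff (space \<P> - A) (space \<P> - a)) < \<epsilon>"
        using A(2) by simp
      then show "\<exists>k A. cylinder k A \<and> P.prob (sym_diff A ((\<Pi>\<^sub>E i\<in>UNIV. space (M i)) - a)) < \<epsilon>"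
        unfolding space_PiM by (intro exI)
    qed
  next
    case (Union a)
    have as: "range a \<subseteq> sets \<P>" using Union by auto
    show ?case
    proof (intro conjI allI impI)
      show U: "(\<Union>i. a i) \<in> sets \<P>" using as by auto
      fix \<epsilon> :: real assume e: "\<epsilon> > 0"
      have "(\<lambda>n. P.prob (\<Union>i<n. a i)) \<longlonglongrightarrow> P.prob (\<Union>n. \<Union>i<n. a i)"
        using as by (intro P.finite_Lim_measure_incseq) (auto simp: incseq_def, force)
      moreover have "(\<Union>n. \<Union>i<n. a i) = (\<Union>i. a i)" by auto
      ultimately obtain n where n: "\<bar>P.prob (\<Union>i<n. a i) - P.prob (\<Union>i. a i)\<bar> < \<epsilon>/2"
        using e by (metis LIMSEQ_D half_gt_zero order_refl real_norm_def)
      have fs: "(\<Union>i<n. a i) \<in> sets \<P>" using as by auto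
      have "P.prob ((\<Union>i. a i) - (\<Union>i<n. a i)) = P.prob (\<Union>i. a i) - P.prob (\<Union>i<n. a i)"
        by (intro P.finite_measure_Diff U fs) auto
      with n have n': "P.prob ((\<Union>i. a i) - (\<Union>i<n. a i)) < \<epsilon>/2" by linarith
      define \<eta> where "\<eta> = \<epsilon> / (2 * (real n + 1))"
      have eta: "\<eta> > 0" "n * \<eta> < \<epsilon>/2" using e by (auto simp: \<eta>_def field_simps)
      have "\<forall>i. \<exists>A. (\<exists>k. cylinder k A) \<and> P.prob (sym_diff A (a i)) < \<eta>" using Union eta(1) by blast
      then obtain A where A: "\<And>i. \<exists>k. cylinder k (A i)" "\<And>i. P.prob (sym_diff (A i) (a i)) < \<eta>" by metis
      have As: "A i \<in> sets \<P>" for i using A(1) unfolding cylinder_def by blast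
      have ss: "sym_diff (A i) (a i) \<in> sets \<P>" for i using As as by auto
      obtain k where k: "cylinder k (\<Union>i<n. A i)" using cylinder_UN[of A n, OF A(1)] by blast
      have "P.prob (sym_diff (\<Union>i<n. A i) (\<Union>i. a i)) \<le> P.prob ((\<Union>i<n. sym_diff (A i) (a i)) \<union> ((\<Union>i. a i) - (\<Union>i<n. a i)))"
        using ss as fs U by (intro P.finite_measure_mono) auto
      also have "\<dots> \<le> P.prob (\<Union>i<n. sym_diff (A i) (a i)) + P.prob ((\<Union>i. a i) - (\<Union>i<n. a i))"
        using ss as fs U by (intro measure_Un_le) auto
      also have "P.prob (\<Union>i<n. sym_diff (A i) (a i)) \<le> (\<Sum>i<n. P.prob (sym_diff (A i) (a i)))"
        using ss by (intro P.finite_measure_subadditive_finite) auto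
      also have "\<dots> \<le> (\<Sum>i<n. \<eta>)" using A(2) by (intro sum_mono) (simp add: order_less_imp_le)
      also have "\<dots> = n * \<eta>" by simp
      finally have "P.prob (sym_diff (\<Union>i<n. A i) (\<Union>i. a i)) < \<epsilon>" using eta n' by linarith
      then show "\<exists>k A. cylinder k A \<and> P.prob (sym_diff A (\<Union> (range a))) < \<epsilon>" using k by blast
    qed
  qed
  then show ?thesis using assms(2) by blast
qed

text \<open>Doob's inequality by stopping: \<open>E i\<close> is the event that \<open>i\<close> is
  the first index from \<open>k\<close> on at which the conditional probability exceeds
  \<open>c\<close>. It depends on the coordinates below \<open>i\<close> only, so conditioning at
  \<open>i\<close> shows that \<open>H\<close> fills at least the fraction \<open>c\<close> of
  \<open>E i\<close>; the events \<open>E i\<close> are disjoint.\<close>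

lemma maximal_inequality:
  assumes H: "H \<in> sets \<P>" and l: "c > 0"
  shows "P.prob {\<omega>\<in>space \<P>. \<exists>i\<ge>k. P.prob {\<omega>'\<in>space \<P>. mix i \<omega> \<omega>' \<in> H} > c} \<le> P.prob H / c"
proof -
  define Z where "Z = (\<lambda>i \<omega>. P.prob {\<omega>'\<in>space \<P>. mix i \<omega> \<omega>' \<in> H})"
  have [measurable]: "Z i \<in> borel_measurable \<P>" for i
    unfolding Z_def by (rule borel_measurable_mix_section[OF H])
  define E where "E = (\<lambda>i. {\<omega>\<in>space \<P>. k \<le> i \<and> Z i \<omega> > c \<and> (\<forall>j<i. k \<le> j \<longrightarrow> Z j \<omega> \<le> c)})"
  have E[measurable]: "E i \<in> sets \<P>" for i unfolding E_def by measurable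
  have Zmix: "Z j (mix i \<omega> \<omega>') = Z j \<omega>" if "j \<le> i" for i j \<omega> \<omega>'
    unfolding Z_def mix_mix[OF that] ..
  have Emix: "mix i \<omega> \<omega>' \<in> E i \<longleftrightarrow> \<omega> \<in> E i" if "\<omega> \<in> space \<P>" "\<omega>' \<in> space \<P>" for i \<omega> \<omega>'
    using that mix_in_space[OF that] unfolding E_def by (auto simp: Zmix)
  have disj: "disjoint_family E"
    unfolding disjoint_family_on_def
  proof (intro ballI impI)
    fix m n :: nat assume "m \<noteq> n"
    then consider "m < n" | "n < m" by linarith
    then show "E m \<inter> E n = {}" by cases (force simp: E_def)+
  qed
  have one: "c * P.prob (E i) \<le> P.prob (H \<inter> E i)" for i
  proof -
    have "ennreal (c * P.prob (E i)) = (\<integral>\<^sup>+\<omega>. ennreal c * indicator (E i) \<omega> \<partial>\<P>)"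
      using l by (simp add: nn_integral_cmult_indicator P.emeasure_eq_measure ennreal_mult'')
    also have "\<dots> \<le> (\<integral>\<^sup>+\<omega>. ennreal (P.prob {\<omega>'\<in>space \<P>. mix i \<omega> \<omega>' \<in> H \<inter> E i}) \<partial>\<P>)"
    proof (rule nn_integral_mono)
      fix \<omega> assume w: "\<omega> \<in> space \<P>"
      show "ennreal c * indicator (E i) \<omega> \<le> ennreal (P.prob {\<omega>'\<in>space \<P>. mix i \<omega> \<omega>' \<in> H \<inter> E i})"
      proof (cases "\<omega> \<in> E i")
        case True
        then have "{\<omega>'\<in>space \<P>. mix i \<omega> \<omega>' \<in> H \<inter> E i} = {\<omega>'\<in>space \<P>. mix i \<omega> \<omega>' \<in> H}"
          using Emix[OF w] by auto
        then have "P.prob {\<omega>'\<in>space \<P>. mix i \<omega> \<omega>' \<in> H \<inter> E i} = Z i \<omega>" by (simp add: Z_def)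
        then show ?thesis using True by (auto simp: E_def intro: ennreal_leI)
      qed simp
    qed
    also have "\<dots> = emeasure \<P> (H \<inter> E i)" by (rule emeasure_mix[symmetric]) (use H in auto)
    finally show ?thesis by (simp add: P.emeasure_eq_measure)
  qed
  have s1: "(\<lambda>i. P.prob (E i)) sums P.prob (\<Union>i. E i)"
    by (rule P.finite_measure_UNION) (use disj in auto)
  have s2: "(\<lambda>i. P.prob (H \<inter> E i)) sums P.prob (\<Union>i. H \<inter> E i)"
    by (rule P.finite_measure_UNION) (use disj H in \<open>auto simp: disjoint_family_on_def\<close>)
  have "c * P.prob (\<Union>i. E i) \<le> P.prob (\<Union>i. H \<inter> E i)"
    by (rule sums_le[OF one sums_mult[OF s1] s2])
  also have "\<dots> \<le> P.prob H" by (rule P.finite_measure_mono) (use H in auto)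
  finally have "P.prob (\<Union>i. E i) \<le> P.prob H / c" using l by (simp add: field_simps)
  moreover have "{\<omega>\<in>space \<P>. \<exists>i\<ge>k. Z i \<omega> > c} = (\<Union>i. E i)"
  proof (intro equalityI subsetI)
    fix \<omega> assume w: "\<omega> \<in> {\<omega>\<in>space \<P>. \<exists>i\<ge>k. Z i \<omega> > c}"
    define i where "i = (LEAST i. i \<ge> k \<and> Z i \<omega> > c)"
    obtain n where "n \<ge> k \<and> Z n \<omega> > c" using w by blast
    then have "i \<ge> k \<and> Z i \<omega> > c" unfolding i_def by (rule LeastI)
    moreover have "Z j \<omega> \<le> c" if "j < i" "k \<le> j" for j
      using not_less_Least[OF that(1)[unfolded i_def]] that(2) by (simp add: not_less)
    ultimately have "\<omega> \<in> E i" using w by (simp add: E_def)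
    then show "\<omega> \<in> (\<Union>i. E i)" by blast
  qed (auto simp: E_def)
  ultimately show ?thesis by (simp add: Z_def)
qed

text \<open>Approximate \<open>G\<close> up to \<epsilon> by an event \<open>A\<close> depending on
  the first \<open>k\<close> coordinates. If \<open>\<omega>\<close> is in \<open>A\<close> and
  \<open>i \<ge> k\<close>, every continuation stays in \<open>A\<close>, so the deficit
  \<open>1 - Y i \<omega>\<close> is the conditional probability of the symmetric difference. The
  maximal inequality keeps it below \<open>c\<close> outside an event of probability
  \<open>\<epsilon> / c\<close>.\<close>

theorem levy_zero_one:
  assumes G: "G \<in> sets \<P>"
  shows "AE \<omega> in \<P>. \<omega> \<in> G \<longrightarrow> (\<lambda>i. P.prob {\<omega>'\<in>space \<P>. mix i \<omega> \<omega>' \<in> G}) \<longlonglongrightarrow> 1"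
proof -
  define Y where "Y = (\<lambda>i \<omega>. P.prob {\<omega>'\<in>space \<P>. mix i \<omega> \<omega>' \<in> G})"
  have [measurable]: "Y i \<in> borel_measurable \<P>" for i
    unfolding Y_def by (rule borel_measurable_mix_section[OF G])
  have [measurable]: "G \<in> sets \<P>" by fact
  have bad: "AE \<omega> in \<P>. \<not> (\<omega> \<in> G \<and> (\<forall>k. \<exists>i\<ge>k. Y i \<omega> < 1 - c))" if l: "c > 0" for c
  proof -
    define Bad where "Bad = {\<omega>\<in>space \<P>. \<omega> \<in> G \<and> (\<forall>k. \<exists>i\<ge>k. Y i \<omega> < 1 - c)}"
    have Bad[measurable]: "Bad \<in> sets \<P>" unfolding Bad_def by measurable
    have small: "P.prob Bad \<le> \<epsilon> + \<epsilon> / c" if e: "\<epsilon> > 0" for \<epsilon>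
    proof -
      obtain k A where A: "cylinder k A" and d: "P.prob (sym_diff A G) < \<epsilon>"
        using cylinder_approx[OF G e] by blast
      have As[measurable]: "A \<in> sets \<P>" using A by (simp add: cylinder_def)
      let ?H = "sym_diff A G"
      let ?W = "{\<omega>\<in>space \<P>. \<exists>i\<ge>k. P.prob {\<omega>'\<in>space \<P>. mix i \<omega> \<omega>' \<in> ?H} > c}"
      have H: "?H \<in> sets \<P>" by measurable
      have Wm: "?W \<in> sets \<P>" using borel_measurable_mix_section[OF H] by measurable
      have sub: "Bad \<subseteq> ?H \<union> ?W"
      proof
        fix \<omega> assume w: "\<omega> \<in> Bad"
        then have ws: "\<omega> \<in> space \<P>" and wG: "\<omega> \<in> G" by (auto simp: Bad_def)
        obtain i where i: "i \<ge> k" "Y i \<omega> < 1 - c" using w by (auto simp: Bad_def)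
        show "\<omega> \<in> ?H \<union> ?W"
        proof (cases "\<omega> \<in> A")
          case True
          have mA: "mix i \<omega> \<omega>' \<in> A" if "\<omega>' \<in> space \<P>" for \<omega>'
          proof -
            have "\<forall>j<k. \<omega> j = mix i \<omega> \<omega>' j" using i(1) by (auto simp: mix_def)
            then show ?thesis using A True ws mix_in_space[OF ws that] unfolding cylinder_def by blast
          qed
          have "1 - Y i \<omega> = P.prob (space \<P> - {\<omega>'\<in>space \<P>. mix i \<omega> \<omega>' \<in> G})"
            unfolding Y_def by (rule P.prob_compl[OF mix_section_sets[OF G ws], symmetric])
          also have "space \<P> - {\<omega>'\<in>space \<P>. mix i \<omega> \<omega>' \<in> G} = {\<omega>'\<in>space \<P>. mix i \<omega> \<omega>' \<in> ?H}"
            using mA by auto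
          finally have "P.prob {\<omega>'\<in>space \<P>. mix i \<omega> \<omega>' \<in> ?H} > c" using i(2) by linarith
          then show ?thesis using ws i(1) by blast
        next
          case False then show ?thesis using wG by blast
        qed
      qed
      have "P.prob Bad \<le> P.prob (?H \<union> ?W)" by (rule P.finite_measure_mono[OF sub sets.Un[OF H Wm]])
      also have "\<dots> \<le> P.prob ?H + P.prob ?W" by (rule measure_Un_le[OF H Wm])
      also have "\<dots> \<le> P.prob ?H + P.prob ?H / c"
        using maximal_inequality[OF H l, of k] by simp
      also have "\<dots> \<le> \<epsilon> + \<epsilon> / c" using d l by (intro add_mono divide_right_mono) auto
      finally show ?thesis .
    qed
    have "P.prob Bad \<le> 0"
    proof (rule field_le_epsilon)
      fix e :: real assume "e > 0"
      then have "e / (1 + 1/c) > 0" using l by (simp add: add_pos_pos)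
      moreover have "e / (1 + 1/c) + e / (1 + 1/c) / c = e"
      proof -
        have "1 + 1/c > 0" using l by (simp add: add_pos_pos)
        then have "e / (1 + 1/c) * (1 + 1/c) = e" by simp
        moreover have "x + x / c = x * (1 + 1/c)" for x by (simp add: distrib_left)
        ultimately show ?thesis by metis
      qed
      ultimately show "P.prob Bad \<le> 0 + e" using small by fastforce
    qed
    then have "Bad \<in> null_sets \<P>"
      using measure_nonneg[of \<P> Bad] by (intro null_setsI) (auto simp: P.emeasure_eq_measure)
    then show ?thesis by (rule AE_I') (auto simp: Bad_def)
  qed
  have "AE \<omega> in \<P>. \<forall>n. \<not> (\<omega> \<in> G \<and> (\<forall>k. \<exists>i\<ge>k. Y i \<omega> < 1 - 1 / Suc n))"
    by (subst AE_all_countable) (intro allI bad, simp)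
  then have "AE \<omega> in \<P>. \<omega> \<in> G \<longrightarrow> (\<lambda>i. Y i \<omega>) \<longlonglongrightarrow> 1"
  proof (rule AE_mp, intro AE_I2 impI)
    fix \<omega> assume a: "\<forall>n. \<not> (\<omega> \<in> G \<and> (\<forall>k. \<exists>i\<ge>k. Y i \<omega> < 1 - 1 / real (Suc n)))" and w: "\<omega> \<in> G"
    show "(\<lambda>i. Y i \<omega>) \<longlonglongrightarrow> 1"
    proof (rule LIMSEQ_I)
      fix r :: real assume "r > 0"
      then obtain n where n: "1 / real (Suc n) < r" by (metis nat_approx_posE)
      obtain k where k: "\<And>i. i \<ge> k \<Longrightarrow> \<not> Y i \<omega> < 1 - 1 / real (Suc n)" using a w by blast
      have "norm (Y i \<omega> - 1) < r" if "i \<ge> k" for i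
        using k[OF that] n P.prob_le_1[of "{\<omega>'\<in>space \<P>. mix i \<omega> \<omega>' \<in> G}"] by (auto simp: Y_def)
      then show "\<exists>no. \<forall>n\<ge>no. norm (Y n \<omega> - 1) < r" by blast
    qed
  qed
  then show ?thesis by (simp add: Y_def)
qed

end

section \<open>Directed metric graphs\<close>

context
  fixes G :: "'m::metric_space dgraph" and e :: "'m set"
  assumes G: "directed_metric_graph G" and e: "e \<in> edges G"
begin

lemma edge_param:
  obtains \<gamma> where "\<gamma> 0 = src G e" "\<gamma> (elen G e) = snk G e" "\<gamma> ` {0..elen G e} = e" "elen G e > 0"
    "\<And>s t. s \<in> {0..elen G e} \<Longrightarrow> t \<in> {0..elen G e} \<Longrightarrow> dist (\<gamma> s) (\<gamma> t) = \<bar>s - t\<bar>"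
proof -
  obtain l \<gamma> where l: "l > 0" and g: "geodesic (src G e) (snk G e) 0 l \<gamma>" and im: "\<gamma> ` {0..l} = e"
    using G e unfolding directed_metric_graph_def by meson
  have ends: "\<gamma> 0 = src G e" "\<gamma> l = snk G e"
    and iso: "\<And>s t. s \<in> {0..l} \<Longrightarrow> t \<in> {0..l} \<Longrightarrow> dist (\<gamma> s) (\<gamma> t) = \<bar>s - t\<bar>"
    using g unfolding geodesic_def by blast+
  have "elen G e = l" unfolding elen_def ends[symmetric] using iso[of 0 l] l by simp
  then show thesis using that[of \<gamma>] ends im l iso by simp
qed

lemma elen_pos: "elen G e > 0"
  using edge_param by blast

lemma edge_ends: "src G e \<in> e" "snk G e \<in> e" "src G e \<in> verts G" "snk G e \<in> verts G"
proof -
  have "e \<inter> verts G = {src G e, snk G e}" using G e unfolding directed_metric_graph_def by blast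
  then show "src G e \<in> e" "snk G e \<in> e" "src G e \<in> verts G" "snk G e \<in> verts G" by blast+
qed

lemma edge_verts: "x \<in> e \<Longrightarrow> x \<in> verts G \<longleftrightarrow> x = src G e \<or> x = snk G e"
proof -
  have "e \<inter> verts G = {src G e, snk G e}" using G e unfolding directed_metric_graph_def by blast
  then show "x \<in> e \<Longrightarrow> x \<in> verts G \<longleftrightarrow> x = src G e \<or> x = snk G e" by blast
qed

lemma edge_subset: "e \<subseteq> points G"
  using G e unfolding directed_metric_graph_def by blast

lemma ecoord_bounds: "x \<in> e \<Longrightarrow> 0 \<le> ecoord G e x \<and> ecoord G e x \<le> elen G e"
  using ecoord_image[OF G e] by (metis atLeastAtMost_iff imageI)

lemma edge_dist: "x \<in> e \<Longrightarrow> y \<in> e \<Longrightarrow> dist x y = \<bar>ecoord G e x - ecoord G e y\<bar>"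
proof -
  assume xy: "x \<in> e" "y \<in> e"
  obtain \<gamma> where g: "\<gamma> 0 = src G e" "\<gamma> ` {0..elen G e} = e" "elen G e > 0"
    "\<And>s t. s \<in> {0..elen G e} \<Longrightarrow> t \<in> {0..elen G e} \<Longrightarrow> dist (\<gamma> s) (\<gamma> t) = \<bar>s - t\<bar>"
    using edge_param by metis
  obtain s t where st: "s \<in> {0..elen G e}" "t \<in> {0..elen G e}" "x = \<gamma> s" "y = \<gamma> t"
    using xy g(2) by (metis imageE)
  have "ecoord G e (\<gamma> s) = s" if "s \<in> {0..elen G e}" for s
    unfolding ecoord_def g(1)[symmetric] using g(4)[of 0 s] that g(3) by simp
  then show ?thesis using st g(4) by simp
qed

lemma ecoord_snk: "ecoord G e (snk G e) = elen G e"
  by (simp add: ecoord_def elen_def)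

lemma ecoord_eqD: "x \<in> e \<Longrightarrow> y \<in> e \<Longrightarrow> ecoord G e x = ecoord G e y \<Longrightarrow> x = y"
  using edge_dist by force

lemma epoint_in: "t \<in> {0..elen G e} \<Longrightarrow> epoint G e t \<in> e \<and> ecoord G e (epoint G e t) = t"
  unfolding epoint_def
proof (rule theI')
  assume "t \<in> {0..elen G e}"
  then obtain x where "x \<in> e" "ecoord G e x = t" using ecoord_image[OF G e] by (metis imageE)
  then show "\<exists>!x. x \<in> e \<and> ecoord G e x = t" using ecoord_eqD by blast
qed

lemma epoint_ecoord: "x \<in> e \<Longrightarrow> epoint G e (ecoord G e x) = x"
  using epoint_in[of "ecoord G e x"] ecoord_bounds ecoord_eqD by (meson atLeastAtMost_iff)

lemma edge_compact: "compact e"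
proof -
  obtain \<gamma> where g: "\<gamma> ` {0..elen G e} = e"
    "\<And>s t. s \<in> {0..elen G e} \<Longrightarrow> t \<in> {0..elen G e} \<Longrightarrow> dist (\<gamma> s) (\<gamma> t) = \<bar>s - t\<bar>"
    using edge_param by metis
  have "continuous_on {0..elen G e} \<gamma>"
    unfolding continuous_on_iff using g(2) by (metis dist_real_def)
  then have "compact (\<gamma> ` {0..elen G e})" by (rule compact_continuous_image) simp
  then show ?thesis using g(1) by simp
qed

lemma infinite_edge: "infinite e"
proof
  assume "finite e"
  then have "finite {0..elen G e}" using ecoord_image[OF G e] by (metis finite_imageI)
  then show False using elen_pos by (simp add: infinite_Icc)
qed

lemma containing_edge_eq: "x \<in> e \<Longrightarrow> x \<notin> verts G \<Longrightarrow> containing_edge G x = e"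
  unfolding containing_edge_def using G e unfolding directed_metric_graph_def
  by (intro the_equality) blast+

lemma edge_eqI: "e2 \<in> edges G \<Longrightarrow> x \<in> e \<Longrightarrow> x \<in> e2 \<Longrightarrow> x \<notin> verts G \<Longrightarrow> e2 = e"
  using G e unfolding directed_metric_graph_def by blast

end

lemma verts_subset: "directed_metric_graph G \<Longrightarrow> verts G \<subseteq> points G"
  by (simp add: directed_metric_graph_def)

lemma points_compact:
  assumes G: "directed_metric_graph G"
  shows "compact (points G)"
proof -
  have "points G = \<Union>(edges G)" "finite (edges G)" using G unfolding directed_metric_graph_def by auto
  then show ?thesis using edge_compact[OF G] by (simp add: compact_Union)
qed

section \<open>Geometry of a thick inverse system\<close>

locale thick_system =
  fixes S :: "'m::complete_space inv_system" and \<pi> :: "nat \<Rightarrow> 'm \<Rightarrow> 'm" and \<delta> :: "nat \<Rightarrow> real"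
  assumes tis: "thick_inverse_system S"
    and \<delta>_pos: "\<And>i. \<delta> i > 0" and \<delta>_dec: "decseq \<delta>" and \<delta>_0: "\<delta> 0 < 1/2"
    and \<delta>_E: "\<And>i. delta_E S i \<le> \<delta> i" and \<delta>_d: "\<And>i. delta_d S i \<le> ennreal (\<delta> i)"
    and lp: "limit_projections S \<pi>"
begin

abbreviation "X i \<equiv> points (gr S i)"
abbreviation "E i \<equiv> edges (gr S i)"
abbreviation "E' i \<equiv> edges (sub S i)"
abbreviation "V i \<equiv> verts (gr S i)"
abbreviation "V' i \<equiv> verts (sub S i)"
abbreviation "XI \<equiv> X_inf S"

definition ht :: "'m \<Rightarrow> real" where "ht y = unit_coord S (\<pi> 0 y)"

lemma G: "directed_metric_graph (gr S i)"
  using tis unfolding thick_inverse_system_def by blast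

lemma X_Suc: "X i \<subseteq> X (Suc i)"
  using tis unfolding thick_inverse_system_def by blast

lemma X_mono: "i \<le> j \<Longrightarrow> X i \<subseteq> X j"
  by (rule lift_Suc_mono_le[of X]) (use X_Suc in auto)

lemma bond_in: "x \<in> X (Suc i) \<Longrightarrow> bond S i x \<in> X i"
  using tis unfolding thick_inverse_system_def by blast

lemma A2: "A2 S" and A1: "A1 S" and A4: "A4 S" and A3: "A3 S"
  using tis unfolding thick_inverse_system_def by blast+

lemma subdiv: "directed_subdivision (sub S i) (gr S i)"
  using A2 unfolding A2_def by blast

lemma H: "directed_metric_graph (sub S i)"
  using subdiv unfolding directed_subdivision_def by blast

lemma sub_points: "points (sub S i) = X i"
  using subdiv unfolding directed_subdivision_def by blast

lemma V_sub: "V i \<subseteq> V' i"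
  using subdiv unfolding directed_subdivision_def by blast

lemma sub_parent:
  assumes "e' \<in> E' i"
  obtains e where "e \<in> E i" "e' \<subseteq> e" "ecoord (gr S i) e (src (sub S i) e') < ecoord (gr S i) e (snk (sub S i) e')"
  using subdiv assms unfolding directed_subdivision_def by blast

lemma finite_E: "finite (E i)" and finite_E': "finite (E' i)" and finite_V: "finite (V i)"
  using G[of i] H[of i] unfolding directed_metric_graph_def by auto

lemma X_E: "X i = \<Union>(E i)" and X_E': "X i = \<Union>(E' i)"
  using G[of i] H[of i] sub_points[of i] unfolding directed_metric_graph_def by auto

lemma in_E: assumes "x \<in> X i" obtains e where "e \<in> E i" "x \<in> e"
  using assms unfolding X_E by blast

lemma in_E': assumes "x \<in> X i" obtains e' where "e' \<in> E' i" "x \<in> e'"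
  using assms unfolding X_E' by blast

context
  fixes i e'
  assumes e': "e' \<in> E' i"
begin

lemma A2': "bond_preimage S i e' = e' \<union> opp S i e' \<and> e' \<in> E (Suc i) \<and> opp S i e' \<in> E (Suc i) \<and>
    src (gr S (Suc i)) e' = src (sub S i) e' \<and> snk (gr S (Suc i)) e' = snk (sub S i) e' \<and>
    (opp S i e' = e' \<or> src (gr S (Suc i)) (opp S i e') = src (gr S (Suc i)) e' \<and>
       snk (gr S (Suc i)) (opp S i e') = snk (gr S (Suc i)) e' \<and>
       (opp S i e' - {src (gr S (Suc i)) (opp S i e'), snk (gr S (Suc i)) (opp S i e')}) \<inter> \<Union>(E (Suc i) - {opp S i e'}) = {}) \<and>
    (terminal S i e' \<longrightarrow> opp S i e' = e')"
  using A2 e' unfolding A2_def Let_def by blast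

lemma sub_edge: "e' \<in> E (Suc i)"
  "src (gr S (Suc i)) e' = src (sub S i) e'" "snk (gr S (Suc i)) e' = snk (sub S i) e'"
  "elen (gr S (Suc i)) e' = elen (sub S i) e'"
  using A2' by (auto simp: elen_def)

lemma opp_edge: "opp S i e' \<in> E (Suc i)"
  "src (gr S (Suc i)) (opp S i e') = src (sub S i) e'" "snk (gr S (Suc i)) (opp S i e') = snk (sub S i) e'"
  "elen (gr S (Suc i)) (opp S i e') = elen (sub S i) e'"
  using A2' by (auto simp: elen_def)

lemma terminal_opp: "terminal S i e' \<Longrightarrow> opp S i e' = e'"
  using A2' by blast

lemma preimage_in: "x \<in> X (Suc i) \<Longrightarrow> bond S i x \<in> e' \<Longrightarrow> x \<in> e' \<or> x \<in> opp S i e'"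
  using A2' unfolding bond_preimage_def by blast

lemma bond_id_edge: "x \<in> e' \<Longrightarrow> bond S i x = x"
  using A4 e' unfolding A4_def by blast

lemma bond_opp_image: "bond S i ` opp S i e' = e'"
  using A4 e' unfolding A4_def by blast

lemma bond_opp_dist: "x \<in> opp S i e' \<Longrightarrow> y \<in> opp S i e' \<Longrightarrow> dist (bond S i x) (bond S i y) = dist x y"
  using A4 e' unfolding A4_def by blast

lemma src_in_opp: "src (sub S i) e' \<in> opp S i e'" "snk (sub S i) e' \<in> opp S i e'"
  using edge_ends[OF G opp_edge(1)] opp_edge by auto

lemma sub_edge_X: "e' \<subseteq> X i"
  using edge_subset[OF H e'] sub_points by simp

end

lemma bond_src: 
  assumes "e' \<in> E' i" shows "bond S i (src (sub S i) e') = src (sub S i) e'" "bond S i (snk (sub S i) e') = snk (sub S i) e'"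
  using bond_id_edge[OF assms] edge_ends[OF H assms] by auto

text \<open>(A2) names edges of the next graph; that there are no others is derived here. A further
  edge would meet all the named ones in vertices only, while these cover the graph, so it would be a
  finite set.\<close>

lemma E_Suc:
  assumes e: "e \<in> E (Suc i)"
  obtains e' where "e' \<in> E' i" "e = e' \<or> e = opp S i e'"
proof (rule ccontr)
  assume "\<not> thesis"
  then have no: "\<And>e'. e' \<in> E' i \<Longrightarrow> e \<noteq> e' \<and> e \<noteq> opp S i e'" using that by blast
  have "e \<subseteq> V (Suc i)"
  proof
    fix x assume x: "x \<in> e"
    then have xX: "x \<in> X (Suc i)" using e X_E by blast
    obtain e' where e': "e' \<in> E' i" "bond S i x \<in> e'" using in_E'[OF bond_in[OF xX]] by blast
    have "x \<in> e' \<or> x \<in> opp S i e'" by (rule preimage_in[OF e'(1) xX e'(2)])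
    then show "x \<in> V (Suc i)"
      using edge_eqI[OF G e _ x] sub_edge(1)[OF e'(1)] opp_edge(1)[OF e'(1)] no[OF e'(1)] by metis
  qed
  then show False using infinite_edge[OF G e] finite_V finite_subset by blast
qed

lemma V'_V: "V' i \<subseteq> V (Suc i)"
proof
  fix v assume v: "v \<in> V' i"
  then have "v \<in> X i" using verts_subset[OF H] sub_points by auto
  then obtain e' where e': "e' \<in> E' i" "v \<in> e'" by (rule in_E')
  then show "v \<in> V (Suc i)"
    using edge_verts[OF H e'(1) e'(2)] v sub_edge[OF e'(1)] edge_ends[OF G sub_edge(1)[OF e'(1)]] by metis
qed

lemma V_mono: "i \<le> j \<Longrightarrow> V i \<subseteq> V j"
  by (rule lift_Suc_mono_le[of V]) (use V_sub V'_V in blast)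

lemma V_X: "V i \<subseteq> X i" and V'_X: "V' i \<subseteq> X i"
  using verts_subset[OF G] verts_subset[OF H] sub_points by auto

text \<open>The opposite edge shares both ends with \<open>e'\<close>, and the bond fixes them and
  is isometric on it, so no second point lies over a vertex. Hence a point whose next projection
  differs from the present one does not project to a vertex of the subdivision.\<close>

lemma vert_fix:
  assumes v: "v \<in> V' i" and z: "z \<in> X (Suc i)" "bond S i z = v"
  shows "z = v"
proof -
  obtain e' where e': "e' \<in> E' i" "v \<in> e'" using v V'_X in_E' by blast
  have ends: "v = src (sub S i) e' \<or> v = snk (sub S i) e'" using edge_verts[OF H e'] v by blast
  have "z \<in> e' \<or> z \<in> opp S i e'" using preimage_in[OF e'(1) z(1)] z e' by auto
  then show ?thesis
  proof
    assume "z \<in> e'" then show ?thesis using bond_id_edge[OF e'(1)] z by metis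
  next
    assume "z \<in> opp S i e'"
    moreover have "v \<in> opp S i e'" using ends src_in_opp[OF e'(1)] by metis
    moreover have "bond S i v = v" using ends bond_src[OF e'(1)] by metis
    ultimately show ?thesis using bond_opp_dist[OF e'(1), of z v] z by simp
  qed
qed

subsection \<open>The limit space\<close>

lemma X_XI: "X i \<subseteq> XI"
  unfolding X_inf_def by (meson UN_upper UNIV_I closure_subset order_trans)

lemma closed_XI: "closed XI" unfolding X_inf_def by simp

lemma pi_in: "x \<in> XI \<Longrightarrow> \<pi> i x \<in> X i"
  and pi_cont: "continuous_on XI (\<pi> i)"
  and pi_bonds: "x \<in> X (i + k) \<Longrightarrow> \<pi> i x = bonds S i k x"
  using lp unfolding limit_projections_def by blast+

lemma pi_XI: "x \<in> XI \<Longrightarrow> \<pi> i x \<in> XI"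
  using pi_in X_XI by blast

lemma pi_id: "x \<in> X i \<Longrightarrow> \<pi> i x = x"
  using pi_bonds[of x i 0] by simp

lemma pi_bond: "x \<in> X (Suc i) \<Longrightarrow> \<pi> i x = bond S i x"
  using pi_bonds[of x i 1] by simp

lemma bonds_Suc': "bonds S i (Suc n) = bond S i \<circ> bonds S (Suc i) n"
  by (induction n) (auto simp: fun_eq_iff)

text \<open>Identities and bounds for the projections are checked at points of late stages, where
  the projections are compositions of bonds, and extend by density.\<close>

lemma XI_closedI:
  assumes "closed A" "\<And>k x. k \<ge> i \<Longrightarrow> x \<in> X k \<Longrightarrow> x \<in> A"
  shows "XI \<subseteq> A"
  unfolding X_inf_def
proof (rule closure_minimal[OF _ assms(1)])
  show "(\<Union>i. X i) \<subseteq> A"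
  proof
    fix x assume "x \<in> (\<Union>i. X i)"
    then obtain k where "x \<in> X k" by blast
    then have "x \<in> X (max i k)" using X_mono[of k "max i k"] by auto
    then show "x \<in> A" using assms(2)[of "max i k" x] by simp
  qed
qed

lemma pi_pi_Suc: "x \<in> XI \<Longrightarrow> \<pi> i (\<pi> (Suc i) x) = \<pi> i x"
proof -
  have c: "continuous_on XI (\<lambda>x. dist (\<pi> i (\<pi> (Suc i) x)) (\<pi> i x))"
    by (intro continuous_intros pi_cont continuous_on_compose2[OF pi_cont[of i] pi_cont[of "Suc i"]])
      (use pi_XI in auto)
  have "XI \<subseteq> {x\<in>XI. dist (\<pi> i (\<pi> (Suc i) x)) (\<pi> i x) = 0}"
  proof (rule XI_closedI[of _ "Suc i"])
    show "closed {x\<in>XI. dist (\<pi> i (\<pi> (Suc i) x)) (\<pi> i x) = 0}"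
      by (rule continuous_closed_preimage_constant[OF c closed_XI])
    fix k x assume k: "Suc i \<le> k" and x: "x \<in> X k"
    then obtain n where n: "k = Suc i + n" using le_Suc_ex by blast
    have "\<pi> i x = bonds S i (Suc n) x" using x n by (intro pi_bonds) simp
    then have "\<pi> i x = bond S i (bonds S (Suc i) n x)" by (simp only: bonds_Suc' comp_apply)
    moreover have "\<pi> (Suc i) x = bonds S (Suc i) n x" using x n by (intro pi_bonds) simp
    moreover have "\<pi> (Suc i) x \<in> X (Suc i)" using x X_XI pi_in by blast
    ultimately show "x \<in> {x\<in>XI. dist (\<pi> i (\<pi> (Suc i) x)) (\<pi> i x) = 0}"
      using x X_XI by (auto simp: pi_bond)
  qed
  then show "x \<in> XI \<Longrightarrow> \<pi> i (\<pi> (Suc i) x) = \<pi> i x" by auto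
qed

lemma pi_step: "x \<in> XI \<Longrightarrow> \<pi> i x = bond S i (\<pi> (Suc i) x)"
  using pi_pi_Suc pi_bond pi_in by metis

lemma pi_pi: "i \<le> j \<Longrightarrow> x \<in> XI \<Longrightarrow> \<pi> i (\<pi> j x) = \<pi> i x"
proof (induction j arbitrary: x rule: dec_induct)
  case base then show ?case by (simp add: pi_id pi_in)
next
  case (step n)
  have "\<pi> i (\<pi> n (\<pi> (Suc n) x)) = \<pi> i (\<pi> (Suc n) x)" by (rule step.IH[OF pi_XI[OF step.prems]])
  then show ?case using step.IH[OF step.prems] pi_pi_Suc[OF step.prems] by simp
qed

lemma ht_pi: "x \<in> XI \<Longrightarrow> ht (\<pi> i x) = ht x"
  by (simp add: ht_def pi_pi)

lemma ht_bond: "x \<in> X (Suc i) \<Longrightarrow> ht (bond S i x) = ht x"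
  using ht_pi[of x i] X_XI pi_bond by fastforce

lemma ht_cont: "continuous_on XI ht"
  unfolding ht_def unit_coord_def by (intro continuous_intros pi_cont)

end

context thick_system
begin

subsection \<open>Heights\<close>

text \<open>A distance determines a difference of coordinates only up to sign. The distances to both
  ends of \<open>e'\<close> together with the orientation of the subdivision fix the sign.\<close>

lemma ht_sub_aux:
  assumes IH: "\<And>e x. e \<in> E i \<Longrightarrow> x \<in> e \<Longrightarrow> ht x = ht (src (gr S i) e) + ecoord (gr S i) e x"
    and e': "e' \<in> E' i" and x: "x \<in> e'"
  shows "ht x = ht (src (sub S i) e') + ecoord (sub S i) e' x"
proof -
  obtain e where e: "e \<in> E i" "e' \<subseteq> e"
    "ecoord (gr S i) e (src (sub S i) e') < ecoord (gr S i) e (snk (sub S i) e')"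
    by (rule sub_parent[OF e'])
  note ends = edge_ends[OF H e']
  let ?c = "ecoord (gr S i) e" and ?u = "src (sub S i) e'" and ?v = "snk (sub S i) e'"
  let ?t = "ecoord (sub S i) e' x" and ?l = "elen (sub S i) e'"
  have in_e: "x \<in> e" "?u \<in> e" "?v \<in> e" using x ends e(2) by auto
  have t: "0 \<le> ?t" "?t \<le> ?l" using ecoord_bounds[OF H e' x] by auto
  have 1: "\<bar>?c ?u - ?c x\<bar> = ?t"
    using edge_dist[OF G e(1) in_e(2) in_e(1)] by (simp add: ecoord_def)
  have 2: "\<bar>?c ?u - ?c ?v\<bar> = ?l"
    using edge_dist[OF G e(1) in_e(2) in_e(3)] by (simp add: elen_def)
  have 3: "\<bar>?c ?v - ?c x\<bar> = ?l - ?t"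
    using edge_dist[OF G e(1) in_e(3) in_e(1)] edge_dist[OF H e' ends(2) x] t ecoord_snk[OF H e'] by simp
  have "?c x - ?c ?u = ?t" using 1 2 3 e(3) t by linarith
  then show ?thesis using IH[OF e(1) in_e(1)] IH[OF e(1) in_e(2)] by simp
qed

text \<open>By induction on the stage: a subedge inherits the formula from the edge containing it,
  and an opposite edge inherits it through the bond, which preserves heights, is isometric there and
  fixes the source.\<close>

lemma ht_E: "e \<in> E i \<Longrightarrow> x \<in> e \<Longrightarrow> ht x = ht (src (gr S i) e) + ecoord (gr S i) e x"
proof (induction i arbitrary: e x)
  case 0
  obtain e0 where e0: "E 0 = {e0}" "src (gr S 0) e0 = zero_pt S"
    using A1 unfolding A1_def by blast
  have "e = e0" using 0 e0 by simp
  then have "src (gr S 0) e \<in> e" "src (gr S 0) e = zero_pt S" using edge_ends[OF G 0(1)] e0 by auto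
  moreover have "e \<subseteq> X 0" by (rule edge_subset[OF G 0(1)])
  ultimately have "\<pi> 0 x = x" "\<pi> 0 (zero_pt S) = zero_pt S" using 0 pi_id by auto
  then show ?case by (simp add: ht_def unit_coord_def ecoord_def \<open>src (gr S 0) e = zero_pt S\<close>)
next
  case (Suc i)
  obtain e' where e': "e' \<in> E' i" "e = e' \<or> e = opp S i e'" by (rule E_Suc[OF Suc.prems(1)])
  have sub: "ht y = ht (src (sub S i) e') + ecoord (sub S i) e' y" if "y \<in> e'" for y
    by (rule ht_sub_aux[OF _ e'(1) that]) (rule Suc.IH)
  show ?case
  proof (cases "e = e'")
    case True
    then show ?thesis using sub[of x] Suc.prems sub_edge(2)[OF e'(1)] by (simp add: ecoord_def)
  next
    case False
    then have eo: "e = opp S i e'" using e' by blast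
    have src: "src (gr S (Suc i)) e = src (sub S i) e'" using opp_edge(2)[OF e'(1)] eo by simp
    have xb: "bond S i x \<in> e'" using bond_opp_image[OF e'(1)] Suc.prems eo by blast
    have "ht x = ht (bond S i x)"
      using ht_bond[of x i] edge_subset[OF G Suc.prems(1)] Suc.prems by auto
    also have "\<dots> = ht (src (sub S i) e') + dist (src (sub S i) e') (bond S i x)"
      using sub[OF xb] by (simp add: ecoord_def)
    also have "dist (src (sub S i) e') (bond S i x) = dist (src (sub S i) e') x"
      using bond_opp_dist[OF e'(1), of "src (sub S i) e'" x] src_in_opp[OF e'(1)] bond_src[OF e'(1)] Suc.prems eo by simp
    finally show ?thesis using src by (simp add: ecoord_def)
  qed
qed

definition lo :: "nat \<Rightarrow> 'm set \<Rightarrow> real" where "lo i e = ht (src (gr S i) e)"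
definition hi :: "nat \<Rightarrow> 'm set \<Rightarrow> real" where "hi i e = ht (snk (gr S i) e)"

context
  fixes i e
  assumes e: "e \<in> E i"
begin

lemma ecoord_ht: "x \<in> e \<Longrightarrow> ecoord (gr S i) e x = ht x - lo i e"
  using ht_E[OF e] by (simp add: lo_def)

lemma elen_ht: "elen (gr S i) e = hi i e - lo i e"
  using ecoord_ht[of "snk (gr S i) e"] edge_ends[OF G e] ecoord_snk[OF G e] by (simp add: hi_def)

lemma lo_less_hi: "lo i e < hi i e"
  using elen_pos[OF G e] elen_ht by simp

lemma dist_ht: "x \<in> e \<Longrightarrow> y \<in> e \<Longrightarrow> dist x y = \<bar>ht x - ht y\<bar>"
  using edge_dist[OF G e] ecoord_ht by simp

lemma ht_bounds: "x \<in> e \<Longrightarrow> lo i e \<le> ht x \<and> ht x \<le> hi i e"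
  using ecoord_bounds[OF G e, of x] ecoord_ht[of x] elen_ht by simp

lemma ht_inj: "x \<in> e \<Longrightarrow> y \<in> e \<Longrightarrow> ht x = ht y \<Longrightarrow> x = y"
  using dist_ht by fastforce

lemma ht_onto: "lo i e \<le> s \<Longrightarrow> s \<le> hi i e \<Longrightarrow> \<exists>x\<in>e. ht x = s"
  using epoint_in[OF G e, of "s - lo i e"] elen_ht ecoord_ht by fastforce

lemma ht_image: "ht ` e = {lo i e..hi i e}"
  using ht_onto ht_bounds by force

lemma vert_iff_ht: "x \<in> e \<Longrightarrow> x \<in> V i \<longleftrightarrow> ht x = lo i e \<or> ht x = hi i e"
  using edge_verts[OF G e] ht_inj edge_ends[OF G e] unfolding lo_def hi_def by metis

lemma edge_X: "e \<subseteq> X i" by (rule edge_subset[OF G e])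

end

lemma opp_ht:
  assumes "e' \<in> E' i" 
  shows "lo (Suc i) (opp S i e') = lo (Suc i) e'" "hi (Suc i) (opp S i e') = hi (Suc i) e'"
  using sub_edge[OF assms] opp_edge[OF assms] by (auto simp: lo_def hi_def)

lemma X0_edge:
  obtains e0 where "E 0 = {e0}" "X 0 = e0" "lo 0 e0 = 0" "hi 0 e0 = 1"
proof -
  obtain e0 where e0: "E 0 = {e0}" "src (gr S 0) e0 = zero_pt S" "snk (gr S 0) e0 = one_pt S" "elen (gr S 0) e0 = 1"
    using A1 unfolding A1_def by blast
  have X0: "X 0 = e0" using X_E[of 0] e0 by simp
  have "zero_pt S \<in> e0" using edge_ends[OF G, of e0 0] e0 by auto
  then have "lo 0 e0 = 0" using e0 X0 pi_id[of "zero_pt S" 0] by (simp add: lo_def ht_def unit_coord_def)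
  moreover have "hi 0 e0 = 1" using elen_ht[of e0 0] e0 calculation by simp
  ultimately show thesis using that e0 X0 by blast
qed

lemma ht_01: "x \<in> XI \<Longrightarrow> ht x \<in> {0..1}"
proof -
  assume x: "x \<in> XI"
  obtain e0 where e0: "E 0 = {e0}" "X 0 = e0" "lo 0 e0 = 0" "hi 0 e0 = 1" by (rule X0_edge)
  have "\<pi> 0 x \<in> e0" using pi_in[OF x] e0 by blast
  then show ?thesis using ht_bounds[of e0 0 "\<pi> 0 x"] ht_pi[OF x, of 0] e0 by simp
qed

lemma X_ne: "X i \<noteq> {}"
proof -
  obtain e0 where e0: "E 0 = {e0}" "X 0 = e0" by (rule X0_edge)
  then have "e0 \<noteq> {}" using edge_ends[OF G, of e0 0] by auto
  then show ?thesis using X_mono[of 0 i] e0 by auto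
qed

lemma E'_ne: "E' i \<noteq> {}"
  using X_ne[of i] X_E'[of i] by auto

lemma E_ne: "E i \<noteq> {}"
  using X_ne[of i] X_E[of i] by auto

subsection \<open>Distances to the projections\<close>

definition mesh :: "nat \<Rightarrow> real" where "mesh i = Max (elen (sub S i) ` E' i)"

lemma elen_le_mesh: "e' \<in> E' i \<Longrightarrow> elen (sub S i) e' \<le> mesh i"
  unfolding mesh_def using finite_E' by (intro Max_ge) auto

lemma mesh_pos: "mesh i > 0"
  using E'_ne[of i] elen_le_mesh[of _ i] elen_pos[OF H, of _ i] by (meson all_not_in_conv order_less_le_trans)

text \<open>\<open>delta_E\<close> divides by the shortest edge, so the longest subedge is short
  relative to every edge of the stage, not only to the one containing it.\<close>

lemma mesh_le: assumes "e \<in> E i" shows "mesh i \<le> \<delta> i * elen (gr S i) e"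
proof -
  have D: "Delta_E S i \<in> elen (gr S i) ` E i"
    unfolding Delta_E_def using finite_E E_ne by (intro Min_in) auto
  then have D0: "Delta_E S i > 0" using elen_pos[OF G] by auto
  have "Delta_E S i \<le> elen (gr S i) e"
    unfolding Delta_E_def using finite_E assms by (intro Min_le) auto
  moreover have "mesh i / Delta_E S i \<le> \<delta> i" using \<delta>_E[of i] unfolding delta_E_def mesh_def .
  then have "mesh i \<le> \<delta> i * Delta_E S i" using D0 by (simp add: field_simps)
  ultimately show ?thesis using \<delta>_pos[of i] by (meson mult_left_mono order_less_imp_le order_trans)
qed

lemma \<delta>_half: "\<delta> i < 1/2"
  using decseqD[OF \<delta>_dec, of 0 i] \<delta>_0 by simp

lemma mesh_Suc: assumes "e' \<in> E' i" shows "mesh (Suc i) \<le> elen (sub S i) e' / 2"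
proof -
  have "mesh (Suc i) \<le> \<delta> (Suc i) * elen (sub S i) e'"
    using mesh_le[OF sub_edge(1)[OF assms]] sub_edge(4)[OF assms] by simp
  also have "\<dots> \<le> 1/2 * elen (sub S i) e'"
    using \<delta>_half[of "Suc i"] elen_pos[OF H assms] by (intro mult_right_mono) auto
  finally show ?thesis by simp
qed

text \<open>A subedge of stage \<open>i\<close> is an edge of stage \<open>Suc i\<close>, so the
  meshes of all later stages can be compared with any single subedge; each stage contributes a
  factor 1/2 because \<open>\<delta>\<close> stays below 1/2.\<close>

lemma mesh_decay: assumes "e' \<in> E' i" shows "mesh (Suc i + n) \<le> (1/2)^(Suc n) * elen (sub S i) e'"
proof (induction n)
  case 0 show ?case using mesh_Suc[OF assms] by simp
next
  case (Suc n)
  obtain e'' where e'': "e'' \<in> E' (Suc i + n)" using E'_ne by blast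
  have "mesh (Suc i + Suc n) \<le> mesh (Suc i + n) / 2"
    using mesh_Suc[OF e''] elen_le_mesh[OF e''] by simp
  then show ?case using Suc by simp
qed

lemma mesh_exp: "mesh n \<le> (1/2)^n"
proof (cases n)
  case 0
  obtain e0 where e0: "E 0 = {e0}" "lo 0 e0 = 0" "hi 0 e0 = 1" by (rule X0_edge)
  have "mesh 0 \<le> \<delta> 0 * 1" using mesh_le[of e0 0] elen_ht[of e0 0] e0 by simp
  then show ?thesis using 0 \<delta>_half[of 0] by simp
next
  case (Suc m)
  obtain e' where e': "e' \<in> E' 0" using E'_ne by blast
  obtain e0 where e0: "E 0 = {e0}" "lo 0 e0 = 0" "hi 0 e0 = 1" by (rule X0_edge)
  have "mesh 0 \<le> \<delta> 0 * 1" using mesh_le[of e0 0] elen_ht[of e0 0] e0 by simp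
  then have "elen (sub S 0) e' \<le> 1" using elen_le_mesh[OF e'] \<delta>_half[of 0] by simp
  then have "(1/2)^(Suc m) * elen (sub S 0) e' \<le> (1/2)^(Suc m)" by (intro mult_left_le) auto
  moreover have "mesh n \<le> (1/2)^(Suc m) * elen (sub S 0) e'" using mesh_decay[OF e', of m] Suc by simp
  ultimately show ?thesis unfolding Suc by (rule order_trans[rotated])
qed

lemma dist_bond:
  assumes z: "z \<in> X (Suc i)" and e': "e' \<in> E' i" "bond S i z \<in> e'"
  shows "dist z (bond S i z) \<le> 2 * elen (sub S i) e'"
proof -
  have "z \<in> e' \<or> z \<in> opp S i e'" by (rule preimage_in[OF e'(1) z e'(2)])
  then show ?thesis
  proof
    assume "z \<in> e'"
    then show ?thesis using bond_id_edge[OF e'(1)] elen_pos[OF H e'(1)] by simp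
  next
    assume zo: "z \<in> opp S i e'"
    have "dist (src (sub S i) e') z \<le> elen (sub S i) e'"
      using ecoord_bounds[OF G opp_edge(1)[OF e'(1)] zo] opp_edge[OF e'(1)] by (simp add: ecoord_def)
    moreover have "dist (src (sub S i) e') (bond S i z) \<le> elen (sub S i) e'"
      using ecoord_bounds[OF H e'] by (simp add: ecoord_def)
    ultimately show ?thesis using dist_triangle3[of z "bond S i z" "src (sub S i) e'"] by simp
  qed
qed

text \<open>The first move is at most twice the length of \<open>e'\<close>, the later ones at most
  twice meshes that decay geometrically relative to that length: 2 (1 + 1/2 + 1/4 + ...) = 4. A
  bound by the length of \<open>e'\<close> itself, rather than by the mesh of stage
  \<open>i\<close>, is what combines with \<open>nonterminal_dist\<close>.\<close>

lemma dist_pi_n: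
  assumes z: "z \<in> XI" and e': "e' \<in> E' i" "\<pi> i z \<in> e'"
  shows "dist (\<pi> (i + n) z) (\<pi> i z) \<le> 4 * elen (sub S i) e' * (1 - (1/2)^n)"
proof (induction n)
  case 0 show ?case by simp
next
  case (Suc n)
  have X: "\<pi> (Suc (i + n)) z \<in> X (Suc (i + n))" "bond S (i + n) (\<pi> (Suc (i + n)) z) = \<pi> (i + n) z"
    by (rule pi_in[OF z]) (rule pi_step[OF z, symmetric])
  have "dist (\<pi> (Suc (i + n)) z) (\<pi> (i + n) z) \<le> 2 * ((1/2)^n * elen (sub S i) e')"
  proof (cases n)
    case 0
    then show ?thesis using dist_bond[OF X(1), of e'] X(2) e' by simp
  next
    case (Suc m)
    obtain e'' where e'': "e'' \<in> E' (i + n)" "\<pi> (i + n) z \<in> e''" using in_E'[OF pi_in[OF z]] by blast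
    have "dist (\<pi> (Suc (i + n)) z) (\<pi> (i + n) z) \<le> 2 * elen (sub S (i + n)) e''"
      using dist_bond[OF X(1), of e''] X(2) e'' by simp
    also have "elen (sub S (i + n)) e'' \<le> mesh (i + n)" by (rule elen_le_mesh[OF e''(1)])
    also have "\<dots> \<le> (1/2)^n * elen (sub S i) e'" using mesh_decay[OF e'(1), of m] Suc by simp
    finally show ?thesis by simp
  qed
  then have "dist (\<pi> (i + Suc n) z) (\<pi> i z) \<le> 2 * ((1/2)^n * elen (sub S i) e') + 4 * elen (sub S i) e' * (1 - (1/2)^n)"
    using Suc dist_triangle[of "\<pi> (i + Suc n) z" "\<pi> i z" "\<pi> (i + n) z"] by simp
  also have "\<dots> = 4 * elen (sub S i) e' * (1 - (1/2)^(Suc n))" by (simp add: algebra_simps)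
  finally show ?case .
qed

lemma dist_pi_pi:
  assumes z: "z \<in> XI" and e': "e' \<in> E' i" "\<pi> i z \<in> e'" and ij: "i \<le> j"
  shows "dist (\<pi> j z) (\<pi> i z) \<le> 4 * elen (sub S i) e'"
proof -
  obtain n where n: "j = i + n" using ij le_Suc_ex by blast
  have "4 * elen (sub S i) e' * (1 - (1/2)^n) \<le> 4 * elen (sub S i) e' * 1"
    using elen_pos[OF H e'(1)] by (intro mult_left_mono) auto
  then show ?thesis using dist_pi_n[OF z e', of n] n by simp
qed

lemma dist_pi_mesh: "z \<in> XI \<Longrightarrow> dist z (\<pi> j z) \<le> 4 * mesh j"
proof -
  have c: "continuous_on XI (\<lambda>x. dist x (\<pi> j x))" by (intro continuous_intros pi_cont)
  have "XI \<subseteq> XI \<inter> (\<lambda>x. dist x (\<pi> j x)) -` {..4 * mesh j}"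
  proof (rule XI_closedI[of _ j])
    show "closed (XI \<inter> (\<lambda>x. dist x (\<pi> j x)) -` {..4 * mesh j})"
      by (rule continuous_closed_preimage[OF c closed_XI]) simp
    fix k x assume k: "k \<ge> j" and x: "x \<in> X k"
    then have xI: "x \<in> XI" using X_XI by blast
    obtain e' where e': "e' \<in> E' j" "\<pi> j x \<in> e'" using in_E'[OF pi_in[OF xI]] by blast
    have "dist (\<pi> k x) (\<pi> j x) \<le> 4 * mesh j"
      using dist_pi_pi[OF xI e' k] elen_le_mesh[OF e'(1)] by simp
    then show "x \<in> XI \<inter> (\<lambda>x. dist x (\<pi> j x)) -` {..4 * mesh j}" using xI pi_id[OF x] by simp
  qed
  then show "z \<in> XI \<Longrightarrow> dist z (\<pi> j z) \<le> 4 * mesh j" by auto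
qed

lemma mesh_lim: "mesh \<longlonglongrightarrow> 0"
proof (rule tendsto_sandwich[OF _ _ tendsto_const])
  show "(\<lambda>n. (1/2::real)^n) \<longlonglongrightarrow> 0" by (rule LIMSEQ_power_zero) simp
qed (use mesh_pos mesh_exp in \<open>auto intro: always_eventually order_less_imp_le\<close>)

lemma pi_lim: assumes "z \<in> XI" shows "(\<lambda>j. \<pi> j z) \<longlonglongrightarrow> z"
proof -
  have "(\<lambda>j. dist (\<pi> j z) z) \<longlonglongrightarrow> 0"
  proof (rule tendsto_sandwich[OF _ _ tendsto_const])
    show "(\<lambda>j. 4 * mesh j) \<longlonglongrightarrow> 0" using tendsto_mult_left[OF mesh_lim, of 4] by simp
    show "\<forall>\<^sub>F j in sequentially. dist (\<pi> j z) z \<le> 4 * mesh j"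
      using dist_pi_mesh[OF assms] by (simp add: dist_commute[of _ z])
  qed simp
  then show ?thesis by (rule tendsto_dist_iff[THEN iffD2])
qed

lemma dist_pi_le:
  assumes z: "z \<in> XI" and e': "e' \<in> E' i" "\<pi> i z \<in> e'"
  shows "dist z (\<pi> i z) \<le> 4 * elen (sub S i) e'"
proof (rule LIMSEQ_le_const2)
  show "(\<lambda>j. dist (\<pi> j z) (\<pi> i z)) \<longlonglongrightarrow> dist z (\<pi> i z)"
    by (intro tendsto_dist pi_lim z tendsto_const)
  show "\<exists>N. \<forall>n\<ge>N. dist (\<pi> n z) (\<pi> i z) \<le> 4 * elen (sub S i) e'"
    using dist_pi_pi[OF z e'] by blast
qed

lemma XI_eqI: "x \<in> XI \<Longrightarrow> y \<in> XI \<Longrightarrow> (\<And>j. j \<ge> i \<Longrightarrow> \<pi> j x = \<pi> j y) \<Longrightarrow> x = y"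
proof -
  assume xy: "x \<in> XI" "y \<in> XI" and eq: "\<And>j. j \<ge> i \<Longrightarrow> \<pi> j x = \<pi> j y"
  have "(\<lambda>j. \<pi> j x) \<longlonglongrightarrow> y"
    using pi_lim[OF xy(2)] eq by (subst tendsto_cong[of _ "\<lambda>j. \<pi> j y"]) (auto simp: eventually_sequentially)
  then show "x = y" using pi_lim[OF xy(1)] LIMSEQ_unique by blast
qed

text \<open>Real form of the bound on \<open>delta_d\<close>. \<open>Delta_d\<close> is not 0, since
  the quotient would then be infinite, and not infinite, since it is at most
  \<open>dist p q\<close>.\<close>

lemma nonterminal_dist:
  assumes e: "e \<in> E i" and e': "e' \<in> E' i" "\<not> terminal S i e'" "e' \<subseteq> e" and p: "p \<in> e'" and q: "q \<in> X i" "q \<notin> e"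
  shows "elen (sub S i) e' \<le> \<delta> i * dist p q"
proof -
  have nt: "e' \<in> nonterminal_edges S i" using e' by (simp add: nonterminal_edges_def)
  have "Delta_d S i \<le> set_distance e' (X i - e)"
    unfolding Delta_d_def by (rule INF_lower2[OF e], rule INF_lower) (use nt e'(3) in simp)
  also have "\<dots> \<le> ennreal (dist p q)"
    unfolding set_distance_def by (rule INF_lower2[OF p], rule INF_lower) (use q in simp)
  finally have D: "Delta_d S i \<le> ennreal (dist p q)" .
  have "ennreal (elen (sub S i) e') / Delta_d S i \<le> delta_d S i"
    unfolding delta_d_def using nt by (rule SUP_upper)
  also have "\<dots> \<le> ennreal (\<delta> i)" by (rule \<delta>_d)
  finally have le: "ennreal (elen (sub S i) e') / Delta_d S i \<le> ennreal (\<delta> i)" .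
  have pos: "elen (sub S i) e' > 0" by (rule elen_pos[OF H e'(1)])
  have nz: "Delta_d S i \<noteq> 0"
  proof
    assume "Delta_d S i = 0"
    then have "ennreal (elen (sub S i) e') / Delta_d S i = \<infinity>"
      using pos by (simp add: ennreal_divide_zero)
    then show False using le by (simp add: top_unique)
  qed
  have nt: "Delta_d S i \<noteq> \<infinity>" using D by (metis ennreal_neq_top infinity_ennreal_def neq_top_trans)
  obtain d where d: "Delta_d S i = ennreal d" "d > 0"
    using nz nt by (cases "Delta_d S i") (auto simp: ennreal_eq_0_iff not_le)
  have "elen (sub S i) e' / d \<le> \<delta> i"
    using le d pos \<delta>_pos[of i] by (simp add: divide_ennreal ennreal_le_iff)
  then have "elen (sub S i) e' \<le> \<delta> i * d" using d(2) by (simp add: field_simps)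
  also have "\<dots> \<le> \<delta> i * dist p q"
    using D d \<delta>_pos[of i] by (intro mult_left_mono) (auto simp: ennreal_le_iff)
  finally show ?thesis .
qed

lemma edge_image:
  assumes "e \<in> E (i + n)"
  shows "\<exists>e0\<in>E i. \<forall>x\<in>e. \<pi> i x \<in> e0"
  using assms
proof (induction n arbitrary: e)
  case 0
  then have "\<pi> i x \<in> e" if "x \<in> e" for x using that edge_X[of e i] pi_id by auto
  then show ?case using 0 by auto
next
  case (Suc n)
  then have e: "e \<in> E (Suc (i + n))" by simp
  obtain e' where e': "e' \<in> E' (i + n)" "e = e' \<or> e = opp S (i + n) e'" by (rule E_Suc[OF e])
  obtain e1 where e1: "e1 \<in> E (i + n)" "e' \<subseteq> e1" by (rule sub_parent[OF e'(1)])
  obtain e0 where e0: "e0 \<in> E i" "\<And>x. x \<in> e1 \<Longrightarrow> \<pi> i x \<in> e0" using Suc.IH[OF e1(1)] by blast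
  have "\<pi> i x \<in> e0" if x: "x \<in> e" for x
  proof -
    have xX: "x \<in> X (Suc (i + n))" using x edge_X[OF e] by blast
    have "bond S (i + n) x \<in> e'" using e' x bond_id_edge[OF e'(1)] bond_opp_image[OF e'(1)] by auto
    then have "\<pi> i (\<pi> (i + n) x) \<in> e0" using e0(2) e1(2) pi_bond[OF xX] by auto
    then show ?thesis using pi_pi[of i "i + n" x] subsetD[OF X_XI xX] by simp
  qed
  then show ?case using e0(1) by blast
qed

text \<open>At the first stage \<open>j\<close> whose bond moves \<open>z\<close>, the projection of \<open>z\<close> lies on a nonterminal subedge, and
  \<open>delta_d\<close> bounds the length of that subedge by the distance to other edges.\<close>

lemma dist_pi_other_edge:
  assumes z: "z \<in> XI" and w: "w \<in> XI" and e: "e \<in> E i" "\<pi> i z \<in> e" "\<pi> i w \<notin> e"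
  obtains j where "j \<ge> i" "\<pi> j z = \<pi> i z" "dist z (\<pi> i z) \<le> 4 * \<delta> i * dist (\<pi> i z) (\<pi> j w)"
proof (cases "\<forall>j\<ge>i. \<pi> j z = \<pi> i z")
  case True
  have zi: "\<pi> j (\<pi> i z) = \<pi> i z" if "j \<ge> i" for j
    using pi_id[of "\<pi> i z" j] pi_in[OF z, of i] X_mono[OF that] by auto
  have "z = \<pi> i z" by (rule XI_eqI[OF z pi_XI[OF z], of i]) (metis True zi)
  then have "dist z (\<pi> i z) = 0" by (metis dist_self)
  moreover have "0 \<le> 4 * \<delta> i * dist (\<pi> i z) (\<pi> i w)" using \<delta>_pos[of i] by simp
  ultimately show thesis using that[of i] by simp
next
  case False
  define p where "p = \<pi> i z"
  define l where "l = (LEAST j. j \<ge> i \<and> \<pi> j z \<noteq> p)"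
  have "\<exists>j. j \<ge> i \<and> \<pi> j z \<noteq> p" using False by (simp add: p_def)
  then have l: "l \<ge> i" "\<pi> l z \<noteq> p" unfolding l_def by (metis (mono_tags, lifting) LeastI_ex)+
  have "l \<noteq> i" using l by (auto simp: p_def)
  then obtain j where j: "l = Suc j" "j \<ge> i" using l by (metis Suc_le_D Suc_le_mono le_antisym not_less_eq_eq)
  have pj: "\<pi> j z = p"
    using not_less_Least[of j "\<lambda>j. j \<ge> i \<and> \<pi> j z \<noteq> p"] j l_def by auto
  have X: "\<pi> (Suc j) z \<in> X (Suc j)" "bond S j (\<pi> (Suc j) z) = p"
    using pi_in[OF z] pi_step[OF z, of j] pj by auto
  have move: "\<pi> (Suc j) z \<noteq> p" using l j by simp
  have pX: "p \<in> X j" using pj pi_in[OF z] by auto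
  obtain e' where e': "e' \<in> E' j" "p \<in> e'" using in_E'[OF pX] by blast
  have pv: "p \<notin> V' j" using vert_fix[of p j "\<pi> (Suc j) z"] X move by blast
  \<comment> \<open>The next projection leaves \<open>p\<close>, so \<open>e'\<close> has a second
    branch and cannot be terminal.\<close>
  have "opp S j e' \<noteq> e'"
  proof
    assume "opp S j e' = e'"
    then have "\<pi> (Suc j) z \<in> e'" using preimage_in[OF e'(1) X(1)] X(2) e'(2) by auto
    then show False using bond_id_edge[OF e'(1)] X(2) move by metis
  qed
  then have nt: "\<not> terminal S j e'" using terminal_opp[OF e'(1)] by blast
  obtain ej where ej: "ej \<in> E j" "e' \<subseteq> ej" by (rule sub_parent[OF e'(1)])
  obtain n where n: "j = i + n" using j le_Suc_ex by blast
  obtain e0 where e0: "e0 \<in> E i" "\<And>x. x \<in> ej \<Longrightarrow> \<pi> i x \<in> e0" using edge_image[of ej i n] ej n by blast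
  have "\<pi> i p = p" using pi_pi[of i j z] j z pj by (simp add: p_def)
  then have "p \<in> e0" using e0(2)[of p] ej e' by auto
  moreover have "p \<notin> V i" using pv V_sub[of j] V_mono[OF j(2)] by blast
  ultimately have "e0 = e" using edge_eqI[OF G e(1) e0(1)] e(2) p_def by blast
  then have "\<pi> j w \<notin> ej" using e0(2)[of "\<pi> j w"] pi_pi[OF j(2) w] e(3) by auto
  then have "elen (sub S j) e' \<le> \<delta> j * dist p (\<pi> j w)"
    using nonterminal_dist[OF ej(1) e'(1) nt ej(2) e'(2) pi_in[OF w]] by blast
  also have "\<dots> \<le> \<delta> i * dist p (\<pi> j w)"
    using decseqD[OF \<delta>_dec j(2)] by (intro mult_right_mono) auto
  finally have "elen (sub S j) e' \<le> \<delta> i * dist p (\<pi> j w)" .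
  moreover have "dist z p \<le> 4 * elen (sub S j) e'" using dist_pi_le[OF z e'(1)] pj e'(2) by simp
  ultimately show thesis using that[of j] j pj by (simp add: p_def)
qed

lemma terminalI: "e' \<in> E' i \<Longrightarrow> e \<in> E i \<Longrightarrow> e' \<subseteq> e \<Longrightarrow> v \<in> V i \<Longrightarrow> v \<in> e' \<Longrightarrow> terminal S i e'"
  unfolding terminal_def using edge_verts[OF G] by blast

text \<open>Used in contrapositive form: nearby points project into the same edge. Projecting moves
  both points by small multiples of \<open>\<delta> i * D\<close>, where \<open>D\<close> is the
  distance of the projections, so \<open>D\<close> is comparable to \<open>dist x y\<close>. For
  \<open>x\<close> this comes from the nonterminal subedge \<open>e'\<close>; the projection of
  \<open>y\<close> may lie on a terminal one, so \<open>dist_pi_other_edge\<close> takes its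
  place.\<close>

lemma localization:
  assumes x: "x \<in> XI" and y: "y \<in> XI" and e: "e \<in> E i" and e': "e' \<in> E' i" "e' \<subseteq> e" "\<not> terminal S i e'"
    and px: "\<pi> i x \<in> e'" and py: "\<pi> i y \<notin> e" and d: "\<delta> i \<le> 1/32"
  shows "elen (sub S i) e' \<le> 2 * \<delta> i * dist x y"
proof -
  define D where "D = dist (\<pi> i x) (\<pi> i y)"
  have D: "elen (sub S i) e' \<le> \<delta> i * D"
    unfolding D_def by (rule nonterminal_dist[OF e e'(1,3,2) px pi_in[OF y] py])
  have "D \<ge> 0" by (simp add: D_def)
  have dx: "dist x (\<pi> i x) \<le> 4 * \<delta> i * D" using dist_pi_le[OF x e'(1) px] D by simp
  obtain e2 where e2: "e2 \<in> E i" "\<pi> i y \<in> e2" using in_E[OF pi_in[OF y]] by blast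
  have "\<pi> i x \<notin> e2"
  proof
    assume "\<pi> i x \<in> e2"
    then have "\<pi> i x \<in> V i" using edge_eqI[OF G e e2(1)] px e'(2) e2(2) py by blast
    then show False using terminalI[OF e'(1) e e'(2)] px e'(3) by blast
  qed
  then obtain j where j: "j \<ge> i" "dist y (\<pi> i y) \<le> 4 * \<delta> i * dist (\<pi> i y) (\<pi> j x)"
    using dist_pi_other_edge[OF y x e2] by metis
  have "dist (\<pi> i y) (\<pi> j x) \<le> D + 4 * \<delta> i * D"
    using dist_triangle[of "\<pi> i y" "\<pi> j x" "\<pi> i x"] dist_pi_pi[OF x e'(1) px j(1)] D
    by (simp add: D_def dist_commute)
  also have "\<dots> \<le> D + 4 * (1/32) * D" using d \<open>D \<ge> 0\<close> by (intro add_left_mono mult_right_mono) auto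
  also have "\<dots> \<le> 2 * D" using \<open>D \<ge> 0\<close> by simp
  finally have "4 * \<delta> i * dist (\<pi> i y) (\<pi> j x) \<le> 4 * \<delta> i * (2 * D)"
    using \<delta>_pos[of i] by (intro mult_left_mono) auto
  then have dy: "dist y (\<pi> i y) \<le> 8 * \<delta> i * D" using j(2) by linarith
  have "D \<le> dist x (\<pi> i x) + dist x y + dist y (\<pi> i y)"
    unfolding D_def using dist_triangle[of "\<pi> i x" "\<pi> i y" x] dist_triangle[of x "\<pi> i y" y] by (simp add: dist_commute)
  also have "\<dots> \<le> dist x y + 12 * \<delta> i * D" using dx dy by simp
  \<comment> \<open>The displacements 4 + 8 = 12 times at most 1/32 stay below 1/2 and are absorbed
    into \<open>D\<close>.\<close>
  also have "12 * \<delta> i * D \<le> 12 * (1/32) * D" using d \<open>D \<ge> 0\<close> by (intro mult_right_mono) auto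
  finally have "D \<le> 2 * dist x y" using \<open>D \<ge> 0\<close> by simp
  then have "\<delta> i * D \<le> \<delta> i * (2 * dist x y)" using \<delta>_pos[of i] by (intro mult_left_mono) auto
  then show ?thesis using D by simp
qed

end

type_synonym 'a choices = "nat \<Rightarrow> 'a set \<Rightarrow> bool"

text \<open>Remove the leftmost interval: it starts at \<open>a\<close>, and all others start at its
  end or later, so they tile what remains.\<close>

lemma tiling_list:
  fixes lo hi :: "'a \<Rightarrow> real"
  assumes "finite I" "a < b" "\<And>e. e \<in> I \<Longrightarrow> lo e < hi e" "\<And>e. e \<in> I \<Longrightarrow> a \<le> lo e \<and> hi e \<le> b"
    "\<And>s. a < s \<Longrightarrow> s < b \<Longrightarrow> \<exists>e\<in>I. lo e \<le> s \<and> s \<le> hi e"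
    "\<And>e e' s. e \<in> I \<Longrightarrow> e' \<in> I \<Longrightarrow> lo e < s \<Longrightarrow> s < hi e \<Longrightarrow> lo e' < s \<Longrightarrow> s < hi e' \<Longrightarrow> e = e'"
  shows "\<exists>es. set es = I \<and> es \<noteq> [] \<and> successively (\<lambda>e e'. hi e = lo e') es \<and> lo (hd es) = a \<and> hi (last es) = b"
  using assms
proof (induction "card I" arbitrary: I a rule: less_induct)
  case less
  obtain e1 where "e1 \<in> I" using less.prems(5)[of "(a+b)/2"] less.prems(2) by auto
  then have ne: "I \<noteq> {}" by blast
  obtain e where e: "e \<in> I" "\<And>e'. e' \<in> I \<Longrightarrow> lo e \<le> lo e'"
    using arg_min_if_finite[OF less.prems(1) ne, of lo] by (metis not_le)
  have loe: "lo e = a"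
  proof (rule ccontr)
    assume "lo e \<noteq> a"
    then have "a < lo e" using less.prems(4)[OF e(1)] by simp
    moreover have "lo e < b" using less.prems(3,4)[OF e(1)] by simp
    ultimately obtain e' where "e' \<in> I" "lo e' \<le> (a + lo e)/2" using less.prems(5)[of "(a + lo e)/2"] by auto
    then show False using e(2)[of e'] \<open>a < lo e\<close> by simp
  qed
  have right: "hi e \<le> lo e'" if e': "e' \<in> I" "e' \<noteq> e" for e'
  proof (rule ccontr)
    assume "\<not> hi e \<le> lo e'"
    then have "lo e' < min (hi e) (hi e')" using less.prems(3)[OF e'(1)] by simp
    then obtain s where "lo e' < s" "s < hi e" "s < hi e'" by (metis dense min_less_iff_conj)
    then show False using less.prems(6)[OF e(1) e'(1), of s] loe less.prems(4)[OF e'(1)] e'(2) by auto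
  qed
  show ?case
  proof (cases "hi e = b")
    case True
    have "I = {e}"
    proof (rule ccontr)
      assume "I \<noteq> {e}"
      then obtain e' where "e' \<in> I" "e' \<noteq> e" using e(1) by blast
      then show False using right[of e'] less.prems(3,4)[of e'] True by simp
    qed
    then show ?thesis using loe True by (intro exI[of _ "[e]"]) simp
  next
    case False
    then have hb: "hi e < b" using less.prems(4)[OF e(1)] by simp
    have "\<exists>es. set es = I - {e} \<and> es \<noteq> [] \<and> successively (\<lambda>e e'. hi e = lo e') es \<and> lo (hd es) = hi e \<and> hi (last es) = b"
    proof (rule less.hyps)
      show "card (I - {e}) < card I" using less.prems(1) e(1) by (rule card_Diff1_less)
      show "\<exists>e'\<in>I - {e}. lo e' \<le> s \<and> s \<le> hi e'" if "hi e < s" "s < b" for s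
        using less.prems(5)[of s] that less.prems(3)[OF e(1)] loe by force
      show "hi e \<le> lo e' \<and> hi e' \<le> b" if "e' \<in> I - {e}" for e'
        using right[of e'] less.prems(4)[of e'] that by auto
    qed (use less.prems hb in auto)
    then obtain es where es: "set es = I - {e}" "es \<noteq> []" "successively (\<lambda>e e'. hi e = lo e') es"
      "lo (hd es) = hi e" "hi (last es) = b" by blast
    then show ?thesis using e(1) loe
      by (intro exI[of _ "e # es"]) (auto simp: successively_Cons)
  qed
qed

context thick_system
begin

subsection \<open>Lifting curves\<close>

text \<open>A lift from \<open>X i\<close> to \<open>X (Suc i)\<close> is determined by the choice, for each edge \<open>e'\<close> of the
  subdivision, of \<open>e'\<close> itself or of its opposite edge.\<close>

definition branch :: "nat \<Rightarrow> bool \<Rightarrow> 'm set \<Rightarrow> 'm set" where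
  "branch i b e' = (if b then opp S i e' else e')"

text \<open>A vertex lies on several subedges, whose choices may differ. Fixing it is consistent
  with all of them, because both branches share their ends, and makes the lift continuous.\<close>

definition lift :: "nat \<Rightarrow> ('m set \<Rightarrow> bool) \<Rightarrow> 'm \<Rightarrow> 'm" where
  "lift i \<xi> p = (if p \<in> V' i then p else
     let e' = containing_edge (sub S i) p in SOME z. z \<in> branch i (\<xi> e') e' \<and> bond S i z = p)"

context
  fixes i e'
  assumes e': "e' \<in> E' i"
begin

lemma branch_edge: "branch i b e' \<in> E (Suc i)"
  using sub_edge(1)[OF e'] opp_edge(1)[OF e'] by (simp add: branch_def)

lemma branch_ends: "src (gr S (Suc i)) (branch i b e') = src (sub S i) e'"
  "snk (gr S (Suc i)) (branch i b e') = snk (sub S i) e'"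
  "src (sub S i) e' \<in> branch i b e'" "snk (sub S i) e' \<in> branch i b e'"
  using sub_edge[OF e'] opp_edge[OF e'] edge_ends[OF H e'] src_in_opp[OF e'] by (auto simp: branch_def)

lemma bond_branch_dist: "z \<in> branch i b e' \<Longrightarrow> w \<in> branch i b e' \<Longrightarrow> dist (bond S i z) (bond S i w) = dist z w"
  using bond_opp_dist[OF e'] bond_id_edge[OF e'] by (auto simp: branch_def split: if_splits)

lemma bond_branch_image: "bond S i ` branch i b e' = e'"
  using bond_opp_image[OF e'] bond_id_edge[OF e'] by (auto simp: branch_def)

lemma lift_branch:
  assumes p: "p \<in> e'"
  shows "lift i \<xi> p \<in> branch i (\<xi> e') e'" "bond S i (lift i \<xi> p) = p"
proof -
  have "lift i \<xi> p \<in> branch i (\<xi> e') e' \<and> bond S i (lift i \<xi> p) = p"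
  proof (cases "p \<in> V' i")
    case True
    then have ends: "p = src (sub S i) e' \<or> p = snk (sub S i) e'" using edge_verts[OF H e' p] by simp
    have "p \<in> branch i (\<xi> e') e'" by (rule disjE[OF ends]) (simp_all only: branch_ends(3,4))
    then show ?thesis using True bond_id_edge[OF e' p] by (simp add: lift_def)
  next
    case False
    have ce: "containing_edge (sub S i) p = e'" by (rule containing_edge_eq[OF H e' p False])
    have "p \<in> bond S i ` branch i (\<xi> e') e'" using p by (simp only: bond_branch_image)
    then have "\<exists>z. z \<in> branch i (\<xi> e') e' \<and> bond S i z = p" by auto
    then have "(SOME z. z \<in> branch i (\<xi> e') e' \<and> bond S i z = p) \<in> branch i (\<xi> e') e' \<and>
        bond S i (SOME z. z \<in> branch i (\<xi> e') e' \<and> bond S i z = p) = p" by (rule someI_ex)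
    then show ?thesis using False by (simp add: lift_def ce)
  qed
  then show "lift i \<xi> p \<in> branch i (\<xi> e') e'" "bond S i (lift i \<xi> p) = p" by auto
qed

lemma lift_dist: "p \<in> e' \<Longrightarrow> q \<in> e' \<Longrightarrow> dist (lift i \<xi> p) (lift i \<xi> q) = dist p q"
  using bond_branch_dist[of "lift i \<xi> p" "\<xi> e'" "lift i \<xi> q"] lift_branch[of p \<xi>] lift_branch[of q \<xi>] by simp

lemma lift_eqI:
  assumes "z \<in> branch i (\<xi> e') e'"
  shows "lift i \<xi> (bond S i z) = z"
proof -
  have p: "bond S i z \<in> e'" using bond_branch_image assms by blast
  have "dist (bond S i (lift i \<xi> (bond S i z))) (bond S i z) = dist (lift i \<xi> (bond S i z)) z"
    by (rule bond_branch_dist[of "lift i \<xi> (bond S i z)" "\<xi> e'", OF lift_branch(1)[OF p] assms])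
  then show ?thesis using lift_branch(2)[OF p] by simp
qed

end

lemma lift_X: "p \<in> X i \<Longrightarrow> lift i \<xi> p \<in> X (Suc i)"
  and bond_lift: "p \<in> X i \<Longrightarrow> bond S i (lift i \<xi> p) = p"
proof -
  assume p: "p \<in> X i"
  obtain e' where e': "e' \<in> E' i" "p \<in> e'" using in_E'[OF p] by blast
  show "lift i \<xi> p \<in> X (Suc i)" using lift_branch(1)[OF e'] edge_X[OF branch_edge[OF e'(1)]] by blast
  show "bond S i (lift i \<xi> p) = p" by (rule lift_branch(2)[OF e'])
qed

lemma pi_lift: "p \<in> X i \<Longrightarrow> \<pi> i (lift i \<xi> p) = p"
  using pi_bond[OF lift_X] bond_lift by simp

lemma lift_vert: "p \<in> V' i \<Longrightarrow> lift i \<xi> p = p"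
  by (simp add: lift_def)

text \<open>The conclusion covers all \<open>\<xi>\<close> with the right value on the subedges
  through the projection, so that choices made for different points can be combined.\<close>

lemma lift_choice:
  assumes z: "z \<in> X (Suc i)"
  obtains b where "\<And>\<xi>. (\<And>e'. e' \<in> E' i \<Longrightarrow> bond S i z \<in> e' \<Longrightarrow> \<xi> e' = b) \<Longrightarrow> lift i \<xi> (bond S i z) = z"
proof -
  obtain e' where e': "e' \<in> E' i" "bond S i z \<in> e'" using in_E'[OF bond_in[OF z]] by blast
  define b where "b = (z \<notin> e')"
  have "z \<in> branch i b e'" using preimage_in[OF e'(1) z e'(2)] by (auto simp: b_def branch_def)
  then have "lift i \<xi> (bond S i z) = z" if "\<And>e'. e' \<in> E' i \<Longrightarrow> bond S i z \<in> e' \<Longrightarrow> \<xi> e' = b" for \<xi>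
    using lift_eqI[OF e'(1), of z \<xi>] that[OF e'] by simp
  then show thesis by (rule that)
qed

lemma lift_continuous: "continuous_on (X i) (lift i \<xi>)"
proof -
  have "continuous_on (\<Union>e'\<in>E' i. e') (lift i \<xi>)"
  proof (rule continuous_on_closed_Union)
    fix e' assume e': "e' \<in> E' i"
    show "closed e'" using edge_compact[OF H e'] by (rule compact_imp_closed)
    show "continuous_on e' (lift i \<xi>)"
      unfolding continuous_on_iff using lift_dist[OF e', of _ _ \<xi>] by metis
  qed (rule finite_E')
  then show ?thesis using X_E'[of i] by simp
qed

primrec lifts :: "'m choices \<Rightarrow> nat \<Rightarrow> nat \<Rightarrow> 'm \<Rightarrow> 'm" where
  "lifts \<xi> i 0 p = p"
| "lifts \<xi> i (Suc n) p = lift (i + n) (\<xi> (i + n)) (lifts \<xi> i n p)"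

lemma lifts_X: "p \<in> X i \<Longrightarrow> lifts \<xi> i n p \<in> X (i + n)"
  by (induction n) (auto intro: lift_X)

lemma pi_lifts: "p \<in> X i \<Longrightarrow> \<pi> (i + m) (lifts \<xi> i (m + n) p) = lifts \<xi> i m p"
proof (induction n)
  case 0 then show ?case using pi_id[OF lifts_X] by simp
next
  case (Suc n)
  let ?z = "lifts \<xi> i (m + n) p"
  have z: "?z \<in> X (i + (m + n))" by (rule lifts_X[OF Suc.prems])
  let ?w = "lift (i + (m + n)) (\<xi> (i + (m + n))) ?z"
  have "?w \<in> XI" by (rule subsetD[OF X_XI lift_X[OF z]])
  then have "\<pi> (i + m) ?w = \<pi> (i + m) (\<pi> (i + (m + n)) ?w)" using pi_pi[of "i + m" "i + (m + n)" ?w] by simp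
  also have "\<dots> = \<pi> (i + m) ?z" using pi_lift[OF z] by simp
  finally show ?case using Suc by simp
qed

lemma ht_lifts: "p \<in> X i \<Longrightarrow> ht (lifts \<xi> i n p) = ht p"
  using pi_lifts[of p i 0 \<xi> n] ht_pi[of "lifts \<xi> i n p" i] subsetD[OF X_XI lifts_X[of p i \<xi> n]] by simp

lemma lifts_continuous: "continuous_on (X i) (lifts \<xi> i n)"
proof (induction n)
  case (Suc n)
  show ?case unfolding lifts.simps
    by (rule continuous_on_compose2[OF lift_continuous Suc]) (use lifts_X in auto)
qed simp

lemma lifts_cong: "(\<And>j. i \<le> j \<Longrightarrow> j < i + n \<Longrightarrow> \<xi> j = \<xi>' j) \<Longrightarrow> lifts \<xi> i n p = lifts \<xi>' i n p"
  by (induction n) auto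

lemma lifts_Suc': "lifts \<xi> i (Suc n) p = lifts \<xi> (Suc i) n (lift i (\<xi> i) p)"
  by (induction n) auto

definition lift_inf :: "'m choices \<Rightarrow> nat \<Rightarrow> 'm \<Rightarrow> 'm" where
  "lift_inf \<xi> i p = lim (\<lambda>n. lifts \<xi> i n p)"

lemma lifts_Cauchy: assumes p: "p \<in> X i" shows "Cauchy (\<lambda>n. lifts \<xi> i n p)"
proof (rule metric_CauchyI)
  fix e :: real assume "e > 0"
  have "(\<lambda>n. 4 * mesh (i + n)) \<longlonglongrightarrow> 4 * 0"
    by (intro tendsto_mult tendsto_const LIMSEQ_ignore_initial_segment[OF mesh_lim, of i, folded add.commute[of i]])
  then obtain N where N: "4 * mesh (i + N) < e / 2"
    using order_tendstoD(2)[of "\<lambda>n. 4 * mesh (i + n)" "4 * 0" sequentially "e/2"] \<open>e > 0\<close>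
    by (auto simp: eventually_sequentially)
  have d: "dist (lifts \<xi> i m p) (lifts \<xi> i N p) < e / 2" if mN: "m \<ge> N" for m
  proof -
    obtain n where n: "m = N + n" using le_Suc_ex[OF mN] by blast
    have "lifts \<xi> i m p \<in> XI" by (rule subsetD[OF X_XI lifts_X[OF p]])
    then have "dist (lifts \<xi> i m p) (\<pi> (i + N) (lifts \<xi> i m p)) \<le> 4 * mesh (i + N)" by (rule dist_pi_mesh)
    then show ?thesis using pi_lifts[OF p, of N \<xi> n] n N by simp
  qed
  show "\<exists>M. \<forall>m\<ge>M. \<forall>n\<ge>M. dist (lifts \<xi> i m p) (lifts \<xi> i n p) < e"
    using d dist_triangle_half_l by blast
qed

lemma lifts_lim: "p \<in> X i \<Longrightarrow> (\<lambda>n. lifts \<xi> i n p) \<longlonglongrightarrow> lift_inf \<xi> i p"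
  unfolding lift_inf_def using lifts_Cauchy by (simp add: Cauchy_convergent convergent_LIMSEQ_iff[symmetric])

lemma lift_inf_XI: assumes p: "p \<in> X i" shows "lift_inf \<xi> i p \<in> XI"
proof (rule closed_sequentially[OF closed_XI _ lifts_lim[OF p]])
  show "lifts \<xi> i n p \<in> XI" for n by (rule subsetD[OF X_XI lifts_X[OF p]])
qed

lemma pi_lift_inf: assumes p: "p \<in> X i" shows "\<pi> (i + m) (lift_inf \<xi> i p) = lifts \<xi> i m p"
proof (rule LIMSEQ_unique)
  have "(\<lambda>n. \<pi> (i + m) (lifts \<xi> i n p)) \<longlonglongrightarrow> \<pi> (i + m) (lift_inf \<xi> i p)"
    by (rule continuous_on_tendsto_compose[OF pi_cont lifts_lim[OF p] lift_inf_XI[OF p]])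
      (intro always_eventually allI subsetD[OF X_XI lifts_X[OF p]])
  then show "(\<lambda>n. \<pi> (i + m) (lifts \<xi> i (n + m) p)) \<longlonglongrightarrow> \<pi> (i + m) (lift_inf \<xi> i p)"
    by (rule LIMSEQ_ignore_initial_segment)
  show "(\<lambda>n. \<pi> (i + m) (lifts \<xi> i (n + m) p)) \<longlonglongrightarrow> lifts \<xi> i m p"
    using pi_lifts[OF p, of m \<xi>] by (simp add: add.commute)
qed

lemma pi_lift_inf_0: "p \<in> X i \<Longrightarrow> \<pi> i (lift_inf \<xi> i p) = p"
  using pi_lift_inf[of p i 0 \<xi>] by simp

lemma lift_inf_Suc: "p \<in> X i \<Longrightarrow> lift_inf \<xi> i p = lift_inf \<xi> (Suc i) (lift i (\<xi> i) p)"
proof -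
  assume p: "p \<in> X i"
  have "(\<lambda>n. lifts \<xi> (Suc i) n (lift i (\<xi> i) p)) \<longlonglongrightarrow> lift_inf \<xi> i p"
    using LIMSEQ_Suc[OF lifts_lim[OF p, of \<xi>]] by (simp only: lifts_Suc')
  then show ?thesis using lifts_lim[OF lift_X[OF p]] LIMSEQ_unique by blast
qed

lemma lift_inf_cong: "(\<And>j. i \<le> j \<Longrightarrow> \<xi> j = \<xi>' j) \<Longrightarrow> lift_inf \<xi> i p = lift_inf \<xi>' i p"
  unfolding lift_inf_def using lifts_cong[of i _ \<xi> \<xi>' p] by simp

subsection \<open>Sections of the height function\<close>

definition ht_section :: "nat \<Rightarrow> real \<Rightarrow> real \<Rightarrow> (real \<Rightarrow> 'm) \<Rightarrow> bool" where
  "ht_section k a b c \<longleftrightarrow> continuous_on {a..b} c \<and> (\<forall>s\<in>{a..b}. c s \<in> X k \<and> ht (c s) = s)"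

lemma section_lifts:
  assumes c: "ht_section i a b c"
  shows "ht_section (i + n) a b (\<lambda>s. lifts \<xi> i n (c s))"
  unfolding ht_section_def
proof (intro conjI ballI)
  show "continuous_on {a..b} (\<lambda>s. lifts \<xi> i n (c s))"
    by (rule continuous_on_compose2[OF lifts_continuous, of _ _ i]) (use c in \<open>auto simp: ht_section_def\<close>)
qed (use c lifts_X ht_lifts in \<open>auto simp: ht_section_def\<close>)

lemma section_closed_edge:
  assumes c: "ht_section k a b c" and e: "closed F"
  shows "closed ({a..b} \<inter> c -` F)"
  using c e by (intro continuous_closed_preimage) (auto simp: ht_section_def)

text \<open>Height is arclength on each edge, so \<open>c\<close> is isometric on each of the
  finitely many closed sets of parameters that it sends into one edge.\<close>

lemma section_lipschitz:
  assumes c: "ht_section k a b c" and st: "s \<in> {a..b}" "t \<in> {a..b}"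
  shows "dist (c s) (c t) \<le> \<bar>s - t\<bar>"
proof -
  have "1-lipschitz_on {a..b} c"
  proof (rule lipschitz_on_closed_Union[where I="E k" and U="\<lambda>e. {a..b} \<inter> c -` e"])
    fix e assume e: "e \<in> E k"
    show "closed ({a..b} \<inter> c -` e)"
      by (rule section_closed_edge[OF c]) (rule compact_imp_closed[OF edge_compact[OF G e]])
    show "1-lipschitz_on ({a..b} \<inter> c -` e) c"
    proof (rule lipschitz_onI)
      fix x y assume "x \<in> {a..b} \<inter> c -` e" "y \<in> {a..b} \<inter> c -` e"
      then show "dist (c x) (c y) \<le> 1 * dist x y"
        using dist_ht[OF e, of "c x" "c y"] c by (simp add: ht_section_def dist_real_def)
    qed simp
  next
    show "{a..b} \<subseteq> (\<Union>e\<in>E k. {a..b} \<inter> c -` e)"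
      using c X_E[of k] by (auto simp: ht_section_def)
  qed (auto simp: finite_E)
  from lipschitz_onD[OF this st] show ?thesis by (simp add: dist_real_def)
qed

text \<open>Over the open height interval of \<open>e\<close>, the parameters with value in
  \<open>e\<close> and those with value in another edge form two closed sets. A common parameter
  would give a vertex at a height strictly between the ends of \<open>e\<close>. Connectedness
  leaves only the first set, and the end heights follow by closure.\<close>

lemma section_cover:
  assumes c: "ht_section k a b c" and t: "t \<in> {a..b}" and e: "e \<in> E k" "c t \<in> e" "c t \<notin> V k"
    and s: "s \<in> {a..b}" "lo k e \<le> s" "s \<le> hi k e"
  shows "c s \<in> e"
proof -
  define J where "J = {a..b} \<inter> {lo k e<..<hi k e}"
  define A where "A = {a..b} \<inter> c -` e"
  define B where "B = {a..b} \<inter> c -` (\<Union>(E k - {e}))"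
  have htc: "ht (c x) = x" "c x \<in> X k" if "x \<in> {a..b}" for x using c that by (auto simp: ht_section_def)
  have A: "closed A" unfolding A_def
    by (rule section_closed_edge[OF c]) (rule compact_imp_closed[OF edge_compact[OF G e(1)]])
  have "closed (\<Union>(E k - {e}))" using finite_E[of k] edge_compact[OF G, of _ k]
    by (intro closed_Union) (auto intro: compact_imp_closed)
  then have B: "closed B" unfolding B_def by (rule section_closed_edge[OF c])
  have tJ: "t \<in> J" using t ht_bounds[OF e(1,2)] vert_iff_ht[OF e(1,2)] e(3) htc(1)[OF t] by (auto simp: J_def)
  have "connected J" unfolding J_def by (intro convex_connected convex_Int) auto
  moreover have JAB: "J \<subseteq> A \<union> B"
  proof
    fix x assume "x \<in> J"
    then have x: "x \<in> {a..b}" by (simp add: J_def)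
    obtain e2 where "e2 \<in> E k" "c x \<in> e2" using in_E[OF htc(2)[OF x]] by blast
    then show "x \<in> A \<union> B" using x by (cases "e2 = e") (auto simp: A_def B_def)
  qed
  moreover have "A \<inter> B \<inter> J = {}"
  proof (rule ccontr)
    assume "A \<inter> B \<inter> J \<noteq> {}"
    then obtain x e2 where x: "x \<in> J" "c x \<in> e" "e2 \<in> E k" "e2 \<noteq> e" "c x \<in> e2" by (auto simp: A_def B_def)
    then have "c x \<in> V k" using edge_eqI[OF G e(1) x(3) x(2) x(5)] by blast
    then have "ht (c x) = lo k e \<or> ht (c x) = hi k e" using vert_iff_ht[OF e(1) x(2)] by blast
    then show False using x(1) htc(1)[of x] by (auto simp: J_def)
  qed
  moreover have "A \<inter> J \<noteq> {}" using tJ t e(2) by (auto simp: A_def)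
  ultimately have "B \<inter> J = {}" using A B unfolding connected_closed by blast
  then have JA: "J \<subseteq> A" using JAB by blast
  have "s \<in> A"
  proof -
    have "s \<in> J \<or> s = lo k e \<or> s = hi k e" using s by (auto simp: J_def)
    then consider "s \<in> J" | "s = lo k e" | "s = hi k e" by blast
    then show ?thesis
    proof cases
      case 1 then show ?thesis using JA by blast
    next
      case 2
      then have lt: "s < t" using tJ by (auto simp: J_def)
      have "{s<..t} \<subseteq> J" using 2 tJ s by (auto simp: J_def)
      then have "closure {s<..t} \<subseteq> A" using JA A by (meson closure_minimal order_trans)
      then show ?thesis using lt by auto
    next
      case 3
      then have lt: "t < s" using tJ by (auto simp: J_def)
      have "{t..<s} \<subseteq> J" using 3 tJ s by (auto simp: J_def)
      then have "closure {t..<s} \<subseteq> A" using JA A by (meson closure_minimal order_trans)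
      then show ?thesis using lt by auto
    qed
  qed
  then show ?thesis by (simp add: A_def)
qed

lemma section_cover_eq:
  assumes c: "ht_section k a b c" and t: "t \<in> {a..b}" and e: "e \<in> E k" "c t \<in> e" "c t \<notin> V k"
    and x: "x \<in> e" "ht x \<in> {a..b}"
  shows "c (ht x) = x"
proof -
  have "c (ht x) \<in> e" using section_cover[OF c t e, of "ht x"] ht_bounds[OF e(1) x(1)] x(2) by blast
  then show ?thesis using ht_inj[OF e(1) _ x(1)] c x(2) by (simp add: ht_section_def)
qed

end

context thick_system
begin

subsection \<open>Monotone geodesics\<close>

definition cl :: "real \<Rightarrow> real" where "cl t = max 0 (min 1 t)"

lemma cl_01: "cl t \<in> {0..1}" and cl_id: "t \<in> {0..1} \<Longrightarrow> cl t = t" and cl_dist: "\<bar>cl s - cl t\<bar> \<le> \<bar>s - t\<bar>"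
  and cl_cl: "cl (cl t) = cl t"
  by (auto simp: cl_def)

definition base :: "real \<Rightarrow> 'm" where "base t = inv_into (X 0) ht (cl t)"

lemma base_X: "base t \<in> X 0" and ht_base: "ht (base t) = cl t"
proof -
  obtain e0 where e0: "E 0 = {e0}" "X 0 = e0" "lo 0 e0 = 0" "hi 0 e0 = 1" by (rule X0_edge)
  have "ht ` X 0 = {0..1}" using ht_image[of e0 0] e0 by simp
  then have m: "cl t \<in> ht ` X 0" using cl_01 by simp
  show "base t \<in> X 0" unfolding base_def by (rule inv_into_into[OF m])
  show "ht (base t) = cl t" unfolding base_def by (rule f_inv_into_f[OF m])
qed

lemma dist_X0: "p \<in> X 0 \<Longrightarrow> q \<in> X 0 \<Longrightarrow> dist p q = \<bar>ht p - ht q\<bar>"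
proof -
  obtain e0 where e0: "E 0 = {e0}" "X 0 = e0" by (rule X0_edge)
  show "p \<in> X 0 \<Longrightarrow> q \<in> X 0 \<Longrightarrow> dist p q = \<bar>ht p - ht q\<bar>" using dist_ht[of e0 0 p q] e0 by simp
qed

lemma base_ht: "p \<in> X 0 \<Longrightarrow> base (ht p) = p"
  using dist_X0[OF base_X, of p "ht p"] ht_base[of "ht p"] cl_id[OF ht_01[OF subsetD[OF X_XI]], of p 0] by simp

lemma base_cl: "base (cl t) = base t"
  by (simp add: base_def cl_cl)

lemma base_section: "ht_section 0 0 1 base"
  unfolding ht_section_def
proof (intro conjI ballI)
  show "continuous_on {0..1} base"
    unfolding continuous_on_iff
  proof (intro ballI allI impI)
    fix x e :: real assume "e > 0"
    have "dist (base x') (base x) \<le> dist x' x" for x'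
      using dist_X0[OF base_X base_X, of x' x] cl_dist[of x' x] by (simp add: ht_base dist_real_def)
    then show "\<exists>d>0. \<forall>x'\<in>{0..1}. dist x' x < d \<longrightarrow> dist (base x') (base x) < e"
      using \<open>e > 0\<close> order_le_less_trans by blast
  qed
qed (auto simp: base_X ht_base cl_id)

definition curve :: "'m choices \<Rightarrow> nat \<Rightarrow> real \<Rightarrow> 'm" where "curve \<xi> n t = lifts \<xi> 0 n (base t)"
definition curve_inf :: "'m choices \<Rightarrow> real \<Rightarrow> 'm" where "curve_inf \<xi> t = lift_inf \<xi> 0 (base t)"

lemma curve_section: "ht_section n 0 1 (curve \<xi> n)"
  using section_lifts[OF base_section, of n \<xi>] by (simp add: curve_def[abs_def])

lemma curve_X: "curve \<xi> n t \<in> X n" and ht_curve: "ht (curve \<xi> n t) = cl t" and curve_cl: "curve \<xi> n (cl t) = curve \<xi> n t"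
  using lifts_X[OF base_X, of \<xi> n t] ht_lifts[OF base_X, of \<xi> n t] by (auto simp: curve_def base_cl ht_base)

lemma curve_0: "curve \<xi> 0 t = base t" by (simp add: curve_def)

lemma curve_Suc: "curve \<xi> (Suc n) t = lift n (\<xi> n) (curve \<xi> n t)"
  by (simp add: curve_def)

lemma curve_cong: "(\<And>j. j < n \<Longrightarrow> \<xi> j = \<xi>' j) \<Longrightarrow> curve \<xi> n t = curve \<xi>' n t"
  unfolding curve_def by (rule lifts_cong) simp

lemma curve_inf_XI: "curve_inf \<xi> t \<in> XI"
  unfolding curve_inf_def by (rule lift_inf_XI[OF base_X])

lemma pi_curve_inf: "\<pi> n (curve_inf \<xi> t) = curve \<xi> n t"
  using pi_lift_inf[OF base_X, of n \<xi> t] by (simp add: curve_inf_def curve_def)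

lemma curve_inf_lift: "curve_inf \<xi> t = lift_inf \<xi> i (curve \<xi> i t)"
proof (induction i)
  case (Suc i)
  then show ?case using lift_inf_Suc[OF curve_X] by (simp add: curve_Suc)
qed (simp add: curve_inf_def curve_0)

lemma curve_dist: "dist (curve \<xi> n s) (curve \<xi> n t) \<le> \<bar>cl s - cl t\<bar>"
  using section_lipschitz[OF curve_section cl_01 cl_01, of \<xi> n s t] by (simp add: curve_cl)

lemma curve_lim: "(\<lambda>n. curve \<xi> n t) \<longlonglongrightarrow> curve_inf \<xi> t"
  using pi_lim[OF curve_inf_XI, of \<xi> t] by (simp add: pi_curve_inf)

lemma curve_inf_dist: "dist (curve_inf \<xi> s) (curve_inf \<xi> t) \<le> \<bar>s - t\<bar>"
proof (rule LIMSEQ_le_const2)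
  show "(\<lambda>n. dist (curve \<xi> n s) (curve \<xi> n t)) \<longlonglongrightarrow> dist (curve_inf \<xi> s) (curve_inf \<xi> t)"
    by (intro tendsto_dist curve_lim)
  show "\<exists>N. \<forall>n\<ge>N. dist (curve \<xi> n s) (curve \<xi> n t) \<le> \<bar>s - t\<bar>"
    using curve_dist cl_dist order_trans by blast
qed

text \<open>The edges covered by a curve form a directed path, whose union is isometric to an interval by (A3).
  Distances add up along the curve by monotonicity of its coordinate in that interval, and
  the two ends are at distance \<open>1\<close> because the curve is isometric on each edge.\<close>

lemma curve_isometric:
  assumes st: "s \<in> {0..1}" "t \<in> {0..1}"
  shows "dist (curve \<xi> k s) (curve \<xi> k t) = \<bar>s - t\<bar>"
proof -
  define c where "c = curve \<xi> k"
  have sec: "ht_section k 0 1 c" unfolding c_def by (rule curve_section)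
  have cX: "c x \<in> X k" "ht (c x) = x" if "x \<in> {0..1}" for x using sec that by (auto simp: ht_section_def)
  have ccont: "continuous_on {0..1} c" using sec by (simp add: ht_section_def)
  have lip: "dist (c x) (c y) \<le> \<bar>x - y\<bar>" if "x \<in> {0..1}" "y \<in> {0..1}" for x y
    by (rule section_lipschitz[OF sec that])
  define I where "I = {e \<in> E k. e \<subseteq> c ` {0..1}}"
  have finI: "finite I" unfolding I_def using finite_E[of k] by simp
  have nonvert: "\<exists>e\<in>I. c x \<in> e" if x: "x \<in> {0..1}" "c x \<notin> V k" for x
  proof -
    obtain e where e: "e \<in> E k" "c x \<in> e" using in_E[OF cX(1)[OF x(1)]] by blast
    have "e \<subseteq> c ` {0..1}"
    proof
      fix y assume y: "y \<in> e"
      have h: "ht y \<in> {0..1}" using ht_01[OF subsetD[OF X_XI]] edge_X[OF e(1)] y by blast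
      have "c (ht y) = y" by (rule section_cover_eq[OF sec x(1) e x(2) y h])
      then show "y \<in> c ` {0..1}" using h by (metis imageI)
    qed
    then show ?thesis using e by (auto simp: I_def)
  qed
  define T where "T = {0..1} \<inter> c -` (\<Union>I)"
  have "closed (\<Union>I)"
    using finI edge_compact[OF G, of _ k] by (intro closed_Union) (auto simp: I_def intro: compact_imp_closed)
  then have T: "closed T" unfolding T_def by (rule section_closed_edge[OF sec])
  \<comment> \<open>Only finitely many heights belong to vertices, so every parameter is a limit of
    parameters with nonvertex values, and those lie in the closed set \<open>T\<close>.\<close>
  have cover: "x \<in> T" if x: "x \<in> {0..1}" for x
  proof -
    have "\<exists>y\<in>T. dist y x < r" if r: "r > 0" for r
    proof -
      have "max 0 (x - r) < min 1 (x + r)" using x r by auto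
      then have "infinite {max 0 (x - r)<..<min 1 (x + r)}" by (rule infinite_Ioo)
      moreover have "finite (ht ` V k)" using finite_V by simp
      ultimately have "{max 0 (x - r)<..<min 1 (x + r)} - ht ` V k \<noteq> {}"
        by (metis Diff_infinite_finite finite.emptyI)
      then obtain y where y: "y \<in> {max 0 (x - r)<..<min 1 (x + r)}" "y \<notin> ht ` V k" by blast
      have y01: "y \<in> {0..1}" using y(1) by auto
      have "c y \<notin> V k" using y(2) cX(2)[OF y01] by (metis imageI)
      then have "y \<in> T" using nonvert[OF y01] y01 by (auto simp: T_def)
      moreover have "dist y x < r" using y(1) by (auto simp: dist_real_def)
      ultimately show ?thesis by blast
    qed
    then show ?thesis using closed_approachable[OF T] by blast
  qed
  have c_edge: "c (ht y) = y" "ht y \<in> {0..1}" if ey: "e \<in> I" "y \<in> e" for e y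
  proof -
    obtain x where "x \<in> {0..1}" "y = c x" using ey by (auto simp: I_def)
    then show "c (ht y) = y" "ht y \<in> {0..1}" using cX(2) by auto
  qed
  have IE: "e \<in> E k" if "e \<in> I" for e using that by (simp add: I_def)
  have ends: "c (lo k e) = src (gr S k) e" "c (hi k e) = snk (gr S k) e" "lo k e \<in> {0..1}" "hi k e \<in> {0..1}" if "e \<in> I" for e
    using c_edge[OF that edge_ends(1)[OF G IE[OF that]]] c_edge[OF that edge_ends(2)[OF G IE[OF that]]]
    by (auto simp: lo_def hi_def)
  have "\<exists>es. set es = I \<and> es \<noteq> [] \<and> successively (\<lambda>e e'. hi k e = lo k e') es \<and> lo k (hd es) = 0 \<and> hi k (last es) = 1"
  proof (rule tiling_list[OF finI])
    show "\<exists>e\<in>I. lo k e \<le> x \<and> x \<le> hi k e" if "0 < x" "x < 1" for x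
    proof -
      have x: "x \<in> {0..1}" using that by simp
      obtain e where e: "e \<in> I" "c x \<in> e" using cover[OF x] by (auto simp: T_def)
      then show ?thesis using ht_bounds[OF IE[OF e(1)] e(2)] cX(2)[OF x] by auto
    qed
    show "e = e'" if e: "e \<in> I" "e' \<in> I" "lo k e < x" "x < hi k e" "lo k e' < x" "x < hi k e'" for e e' x
    proof -
      obtain y where y: "y \<in> e" "ht y = x" using ht_onto[OF IE[OF e(1)], of x] e by auto
      obtain y' where y': "y' \<in> e'" "ht y' = x" using ht_onto[OF IE[OF e(2)], of x] e by auto
      have "y = y'" using c_edge(1)[OF e(1) y(1)] c_edge(1)[OF e(2) y'(1)] y y' by simp
      moreover have "y \<notin> V k" using vert_iff_ht[OF IE[OF e(1)] y(1)] y(2) e by simp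
      ultimately show ?thesis using edge_eqI[OF G IE[OF e(1)] IE[OF e(2)] y(1)] y'(1) by blast
    qed
  qed (use lo_less_hi[OF IE] ends in auto)
  then obtain es where es: "set es = I" "es \<noteq> []" "successively (\<lambda>e e'. hi k e = lo k e') es"
    "lo k (hd es) = 0" "hi k (last es) = 1" by blast
  have "successively (\<lambda>e e'. snk (gr S k) e = src (gr S k) e') es"
  proof (rule successively_mono[OF es(3)])
    fix x y assume "x \<in> set es" "y \<in> set es" "hi k x = lo k y"
    then show "snk (gr S k) x = src (gr S k) y" using ends es(1) by metis
  qed
  then have "directed_path (gr S k) es" using es(1,2) by (auto simp: directed_path_def I_def)
  then have "isometric_to_interval (\<Union>I)" using A3 es(1) unfolding A3_def by metis
  moreover have "\<Union>I = c ` {0..1}" using cover by (auto simp: I_def T_def)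
  ultimately have "isometric_to_interval (c ` {0..1})" by simp
  then obtain p q A B \<kappa> where g: "geodesic p q A B \<kappa>" "\<kappa> ` {A..B} = c ` {0..1}"
    unfolding isometric_to_interval_def by blast
  have iso: "dist (\<kappa> x) (\<kappa> y) = \<bar>x - y\<bar>" if "x \<in> {A..B}" "y \<in> {A..B}" for x y
    using g(1) that by (simp add: geodesic_def)
  define \<theta> where "\<theta> = (\<lambda>x. inv_into {A..B} \<kappa> (c x))"
  have th: "\<theta> x \<in> {A..B}" "\<kappa> (\<theta> x) = c x" if "x \<in> {0..1}" for x
    using that g(2) unfolding \<theta>_def by (metis imageI inv_into_into, metis imageI f_inv_into_f)
  have th_dist: "dist (c x) (c y) = \<bar>\<theta> x - \<theta> y\<bar>" if "x \<in> {0..1}" "y \<in> {0..1}" for x y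
    using iso[OF th(1)[OF that(1)] th(1)[OF that(2)]] th(2) that by simp
  have th_cont: "continuous_on {0..1} \<theta>"
    using ccont th_dist unfolding continuous_on_iff by (simp add: dist_real_def)
  have th_inj: "inj_on \<theta> {0..1}"
  proof (rule inj_onI)
    fix x y assume "x \<in> {0..1}" "y \<in> {0..1}" "\<theta> x = \<theta> y"
    then show "x = y" using th(2) cX(2) by metis
  qed
  have add: "dist (c x) (c z) = dist (c x) (c y) + dist (c y) (c z)"
    if "x \<in> {0..1}" "z \<in> {0..1}" "x < y" "y < z" for x y z
  proof -
    have y: "y \<in> {0..1}" using that by auto
    have sub: "{x..z} \<subseteq> {0..1}" using that by auto
    have "(\<theta> x < \<theta> y \<and> \<theta> y < \<theta> z) \<or> (\<theta> z < \<theta> y \<and> \<theta> y < \<theta> x)"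
      using continuous_inj_imp_mono[OF that(3,4) continuous_on_subset[OF th_cont sub] inj_on_subset[OF th_inj sub]] .
    then show ?thesis using th_dist that(1,2) y by auto
  qed
  have edge_len: "dist (c (lo k e)) (c (hi k e)) = hi k e - lo k e" if "e \<in> I" for e
    using elen_ht[OF IE[OF that]] ends[OF that] by (simp add: elen_def)
  have total: "lo k (hd fs) < hi k (last fs) \<and> dist (c (lo k (hd fs))) (c (hi k (last fs))) = hi k (last fs) - lo k (hd fs)"
    if "fs \<noteq> []" "set fs \<subseteq> I" "successively (\<lambda>e e'. hi k e = lo k e') fs" for fs
    using that
  proof (induction fs rule: list_nonempty_induct)
    case (single e)
    then show ?case using edge_len lo_less_hi[OF IE] by simp
  next
    case (cons e fs)
    have IH: "lo k (hd fs) < hi k (last fs)" "dist (c (lo k (hd fs))) (c (hi k (last fs))) = hi k (last fs) - lo k (hd fs)"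
      using cons by (auto simp: successively_Cons)
    have e: "e \<in> I" "last fs \<in> I" "hi k e = lo k (hd fs)" using cons by (auto simp: successively_Cons)
    have l: "lo k e < hi k e" by (rule lo_less_hi[OF IE[OF e(1)]])
    have "dist (c (lo k e)) (c (hi k (last fs))) = dist (c (lo k e)) (c (hi k e)) + dist (c (hi k e)) (c (hi k (last fs)))"
      by (rule add) (use ends[OF e(1)] ends[OF e(2)] l IH(1) e(3) in auto)
    then show ?case using IH e(3) l edge_len[OF e(1)] cons.hyps by simp
  qed
  have one: "dist (c 0) (c 1) = 1" using total[OF es(2) _ es(3)] es by simp
  \<comment> \<open>The ends are at distance 1 and the curve is 1-Lipschitz, so no part of it can
    fall short of its full length.\<close>
  have le: "y - x \<le> dist (c x) (c y)" if "x \<in> {0..1}" "y \<in> {0..1}" for x y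
  proof -
    have "1 \<le> dist (c 0) (c x) + dist (c x) (c y) + dist (c y) (c 1)"
      using one dist_triangle[of "c 0" "c 1" "c x"] dist_triangle[of "c x" "c 1" "c y"] by simp
    moreover have "dist (c 0) (c x) \<le> x" using lip[of 0 x] that by simp
    moreover have "dist (c y) (c 1) \<le> 1 - y" using lip[of y 1] that by simp
    ultimately show ?thesis by simp
  qed
  have "dist (c s) (c t) = \<bar>s - t\<bar>"
    using lip[OF st] le[OF st] le[OF st(2,1)] by (simp add: dist_commute abs_if split: if_splits)
  then show ?thesis by (simp add: c_def)
qed

text \<open>At each stage a single choice, used on all subedges at once, reproduces the next
  projection of \<open>p\<close>; this is why one coin per stage reaches every point.\<close>

lemma curve_through: 
  assumes p: "p \<in> XI"
  obtains b where "\<And>k. curve (\<lambda>i _. b i) k (ht p) = \<pi> k p"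
proof -
  have "\<exists>b. \<forall>\<xi>. (\<forall>e'\<in>E' i. \<pi> i p \<in> e' \<longrightarrow> \<xi> e' = b) \<longrightarrow> lift i \<xi> (\<pi> i p) = \<pi> (Suc i) p" for i
    using lift_choice[OF pi_in[OF p, of "Suc i"]] pi_step[OF p, of i] by metis
  then obtain b where b: "\<And>i \<xi>. (\<forall>e'\<in>E' i. \<pi> i p \<in> e' \<longrightarrow> \<xi> e' = b i) \<Longrightarrow> lift i \<xi> (\<pi> i p) = \<pi> (Suc i) p"
    by metis
  have "curve (\<lambda>i _. b i) k (ht p) = \<pi> k p" for k
  proof (induction k)
    case 0
    show ?case using base_ht[OF pi_in[OF p, of 0]] ht_pi[OF p, of 0] by (simp add: curve_0)
  next
    case (Suc k)
    show ?case unfolding curve_Suc Suc by (rule b) simp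
  qed
  then show thesis by (rule that)
qed

text \<open>As long as no subedge contains both projections, the branches for \<open>x\<close> and
  \<open>y\<close> can be chosen independently, so at each stage some monotone curve passes through
  both projections, and such curves are isometric. The separation persists, since a common subedge
  at a later stage would project into a common one before.\<close>

lemma dist_eq_ht:
  assumes x: "x \<in> XI" and y: "y \<in> XI" and e: "e \<in> E i" "\<pi> i x \<in> e" "\<pi> i y \<in> e"
    and no: "\<And>e'. e' \<in> E' i \<Longrightarrow> \<pi> i x \<in> e' \<Longrightarrow> \<pi> i y \<notin> e'"
  shows "dist x y = \<bar>ht x - ht y\<bar>"
proof -
  have step: "(\<exists>\<xi>. curve \<xi> (i + n) (ht x) = \<pi> (i + n) x \<and> curve \<xi> (i + n) (ht y) = \<pi> (i + n) y) \<and>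
    (\<forall>e'\<in>E' (i + n). \<pi> (i + n) x \<in> e' \<longrightarrow> \<pi> (i + n) y \<notin> e')" for n
  proof (induction n)
    case 0
    \<comment> \<open>A curve through the midpoint, which is not a vertex, runs along the whole of
      \<open>e\<close>.\<close>
    obtain m where m: "m \<in> e" "ht m = (lo i e + hi i e) / 2"
      using ht_onto[OF e(1), of "(lo i e + hi i e) / 2"] lo_less_hi[OF e(1)] by auto
    have mX: "m \<in> X i" using m(1) edge_X[OF e(1)] by blast
    have mv: "m \<notin> V i" using vert_iff_ht[OF e(1) m(1)] m(2) lo_less_hi[OF e(1)] by auto
    have mXI: "m \<in> XI" using mX X_XI by blast
    obtain b where "\<And>k. curve (\<lambda>i _. b i) k (ht m) = \<pi> k m" using curve_through[OF mXI] by blast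
    then have cm: "curve (\<lambda>i _. b i) i (ht m) = m" using pi_id[OF mX] by simp
    have "curve (\<lambda>i _. b i) i (ht (\<pi> i w)) = \<pi> i w" if w: "w \<in> XI" "\<pi> i w \<in> e" for w
      using section_cover_eq[OF curve_section ht_01[OF mXI] e(1), of "\<lambda>i _. b i" "\<pi> i w"] cm m(1) mv w(2)
        ht_01[OF pi_XI[OF w(1)], of i] by simp
    then show ?case using x y e(2,3) no ht_pi by (intro conjI exI[of _ "\<lambda>i _. b i"]) auto
  next
    case (Suc n)
    let ?k = "i + n"
    obtain \<xi> where \<xi>: "curve \<xi> ?k (ht x) = \<pi> ?k x" "curve \<xi> ?k (ht y) = \<pi> ?k y" using Suc by blast
    have nk: "\<And>e'. e' \<in> E' ?k \<Longrightarrow> \<pi> ?k x \<in> e' \<Longrightarrow> \<pi> ?k y \<notin> e'" using Suc by blast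
    obtain bx where bx: "\<And>\<xi>. (\<And>e'. e' \<in> E' ?k \<Longrightarrow> \<pi> ?k x \<in> e' \<Longrightarrow> \<xi> e' = bx) \<Longrightarrow> lift ?k \<xi> (\<pi> ?k x) = \<pi> (Suc ?k) x"
      using lift_choice[OF pi_in[OF x, of "Suc ?k"]] pi_step[OF x, of ?k] by metis
    obtain bY where bY: "\<And>\<xi>. (\<And>e'. e' \<in> E' ?k \<Longrightarrow> \<pi> ?k y \<in> e' \<Longrightarrow> \<xi> e' = bY) \<Longrightarrow> lift ?k \<xi> (\<pi> ?k y) = \<pi> (Suc ?k) y"
      using lift_choice[OF pi_in[OF y, of "Suc ?k"]] pi_step[OF y, of ?k] by metis
    define \<xi>' where "\<xi>' = (\<lambda>j e'. if j = ?k then (if \<pi> ?k x \<in> e' then bx else bY) else \<xi> j e')"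
    have c: "curve \<xi>' ?k t = curve \<xi> ?k t" for t by (rule curve_cong) (simp add: \<xi>'_def)
    have "curve \<xi>' (Suc ?k) (ht x) = \<pi> (Suc ?k) x"
      unfolding curve_Suc c \<xi> by (rule bx) (simp add: \<xi>'_def)
    moreover have "curve \<xi>' (Suc ?k) (ht y) = \<pi> (Suc ?k) y"
      unfolding curve_Suc c \<xi> by (rule bY) (use nk in \<open>auto simp: \<xi>'_def\<close>)
    moreover have "\<pi> (Suc ?k) y \<notin> e'" if e': "e' \<in> E' (Suc ?k)" "\<pi> (Suc ?k) x \<in> e'" for e'
    proof
      assume ye: "\<pi> (Suc ?k) y \<in> e'"
      obtain e1 where e1: "e1 \<in> E (Suc ?k)" "e' \<subseteq> e1" by (rule sub_parent[OF e'(1)])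
      obtain e2 where e2: "e2 \<in> E' ?k" "e1 = e2 \<or> e1 = opp S ?k e2" by (rule E_Suc[OF e1(1)])
      have im: "bond S ?k z \<in> e2" if "z \<in> e'" for z
        using e2(2) bond_id_edge[OF e2(1)] bond_opp_image[OF e2(1)] e1(2) that by auto
      then have "\<pi> ?k x \<in> e2" "\<pi> ?k y \<in> e2"
        using im[OF e'(2)] im[OF ye] pi_step[OF x, of ?k] pi_step[OF y, of ?k] by auto
      then show False using nk[OF e2(1)] by blast
    qed
    ultimately show ?case by auto
  qed
  have d: "dist (\<pi> (i + n) x) (\<pi> (i + n) y) = \<bar>ht x - ht y\<bar>" for n
  proof -
    obtain \<xi> where "curve \<xi> (i + n) (ht x) = \<pi> (i + n) x" "curve \<xi> (i + n) (ht y) = \<pi> (i + n) y"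
      using step[of n] by blast
    then show ?thesis using curve_isometric[OF ht_01[OF x] ht_01[OF y], of \<xi> "i + n"] by simp
  qed
  have "(\<lambda>n. dist (\<pi> (n + i) x) (\<pi> (n + i) y)) \<longlonglongrightarrow> dist x y"
    by (intro tendsto_dist LIMSEQ_ignore_initial_segment[OF pi_lim] x y)
  moreover have "(\<lambda>n. dist (\<pi> (n + i) x) (\<pi> (n + i) y)) = (\<lambda>n. \<bar>ht x - ht y\<bar>)"
    using d by (simp add: add.commute)
  ultimately show ?thesis using LIMSEQ_unique tendsto_const by metis
qed

text \<open>Takes the place of a global Lipschitz bound on the height: either both projections lie
  on \<open>e'\<close>, whose length bounds the difference, or \<open>dist_eq_ht\<close>
  applies.\<close>

lemma ht_dist_le:
  assumes x: "x \<in> XI" and y: "y \<in> XI" and e: "e \<in> E i" "\<pi> i x \<in> e" "\<pi> i y \<in> e"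
    and e': "e' \<in> E' i" "\<pi> i x \<in> e'" "\<pi> i x \<notin> V' i"
  shows "\<bar>ht x - ht y\<bar> \<le> max (elen (sub S i) e') (dist x y)"
proof (cases "\<pi> i y \<in> e'")
  case True
  have "dist (\<pi> i x) (\<pi> i y) \<le> elen (sub S i) e'"
    using edge_dist[OF H e'(1,2) True] ecoord_bounds[OF H e'(1,2)] ecoord_bounds[OF H e'(1) True] by auto
  moreover have "dist (\<pi> i x) (\<pi> i y) = \<bar>ht x - ht y\<bar>" using dist_ht[OF e] ht_pi x y by simp
  ultimately show ?thesis by simp
next
  case False
  have "\<pi> i y \<notin> f" if "f \<in> E' i" "\<pi> i x \<in> f" for f
    using edge_eqI[OF H e'(1) that(1) e'(2) that(2) e'(3)] False by blast
  then show ?thesis using dist_eq_ht[OF x y e] by simp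
qed

end

section \<open>Random monotone geodesics\<close>

text \<open>The coordinate \<open>0\<close> of the sample space is a uniform parameter in \<open>[0,1]\<close>; the coordinate \<open>Suc i\<close>
  is the coin that decides between an edge of the subdivision of \<open>X i\<close> and its opposite edge.\<close>

definition coins :: "nat \<Rightarrow> real measure" where
  "coins i = (if i = 0 then uniform_measure lborel {0..1}
     else distr (measure_pmf (bernoulli_pmf (1/2))) borel (\<lambda>b. if b then 1 else 0))"

lemma sets_coins[simp, measurable_cong]: "sets (coins i) = sets borel"
  by (simp add: coins_def)

lemma space_coins[simp]: "space (coins i) = UNIV"
  by (simp add: coins_def)

lemma prob_space_coins: "prob_space (coins i)"
  unfolding coins_def by (auto intro!: prob_space_uniform_measure prob_space.prob_space_distr prob_space_measure_pmf)

interpretation coins: seq_prob_space coins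
  by (intro seq_prob_space.intro product_prob_space.intro product_prob_space_axioms.intro
      product_sigma_finite.intro prob_space_coins prob_space_imp_sigma_finite)

abbreviation Omega :: "(nat \<Rightarrow> real) measure" where "Omega \<equiv> Pi\<^sub>M UNIV coins"

text \<open>Since the coins are real-valued as well, the sample space is the Polish space of real
  sequences with its Borel sets, where inner regularity by compact sets is available.\<close>

lemma sets_Omega: "sets Omega = sets borel"
proof -
  have "sets Omega = sets (Pi\<^sub>M UNIV (\<lambda>_::nat. borel :: real measure))" by (intro sets_PiM_cong) auto
  then show ?thesis by (simp add: sets_PiM_equal_borel)
qed

lemma space_Omega[simp]: "space Omega = UNIV"
  by (simp add: space_PiM)

lemma measurable_coord[measurable]: "(\<lambda>\<omega>. \<omega> i) \<in> borel_measurable Omega"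
  using measurable_component_singleton[of i UNIV coins] by (simp cong: measurable_cong_sets)

lemma AE_coins_0: 
  assumes "AE t in lborel. t \<in> {0..1} \<longrightarrow> Q t"
  shows "AE \<omega> in Omega. Q (\<omega> 0)"
proof (rule coins.AE_component)
  show "AE t in coins 0. Q t" unfolding coins_def using assms by (auto intro!: AE_uniform_measureI)
qed simp

lemma AE_coord_null: "N \<in> null_sets lborel \<Longrightarrow> AE \<omega> in Omega. \<omega> 0 \<notin> N"
  by (intro AE_coins_0) (use AE_not_in in force)

lemma AE_coord_01: "AE \<omega> in Omega. \<omega> 0 \<in> {0<..<1}"
proof -
  have "{0,1::real} \<in> null_sets lborel" by (intro finite_imp_null_set_lborel) auto
  then have "AE t in lborel. t \<notin> {0,1::real}" by (rule AE_not_in)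
  then show ?thesis by (intro AE_coins_0) (auto elim: eventually_mono)
qed

lemma AE_coin: "AE \<omega> in Omega. \<forall>i. \<omega> (Suc i) \<in> {0,1}"
proof (subst AE_all_countable, rule allI)
  fix i
  have "AE x in coins (Suc i). x \<in> {0,1}"
    unfolding coins_def by (simp add: AE_distr_iff)
  then show "AE \<omega> in Omega. \<omega> (Suc i) \<in> {0,1}" by (intro coins.AE_component) auto
qed

text \<open>Preserves the law and exchanges the two outcomes of one coin; it takes the place of
  conditioning on that coin. Outcomes other than 0 and 1 form a null event.\<close>

definition flip :: "nat \<Rightarrow> (nat \<Rightarrow> real) \<Rightarrow> nat \<Rightarrow> real" where
  "flip i \<omega> = fun_upd \<omega> (Suc i) (if \<omega> (Suc i) = 1 then 0 else 1)"

lemma map_bernoulli_Not: "map_pmf Not (bernoulli_pmf (1/2)) = bernoulli_pmf (1/2)"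
proof (rule pmf_eqI)
  fix b
  have "pmf (map_pmf Not (bernoulli_pmf (1/2))) (\<not> \<not> b) = pmf (bernoulli_pmf (1/2)) (\<not> b)"
    by (rule pmf_map_inj') (auto simp: inj_on_def)
  then show "pmf (map_pmf Not (bernoulli_pmf (1/2))) b = pmf (bernoulli_pmf (1/2)) b"
    by (cases b) auto
qed

lemma distr_flip: "distr Omega Omega (flip i) = Omega" and measurable_flip: "flip i \<in> measurable Omega Omega"
proof -
  let ?h = "\<lambda>x::real. if x = 1 then 0 else 1 :: real"
  let ?g = "\<lambda>b. if b then 1 else 0 :: real"
  have hm: "?h \<in> measurable (coins (Suc i)) (coins (Suc i))"
    by (simp cong: measurable_cong_sets)
  have "distr (coins (Suc i)) (coins (Suc i)) ?h = distr (distr (measure_pmf (bernoulli_pmf (1/2))) borel ?g) borel ?h"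
    unfolding coins_def by (intro distr_cong) auto
  also have "\<dots> = distr (measure_pmf (bernoulli_pmf (1/2))) borel (?h \<circ> ?g)"
    by (intro distr_distr) auto
  also have "?h \<circ> ?g = ?g \<circ> Not" by auto
  also have "distr (measure_pmf (bernoulli_pmf (1/2))) borel (?g \<circ> Not) =
      distr (distr (measure_pmf (bernoulli_pmf (1/2))) (count_space UNIV) Not) borel ?g"
    by (intro distr_distr[symmetric]) auto
  also have "\<dots> = distr (measure_pmf (map_pmf Not (bernoulli_pmf (1/2)))) borel ?g"
    by (simp only: map_pmf_rep_eq)
  also have "\<dots> = coins (Suc i)" by (simp add: map_bernoulli_Not coins_def)
  finally have hd: "distr (coins (Suc i)) (coins (Suc i)) ?h = coins (Suc i)" .
  show "distr Omega Omega (flip i) = Omega" "flip i \<in> measurable Omega Omega"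
    using coins.distr_upd[OF hm hd] coins.measurable_upd[OF hm] by (simp_all add: flip_def[abs_def])
qed

lemma prob_flip: "A \<in> sets Omega \<Longrightarrow> coins.P.prob {\<omega>. flip i \<omega> \<in> A} = coins.P.prob A"
proof -
  assume A: "A \<in> sets Omega"
  have "measure (distr Omega Omega (flip i)) A = measure Omega (flip i -` A \<inter> space Omega)"
    by (rule measure_distr[OF measurable_flip A])
  then show ?thesis by (simp add: distr_flip vimage_def)
qed

section \<open>Measurability and continuity of the random point\<close>

context thick_system
begin

text \<open>The same coin is used on all edges of a stage. A point of the curve meets only one fibre
  per stage, so its law is the one that independent coins on the edges would give.\<close>

definition bits :: "(nat \<Rightarrow> real) \<Rightarrow> 'm choices" where "bits \<omega> = (\<lambda>i _. \<omega> (Suc i) = 1)"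

definition cur :: "nat \<Rightarrow> (nat \<Rightarrow> real) \<Rightarrow> 'm" where "cur i \<omega> = curve (bits \<omega>) i (\<omega> 0)"
definition Gam :: "(nat \<Rightarrow> real) \<Rightarrow> 'm" where "Gam \<omega> = curve_inf (bits \<omega>) (\<omega> 0)"

lemma bits_flip: "j \<noteq> i \<Longrightarrow> bits (flip i \<omega>) j = bits \<omega> j" "bits (flip i \<omega>) i e' = (\<not> bits \<omega> i e')" "flip i \<omega> 0 = \<omega> 0"
  by (auto simp: bits_def flip_def)

lemma bits_mix: "j + 1 < n \<Longrightarrow> bits (mix n \<omega> \<omega>') j = bits \<omega> j" "n \<le> Suc j \<Longrightarrow> bits (mix n \<omega> \<omega>') j = bits \<omega>' j"
  by (auto simp: bits_def mix_def)

lemma cur_Suc: "cur (Suc i) \<omega> = (if \<omega> (Suc i) = 1 then lift i (\<lambda>_. True) (cur i \<omega>) else lift i (\<lambda>_. False) (cur i \<omega>))"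
  by (simp add: cur_def curve_Suc bits_def)

lemma cur_X: "cur i \<omega> \<in> X i"
  by (simp add: cur_def curve_X)

lemma pi_Gam: "\<pi> i (Gam \<omega>) = cur i \<omega>"
  by (simp add: Gam_def cur_def pi_curve_inf)

lemma Gam_XI: "Gam \<omega> \<in> XI"
  by (simp add: Gam_def curve_inf_XI)

lemma dist_base: "dist (base s) (base t) \<le> dist s t"
  using dist_X0[OF base_X base_X, of s t] cl_dist[of s t] by (simp add: ht_base dist_real_def)

lemma base_continuous: "continuous_on UNIV base"
  unfolding continuous_on_iff using dist_base order_le_less_trans by blast

abbreviation "XM i \<equiv> restrict_space borel (X i)"
abbreviation "XIM \<equiv> restrict_space borel XI"

lemma closed_X: "closed (X i)"
  using points_compact[OF G] by (rule compact_imp_closed)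

lemma lift_measurable: "lift i \<xi> \<in> measurable (XM i) (XM (Suc i))"
  by (rule measurable_restrict_space2)
    (auto simp: space_restrict_space intro!: lift_X borel_measurable_continuous_on_restrict lift_continuous)

lemma measurable_choice_curve:
  assumes "t \<in> borel_measurable Omega"
  shows "(\<lambda>\<omega>. curve (bits \<omega>) i (t \<omega>)) \<in> measurable Omega (XM i)"
proof (induction i)
  case 0
  have "base \<in> borel_measurable borel" by (rule borel_measurable_continuous_onI[OF base_continuous])
  then show ?case unfolding curve_0
    by (intro measurable_restrict_space2 measurable_compose[OF assms]) (auto simp: base_X)
next
  case (Suc i)
  have eq: "curve (bits \<omega>) (Suc i) (t \<omega>) = (if \<omega> (Suc i) = 1 then lift i (\<lambda>_. True) (curve (bits \<omega>) i (t \<omega>))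
      else lift i (\<lambda>_. False) (curve (bits \<omega>) i (t \<omega>)))" for \<omega>
    by (simp add: curve_Suc bits_def)
  show ?case unfolding eq
    by (intro measurable_If measurable_compose[OF Suc lift_measurable]) measurable
qed

lemma measurable_cur: "cur i \<in> measurable Omega (XM i)"
  unfolding cur_def[abs_def] by (rule measurable_choice_curve) measurable

lemma dist_curve_inf_mesh: "dist (curve_inf \<xi> t) (curve \<xi> i t) \<le> 4 * mesh i"
  using dist_pi_mesh[OF curve_inf_XI, of \<xi> t i] by (simp add: pi_curve_inf)

lemma measurable_choice_curve_inf:
  assumes "t \<in> borel_measurable Omega"
  shows "(\<lambda>\<omega>. curve_inf (bits \<omega>) (t \<omega>)) \<in> measurable Omega XIM"
proof (rule measurable_restrict_space2)
  show "(\<lambda>\<omega>. curve_inf (bits \<omega>) (t \<omega>)) \<in> borel_measurable Omega"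
  proof (rule borel_measurable_LIMSEQ_metric)
    show "(\<lambda>\<omega>. curve (bits \<omega>) i (t \<omega>)) \<in> borel_measurable Omega" for i
      using measurable_choice_curve[OF assms, of i] by (simp add: measurable_restrict_space2_iff)
    show "(\<lambda>i. curve (bits \<omega>) i (t \<omega>)) \<longlonglongrightarrow> curve_inf (bits \<omega>) (t \<omega>)" for \<omega>
      by (rule curve_lim)
  qed
qed (auto simp: curve_inf_XI)

lemma measurable_Gam: "Gam \<in> measurable Omega XIM"
  unfolding Gam_def[abs_def] by (rule measurable_choice_curve_inf) measurable

text \<open>The continuation from \<open>p\<close> is written as a full curve: a fixed sequence
  \<open>w\<close> supplies the coins that lead to \<open>p\<close>, and \<open>\<omega>\<close>
  supplies the coins from stage \<open>i\<close> on.\<close>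

lemma measurable_lift_inf: assumes p: "p \<in> X i" shows "(\<lambda>\<omega>. lift_inf (bits \<omega>) i p) \<in> measurable Omega XIM"
proof -
  obtain b where b: "\<And>k. curve (\<lambda>i _. b i) k (ht p) = \<pi> k p" using curve_through[of p] p X_XI by blast
  have bm: "\<exists>w :: nat \<Rightarrow> real. \<forall>j. (w (Suc j) = 1) = b j"
    by (intro exI[of _ "\<lambda>j. if b (j - 1) then 1 else 0"]) auto
  then obtain w :: "nat \<Rightarrow> real" where w: "\<And>j. (w (Suc j) = 1) = b j" by blast
  have "lift_inf (bits \<omega>) i p = curve_inf (bits (mix (Suc i) w \<omega>)) (ht p)" for \<omega>
  proof -
    have "curve (bits (mix (Suc i) w \<omega>)) i (ht p) = curve (\<lambda>i _. b i) i (ht p)"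
      by (rule curve_cong) (simp add: bits_def mix_def w)
    then have "curve (bits (mix (Suc i) w \<omega>)) i (ht p) = p" using b pi_id[OF p] by simp
    then have "curve_inf (bits (mix (Suc i) w \<omega>)) (ht p) = lift_inf (bits (mix (Suc i) w \<omega>)) i p"
      using curve_inf_lift[of "bits (mix (Suc i) w \<omega>)" "ht p" i] by simp
    also have "\<dots> = lift_inf (bits \<omega>) i p" by (rule lift_inf_cong) (simp add: bits_mix)
    finally show ?thesis by simp
  qed
  moreover have "(\<lambda>\<omega>. curve_inf (bits (mix (Suc i) w \<omega>)) (ht p)) \<in> measurable Omega XIM"
  proof (rule measurable_compose[OF _ measurable_choice_curve_inf[of "\<lambda>_. ht p"]])
    show "(\<lambda>\<omega>. mix (Suc i) w \<omega>) \<in> measurable Omega Omega"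
      using measurable_compose[OF measurable_Pair1'[of w Omega Omega] coins.measurable_mix[of "Suc i"]] by simp
  qed simp
  ultimately show ?thesis by simp
qed

text \<open>On these sequences the test \<open>\<omega> (Suc i) = 1\<close> separates two disjoint
  closed sets, which makes the curve point continuous in the sequence.\<close>

definition fair :: "(nat \<Rightarrow> real) set" where "fair = {\<omega>. \<forall>i. \<omega> (Suc i) \<in> {0,1}}"

lemma closed_coord: "closed A \<Longrightarrow> closed {\<omega>::nat \<Rightarrow> real. \<omega> i \<in> A}"
  using continuous_closed_vimage[of A "\<lambda>\<omega>::nat\<Rightarrow>real. \<omega> i"]
  by (metis closed_vimage continuous_on_product_coordinates vimage_def)

lemma cur_continuous: "continuous_on fair (cur i)"
proof (induction i)
  case 0
  have "continuous_on fair (\<lambda>\<omega>. base (\<omega> 0))"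
    by (rule continuous_on_compose2[OF base_continuous continuous_on_subset[OF continuous_on_product_coordinates]]) auto
  then show ?case by (simp add: cur_def[abs_def] curve_0)
next
  case (Suc i)
  let ?A = "\<lambda>x. {\<omega>::nat\<Rightarrow>real. \<omega> (Suc i) \<in> {x}}"
  have cl: "closed (?A 1)" "closed (?A 0)" by (rule closed_coord, simp)+
  have part: "continuous_on (fair \<inter> ?A x) (cur (Suc i))" for x
  proof -
    define \<xi> :: "'m set \<Rightarrow> bool" where "\<xi> = (\<lambda>_. x = 1)"
    have "continuous_on (fair \<inter> ?A x) (\<lambda>\<omega>. lift i \<xi> (cur i \<omega>))"
      by (rule continuous_on_compose2[OF lift_continuous continuous_on_subset[OF Suc]]) (auto simp: cur_X)
    then show ?thesis
      by (rule continuous_on_cong[THEN iffD1, rotated 2]) (auto simp: cur_Suc \<xi>_def)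
  qed
  have "continuous_on ((fair \<inter> ?A 1) \<union> (fair \<inter> ?A 0)) (cur (Suc i))"
  proof (rule continuous_on_Un_local[OF _ _ part part])
    show "closedin (top_of_set (fair \<inter> ?A 1 \<union> fair \<inter> ?A 0)) (fair \<inter> ?A 1)"
      using cl(1) by (intro closedin_closed[THEN iffD2] exI[of _ "?A 1"]) auto
    show "closedin (top_of_set (fair \<inter> ?A 1 \<union> fair \<inter> ?A 0)) (fair \<inter> ?A 0)"
      using cl(2) by (intro closedin_closed[THEN iffD2] exI[of _ "?A 0"]) auto
  qed
  moreover have "(fair \<inter> ?A 1) \<union> (fair \<inter> ?A 0) = fair" by (auto simp: fair_def)
  ultimately show ?case by simp
qed

lemma Gam_continuous: "continuous_on fair Gam"
proof (rule uniform_limit_theorem)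
  show "\<forall>\<^sub>F n in sequentially. continuous_on fair (cur n)" by (simp add: cur_continuous)
  show "uniform_limit fair cur Gam sequentially"
  proof (rule uniform_limitI)
    fix e :: real assume "e > 0"
    have "(\<lambda>n. 4 * mesh n) \<longlonglongrightarrow> 4 * 0" by (intro tendsto_mult tendsto_const mesh_lim)
    then have "\<forall>\<^sub>F n in sequentially. 4 * mesh n < e" by (rule order_tendstoD) (simp add: \<open>e > 0\<close>)
    then show "\<forall>\<^sub>F n in sequentially. \<forall>\<omega>\<in>fair. dist (cur n \<omega>) (Gam \<omega>) < e"
    proof (rule eventually_mono)
      fix n assume "4 * mesh n < e"
      then show "\<forall>\<omega>\<in>fair. dist (cur n \<omega>) (Gam \<omega>) < e"
        using dist_pi_mesh[OF Gam_XI, of _ n] by (auto simp: pi_Gam dist_commute intro: order_le_less_trans)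
    qed
  qed
qed simp

end

locale thick_measure = thick_system S \<pi> \<delta>
  for S :: "'m::complete_space inv_system" and \<pi> :: "nat \<Rightarrow> 'm \<Rightarrow> 'm" and \<delta> :: "nat \<Rightarrow> real" +
  fixes \<mu> :: "nat \<Rightarrow> 'm measure" and \<nu> :: "'m measure"
  assumes sm: "system_measures S \<mu>" and lm: "limit_measure S \<mu> \<pi> \<nu>" and \<delta>_sum: "summable \<delta>"
begin

subsection \<open>The measures of the system are the laws of the random curve\<close>

lemmas system_measuresD =
  sm[unfolded system_measures_def, THEN conjunct1, rule_format]
  sm[unfolded system_measures_def, THEN conjunct2, THEN conjunct1, rule_format]
  sm[unfolded system_measures_def, THEN conjunct2, THEN conjunct2, THEN conjunct1, rule_format]
  sm[unfolded system_measures_def, THEN conjunct2, THEN conjunct2, THEN conjunct2, rule_format]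

lemma mu_prob: "prob_space (\<mu> i)" and sets_mu: "sets (\<mu> i) = sets (XM i)"
  using system_measuresD(1)[of i] by auto

lemma space_mu: "space (\<mu> i) = X i"
  using sets_eq_imp_space_eq[OF sets_mu] by (simp add: space_restrict_space)

lemma in_sets_mu: "A \<in> sets (\<mu> i) \<longleftrightarrow> A \<subseteq> X i \<and> A \<in> sets borel"
  unfolding sets_mu by (rule sets_restrict_space_iff) (simp add: closed_X)

lemma nu_prob: "prob_space \<nu>" and sets_nu: "sets \<nu> = sets XIM" and distr_pi: "distr \<nu> (\<mu> i) (\<pi> i) = \<mu> i"
  using lm by (simp_all add: limit_measure_def)

lemma space_nu: "space \<nu> = XI"
  using sets_eq_imp_space_eq[OF sets_nu] by (simp add: space_restrict_space)

lemma in_sets_nu: "A \<in> sets \<nu> \<longleftrightarrow> A \<subseteq> XI \<and> A \<in> sets borel"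
  unfolding sets_nu by (rule sets_restrict_space_iff) (simp add: closed_XI)

lemma measurable_pi: "\<pi> i \<in> measurable \<nu> (\<mu> i)"
proof -
  have "\<pi> i \<in> measurable XIM (XM i)"
    by (rule measurable_restrict_space2)
      (auto simp: space_restrict_space intro!: pi_in borel_measurable_continuous_on_restrict pi_cont)
  then show ?thesis by (simp cong: measurable_cong_sets add: sets_nu sets_mu)
qed

lemma measurable_cur_mu: "cur i \<in> measurable Omega (\<mu> i)"
  using measurable_cur[of i] by (simp cong: measurable_cong_sets add: sets_mu)

lemma edge_borel: "e \<in> E i \<Longrightarrow> e \<in> sets borel" and sub_edge_borel: "e' \<in> E' i \<Longrightarrow> e' \<in> sets borel"
  using edge_compact[OF G] edge_compact[OF H] by (auto intro: borel_compact)

text \<open>The image is the preimage of \<open>A\<close> under the inverse of the height on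
  \<open>e\<close>, which is an isometry.\<close>

lemma ht_image_borel:
  assumes e: "e \<in> E i" and A: "A \<in> sets borel" "A \<subseteq> e"
  shows "ht ` A \<in> sets borel"
proof -
  define p where "p = inv_into e ht"
  have im: "ht ` e = {lo i e..hi i e}" by (rule ht_image[OF e])
  have p: "p s \<in> e" "ht (p s) = s" if "s \<in> {lo i e..hi i e}" for s
    using that unfolding p_def im[symmetric] by (auto intro: inv_into_into f_inv_into_f)
  have "dist (p s) (p t) = dist s t" if "s \<in> {lo i e..hi i e}" "t \<in> {lo i e..hi i e}" for s t
    using dist_ht[OF e p(1)[OF that(1)] p(1)[OF that(2)]] p(2) that by (simp add: dist_real_def)
  then have "continuous_on {lo i e..hi i e} p" unfolding continuous_on_iff by metis
  then have "p \<in> borel_measurable (restrict_space borel {lo i e..hi i e})"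
    by (rule borel_measurable_continuous_on_restrict)
  from measurable_sets[OF this A(1)] have "p -` A \<inter> {lo i e..hi i e} \<in> sets borel"
    by (auto simp: sets_restrict_space_iff space_restrict_space)
  moreover have "ht ` A = p -` A \<inter> {lo i e..hi i e}"
  proof (intro equalityI subsetI)
    fix s assume "s \<in> ht ` A"
    then obtain x where x: "x \<in> A" "s = ht x" by blast
    have s: "s \<in> {lo i e..hi i e}" using ht_bounds[OF e] x A(2) by auto
    have "p s = x" using ht_inj[OF e p(1)[OF s], of x] p(2)[OF s] x A(2) by auto
    then show "s \<in> p -` A \<inter> {lo i e..hi i e}" using x s by auto
  next
    fix s assume "s \<in> p -` A \<inter> {lo i e..hi i e}"
    then show "s \<in> ht ` A" using p(2)[of s] by (metis IntD1 IntD2 imageI vimageD)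
  qed
  ultimately show ?thesis by simp
qed

lemma glength_ht:
  assumes e: "e \<in> E i" and A: "A \<in> sets borel" "A \<subseteq> e"
  shows "glength (gr S i) A = emeasure lborel (ht ` A)"
proof -
  have z: "emeasure lborel (ecoord (gr S i) e1 ` (A \<inter> e1)) = 0" if e1: "e1 \<in> E i - {e}" for e1
  proof -
    have "A \<inter> e1 \<subseteq> V i" using edge_eqI[OF G e] e1 A(2) by blast
    then have "finite (ecoord (gr S i) e1 ` (A \<inter> e1))" using finite_V by (meson finite_imageI finite_subset)
    then show ?thesis by (simp add: emeasure_lborel_countable countable_finite)
  qed
  have "glength (gr S i) A = emeasure lborel (ecoord (gr S i) e ` (A \<inter> e))"
    unfolding glength_def using z by (simp add: sum.remove[OF finite_E e])
  also have "ecoord (gr S i) e ` (A \<inter> e) = (+) (lo i e) -` (ht ` A)"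
  proof (intro equalityI subsetI)
    fix s assume "s \<in> ecoord (gr S i) e ` (A \<inter> e)"
    then show "s \<in> (+) (lo i e) -` (ht ` A)" using ecoord_ht[OF e] by force
  next
    fix s assume "s \<in> (+) (lo i e) -` (ht ` A)"
    then obtain x where x: "x \<in> A" "lo i e + s = ht x" by auto
    then have "s = ecoord (gr S i) e x" using ecoord_ht[OF e, of x] A(2) by auto
    then show "s \<in> ecoord (gr S i) e ` (A \<inter> e)" using x A(2) by auto
  qed
  also have "emeasure lborel ((+) (lo i e) -` (ht ` A)) = emeasure (distr lborel borel ((+) (lo i e))) (ht ` A)"
    using ht_image_borel[OF e A] by (subst emeasure_distr) auto
  also have "\<dots> = emeasure lborel (ht ` A)" by (simp add: lborel_distr_plus)
  finally show ?thesis .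
qed

lemma mu_density_ennreal:
  assumes e: "e \<in> E i"
  shows "\<exists>c. \<forall>A\<in>sets borel. A \<subseteq> e \<longrightarrow> emeasure (\<mu> i) A = c * emeasure lborel (ht ` A)"
proof -
  have "\<exists>c. \<forall>A\<in>sets (\<mu> i). A \<subseteq> e \<longrightarrow> emeasure (\<mu> i) A = c * glength (gr S i) A"
  proof (cases i)
    case 0
    then show ?thesis using system_measuresD(2) by (intro exI[of _ 1]) simp
  next
    case (Suc j)
    then show ?thesis using system_measuresD(3)[of e j] e by simp
  qed
  then obtain c where c: "\<And>A. A \<in> sets (\<mu> i) \<Longrightarrow> A \<subseteq> e \<Longrightarrow> emeasure (\<mu> i) A = c * glength (gr S i) A" by blast
  have "emeasure (\<mu> i) A = c * emeasure lborel (ht ` A)" if A: "A \<in> sets borel" "A \<subseteq> e" for A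
  proof -
    have "A \<in> sets (\<mu> i)" using A edge_X[OF e] by (auto simp: in_sets_mu)
    then show ?thesis using c[OF _ A(2)] glength_ht[OF e A] by simp
  qed
  then show ?thesis by blast
qed

lemma emeasure_ht_edge: "e \<in> E i \<Longrightarrow> emeasure lborel (ht ` e) = ennreal (hi i e - lo i e)"
  using lo_less_hi[of e i] by (simp add: ht_image)

lemma mu_halves:
  assumes "e' \<in> E' i"
  shows "opp S i e' = e' \<Longrightarrow> measure (\<mu> (Suc i)) e' = measure (\<mu> i) e'"
    "opp S i e' \<noteq> e' \<Longrightarrow> measure (\<mu> (Suc i)) (branch i b e') = measure (\<mu> i) e' / 2"
proof -
  have a: "if opp S i e' = e' then measure (\<mu> (Suc i)) e' = measure (\<mu> i) e'
        else measure (\<mu> (Suc i)) e' = measure (\<mu> i) e' / 2 \<and>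
             measure (\<mu> (Suc i)) (opp S i e') = measure (\<mu> i) e' / 2"
    by (rule system_measuresD(4)[OF assms])
  show "opp S i e' = e' \<Longrightarrow> measure (\<mu> (Suc i)) e' = measure (\<mu> i) e'"
    "opp S i e' \<noteq> e' \<Longrightarrow> measure (\<mu> (Suc i)) (branch i b e') = measure (\<mu> i) e' / 2"
    using a by (auto simp: branch_def)
qed

text \<open>On an edge of positive mass the measure is a nonzero multiple of length, so each subedge
  has positive mass, and a branch over it keeps all or half of that.\<close>

lemma mu_edge_pos: "e \<in> E i \<Longrightarrow> measure (\<mu> i) e > 0"
proof (induction i arbitrary: e)
  case 0
  interpret prob_space "\<mu> 0" by (rule mu_prob)
  have "e \<in> sets (\<mu> 0)" using edge_X[OF 0] edge_borel[OF 0] by (simp add: in_sets_mu)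
  then have "emeasure (\<mu> 0) e = glength (gr S 0) e" by (rule system_measuresD(2))
  then have "ennreal (measure (\<mu> 0) e) = ennreal (elen (gr S 0) e)"
    using glength_edge[OF G 0] by (simp add: emeasure_eq_measure)
  then show ?case using elen_pos[OF G 0] by (metis ennreal_inj measure_nonneg order_less_imp_le)
next
  case (Suc i)
  interpret prob_space "\<mu> i" by (rule mu_prob)
  obtain e' where e': "e' \<in> E' i" "e = e' \<or> e = opp S i e'" by (rule E_Suc[OF Suc.prems])
  obtain e1 where e1: "e1 \<in> E i" "e' \<subseteq> e1" by (rule sub_parent[OF e'(1)])
  obtain c where c: "\<And>A. A \<in> sets borel \<Longrightarrow> A \<subseteq> e1 \<Longrightarrow> emeasure (\<mu> i) A = c * emeasure lborel (ht ` A)"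
    using mu_density_ennreal[OF e1(1)] by blast
  have "emeasure (\<mu> i) e1 \<noteq> 0" using Suc.IH[OF e1(1)] by (simp add: emeasure_eq_measure)
  then have "c \<noteq> 0" using c[OF edge_borel[OF e1(1)]] by auto
  moreover have "emeasure lborel (ht ` e') \<noteq> 0"
    using emeasure_ht_edge[OF sub_edge(1)[OF e'(1)]] lo_less_hi[OF sub_edge(1)[OF e'(1)]] by simp
  ultimately have "emeasure (\<mu> i) e' \<noteq> 0" using c[OF sub_edge_borel[OF e'(1)] e1(2)] by simp
  then have p: "measure (\<mu> i) e' > 0" using measure_nonneg[of "\<mu> i" e'] by (simp add: emeasure_eq_measure less_le)
  show ?case
  proof (cases "opp S i e' = e'")
    case True then show ?thesis using mu_halves(1)[OF e'(1)] p e'(2) by auto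
  next
    case False
    have "e = branch i (e \<noteq> e') e'" using e'(2) by (auto simp: branch_def)
    then show ?thesis using mu_halves(2)[OF e'(1) False, of "e \<noteq> e'"] p by simp
  qed
qed

text \<open>The positive mass of the edge excludes the factor 0, and its finiteness excludes an
  infinite factor.\<close>

lemma mu_density:
  assumes e: "e \<in> E i"
  obtains \<rho> where "\<rho> > 0" "\<And>A. A \<in> sets borel \<Longrightarrow> A \<subseteq> e \<Longrightarrow> measure (\<mu> i) A = \<rho> * measure lborel (ht ` A)"
proof -
  interpret prob_space "\<mu> i" by (rule mu_prob)
  obtain c where c: "\<And>A. A \<in> sets borel \<Longrightarrow> A \<subseteq> e \<Longrightarrow> emeasure (\<mu> i) A = c * emeasure lborel (ht ` A)"
    using mu_density_ennreal[OF e] by blast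
  have m: "ennreal (measure (\<mu> i) e) = c * ennreal (hi i e - lo i e)"
    using c[OF edge_borel[OF e]] emeasure_ht_edge[OF e] by (simp add: emeasure_eq_measure)
  have "c \<noteq> 0" using m mu_edge_pos[OF e] by auto
  moreover have "c \<noteq> \<top>"
  proof
    assume "c = \<top>"
    then have "ennreal (measure (\<mu> i) e) = \<top>" using m lo_less_hi[OF e] by (simp add: ennreal_top_mult)
    then show False by simp
  qed
  ultimately obtain \<rho> where \<rho>: "c = ennreal \<rho>" "\<rho> > 0" by (cases c) (auto simp: less_le)
  have "measure (\<mu> i) A = \<rho> * measure lborel (ht ` A)" if A: "A \<in> sets borel" "A \<subseteq> e" for A
    using c[OF A] \<rho> by (simp add: measure_def enn2real_mult)
  then show thesis using that \<rho>(2) by blast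
qed

lemma V_null: "V i \<in> null_sets (\<mu> i)"
proof -
  interpret prob_space "\<mu> i" by (rule mu_prob)
  have "{v} \<in> null_sets (\<mu> i)" if v: "v \<in> V i" for v
  proof -
    have vX: "v \<in> X i" using v V_X by blast
    obtain e where e: "e \<in> E i" "v \<in> e" using in_E[OF vX] by blast
    obtain \<rho> where \<rho>: "\<And>A. A \<in> sets borel \<Longrightarrow> A \<subseteq> e \<Longrightarrow> measure (\<mu> i) A = \<rho> * measure lborel (ht ` A)"
      using mu_density[OF e(1)] by blast
    have "measure (\<mu> i) {v} = 0" using \<rho>[of "{v}"] e(2) by simp
    then show ?thesis using vX by (intro null_setsI) (auto simp: in_sets_mu emeasure_eq_measure)
  qed
  then have "(\<Union>v\<in>V i. {v}) \<in> null_sets (\<mu> i)" by (intro null_sets_UN' countable_finite finite_V)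
  then show ?thesis by simp
qed

text \<open>The height of the random point is its uniform parameter, and only finitely many heights
  belong to vertices.\<close>

lemma AE_cur_nonvertex: "AE \<omega> in Omega. cur i \<omega> \<notin> V i"
proof -
  have "ht ` V i \<in> null_sets lborel" using finite_V by (intro finite_imp_null_set_lborel) auto
  then have "AE \<omega> in Omega. \<omega> 0 \<notin> ht ` V i" by (rule AE_coord_null)
  with AE_coord_01 show ?thesis
  proof eventually_elim
    case (elim \<omega>)
    have "ht (cur i \<omega>) = \<omega> 0" using elim(1) cl_id[of "\<omega> 0"] by (simp add: cur_def ht_curve)
    then show ?case using elim(2) by (metis imageI)
  qed
qed

text \<open>Distinct edges overlap in vertices only; removing this null set makes the decomposition
  into edges disjoint.\<close>

lemma measure_eqI_edges:
  assumes s: "sets M = sets (\<mu> i)" "sets N = sets (\<mu> i)" and nul: "V i \<in> null_sets M" "V i \<in> null_sets N"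
    and eq: "\<And>A e. A \<in> sets borel \<Longrightarrow> e \<in> E i \<Longrightarrow> A \<subseteq> e - V i \<Longrightarrow> emeasure M A = emeasure N A"
  shows "M = N"
proof (rule measure_eqI)
  show "sets M = sets N" using s by simp
  fix A assume A: "A \<in> sets M"
  let ?F = "\<lambda>e. A \<inter> e - V i"
  have Vb: "V i \<in> sets borel" using finite_V by (intro borel_closed finite_imp_closed)
  have Ab: "A \<in> sets borel" "A \<subseteq> X i" using A s in_sets_mu by auto
  have Fb: "?F e \<in> sets borel" if "e \<in> E i" for e using Ab(1) Vb edge_borel[OF that] by blast
  have F: "?F ` E i \<subseteq> sets M" "?F ` E i \<subseteq> sets N" using Fb Ab s by (auto simp: in_sets_mu)
  have dis: "disjoint_family_on ?F (E i)"
    unfolding disjoint_family_on_def using edge_eqI[OF G] by blast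
  have U: "A - V i = (\<Union>e\<in>E i. ?F e)" using Ab(2) X_E[of i] by auto
  have "emeasure M A = emeasure M (A - V i)" by (rule emeasure_Diff_null_set[OF nul(1) A, symmetric])
  also have "\<dots> = (\<Sum>e\<in>E i. emeasure M (?F e))" unfolding U by (rule sum_emeasure[OF F(1) dis finite_E, symmetric])
  also have "\<dots> = (\<Sum>e\<in>E i. emeasure N (?F e))" by (intro sum.cong refl eq) (auto intro: Fb)
  also have "\<dots> = emeasure N (A - V i)" unfolding U by (rule sum_emeasure[OF F(2) dis finite_E])
  also have "\<dots> = emeasure N A" by (rule emeasure_Diff_null_set[OF nul(2)]) (use A s in simp)
  finally show "emeasure M A = emeasure N A" .
qed

lemma cur_flip: "cur i (flip i \<omega>) = cur i \<omega>"
  unfolding cur_def bits_flip(3) by (rule curve_cong) (simp add: bits_flip)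

text \<open>Flipping the coin of stage \<open>i\<close> preserves the law and the value of
  \<open>cur i\<close> and exchanges the events for the two values of \<open>b\<close>.\<close>

lemma prob_cur_branch:
  assumes A: "A \<in> sets (\<mu> i)"
  shows "coins.P.prob {\<omega>. cur i \<omega> \<in> A \<and> (\<omega> (Suc i) = 1) = b} = coins.P.prob {\<omega>. cur i \<omega> \<in> A} / 2"
proof -
  let ?B = "\<lambda>b. {\<omega>. cur i \<omega> \<in> A \<and> (\<omega> (Suc i) = 1) = b}"
  have "{\<omega>. cur i \<omega> \<in> A} \<in> sets Omega"
    using measurable_sets[OF measurable_cur_mu A] by (simp add: vimage_def)
  moreover have "{\<omega>. (\<omega> (Suc i) = 1) = b} \<in> sets Omega" for b
    using measurable_coord[of "Suc i"] measurable_sets[of "\<lambda>\<omega>. (\<omega> (Suc i) = 1) = b" Omega "count_space UNIV" "{True}"]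
    by (simp add: vimage_def) 
  ultimately have m: "?B b \<in> sets Omega" for b
    using sets.Int[of "{\<omega>. cur i \<omega> \<in> A}" Omega "{\<omega>. (\<omega> (Suc i) = 1) = b}"] by (simp add: Int_def)
  have "{\<omega>. flip i \<omega> \<in> ?B b} = ?B (\<not> b)" for b using cur_flip by (auto simp: flip_def)
  then have eq: "coins.P.prob (?B (\<not> b)) = coins.P.prob (?B b)" using prob_flip[OF m[of b], of i] by simp
  have "{\<omega>. cur i \<omega> \<in> A} = ?B b \<union> ?B (\<not> b)" "?B b \<inter> ?B (\<not> b) = {}" by auto
  then have "coins.P.prob {\<omega>. cur i \<omega> \<in> A} = coins.P.prob (?B b) + coins.P.prob (?B (\<not> b))"
    using coins.P.finite_measure_Union[OF m m, of b "\<not> b"] by simp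
  then show ?thesis using eq by simp
qed

text \<open>Induction on the stage, one edge \<open>f\<close> at a time. The measures on
  \<open>f\<close> and on the subedge below it are multiples of length in the height coordinate, so
  their total masses determine the ratio of the densities: 1 over an interval, 1/2 over a circle.
  The random curve has the same ratio, since over a circle its branch is decided by a fair coin that
  does not affect \<open>cur i\<close>.\<close>

lemma distr_cur: "distr Omega (\<mu> i) (cur i) = \<mu> i"
proof (induction i)
  case 0
  show ?case
  proof (rule measure_eqI)
    fix A assume "A \<in> sets (distr Omega (\<mu> 0) (cur 0))"
    then have A: "A \<in> sets (\<mu> 0)" by simp
    then have Ab: "A \<in> sets borel" "A \<subseteq> X 0" by (auto simp: in_sets_mu)
    obtain e0 where e0: "E 0 = {e0}" "X 0 = e0" "lo 0 e0 = 0" "hi 0 e0 = 1" by (rule X0_edge)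
    have hA: "ht ` A \<in> sets borel" using ht_image_borel[of e0 0 A] Ab e0 by simp
    have "{t \<in> {0..1}. base t \<in> A} = ht ` A"
    proof (intro equalityI subsetI)
      fix t assume "t \<in> {t \<in> {0..1}. base t \<in> A}"
      then show "t \<in> ht ` A" using ht_base[of t] cl_id[of t] by force
    next
      fix t assume "t \<in> ht ` A"
      then obtain x where x: "x \<in> A" "t = ht x" by blast
      then show "t \<in> {t \<in> {0..1}. base t \<in> A}" using base_ht[of x] ht_01[of x] Ab(2) X_XI[of 0] by auto
    qed
    moreover have sub: "ht ` A \<subseteq> {0..1}" using ht_01 Ab(2) X_XI[of 0] by blast
    ultimately have iff: "base t \<in> A \<longleftrightarrow> t \<in> ht ` A" if "t \<in> {0..1}" for t using that by blast
    have "emeasure (distr Omega (\<mu> 0) (cur 0)) A = emeasure Omega {\<omega>. cur 0 \<omega> \<in> A}"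
      by (subst emeasure_distr[OF measurable_cur_mu A]) (simp add: vimage_def)
    also have "\<dots> = emeasure Omega {\<omega>\<in>space Omega. \<omega> 0 \<in> ht ` A}"
    proof (rule emeasure_eq_AE)
      show "AE \<omega> in Omega. \<omega> \<in> {\<omega>. cur 0 \<omega> \<in> A} \<longleftrightarrow> \<omega> \<in> {\<omega>\<in>space Omega. \<omega> 0 \<in> ht ` A}"
        using AE_coord_01 by eventually_elim (simp add: cur_def curve_0 iff)
      show "{\<omega>. cur 0 \<omega> \<in> A} \<in> sets Omega"
        using measurable_sets[OF measurable_cur_mu A] by (simp add: vimage_def)
      show "{\<omega>\<in>space Omega. \<omega> 0 \<in> ht ` A} \<in> sets Omega" using measurable_coord hA by measurable
    qed
    also have "\<dots> = emeasure (coins 0) (ht ` A)"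
      by (rule coins.emeasure_PiM_Collect_single) (use hA in auto)
    also have "\<dots> = emeasure lborel (ht ` A)"
      using hA sub by (simp add: coins_def emeasure_uniform_measure Int_absorb1 divide_ennreal_def)
    also have "\<dots> = glength (gr S 0) A" using glength_ht[of e0 0 A] Ab e0 by simp
    also have "\<dots> = emeasure (\<mu> 0) A" using system_measuresD(2)[OF A] by simp
    finally show "emeasure (distr Omega (\<mu> 0) (cur 0)) A = emeasure (\<mu> 0) A" .
  qed simp
next
  case (Suc i)
  interpret mi: prob_space "\<mu> i" by (rule mu_prob)
  interpret ms: prob_space "\<mu> (Suc i)" by (rule mu_prob)
  have IH: "coins.P.prob {\<omega>. cur i \<omega> \<in> A} = measure (\<mu> i) A" if A: "A \<in> sets (\<mu> i)" for A
    using measure_distr[OF measurable_cur_mu A] Suc by (simp add: vimage_def)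
  show ?case
  proof (rule measure_eqI_edges[of _ "Suc i"])
    show "V (Suc i) \<in> null_sets (distr Omega (\<mu> (Suc i)) (cur (Suc i)))"
      using AE_cur_nonvertex[of "Suc i"] V_null[of "Suc i"] measurable_sets[OF measurable_cur_mu, of "V (Suc i)" "Suc i"]
      by (auto simp: null_sets_distr_iff[OF measurable_cur_mu] vimage_def AE_iff_null null_setsD2)
    fix A f assume Ab: "A \<in> sets borel" and f: "f \<in> E (Suc i)" and Af: "A \<subseteq> f - V (Suc i)"
    obtain e' where e': "e' \<in> E' i" "f = e' \<or> f = opp S i e'" by (rule E_Suc[OF f])
    define b where "b = (f \<noteq> e')"
    have fb: "f = branch i b e'" using e'(2) by (auto simp: branch_def b_def)
    obtain e where e: "e \<in> E i" "e' \<subseteq> e" by (rule sub_parent[OF e'(1)])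
    define A' where "A' = bond S i ` A"
    have A'e: "A' \<subseteq> e'" using bond_branch_image[OF e'(1), of b] Af fb by (auto simp: A'_def)
    have AX: "A \<subseteq> X (Suc i)" using Af edge_X[OF f] by blast
    have htA: "ht ` A' = ht ` A"
      unfolding A'_def image_image using ht_bond AX by (intro image_cong) auto
    have A'eq: "A' = (lift i (\<lambda>_. b) -` A \<inter> X i) \<inter> e'"
    proof (intro equalityI subsetI)
      fix p assume "p \<in> A'"
      then obtain a where a: "a \<in> A" "p = bond S i a" by (auto simp: A'_def)
      have "lift i (\<lambda>_. b) p = a" using lift_eqI[OF e'(1), of a "\<lambda>_. b"] a Af fb by auto
      then show "p \<in> (lift i (\<lambda>_. b) -` A \<inter> X i) \<inter> e'" using a A'e \<open>p \<in> A'\<close> sub_edge_X[OF e'(1)] by auto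
    next
      fix p assume "p \<in> (lift i (\<lambda>_. b) -` A \<inter> X i) \<inter> e'"
      then show "p \<in> A'" using lift_branch(2)[OF e'(1), of p "\<lambda>_. b"] unfolding A'_def by (metis IntD1 IntD2 imageI vimageD)
    qed
    have "lift i (\<lambda>_. b) -` A \<inter> X i \<in> sets (XM i)"
      using measurable_sets[OF lift_measurable[of i "\<lambda>_. b"], of A] Ab AX
      by (simp add: space_restrict_space sets_restrict_space_iff closed_X)
    then have A'b: "A' \<in> sets borel" unfolding A'eq using sub_edge_borel[OF e'(1)] by (auto simp: sets_restrict_space_iff closed_X)
    have A'm: "A' \<in> sets (\<mu> i)" using A'b A'e sub_edge_X[OF e'(1)] by (auto simp: in_sets_mu)
    have Am: "A \<in> sets (\<mu> (Suc i))" using Ab AX by (simp add: in_sets_mu)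
    obtain \<rho> where \<rho>: "\<rho> > 0" "\<And>B. B \<in> sets borel \<Longrightarrow> B \<subseteq> e \<Longrightarrow> measure (\<mu> i) B = \<rho> * measure lborel (ht ` B)"
      using mu_density[OF e(1)] by blast
    obtain \<sigma> where \<sigma>: "\<And>B. B \<in> sets borel \<Longrightarrow> B \<subseteq> f \<Longrightarrow> measure (\<mu> (Suc i)) B = \<sigma> * measure lborel (ht ` B)"
      using mu_density[OF f] by blast
    define l where "l = measure lborel (ht ` e')"
    have l: "l > 0" unfolding l_def
      using emeasure_ht_edge[OF sub_edge(1)[OF e'(1)]] lo_less_hi[OF sub_edge(1)[OF e'(1)]] by (simp add: measure_def)
    have "ht ` f = ht ` e'" using ht_image[OF f] ht_image[OF sub_edge(1)[OF e'(1)]] opp_ht[OF e'(1)] e'(2) by auto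
    then have mf: "measure (\<mu> (Suc i)) f = \<sigma> * l" using \<sigma>[OF edge_borel[OF f]] by (simp add: l_def)
    have me: "measure (\<mu> i) e' = \<rho> * l" using \<rho>(2)[OF sub_edge_borel[OF e'(1)] e(2)] by (simp add: l_def)
    have mA: "measure (\<mu> (Suc i)) A = \<sigma> * measure lborel (ht ` A)" using \<sigma>[OF Ab] Af by blast
    have mA': "measure (\<mu> i) A' = \<rho> * measure lborel (ht ` A)" using \<rho>(2)[OF A'b] A'e e(2) htA by auto
    have "coins.P.prob {\<omega>. cur (Suc i) \<omega> \<in> A} = measure (\<mu> (Suc i)) A"
    proof (cases "opp S i e' = e'")
      case True
      then have fe: "f = e'" using e'(2) by simp
      have "\<sigma> * l = \<rho> * l" using mu_halves(1)[OF e'(1) True] mf me fe by metis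
      then have "\<sigma> = \<rho>" using l by simp
      have "cur (Suc i) \<omega> \<in> A \<longleftrightarrow> cur i \<omega> \<in> A'" for \<omega>
      proof
        assume "cur (Suc i) \<omega> \<in> A"
        moreover have "bond S i (cur (Suc i) \<omega>) = cur i \<omega>" using bond_lift[OF cur_X] by (simp add: cur_Suc)
        ultimately show "cur i \<omega> \<in> A'" unfolding A'_def by (metis imageI)
      next
        assume c: "cur i \<omega> \<in> A'"
        then obtain a where a: "a \<in> A" "cur i \<omega> = bond S i a" by (auto simp: A'_def)
        have "lift i \<xi> (bond S i a) = a" for \<xi>
          using lift_eqI[OF e'(1), of a \<xi>] a Af fe True by (auto simp: branch_def)
        then show "cur (Suc i) \<omega> \<in> A" using a by (simp add: cur_Suc)
      qed
      then show ?thesis using IH[OF A'm] mA mA' \<open>\<sigma> = \<rho>\<close> by simp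
    next
      case False
      have "\<sigma> * l = \<rho> * l / 2" using mu_halves(2)[OF e'(1) False, of b] mf me fb by simp
      then have "\<sigma> = \<rho> / 2" using l by simp
      have "cur (Suc i) \<omega> \<in> A \<longleftrightarrow> cur i \<omega> \<in> A' \<and> (\<omega> (Suc i) = 1) = b" for \<omega>
      proof
        assume c: "cur (Suc i) \<omega> \<in> A"
        define \<xi> :: "'m set \<Rightarrow> bool" where "\<xi> = (\<lambda>_. \<omega> (Suc i) = 1)"
        have cl: "cur (Suc i) \<omega> = lift i \<xi> (cur i \<omega>)" by (simp add: cur_Suc \<xi>_def)
        have "bond S i (cur (Suc i) \<omega>) = cur i \<omega>" using bond_lift[OF cur_X] by (simp add: cl)
        then have cA: "cur i \<omega> \<in> A'" using c unfolding A'_def by (metis imageI)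
        have in1: "cur (Suc i) \<omega> \<in> branch i (\<xi> e') e'" using lift_branch(1)[OF e'(1), of "cur i \<omega>" \<xi>] cA A'e cl by auto
        have "branch i (\<xi> e') e' = branch i b e'"
          using edge_eqI[OF G f branch_edge[OF e'(1)] _ in1] c Af fb by auto
        then show "cur i \<omega> \<in> A' \<and> (\<omega> (Suc i) = 1) = b" using cA False by (auto simp: \<xi>_def branch_def split: if_splits)
      next
        assume c: "cur i \<omega> \<in> A' \<and> (\<omega> (Suc i) = 1) = b"
        then have "lift i (\<lambda>_. b) (cur i \<omega>) \<in> A" using A'eq by blast
        then show "cur (Suc i) \<omega> \<in> A" using c by (auto simp: cur_Suc split: if_splits)
      qed
      then show ?thesis using prob_cur_branch[OF A'm, of b] IH[OF A'm] mA mA' \<open>\<sigma> = \<rho> / 2\<close> by simp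
    qed
    then show "emeasure (distr Omega (\<mu> (Suc i)) (cur (Suc i))) A = emeasure (\<mu> (Suc i)) A"
      by (subst emeasure_distr[OF measurable_cur_mu Am])
        (simp add: vimage_def coins.P.emeasure_eq_measure ms.emeasure_eq_measure)
  qed (use V_null in auto)
qed

lemma prob_cur: "A \<in> sets (\<mu> i) \<Longrightarrow> coins.P.prob {\<omega>. cur i \<omega> \<in> A} = measure (\<mu> i) A"
  using measure_distr[OF measurable_cur_mu, of A i] distr_cur[of i] by (simp add: vimage_def)


section \<open>Comparison of the law of the random point with the limit measure\<close>

lemma mesh_dec: "mesh (Suc i) \<le> mesh i"
proof -
  obtain e' where e': "e' \<in> E' i" using E'_ne by blast
  then show ?thesis using mesh_Suc[OF e'] elen_le_mesh[OF e'] elen_pos[OF H e'] by linarith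
qed

text \<open>So far only the laws of the projections agree. Both the random point and a point of the
  limit space are within \<open>4 * mesh n\<close> of their projections to stage \<open>n\<close>,
  so passing through that stage enlarges \<open>F\<close> to its neighbourhood of radius
  \<open>8 * mesh n\<close>; these neighbourhoods shrink to \<open>F\<close> because it is
  closed.\<close>

lemma nu_closed:
  assumes F: "closed F" "F \<subseteq> XI"
  shows "coins.P.prob {\<omega>. Gam \<omega> \<in> F} \<le> measure \<nu> F"
proof (cases "F = {}")
  case False
  interpret nu: prob_space \<nu> by (rule nu_prob)
  define W where "W = (\<lambda>n. XI \<inter> {x. infdist x F \<le> 8 * mesh n})"
  define U where "U = (\<lambda>n. X n \<inter> {x. infdist x F \<le> 4 * mesh n})"
  have cl: "closed {x. infdist x F \<le> c}" for c
    by (intro closed_Collect_le continuous_intros)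
  have Wm: "W n \<in> sets \<nu>" for n unfolding W_def in_sets_nu using closed_XI cl by auto
  have Um: "U n \<in> sets (\<mu> n)" for n unfolding U_def in_sets_mu using closed_X cl by auto
  have le: "coins.P.prob {\<omega>. Gam \<omega> \<in> F} \<le> measure \<nu> (W n)" for n
  proof -
    have "coins.P.prob {\<omega>. Gam \<omega> \<in> F} \<le> coins.P.prob {\<omega>. cur n \<omega> \<in> U n}"
    proof (rule coins.P.finite_measure_mono)
      show "{\<omega>. cur n \<omega> \<in> U n} \<in> sets Omega"
        using measurable_sets[OF measurable_cur_mu Um] by (simp add: vimage_def)
      show "{\<omega>. Gam \<omega> \<in> F} \<subseteq> {\<omega>. cur n \<omega> \<in> U n}"
      proof (intro subsetI CollectI)
        fix \<omega> assume "\<omega> \<in> {\<omega>. Gam \<omega> \<in> F}"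
        then have g: "Gam \<omega> \<in> F" by simp
        have "infdist (cur n \<omega>) F \<le> dist (cur n \<omega>) (Gam \<omega>)" by (rule infdist_le[OF g])
        also have "\<dots> \<le> 4 * mesh n" using dist_pi_mesh[OF Gam_XI, of \<omega> n] by (simp add: pi_Gam dist_commute)
        finally show "cur n \<omega> \<in> U n" by (simp add: U_def cur_X)
      qed
    qed
    also have "\<dots> = measure (\<mu> n) (U n)" by (rule prob_cur[OF Um])
    also have "\<dots> = measure \<nu> (\<pi> n -` U n \<inter> space \<nu>)"
      using measure_distr[OF measurable_pi Um] distr_pi by simp
    also have "\<dots> \<le> measure \<nu> (W n)"
    proof (rule nu.finite_measure_mono[OF _ Wm])
      show "\<pi> n -` U n \<inter> space \<nu> \<subseteq> W n"
      proof
        fix x assume "x \<in> \<pi> n -` U n \<inter> space \<nu>"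
        then have x: "x \<in> XI" "infdist (\<pi> n x) F \<le> 4 * mesh n" by (auto simp: U_def space_nu)
        have "infdist x F \<le> infdist (\<pi> n x) F + dist x (\<pi> n x)" by (rule infdist_triangle)
        then show "x \<in> W n" using x dist_pi_mesh[OF x(1), of n] by (simp add: W_def)
      qed
    qed
    finally show ?thesis .
  qed
  have dec: "decseq W"
    by (rule decseq_SucI) (use mesh_dec in \<open>auto simp: W_def intro: order_trans\<close>)
  have "(\<lambda>n. measure \<nu> (W n)) \<longlonglongrightarrow> measure \<nu> (\<Inter>n. W n)"
    by (rule nu.finite_Lim_measure_decseq[OF _ dec]) (use Wm in auto)
  moreover have "(\<Inter>n. W n) = F"
  proof (intro equalityI subsetI)
    fix x assume x: "x \<in> (\<Inter>n. W n)"
    have "(\<lambda>n. 8 * mesh n) \<longlonglongrightarrow> 8 * 0" by (intro tendsto_mult tendsto_const mesh_lim)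
    then have "infdist x F \<le> 8 * 0"
      by (rule LIMSEQ_le_const) (use x in \<open>auto simp: W_def\<close>)
    then have "infdist x F = 0" using infdist_nonneg[of x F] by simp
    then show "x \<in> F" using in_closed_iff_infdist_zero[OF F(1) False] by blast
  next
    fix x assume x: "x \<in> F"
    then have "infdist x F = 0" by simp
    then show "x \<in> (\<Inter>n. W n)" using x F(2) mesh_pos by (auto simp: W_def less_imp_le)
  qed
  ultimately have "(\<lambda>n. measure \<nu> (W n)) \<longlonglongrightarrow> measure \<nu> F" by simp
  then show ?thesis by (rule LIMSEQ_le_const) (use le in blast)
qed simp

text \<open>\<open>Gam\<close> is continuous on fair coin sequences, so the images of compact sets are closed; the sets of
  good points need not be shown measurable.\<close>

lemma AE_nu_transfer:
  assumes "AE \<omega> in Omega. Q (Gam \<omega>)"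
  shows "AE x in \<nu>. Q x"
proof -
  interpret nu: prob_space \<nu> by (rule nu_prob)
  have "AE \<omega> in Omega. Q (Gam \<omega>) \<and> \<omega> \<in> fair"
    using assms AE_coin unfolding fair_def by eventually_elim simp
  then obtain N where N: "{\<omega>\<in>space Omega. \<not> (Q (Gam \<omega>) \<and> \<omega> \<in> fair)} \<subseteq> N" "N \<in> null_sets Omega"
    by (rule AE_E) (rule that, assumption, rule null_setsI)
  define B where "B = - N"
  have Bm: "B \<in> sets borel" using N(2) by (auto simp: B_def sets_Omega[symmetric] null_sets_def intro: sets.compl_sets[of _ Omega, simplified, folded Compl_eq_Diff_UNIV])
  have B: "Q (Gam \<omega>)" "\<omega> \<in> fair" if "\<omega> \<in> B" for \<omega> using N(1) that by (auto simp: B_def)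
  have "emeasure Omega (space Omega - N) = emeasure Omega (space Omega)"
    by (rule emeasure_Diff_null_set[OF N(2) sets.top])
  then have B1: "emeasure Omega B = 1"
    using coins.P.emeasure_space_1 by (simp add: B_def Compl_eq_Diff_UNIV)
  have ex: "\<exists>K. K \<subseteq> B \<and> compact K \<and> coins.P.prob K > 1 - 1 / Suc n" for n
  proof -
    have "emeasure Omega B = (SUP K \<in> {K. K \<subseteq> B \<and> compact K}. emeasure Omega K)"
      by (rule inner_regular[OF sets_Omega _ Bm]) (simp add: coins.P.emeasure_space_1[simplified])
    then have "ennreal (1 - 1 / Suc n) < (SUP K \<in> {K. K \<subseteq> B \<and> compact K}. emeasure Omega K)"
      using B1 by (simp add: ennreal_less_one_iff)
    then obtain K where K: "K \<subseteq> B" "compact K" "ennreal (1 - 1 / Suc n) < emeasure Omega K"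
      by (auto simp: less_SUP_iff)
    then have "1 - 1 / Suc n < coins.P.prob K"
      by (simp add: coins.P.emeasure_eq_measure ennreal_less_iff)
    then show ?thesis using K by blast
  qed
  then obtain K where K: "\<And>n. K n \<subseteq> B" "\<And>n. compact (K n)" "\<And>n. coins.P.prob (K n) > 1 - 1 / Suc n"
    by metis
  have Kf: "K n \<subseteq> fair" for n using K(1) B by blast
  have cpt: "compact (Gam ` K n)" for n
    by (rule compact_continuous_image[OF continuous_on_subset[OF Gam_continuous Kf] K(2)])
  have GK: "closed (Gam ` K n)" "Gam ` K n \<subseteq> XI" for n
    using compact_imp_closed[OF cpt] Gam_XI by auto
  have GKm: "Gam ` K n \<in> sets \<nu>" for n using GK by (simp add: in_sets_nu)
  define U where "U = (\<Union>n. Gam ` K n)"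
  have Um: "U \<in> sets \<nu>" unfolding U_def using GKm by auto
  have "1 - 1 / Suc n \<le> nu.prob U" for n
  proof -
    have "{\<omega>. Gam \<omega> \<in> Gam ` K n} \<in> sets Omega"
      using measurable_sets[OF measurable_Gam, of "Gam ` K n"] GKm[of n] by (simp add: vimage_def sets_nu)
    then have "coins.P.prob (K n) \<le> coins.P.prob {\<omega>. Gam \<omega> \<in> Gam ` K n}"
      by (intro coins.P.finite_measure_mono) auto
    also have "\<dots> \<le> nu.prob (Gam ` K n)" by (rule nu_closed[OF GK])
    also have "\<dots> \<le> nu.prob U" by (intro nu.finite_measure_mono Um) (auto simp: U_def)
    finally show ?thesis using K(3)[of n] by simp
  qed
  moreover have "(\<lambda>n. 1 - 1 / real (Suc n)) \<longlonglongrightarrow> 1 - 0"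
    by (intro tendsto_diff tendsto_const LIMSEQ_Suc[OF lim_inverse_n'])
  ultimately have "1 - 0 \<le> nu.prob U" by (intro LIMSEQ_le_const2) auto
  then have "nu.prob U = 1" using nu.prob_le_1[of U] by simp
  then have "AE x in \<nu>. x \<in> U" by (rule nu.AE_prob_1)
  then show ?thesis
  proof eventually_elim
    case (elim x)
    then show ?case using K(1) B(1) unfolding U_def by blast
  qed
qed

text \<open>Needed for the uniqueness of the Lipschitz conditional expectation. On an edge through
  \<open>x\<close> the ball contains a height interval of positive length.\<close>

lemma mu_ball_pos:
  assumes x: "x \<in> X i" and r: "r > 0"
  shows "measure (\<mu> i) (X i \<inter> ball x r) > 0"
proof -
  interpret prob_space "\<mu> i" by (rule mu_prob)
  obtain e where e: "e \<in> E i" "x \<in> e" using in_E[OF x] by blast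
  obtain \<rho> where \<rho>: "\<rho> > 0" "\<And>A. A \<in> sets borel \<Longrightarrow> A \<subseteq> e \<Longrightarrow> measure (\<mu> i) A = \<rho> * measure lborel (ht ` A)"
    using mu_density[OF e(1)] by blast
  define A where "A = e \<inter> ball x r"
  have A: "A \<in> sets borel" "A \<subseteq> e" unfolding A_def using edge_borel[OF e(1)] by auto
  define a b where "a = max (lo i e) (ht x - r)" and "b = min (hi i e) (ht x + r)"
  have ab: "a < b" using ht_bounds[OF e] lo_less_hi[OF e(1)] r by (auto simp: a_def b_def)
  have sub: "{a<..<b} \<subseteq> ht ` A"
  proof
    fix s assume s: "s \<in> {a<..<b}"
    then obtain y where y: "y \<in> e" "ht y = s" using ht_onto[OF e(1), of s] by (auto simp: a_def b_def)
    have "dist x y < r" using dist_ht[OF e y(1)] y(2) s by (auto simp: a_def b_def)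
    then show "s \<in> ht ` A" using y by (auto simp: A_def)
  qed
  have bdd: "ht ` A \<subseteq> {lo i e..hi i e}" using ht_bounds[OF e(1)] A(2) by auto
  have "emeasure lborel (ht ` A) \<le> emeasure lborel {lo i e..hi i e}" by (rule emeasure_mono[OF bdd]) simp
  then have "emeasure lborel (ht ` A) \<noteq> \<infinity>" using lo_less_hi[OF e(1)] by (auto simp: top_unique)
  then have "measure lborel {a<..<b} \<le> measure lborel (ht ` A)"
    using ht_image_borel[OF e(1) A] sub by (intro measure_mono_fmeasurable) (auto simp: fmeasurable_def less_top)
  then have "measure lborel (ht ` A) > 0" using ab by simp
  then have "measure (\<mu> i) A > 0" using \<rho>(2)[OF A] \<rho>(1) by simp
  also have "measure (\<mu> i) A \<le> measure (\<mu> i) (X i \<inter> ball x r)"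
    using edge_X[OF e(1)] closed_X by (intro finite_measure_mono) (auto simp: A_def in_sets_mu)
  finally show ?thesis .
qed

lemma sum_mu_edges: "(\<Sum>e\<in>E i. measure (\<mu> i) e) \<le> 1"
proof -
  interpret prob_space "\<mu> i" by (rule mu_prob)
  have em: "e \<in> sets (\<mu> i)" if "e \<in> E i" for e using edge_borel[OF that] edge_X[OF that] by (simp add: in_sets_mu)
  have m: "(\<lambda>e. e - V i) ` E i \<subseteq> sets (\<mu> i)" using em V_null[of i] by auto
  have dis: "disjoint_family_on (\<lambda>e. e - V i) (E i)"
    unfolding disjoint_family_on_def using edge_eqI[OF G] by blast
  have "(\<Sum>e\<in>E i. measure (\<mu> i) e) = (\<Sum>e\<in>E i. measure (\<mu> i) (e - V i))"
    by (intro sum.cong refl measure_Diff_null_set[symmetric] V_null em)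
  also have "\<dots> = measure (\<mu> i) (\<Union>e\<in>E i. e - V i)"
    using finite_measure_finite_Union[OF finite_E m dis] by simp
  finally show ?thesis by simp
qed

section \<open>Almost every point is deep\<close>

definition term_union :: "nat \<Rightarrow> 'm set" where "term_union i = \<Union>{e'. terminal S i e'}"

lemma term_union_measurable: "term_union i \<in> sets (\<mu> i)"
proof -
  have sub: "{e'. terminal S i e'} \<subseteq> E' i" by (auto simp: terminal_def)
  then have "finite {e'. terminal S i e'}" using finite_E' by (rule finite_subset)
  moreover have "e' \<in> sets (\<mu> i)" if "terminal S i e'" for e'
  proof -
    have "e' \<in> E' i" using sub that by auto
    then show ?thesis using sub_edge_borel sub_edge_X by (simp add: in_sets_mu)
  qed
  ultimately have "finite {e'. terminal S i e'}" "\<And>e'. terminal S i e' \<Longrightarrow> e' \<in> sets (\<mu> i)" by auto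
  then show ?thesis unfolding term_union_def by (intro sets.finite_Union) auto
qed

text \<open>On each edge, terminal subedges stay within \<open>mesh i\<close> of the two ends, and
  \<open>mesh i\<close> is at most the fraction \<open>\<delta> i\<close> of the edge, on which the
  measure is uniform.\<close>

lemma mu_term_union: "measure (\<mu> i) (term_union i) \<le> 2 * \<delta> i"
proof -
  interpret prob_space "\<mu> i" by (rule mu_prob)
  define Z where "Z = (\<lambda>e. e \<inter> ht -` ({lo i e..lo i e + mesh i} \<union> {hi i e - mesh i..hi i e}))"
  have Zcl: "closed (Z e)" if e: "e \<in> E i" for e
    unfolding Z_def by (rule continuous_closed_preimage[OF continuous_on_subset[OF ht_cont]])
      (use edge_X[OF e] X_XI compact_imp_closed[OF edge_compact[OF G e]] in auto)
  have Zm: "Z e \<in> sets (\<mu> i)" "Z e \<in> sets borel" "Z e \<subseteq> e" if "e \<in> E i" for e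
    using Zcl[OF that] edge_X[OF that] by (auto simp: in_sets_mu Z_def)
  have "term_union i \<subseteq> (\<Union>e\<in>E i. Z e)"
  proof
    fix x assume "x \<in> term_union i"
    then obtain e' e where x: "x \<in> e'" "e' \<in> E' i" "e \<in> E i" "e' \<subseteq> e" "src (gr S i) e \<in> e' \<or> snk (gr S i) e \<in> e'"
      by (auto simp: term_union_def terminal_def)
    have d: "dist x y \<le> mesh i" if "y \<in> e'" for y
      using edge_dist[OF H x(2) x(1) that] ecoord_bounds[OF H x(2) x(1)] ecoord_bounds[OF H x(2) that]
        elen_le_mesh[OF x(2)] by auto
    have xe: "x \<in> e" using x by blast
    from x(5) have "x \<in> Z e"
    proof
      assume "src (gr S i) e \<in> e'"
      then show ?thesis using d dist_ht[OF x(3) xe] xe edge_ends[OF G x(3)] ht_bounds[OF x(3) xe]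
        by (fastforce simp: Z_def lo_def)
    next
      assume "snk (gr S i) e \<in> e'"
      then show ?thesis using d dist_ht[OF x(3) xe] xe edge_ends[OF G x(3)] ht_bounds[OF x(3) xe]
        by (fastforce simp: Z_def hi_def)
    qed
    then show "x \<in> (\<Union>e\<in>E i. Z e)" using x(3) by blast
  qed
  then have "measure (\<mu> i) (term_union i) \<le> measure (\<mu> i) (\<Union>e\<in>E i. Z e)"
    using Zm finite_E by (intro finite_measure_mono) auto
  also have "\<dots> \<le> (\<Sum>e\<in>E i. measure (\<mu> i) (Z e))"
    using Zm by (intro finite_measure_subadditive_finite finite_E) auto
  also have "\<dots> \<le> (\<Sum>e\<in>E i. 2 * \<delta> i * measure (\<mu> i) e)"
  proof (rule sum_mono)
    fix e assume e: "e \<in> E i"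
    obtain \<rho> where \<rho>: "\<rho> > 0" "\<And>A. A \<in> sets borel \<Longrightarrow> A \<subseteq> e \<Longrightarrow> measure (\<mu> i) A = \<rho> * measure lborel (ht ` A)"
      using mu_density[OF e] by blast
    have "measure lborel (ht ` Z e) \<le> measure lborel ({lo i e..lo i e + mesh i} \<union> {hi i e - mesh i..hi i e})"
      using ht_image_borel[OF e Zm(2,3)[OF e]]
      by (intro measure_mono_fmeasurable fmeasurable.Un fmeasurable_cbox[of "_::real", simplified]) (auto simp: Z_def)
    also have "\<dots> \<le> measure lborel {lo i e..lo i e + mesh i} + measure lborel {hi i e - mesh i..hi i e}"
      by (rule measure_Un_le) auto
    also have "\<dots> = 2 * mesh i" using mesh_pos[of i] by simp
    also have "\<dots> \<le> 2 * (\<delta> i * (hi i e - lo i e))" using mesh_le[OF e] elen_ht[OF e] by simp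
    also have "hi i e - lo i e = measure lborel (ht ` e)" using lo_less_hi[OF e] by (simp add: ht_image[OF e])
    finally have "\<rho> * measure lborel (ht ` Z e) \<le> \<rho> * (2 * (\<delta> i * measure lborel (ht ` e)))"
      using \<rho>(1) by (intro mult_left_mono) auto
    then show "measure (\<mu> i) (Z e) \<le> 2 * \<delta> i * measure (\<mu> i) e"
      unfolding \<rho>(2)[OF Zm(2,3)[OF e]] \<rho>(2)[OF edge_borel[OF e] order_refl] by (simp add: algebra_simps)
  qed
  also have "\<dots> = 2 * \<delta> i * (\<Sum>e\<in>E i. measure (\<mu> i) e)" by (simp add: sum_distrib_left)
  also have "\<dots> \<le> 2 * \<delta> i * 1" using \<delta>_pos[of i] sum_mu_edges by (intro mult_left_mono) auto
  finally show ?thesis by simp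
qed

lemma preimage_iff: "x \<in> XI \<Longrightarrow> \<pi> (Suc i) x \<in> bond_preimage S i e' \<longleftrightarrow> \<pi> i x \<in> e'"
  unfolding bond_preimage_def using pi_in[of x "Suc i"] pi_step[of x i] by simp

text \<open>Borel-Cantelli with the summable bounds \<open>2 * \<delta> i\<close>.\<close>

lemma AE_deep: "AE x in \<nu>. x \<in> deep_points S \<pi>"
proof -
  interpret nu: prob_space \<nu> by (rule nu_prob)
  define A where "A = (\<lambda>i. \<pi> i -` term_union i \<inter> space \<nu>)"
  have Am: "A i \<in> sets \<nu>" for i unfolding A_def by (rule measurable_sets[OF measurable_pi term_union_measurable])
  have "measure \<nu> (A i) \<le> 2 * \<delta> i" for i
  proof -
    have "measure (distr \<nu> (\<mu> i) (\<pi> i)) (term_union i) = measure \<nu> (A i)"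
      unfolding A_def by (rule measure_distr[OF measurable_pi term_union_measurable])
    then show ?thesis using mu_term_union[of i] by (simp add: distr_pi)
  qed
  then have "summable (\<lambda>i. measure \<nu> (A i))"
    by (intro summable_comparison_test[OF _ summable_mult[OF \<delta>_sum, of 2]]) auto
  then have "AE x in \<nu>. \<forall>\<^sub>F i in sequentially. x \<in> space \<nu> - A i"
    by (intro borel_cantelli_AE1 Am) (simp_all add: nu.emeasure_eq_measure)
  with AE_space show ?thesis
  proof eventually_elim
    case (elim x)
    then have x: "x \<in> XI" by (simp add: space_nu)
    have "\<forall>\<^sub>F i in sequentially. \<forall>e'. terminal S i e' \<longrightarrow> \<pi> (Suc i) x \<notin> bond_preimage S i e'"
      using elim(2) by (rule eventually_mono) (auto simp: A_def term_union_def preimage_iff[OF x])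
    then show ?case using x by (simp add: deep_points_def)
  qed
qed

end

section \<open>Conditional expectations of Lipschitz functions\<close>

lemma (in prob_space) bint_cong:
  fixes F G :: "'a \<Rightarrow> 'b::banach"
  assumes "unif_approx M F" "unif_approx M G" "\<And>x. x \<in> space M \<Longrightarrow> F x = G x"
  shows "bint M F = bint M G"
  using bint_close[OF assms(1,2), of 0] assms(3) by simp

lemma (in prob_space) bint_indicator:
  fixes c :: "'b::banach"
  assumes A: "A \<in> sets M"
  shows "bint M (\<lambda>x. indicator A x *\<^sub>R c) = prob A *\<^sub>R c"
proof -
  let ?I = "sb_integral M"
  have s: "simple_function M (indicator A :: 'a \<Rightarrow> real)" by (rule simple_function_indicator[OF A])
  then have si: "sb_integrable M (indicator A :: 'a \<Rightarrow> real)"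
    by (rule simple_bochner_integrable_simple_function)
  have "ennreal (?I (indicator A :: 'a \<Rightarrow> real)) = (\<integral>\<^sup>+x. ennreal (indicator A x) \<partial>M)"
    by (rule simple_bochner_integral_eq_nn_integral[OF si]) simp
  also have "\<dots> = (\<integral>\<^sup>+x. indicator A x \<partial>M)" by (intro nn_integral_cong) (auto simp: indicator_def)
  also have "\<dots> = ennreal (prob A)" using A by (simp add: emeasure_eq_measure)
  finally have r: "?I (indicator A :: 'a \<Rightarrow> real) = prob A"
    by (subst (asm) ennreal_inj) (auto intro: simple_bochner_integral_nonneg)
  have lin: "linear (\<lambda>r. r *\<^sub>R c)" by (rule linearI) (auto simp: algebra_simps)
  have "?I (\<lambda>x. indicator A x *\<^sub>R c) = prob A *\<^sub>R c"
    using simple_bochner_integral_linear[OF lin si] r by simp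
  moreover have sc: "simple_function M (\<lambda>x. indicator A x *\<^sub>R c)"
    by (rule simple_function_compose1[OF s])
  obtain v where "bochner_has_integral M (\<lambda>x. indicator A x *\<^sub>R c) v" "(\<lambda>n::nat. ?I (\<lambda>x. indicator A x *\<^sub>R c)) \<longlonglongrightarrow> v"
    by (rule unif_approx_seq_integral[of "\<lambda>_ x. indicator A x *\<^sub>R c" "\<lambda>x. indicator A x *\<^sub>R c"]) (use sc in auto)
  ultimately show ?thesis using bint_eqI LIMSEQ_const_iff by metis
qed

lemma flip_same: "flip j \<omega> (Suc j) = (if \<omega> (Suc j) = 1 then 0 else 1)"
  by (simp add: flip_def)

context thick_measure
begin

lemma compact_XI: "compact XI"
proof -
  have "\<exists>k. finite k \<and> XI \<subseteq> (\<Union>x\<in>k. ball x e)" if e: "e > 0" for e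
  proof -
  have "(\<lambda>n. 4 * mesh n) \<longlonglongrightarrow> 4 * 0" by (intro tendsto_mult tendsto_const mesh_lim)
  then have "\<forall>\<^sub>F n in sequentially. 4 * mesh n < e / 2" by (rule order_tendstoD) (use e in simp)
  then obtain n where n: "4 * mesh n < e / 2" by (auto simp: eventually_sequentially)
  obtain k where k: "finite k" "X n \<subseteq> (\<Union>x\<in>k. ball x (e/2))"
    using points_compact[OF G, of n] e unfolding compact_eq_totally_bounded by (meson half_gt_zero)
  have "XI \<subseteq> (\<Union>x\<in>k. ball x e)"
  proof
    fix z assume z: "z \<in> XI"
    obtain x where x: "x \<in> k" "dist x (\<pi> n z) < e / 2" using k(2) pi_in[OF z, of n] by auto
    have "dist x z < e" using dist_triangle[of x z "\<pi> n z"] x(2) dist_pi_mesh[OF z, of n] n by (simp add: dist_commute)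
    then show "z \<in> (\<Union>x\<in>k. ball x e)" using x(1) by auto
  qed
  then show ?thesis using k(1) by blast
  qed
  then show ?thesis using closed_XI by (simp add: compact_eq_totally_bounded complete_eq_closed)
qed

text \<open>An edge parametrised by height is a section, and all lifts of sections are
  1-Lipschitz.\<close>

lemma lift_inf_dist:
  assumes e: "e \<in> E i" and p: "p \<in> e" and q: "q \<in> e"
  shows "dist (lift_inf \<xi> i p) (lift_inf \<xi> i q) \<le> \<bar>ht p - ht q\<bar>"
proof -
  define c where "c = inv_into e ht"
  have im: "ht ` e = {lo i e..hi i e}" by (rule ht_image[OF e])
  have c: "c s \<in> e" "ht (c s) = s" if "s \<in> {lo i e..hi i e}" for s
    using that unfolding c_def im[symmetric] by (auto intro: inv_into_into f_inv_into_f)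
  have "dist (c s) (c t) = dist s t" if "s \<in> {lo i e..hi i e}" "t \<in> {lo i e..hi i e}" for s t
    using dist_ht[OF e c(1)[OF that(1)] c(1)[OF that(2)]] c(2) that by (simp add: dist_real_def)
  then have "continuous_on {lo i e..hi i e} c" unfolding continuous_on_iff by metis
  then have sec: "ht_section i (lo i e) (hi i e) c" unfolding ht_section_def using c edge_X[OF e] by auto
  have h: "ht p \<in> {lo i e..hi i e}" "ht q \<in> {lo i e..hi i e}" using p q im by blast+
  have cp: "c (ht p) = p" "c (ht q) = q" using ht_inj[OF e c(1)] c(2) h p q by auto
  have le: "dist (lifts \<xi> i n p) (lifts \<xi> i n q) \<le> \<bar>ht p - ht q\<bar>" for n
    using section_lipschitz[OF section_lifts[OF sec, of n \<xi>] h] cp by simp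
  have X: "p \<in> X i" "q \<in> X i" using p q edge_X[OF e] by auto
  show ?thesis
    by (rule LIMSEQ_le_const2[OF tendsto_dist[OF lifts_lim[OF X(1)] lifts_lim[OF X(2)]]]) (use le in blast)
qed

lemma dist_lift_inf_mesh: "p \<in> X i \<Longrightarrow> dist (lift_inf \<xi> i p) p \<le> 4 * mesh i"
  using dist_pi_mesh[OF lift_inf_XI, of p i \<xi> i] pi_lift_inf_0[of p i \<xi>] by simp

text \<open>\<open>q\<close> is its own projection at all later stages, so
  \<open>dist_pi_other_edge\<close> gives \<open>4 * \<delta> i * dist p q\<close>, and
  \<open>\<delta> i < 1/2\<close>.\<close>

lemma dist_lift_inf_other:
  assumes e: "e \<in> E i" "p \<in> e" and q: "q \<in> X i" "q \<notin> e"
  shows "dist (lift_inf \<xi> i p) p \<le> 2 * dist p q"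
proof -
  have p: "p \<in> X i" using e edge_X by blast
  have qI: "q \<in> XI" using q(1) X_XI by blast
  obtain j where j: "j \<ge> i" "dist (lift_inf \<xi> i p) p \<le> 4 * \<delta> i * dist p (\<pi> j q)"
    by (rule dist_pi_other_edge[OF lift_inf_XI[OF p, of \<xi>] qI e(1)])
      (use e q p pi_id[OF q(1)] pi_lift_inf_0[OF p] in auto)
  have "\<pi> j q = q" using pi_id[of q j] q(1) X_mono[OF j(1)] by blast
  moreover have "4 * \<delta> i * dist p q \<le> 4 * (1/2) * dist p q"
    using \<delta>_half[of i] by (intro mult_right_mono) auto
  ultimately show ?thesis using j(2) by simp
qed

text \<open>Test with the indicator of a ball \<open>U\<close> around \<open>x\<close> on which
  \<open>g1 - g2\<close> stays within half the norm of its value \<open>d\<close> at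
  \<open>x\<close>. The integral of \<open>g1 - g2\<close> over \<open>U\<close> vanishes, yet
  differs from \<open>prob U\<close> times \<open>d\<close> by at most half the norm of that
  vector.\<close>

lemma cond_exp_unique:
  fixes g1 g2 :: "'m \<Rightarrow> 'b::banach"
  assumes c: "continuous_on (X i) g1" "continuous_on (X i) g2"
    and ce: "is_cond_exp \<nu> (\<mu> i) (\<pi> i) h g1" "is_cond_exp \<nu> (\<mu> i) (\<pi> i) h g2" and x: "x \<in> X i"
  shows "g1 x = g2 x"
proof (rule ccontr)
  assume "g1 x \<noteq> g2 x"
  interpret prob_space "\<mu> i" by (rule mu_prob)
  define d where "d = g1 x - g2 x"
  have d: "norm d > 0" using \<open>g1 x \<noteq> g2 x\<close> by (simp add: d_def)
  have cd: "continuous_on (X i) (\<lambda>y. g1 y - g2 y)" by (intro continuous_intros c)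
  obtain r where r: "r > 0" "\<And>y. y \<in> X i \<Longrightarrow> dist y x < r \<Longrightarrow> dist (g1 y - g2 y) (g1 x - g2 x) < norm d / 2"
    using cd x d unfolding continuous_on_iff by (metis half_gt_zero)
  define U where "U = X i \<inter> ball x r"
  have U: "U \<in> sets (\<mu> i)" unfolding U_def in_sets_mu using closed_X by auto
  have Up: "prob U > 0" unfolding U_def by (rule mu_ball_pos[OF x r(1)])
  let ?\<phi> = "indicator U :: 'm \<Rightarrow> real"
  have \<phi>: "?\<phi> \<in> borel_measurable (\<mu> i)" "bounded (?\<phi> ` space (\<mu> i))"
    using U by (auto simp: bounded_iff indicator_def intro!: exI[of _ 1])
  have ua: "unif_approx (\<mu> i) (\<lambda>y. ?\<phi> y *\<^sub>R g1 y)" "unif_approx (\<mu> i) (\<lambda>y. ?\<phi> y *\<^sub>R g2 y)" "unif_approx (\<mu> i) (\<lambda>y. ?\<phi> y *\<^sub>R d)"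
    by (intro unif_approx_scaleR \<phi> unif_approx_const unif_approx_continuous_on_compact[OF points_compact[OF G] _ sets_mu] c)+
  obtain v where v: "bochner_has_integral (\<mu> i) (\<lambda>y. ?\<phi> y *\<^sub>R g1 y) v" "bochner_has_integral \<nu> (\<lambda>y. ?\<phi> (\<pi> i y) *\<^sub>R h y) v"
    using ce(1) \<phi> unfolding is_cond_exp_def by blast
  obtain w where w: "bochner_has_integral (\<mu> i) (\<lambda>y. ?\<phi> y *\<^sub>R g2 y) w" "bochner_has_integral \<nu> (\<lambda>y. ?\<phi> (\<pi> i y) *\<^sub>R h y) w"
    using ce(2) \<phi> unfolding is_cond_exp_def by blast
  have "v = w" by (rule bochner_has_integral_unique[OF v(2) w(2)])
  then have z: "bint (\<mu> i) (\<lambda>y. ?\<phi> y *\<^sub>R g1 y - ?\<phi> y *\<^sub>R g2 y) = 0"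
    using bint_diff[OF ua(1,2)] bint_eqI[OF v(1)] bint_eqI[OF w(1)] by simp
  have ud: "unif_approx (\<mu> i) (\<lambda>y. (?\<phi> y *\<^sub>R g1 y - ?\<phi> y *\<^sub>R g2 y) - ?\<phi> y *\<^sub>R d)"
    by (intro unif_approx_diff ua)
  have "norm (bint (\<mu> i) (\<lambda>y. (?\<phi> y *\<^sub>R g1 y - ?\<phi> y *\<^sub>R g2 y) - ?\<phi> y *\<^sub>R d)) \<le> (\<integral>y. norm d / 2 * ?\<phi> y \<partial>\<mu> i)"
  proof (rule bint_norm_le[OF ud])
    show "integrable (\<mu> i) (\<lambda>y. norm d / 2 * ?\<phi> y)"
      using U by (intro Bochner_Integration.integrable_mult_right integrable_real_indicator) (auto simp: emeasure_eq_measure)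
    fix y assume "y \<in> space (\<mu> i)"
    show "norm ((?\<phi> y *\<^sub>R g1 y - ?\<phi> y *\<^sub>R g2 y) - ?\<phi> y *\<^sub>R d) \<le> norm d / 2 * ?\<phi> y"
      using r(2)[of y] by (auto simp: indicator_def U_def d_def dist_norm dist_commute intro: less_imp_le)
  qed
  also have "\<dots> = norm d / 2 * prob U" using U by simp
  finally have "norm (0 - prob U *\<^sub>R d) \<le> norm d / 2 * prob U"
    using bint_diff[OF unif_approx_diff[OF ua(1,2)] ua(3)] z bint_indicator[OF U, of d] by simp
  then show False using mult_pos_pos[OF d Up] by (simp add: mult.commute)
qed

end

section \<open>Averages of a Lipschitz function over random continuations\<close>

locale thick_lip = thick_measure S \<pi> \<delta> \<mu> \<nu>
  for S :: "'m::complete_space inv_system" and \<pi> \<delta> \<mu> \<nu> +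
  fixes f :: "'m \<Rightarrow> 'b::banach" and C :: real
  assumes lip: "C-lipschitz_on XI f"
begin

lemma C_nonneg: "C \<ge> 0" and f_dist: "x \<in> XI \<Longrightarrow> y \<in> XI \<Longrightarrow> norm (f x - f y) \<le> C * dist x y"
  using lipschitz_on_nonneg[OF lip] lipschitz_onD[OF lip] by (auto simp: dist_norm)

lemma f_cont: "continuous_on XI f"
  by (rule lipschitz_on_continuous_on[OF lip])

lemma f_unif_approx: "sets N = sets XIM \<Longrightarrow> unif_approx N f"
  by (rule unif_approx_continuous_on_compact[OF compact_XI f_cont])

lemma f_comp_unif_approx: "p \<in> measurable M XIM \<Longrightarrow> unif_approx M (\<lambda>x. f (p x))"
  by (rule unif_approx_comp[OF f_unif_approx]) auto

text \<open>A version of the conditional expectation defined at every point. All points share the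
  coins of \<open>\<omega>\<close>, so values at two points can be compared one coin sequence at a
  time.\<close>

definition ce :: "nat \<Rightarrow> 'm \<Rightarrow> 'b" where
  "ce i p = bint Omega (\<lambda>\<omega>. f (lift_inf (bits \<omega>) i p))"

lemma ce_unif_approx: "p \<in> X i \<Longrightarrow> unif_approx Omega (\<lambda>\<omega>. f (lift_inf (bits \<omega>) i p))"
  by (rule f_comp_unif_approx[OF measurable_lift_inf])

text \<open>Martingale property: a flip of the coin of stage \<open>i\<close> preserves the law and
  exchanges the two lifts of \<open>p\<close>, so twice the average at \<open>p\<close> is the sum
  of the averages at the lifts. The free \<open>b\<close> lets the first lift be the one that a
  given curve takes.\<close>

lemma ce_step:
  assumes p: "p \<in> X i"
  shows "ce i p = (1/2) *\<^sub>R (ce (Suc i) (lift i (\<lambda>_. b) p) + ce (Suc i) (lift i (\<lambda>_. \<not> b) p))"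
proof -
  let ?A = "\<lambda>b \<omega>. f (lift_inf (bits \<omega>) (Suc i) (lift i (\<lambda>_. b) p))"
  let ?F = "\<lambda>\<omega>. f (lift_inf (bits \<omega>) i p)"
  have q: "lift i (\<lambda>_. b) p \<in> X (Suc i)" for b by (rule lift_X[OF p])
  have F: "?F \<omega> = ?A (\<omega> (Suc i) = 1) \<omega>" for \<omega>
    using lift_inf_Suc[OF p, of "bits \<omega>"] by (simp add: bits_def)
  have fl: "lift_inf (bits (flip i \<omega>)) (Suc i) z = lift_inf (bits \<omega>) (Suc i) z" for \<omega> z
    by (rule lift_inf_cong) (simp add: bits_flip)
  have FT: "?F (flip i \<omega>) = ?A (\<omega> (Suc i) \<noteq> 1) \<omega>" for \<omega>
    unfolding F fl by (simp add: flip_def)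
  have "?F \<omega> + ?F (flip i \<omega>) = ?A b \<omega> + ?A (\<not> b) \<omega>" for \<omega>
    unfolding FT unfolding F by (cases b; cases "\<omega> (Suc i) = 1") (simp_all add: add.commute)
  then have sum: "(\<lambda>\<omega>. ?F \<omega> + ?F (flip i \<omega>)) = (\<lambda>\<omega>. ?A b \<omega> + ?A (\<not> b) \<omega>)" by (rule ext)
  have "bint Omega (\<lambda>\<omega>. ?F (flip i \<omega>)) = bint Omega ?F"
    by (rule coins.P.bint_distr[OF measurable_flip distr_flip ce_unif_approx[OF p]])
  then have "bint Omega (\<lambda>\<omega>. ?F \<omega> + ?F (flip i \<omega>)) = ce i p + ce i p"
    using coins.P.bint_add[OF ce_unif_approx[OF p] unif_approx_comp[OF ce_unif_approx[OF p] measurable_flip]]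
    by (simp add: ce_def)
  moreover have "bint Omega (\<lambda>\<omega>. ?A b \<omega> + ?A (\<not> b) \<omega>) = ce (Suc i) (lift i (\<lambda>_. b) p) + ce (Suc i) (lift i (\<lambda>_. \<not> b) p)"
    using coins.P.bint_add[OF ce_unif_approx[OF q] ce_unif_approx[OF q]] by (simp add: ce_def)
  ultimately have "ce i p + ce i p = ce (Suc i) (lift i (\<lambda>_. b) p) + ce (Suc i) (lift i (\<lambda>_. \<not> b) p)"
    using sum by simp
  then show ?thesis by (metis scaleR_half_double)
qed

text \<open>Continuations in \<open>A\<close> obey the sharp bound \<open>a\<close>; the crude bound
  \<open>b\<close> counts only with the probability of the others.\<close>

lemma ce_diff_bound:
  assumes p: "p \<in> X i" and q: "q \<in> X i" and A: "A \<in> sets Omega"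
    and a: "\<And>\<omega>. \<omega> \<in> A \<Longrightarrow> norm (f (lift_inf (bits \<omega>) i p) - f (lift_inf (bits \<omega>) i q) - w) \<le> a" "0 \<le> a"
    and b: "\<And>\<omega>. norm (f (lift_inf (bits \<omega>) i p) - f (lift_inf (bits \<omega>) i q) - w) \<le> b"
  shows "norm (ce i p - ce i q - w) \<le> a + b * (1 - coins.P.prob A)"
proof -
  let ?F = "\<lambda>\<omega>. f (lift_inf (bits \<omega>) i p) - f (lift_inf (bits \<omega>) i q) - w"
  have "ce i p - ce i q - w = bint Omega ?F"
    unfolding ce_def
    using coins.P.bint_diff[OF unif_approx_diff[OF ce_unif_approx[OF p] ce_unif_approx[OF q]] unif_approx_const[of Omega w]]
      coins.P.bint_diff[OF ce_unif_approx[OF p] ce_unif_approx[OF q]] coins.P.bint_const[of w] by simp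
  also have "norm \<dots> \<le> (\<integral>\<omega>. a + b * indicator (- A) \<omega> \<partial>Omega)"
  proof (rule coins.P.bint_norm_le)
    show "unif_approx Omega ?F" by (intro unif_approx_diff ce_unif_approx p q unif_approx_const)
    have cA: "- A \<in> sets Omega" using sets.compl_sets[OF A] by (simp add: Compl_eq_Diff_UNIV)
    show "integrable Omega (\<lambda>\<omega>. a + b * indicator (- A) \<omega>)"
      using cA by (intro Bochner_Integration.integrable_add Bochner_Integration.integrable_mult_right integrable_real_indicator)
        (auto simp: coins.P.emeasure_eq_measure)
    fix \<omega>
    show "norm (?F \<omega>) \<le> a + b * indicator (- A) \<omega>"
      using a(1)[of \<omega>] b[of \<omega>] a(2) by (auto simp: indicator_def)
  qed
  also have "\<dots> = a + b * (1 - coins.P.prob A)"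
  proof -
    have cA: "- A \<in> sets Omega" using sets.compl_sets[OF A] by (simp add: Compl_eq_Diff_UNIV)
    have "coins.P.prob (- A) = 1 - coins.P.prob A"
      using coins.P.prob_compl[OF A] by (simp add: Compl_eq_Diff_UNIV)
    moreover have "(\<integral>\<omega>. a + b * indicator (- A) \<omega> \<partial>Omega) = a + b * coins.P.prob (- A)"
    proof -
      have i: "integrable Omega (\<lambda>\<omega>. b * indicator (- A) \<omega> :: real)"
        using cA by (intro Bochner_Integration.integrable_mult_right integrable_real_indicator)
          (auto simp: coins.P.emeasure_eq_measure)
      have "(\<integral>\<omega>. a + b * indicator (- A) \<omega> \<partial>Omega) = (\<integral>\<omega>. a \<partial>Omega) + (\<integral>\<omega>. b * indicator (- A) \<omega> \<partial>Omega)"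
        by (rule Bochner_Integration.integral_add[OF _ i]) simp
      then show ?thesis using cA coins.P.prob_space by simp
    qed
    ultimately show ?thesis by simp
  qed
  finally show ?thesis .
qed

lemma ce_near:
  assumes p: "p \<in> X i" and d: "\<And>\<omega>. dist (lift_inf (bits \<omega>) i p) p \<le> d"
  shows "norm (ce i p - f p) \<le> C * d"
proof -
  have "norm (bint Omega (\<lambda>\<omega>. f (lift_inf (bits \<omega>) i p)) - bint Omega (\<lambda>_. f p)) \<le> C * d"
  proof (rule coins.P.bint_close[OF ce_unif_approx[OF p] unif_approx_const])
    fix \<omega>
    have "norm (f (lift_inf (bits \<omega>) i p) - f p) \<le> C * dist (lift_inf (bits \<omega>) i p) p"
      using f_dist[OF lift_inf_XI[OF p]] p X_XI by blast
    also have "\<dots> \<le> C * d" by (rule mult_left_mono[OF d C_nonneg])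
    finally show "norm (f (lift_inf (bits \<omega>) i p) - f p) \<le> C * d" .
  qed
  then show ?thesis by (simp add: ce_def coins.P.bint_const)
qed

lemma ce_dist_edge:
  assumes e: "e \<in> E i" "p \<in> e" "q \<in> e"
  shows "norm (ce i p - ce i q) \<le> C * \<bar>ht p - ht q\<bar>"
proof -
  have X: "p \<in> X i" "q \<in> X i" using e edge_X by auto
  show ?thesis unfolding ce_def
  proof (rule coins.P.bint_close[OF ce_unif_approx[OF X(1)] ce_unif_approx[OF X(2)]])
    fix \<omega>
    have "norm (f (lift_inf (bits \<omega>) i p) - f (lift_inf (bits \<omega>) i q)) \<le> C * dist (lift_inf (bits \<omega>) i p) (lift_inf (bits \<omega>) i q)"
      by (rule f_dist[OF lift_inf_XI[OF X(1)] lift_inf_XI[OF X(2)]])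
    also have "\<dots> \<le> C * \<bar>ht p - ht q\<bar>" by (rule mult_left_mono[OF lift_inf_dist[OF e] C_nonneg])
    finally show "norm (f (lift_inf (bits \<omega>) i p) - f (lift_inf (bits \<omega>) i q)) \<le> C * \<bar>ht p - ht q\<bar>" .
  qed
qed

text \<open>On a common edge the constant is \<open>C\<close>. Otherwise the averages are compared
  with \<open>f\<close>: continuations stay within twice the distance of the two points, which gives
  2 + 1 + 2 = 5.\<close>

lemma ce_lipschitz: "(5 * C)-lipschitz_on (X i) (ce i)"
proof (rule lipschitz_onI)
  show "0 \<le> 5 * C" using C_nonneg by simp
  fix p q assume p: "p \<in> X i" and q: "q \<in> X i"
  obtain e where e: "e \<in> E i" "p \<in> e" using in_E[OF p] by blast
  obtain e2 where e2: "e2 \<in> E i" "q \<in> e2" using in_E[OF q] by blast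
  have Cd: "0 \<le> C * dist p q" using C_nonneg by simp
  consider "q \<in> e" | "p \<in> e2" | "q \<notin> e" "p \<notin> e2" by blast
  then have "norm (ce i p - ce i q) \<le> 5 * (C * dist p q)"
  proof cases
    case 1
    then show ?thesis using ce_dist_edge[OF e 1] dist_ht[OF e 1] Cd by simp
  next
    case 2
    then show ?thesis using ce_dist_edge[OF e2(1) 2 e2(2)] dist_ht[OF e2(1) 2 e2(2)] Cd by simp
  next
    case 3
    have 1: "norm (ce i p - f p) \<le> C * (2 * dist p q)"
      by (rule ce_near[OF p dist_lift_inf_other[OF e q 3(1)]])
    have 2: "norm (ce i q - f q) \<le> C * (2 * dist q p)"
      by (rule ce_near[OF q dist_lift_inf_other[OF e2 p 3(2)]])
    have 3: "norm (f p - f q) \<le> C * dist p q"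
      using p q X_XI by (intro f_dist) auto
    have "ce i p - ce i q = (ce i p - f p) + (f p - f q) - (ce i q - f q)" by simp
    then have "norm (ce i p - ce i q) \<le> norm (ce i p - f p) + norm (f p - f q) + norm (ce i q - f q)"
      by (metis norm_triangle_le_diff norm_triangle_ineq add_mono order_refl)
    then show ?thesis using 1 2 3 by (simp add: dist_commute)
  qed
  then show "dist (ce i p) (ce i q) \<le> 5 * C * dist p q" by (simp add: dist_norm)
qed

text \<open>By \<open>ce_step\<close> the integrals of \<open>\<phi>\<close> against
  \<open>ce j\<close> are the same for all stages \<open>j \<ge> i\<close>. Since
  \<open>ce j\<close> composed with the projection converges uniformly to \<open>f\<close>, their
  common value is the integral over the limit space.\<close>

lemma ce_is_cond_exp: "is_cond_exp \<nu> (\<mu> i) (\<pi> i) f (ce i)"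
  unfolding is_cond_exp_def
proof (intro conjI allI impI)
  interpret nu: prob_space \<nu> by (rule nu_prob)
  have ce_ua: "unif_approx (\<mu> j) (ce j)" for j
    by (rule unif_approx_continuous_on_compact[OF points_compact[OF G] lipschitz_on_continuous_on[OF ce_lipschitz] sets_mu])
  interpret mi: prob_space "\<mu> i" by (rule mu_prob)
  show "\<exists>v. bochner_has_integral (\<mu> i) (ce i) v" using mi.has_bint[OF ce_ua] by blast
  fix \<phi> :: "'m \<Rightarrow> real" assume "\<phi> \<in> borel_measurable (\<mu> i) \<and> bounded (\<phi> ` space (\<mu> i))"
  then have \<phi>: "\<phi> \<in> borel_measurable (\<mu> i)" "bounded (\<phi> ` X i)" by (auto simp: space_mu)
  obtain K where K: "K > 0" "\<And>x. x \<in> X i \<Longrightarrow> \<bar>\<phi> x\<bar> \<le> K" using \<phi>(2) unfolding bounded_pos by auto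
  have pm: "\<pi> i \<in> measurable (\<mu> j) (\<mu> i)" for j
  proof -
    have "\<pi> i \<in> measurable (XM j) (XM i)"
      by (rule measurable_restrict_space2)
        (use pi_in[OF subsetD[OF X_XI]] in \<open>auto simp: space_restrict_space
          intro!: borel_measurable_continuous_on_restrict continuous_on_subset[OF pi_cont X_XI]\<close>)
    then show ?thesis by (simp cong: measurable_cong_sets add: sets_mu)
  qed
  define \<Phi> where "\<Phi> = (\<lambda>j z. \<phi> (\<pi> i z) *\<^sub>R ce j z)"
  have \<phi>j: "(\<lambda>z. \<phi> (\<pi> i z)) \<in> borel_measurable (\<mu> j)" "bounded ((\<lambda>z. \<phi> (\<pi> i z)) ` space (\<mu> j))" for j
    using measurable_compose[OF pm \<phi>(1)] \<phi>(2) pi_in[OF subsetD[OF X_XI]]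
    by (auto simp: space_mu intro: bounded_subset)
  have \<Phi>: "unif_approx (\<mu> j) (\<Phi> j)" for j
    unfolding \<Phi>_def by (rule unif_approx_scaleR[OF \<phi>j ce_ua])
  have \<Phi>cur: "unif_approx Omega (\<lambda>\<omega>. \<Phi> j (cur j \<omega>))" for j
    by (rule unif_approx_comp[OF \<Phi> measurable_cur_mu])
  have v: "bint Omega (\<lambda>\<omega>. \<Phi> j (cur j \<omega>)) = bint (\<mu> j) (\<Phi> j)" for j
    by (rule coins.P.bint_distr[OF measurable_cur_mu distr_cur \<Phi>])
  have vS: "bint (\<mu> (Suc j)) (\<Phi> (Suc j)) = bint (\<mu> j) (\<Phi> j)" if ij: "i \<le> j" for j
  proof -
    let ?F = "\<lambda>j \<omega>. \<Phi> j (cur j \<omega>)"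
    have pc: "\<pi> i (cur (Suc j) \<omega>) = \<pi> i (cur j \<omega>)" for \<omega>
      using pi_pi[OF ij Gam_XI, of \<omega>] pi_pi[of i "Suc j", OF _ Gam_XI, of \<omega>] ij by (simp add: pi_Gam)
    have "?F j \<omega> = (1/2) *\<^sub>R (?F (Suc j) \<omega> + ?F (Suc j) (flip j \<omega>))" for \<omega>
    proof -
      have 1: "cur (Suc j) \<omega> = lift j (\<lambda>_. \<omega> (Suc j) = 1) (cur j \<omega>)"
        "cur (Suc j) (flip j \<omega>) = lift j (\<lambda>_. \<not> (\<omega> (Suc j) = 1)) (cur j \<omega>)"
        by (auto simp: cur_Suc cur_flip flip_same)
      have "ce j (cur j \<omega>) = (1/2) *\<^sub>R (ce (Suc j) (cur (Suc j) \<omega>) + ce (Suc j) (cur (Suc j) (flip j \<omega>)))"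
        unfolding 1 by (rule ce_step[OF cur_X])
      then show ?thesis using pc[of \<omega>] pc[of "flip j \<omega>"] by (simp add: \<Phi>_def cur_flip algebra_simps)
    qed
    then have "(\<lambda>\<omega>. ?F j \<omega>) = (\<lambda>\<omega>. (1/2) *\<^sub>R (?F (Suc j) \<omega> + ?F (Suc j) (flip j \<omega>)))" by (rule ext)
    then have "bint Omega (?F j) = (1/2) *\<^sub>R (bint Omega (?F (Suc j)) + bint Omega (\<lambda>\<omega>. ?F (Suc j) (flip j \<omega>)))"
      using coins.P.bint_cmult[OF unif_approx_add[OF \<Phi>cur[of "Suc j"] unif_approx_comp[OF \<Phi>cur[of "Suc j"] measurable_flip[of j]]], of "1/2"]
        coins.P.bint_add[OF \<Phi>cur[of "Suc j"] unif_approx_comp[OF \<Phi>cur[of "Suc j"] measurable_flip[of j]]]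
      by simp
    also have "bint Omega (\<lambda>\<omega>. ?F (Suc j) (flip j \<omega>)) = bint Omega (?F (Suc j))"
      by (rule coins.P.bint_distr[OF measurable_flip distr_flip \<Phi>cur])
    finally show ?thesis unfolding v by (simp add: scaleR_half_double)
  qed
  have vi: "bint (\<mu> (i + n)) (\<Phi> (i + n)) = bint (\<mu> i) (\<Phi> i)" for n
    by (induction n) (use vS in auto)
  define h where "h = (\<lambda>x. \<phi> (\<pi> i x) *\<^sub>R f x)"
  have h: "unif_approx \<nu> h"
    unfolding h_def using measurable_compose[OF measurable_pi \<phi>(1)] \<phi>(2) pi_in
    by (intro unif_approx_scaleR f_unif_approx sets_nu) (auto simp: space_nu intro: bounded_subset)
  have close: "norm (bint \<nu> h - bint (\<mu> i) (\<Phi> i)) \<le> K * (C * (8 * mesh (i + n)))" for n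
  proof -
    have "bint \<nu> (\<lambda>x. \<Phi> (i + n) (\<pi> (i + n) x)) = bint (\<mu> i) (\<Phi> i)"
      using nu.bint_distr[OF measurable_pi distr_pi \<Phi>, of "i + n"] vi[of n] by simp
    moreover have "norm (bint \<nu> h - bint \<nu> (\<lambda>x. \<Phi> (i + n) (\<pi> (i + n) x))) \<le> K * (C * (8 * mesh (i + n)))"
    proof (rule nu.bint_close[OF h unif_approx_comp[OF \<Phi> measurable_pi]])
      fix x assume "x \<in> space \<nu>"
      then have x: "x \<in> XI" by (simp add: space_nu)
      let ?p = "\<pi> (i + n) x"
      have p: "?p \<in> X (i + n)" by (rule pi_in[OF x])
      have "norm (f x - f ?p) \<le> C * (4 * mesh (i + n))"
        using f_dist[OF x pi_XI[OF x]] mult_left_mono[OF dist_pi_mesh[OF x, of "i + n"] C_nonneg] by (rule order_trans)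
      moreover have "norm (ce (i + n) ?p - f ?p) \<le> C * (4 * mesh (i + n))"
        by (rule ce_near[OF p dist_lift_inf_mesh[OF p]])
      moreover have "norm (f x - ce (i + n) ?p) \<le> norm (f x - f ?p) + norm (ce (i + n) ?p - f ?p)"
        using norm_triangle_ineq4[of "f x - f ?p" "ce (i + n) ?p - f ?p"] by simp
      ultimately have 1: "norm (f x - ce (i + n) ?p) \<le> C * (8 * mesh (i + n))" by simp
      have "h x - \<Phi> (i + n) ?p = \<phi> (\<pi> i x) *\<^sub>R (f x - ce (i + n) ?p)"
        using pi_pi[of i "i + n" x] x by (simp add: h_def \<Phi>_def scaleR_diff_right)
      then have "norm (h x - \<Phi> (i + n) ?p) = \<bar>\<phi> (\<pi> i x)\<bar> * norm (f x - ce (i + n) ?p)" by simp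
      also have "\<dots> \<le> K * (C * (8 * mesh (i + n)))"
        using K 1 pi_in[OF x] by (intro mult_mono) auto
      finally show "norm (h x - \<Phi> (i + n) ?p) \<le> K * (C * (8 * mesh (i + n)))" .
    qed
    ultimately show ?thesis by simp
  qed
  have "(\<lambda>n. K * (C * (8 * mesh (n + i)))) \<longlonglongrightarrow> K * (C * (8 * 0))"
    by (intro tendsto_mult tendsto_const LIMSEQ_ignore_initial_segment[OF mesh_lim])
  then have "norm (bint \<nu> h - bint (\<mu> i) (\<Phi> i)) \<le> K * (C * (8 * 0))"
    by (rule LIMSEQ_le_const) (use close in \<open>auto simp: add.commute\<close>)
  then have eq: "bint \<nu> h = bint (\<mu> i) (\<Phi> i)" by simp
  have \<phi>ce: "unif_approx (\<mu> i) (\<lambda>x. \<phi> x *\<^sub>R ce i x)"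
    by (rule unif_approx_scaleR[OF \<phi>(1) _ ce_ua]) (use \<phi>(2) space_mu in simp)
  have "bint (\<mu> i) (\<lambda>x. \<phi> x *\<^sub>R ce i x) = bint (\<mu> i) (\<Phi> i)"
    by (rule mi.bint_cong[OF \<phi>ce \<Phi>]) (simp add: \<Phi>_def space_mu pi_id)
  then have "bochner_has_integral (\<mu> i) (\<lambda>x. \<phi> x *\<^sub>R ce i x) (bint \<nu> h)"
    using mi.has_bint[OF \<phi>ce] eq by simp
  moreover have "bochner_has_integral \<nu> (\<lambda>x. \<phi> (\<pi> i x) *\<^sub>R f x) (bint \<nu> h)"
    using nu.has_bint[OF h] by (simp add: h_def)
  ultimately show "\<exists>v. bochner_has_integral (\<mu> i) (\<lambda>x. \<phi> x *\<^sub>R ce i x) v \<and> bochner_has_integral \<nu> (\<lambda>x. \<phi> (\<pi> i x) *\<^sub>R f x) v"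
    by blast
qed

lemma lipschitz_cond_exp_eq: "p \<in> X i \<Longrightarrow> lipschitz_cond_exp S \<mu> \<pi> \<nu> i f p = ce i p"
proof -
  assume p: "p \<in> X i"
  let ?P = "\<lambda>g. (\<exists>C. C-lipschitz_on (X i) g) \<and> is_cond_exp \<nu> (\<mu> i) (\<pi> i) f g"
  have "?P (ce i)" using ce_lipschitz ce_is_cond_exp by blast
  then have "?P (lipschitz_cond_exp S \<mu> \<pi> \<nu> i f)" unfolding lipschitz_cond_exp_def by (rule someI[where P="?P"])
  then obtain C' where "C'-lipschitz_on (X i) (lipschitz_cond_exp S \<mu> \<pi> \<nu> i f)"
    "is_cond_exp \<nu> (\<mu> i) (\<pi> i) f (lipschitz_cond_exp S \<mu> \<pi> \<nu> i f)" by blast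
  then show ?thesis
    by (intro cond_exp_unique[OF _ _ _ ce_is_cond_exp p]) (auto intro: lipschitz_on_continuous_on ce_lipschitz)
qed

end

section \<open>Differentiability along the scales\<close>

lemma has_vector_derivative_bound:
  fixes g :: "real \<Rightarrow> 'b::real_normed_vector"
  assumes "(g has_vector_derivative b) (at t)" "e > 0"
  obtains d where "d > 0" "\<And>s. \<bar>s - t\<bar> < d \<Longrightarrow> norm (g s - g t - (s - t) *\<^sub>R b) \<le> e * \<bar>s - t\<bar>"
  using assms unfolding has_vector_derivative_def has_derivative_at_alt by (metis real_norm_def)

text \<open>The size of the neighbourhood \<open>d\<close> does not enter the bound, so it may
  depend on the stage in applications.\<close>

lemma vector_derivative_close:
  fixes g :: "real \<Rightarrow> 'b::real_normed_vector"
  assumes D: "(g has_vector_derivative b) (at t)" and d: "d > 0"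
    and q: "\<And>s. \<bar>s - t\<bar> < d \<Longrightarrow> norm (g s - g t - (s - t) *\<^sub>R q) \<le> K * \<bar>s - t\<bar>"
  shows "norm (b - q) \<le> K"
proof (rule field_le_epsilon)
  fix e :: real assume e: "e > 0"
  obtain d' where d': "d' > 0" "\<And>s. \<bar>s - t\<bar> < d' \<Longrightarrow> norm (g s - g t - (s - t) *\<^sub>R b) \<le> e * \<bar>s - t\<bar>"
    by (rule has_vector_derivative_bound[OF D e]) blast
  define h where "h = min d d' / 2"
  have h: "h > 0" "h < d" "h < d'" using d d'(1) by (auto simp: h_def)
  have "h *\<^sub>R (b - q) = (g (t + h) - g t - (t + h - t) *\<^sub>R q) - (g (t + h) - g t - (t + h - t) *\<^sub>R b)"
    by (simp add: algebra_simps)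
  then have "norm (h *\<^sub>R (b - q)) \<le> K * h + e * h"
    using q[of "t + h"] d'(2)[of "t + h"] h norm_triangle_ineq4[of "g (t + h) - g t - (t + h - t) *\<^sub>R q" "g (t + h) - g t - (t + h - t) *\<^sub>R b"]
    by simp
  moreover have "norm (h *\<^sub>R (b - q)) = h * norm (b - q)" using h by simp
  ultimately have "h * norm (b - q) \<le> h * (K + e)" by (simp only: distrib_left mult.commute)
  then show "norm (b - q) \<le> K + e" using h by simp
qed

lemma sets_Collect_less_imp_le:
  fixes u v :: "'a \<Rightarrow> real"
  assumes [measurable]: "u \<in> borel_measurable M" "v \<in> borel_measurable M"
  shows "{x\<in>space M. u x < c \<longrightarrow> v x \<le> d * u x} \<in> sets M"
  by measurable

lemma UNIV_Omega: "UNIV \<in> sets Omega"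
  using sets.top[of Omega] by simp

context thick_system
begin

lemma lift_inf_vert: assumes "v \<in> V' i" shows "lift_inf \<xi> i v = v"
proof -
  have vX: "v \<in> X i" using assms V'_X by blast
  have vV: "v \<in> V' (i + n)" for n
  proof (induction n)
    case (Suc n)
    then show ?case using V'_V[of "i + n"] V_sub[of "Suc (i + n)"] by auto
  qed (use assms in simp)
  have "lifts \<xi> i n v = v" for n by (induction n) (use vV lift_vert in auto)
  then show ?thesis using lifts_lim[OF vX, of \<xi>] LIMSEQ_unique[OF _ tendsto_const] by fastforce
qed

text \<open>Clamping bounds the parameter for every sequence, so that its multiples of a vector are
  uniformly approximable; on almost every sequence it changes nothing.\<close>

definition tau :: "(nat \<Rightarrow> real) \<Rightarrow> real" where "tau \<omega> = cl (\<omega> 0)"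

lemma Gam_tau: "Gam \<omega> = curve_inf (bits \<omega>) (tau \<omega>)"
  by (simp add: Gam_def tau_def curve_inf_def base_cl)

lemma tau_measurable: "tau \<in> borel_measurable Omega"
  unfolding tau_def[abs_def] cl_def by measurable

text \<open>The choice at stage \<open>j\<close> is coordinate \<open>Suc j\<close>, so
  \<open>mix (Suc i)\<close> keeps the parameter and the coins of all stages below \<open>i\<close>,
  which determine the curve up to stage \<open>i\<close>.\<close>

lemma lift_inf_mix: "lift_inf (bits \<omega>') i (curve (bits \<omega>) i s) = curve_inf (bits (mix (Suc i) \<omega> \<omega>')) s"
proof -
  have "curve (bits (mix (Suc i) \<omega> \<omega>')) i s = curve (bits \<omega>) i s"
    by (rule curve_cong) (simp add: bits_mix)
  then have "curve_inf (bits (mix (Suc i) \<omega> \<omega>')) s = lift_inf (bits (mix (Suc i) \<omega> \<omega>')) i (curve (bits \<omega>) i s)"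
    using curve_inf_lift[of "bits (mix (Suc i) \<omega> \<omega>')" s i] by simp
  also have "\<dots> = lift_inf (bits \<omega>') i (curve (bits \<omega>) i s)" by (rule lift_inf_cong) (simp add: bits_mix)
  finally show ?thesis by simp
qed

lemma tau_mix: "tau (mix (Suc i) \<omega> \<omega>') = tau \<omega>"
  by (simp add: tau_def mix_def)

end

section \<open>Difference quotients along random curves\<close>

context thick_lip
begin

text \<open>\<open>N\<close> is the scale and \<open>m\<close> the accuracy. With \<open>q\<close>
  in the countable set \<open>quots\<close>, differentiability at the parameter entails membership
  in a countable intersection of countable unions of these events, and the zero-one law applies to
  each of them.\<close>

definition quot_near :: "'b \<Rightarrow> nat \<Rightarrow> nat \<Rightarrow> (nat \<Rightarrow> real) set" where
  "quot_near q N m = {\<omega>. \<forall>s. \<bar>s - tau \<omega>\<bar> < 1 / Suc N \<longrightarrow>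
     norm (f (curve_inf (bits \<omega>) s) - f (Gam \<omega>) - (s - tau \<omega>) *\<^sub>R q) \<le> 1 / Suc m * \<bar>s - tau \<omega>\<bar>}"

lemma f_curve_dist: "norm (f (curve_inf \<xi> s) - f (curve_inf \<xi> t)) \<le> C * \<bar>s - t\<bar>"
  using order_trans[OF f_dist[OF curve_inf_XI curve_inf_XI] mult_left_mono[OF curve_inf_dist C_nonneg]] .

lemma f_curve_lipschitz: "C-lipschitz_on UNIV (\<lambda>s. f (curve_inf \<xi> s))"
  by (rule lipschitz_onI) (use f_curve_dist C_nonneg in \<open>auto simp: dist_norm\<close>)

text \<open>Both sides of the defining inequality are continuous in \<open>s\<close>, so the values
  of \<open>s\<close> violating it form an open set, which contains a rational if it is
  nonempty.\<close>

lemma quot_near_measurable: "quot_near q N m \<in> sets Omega"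
proof -
  define H where "H = (\<lambda>s \<omega>. norm (f (curve_inf (bits \<omega>) s) - f (Gam \<omega>) - (s - tau \<omega>) *\<^sub>R q))"
  define B where "B = (\<lambda>s. {\<omega>\<in>space Omega. \<bar>s - tau \<omega>\<bar> < 1 / Suc N \<longrightarrow> H s \<omega> \<le> 1 / Suc m * \<bar>s - tau \<omega>\<bar>})"
  have Hm: "H s \<in> borel_measurable Omega" for s
  proof -
    have b: "bounded ((\<lambda>\<omega>. s - tau \<omega>) ` space Omega)"
      unfolding bounded_iff using cl_01 by (intro exI[of _ "\<bar>s\<bar> + 1"]) (auto simp: tau_def, smt (verit) cl_01 atLeastAtMost_iff)
    have [measurable]: "tau \<in> borel_measurable Omega" by (rule tau_measurable)
    have "unif_approx Omega (\<lambda>\<omega>. f (curve_inf (bits \<omega>) s) - f (Gam \<omega>) - (s - tau \<omega>) *\<^sub>R q)"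
      by (intro unif_approx_diff unif_approx_scaleR unif_approx_const b f_comp_unif_approx measurable_Gam
          measurable_choice_curve_inf) measurable
    from unif_approx_measurable[OF this] show ?thesis unfolding H_def by simp
  qed
  have Bm: "B s \<in> sets Omega" for s
  proof -
    have "(\<lambda>\<omega>. \<bar>s - tau \<omega>\<bar>) \<in> borel_measurable Omega"
      by (intro borel_measurable_abs borel_measurable_diff tau_measurable) simp
    then show ?thesis unfolding B_def by (rule sets_Collect_less_imp_le[OF _ Hm])
  qed
  have "quot_near q N m = (\<Inter>s\<in>\<rat>. B s)"
  proof (intro equalityI subsetI)
    fix \<omega> assume w: "\<omega> \<in> (\<Inter>s\<in>\<rat>. B s)"
    show "\<omega> \<in> quot_near q N m"
    proof (rule ccontr)
      assume "\<omega> \<notin> quot_near q N m"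
      then obtain s where s: "\<bar>s - tau \<omega>\<bar> < 1 / Suc N" "1 / Suc m * \<bar>s - tau \<omega>\<bar> < H s \<omega>"
        by (auto simp: quot_near_def H_def not_le)
      define O' where "O' = {s. \<bar>s - tau \<omega>\<bar> < 1 / Suc N} \<inter> {s. 1 / Suc m * \<bar>s - tau \<omega>\<bar> < H s \<omega>}"
      have cH: "continuous_on UNIV (\<lambda>s. H s \<omega>)"
        unfolding H_def by (intro continuous_intros lipschitz_on_continuous_on[OF f_curve_lipschitz])
      have "open O'" unfolding O'_def by (intro open_Int open_Collect_less continuous_intros cH)
      moreover have "O' \<noteq> {}" using s by (auto simp: O'_def)
      ultimately have "O' \<inter> \<rat> \<noteq> {}" using open_Int_closure_eq_empty[of O' \<rat>] by (auto simp: Rats_closure_real)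
      then obtain r where "r \<in> \<rat>" "r \<in> O'" by blast
      then show False using w by (auto simp: O'_def B_def)
    qed
  qed (auto simp: quot_near_def B_def H_def)
  then show ?thesis using Bm by (simp add: sets.countable_INT' countable_rat Rats_def) 
qed

text \<open>Stands in for a countable dense subset of the target: it approximates all difference
  quotients at scales 1/k, and exists because the limit space is compact.\<close>

definition quots :: "'b set" where
  "quots = (SOME Q. countable Q \<and> (\<forall>x\<in>XI. \<forall>y\<in>XI. \<forall>k::nat. \<forall>\<epsilon>>0. \<exists>q\<in>Q. norm (real k *\<^sub>R (f x - f y) - q) < \<epsilon>))"

lemma quots: "countable quots"
  "x \<in> XI \<Longrightarrow> y \<in> XI \<Longrightarrow> \<epsilon> > 0 \<Longrightarrow> \<exists>q\<in>quots. norm (real k *\<^sub>R (f x - f y) - q) < \<epsilon>"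
proof -
  have "\<forall>n::nat. \<exists>k. finite k \<and> XI \<subseteq> (\<Union>x\<in>k. ball x (1 / Suc n)) \<and> k \<subseteq> XI"
    using seq_compact_imp_totally_bounded[OF compact_imp_seq_compact[OF compact_XI]] by (metis of_nat_0_less_iff zero_less_Suc zero_less_divide_1_iff)
  then obtain K where K: "\<And>n. finite (K n)" "\<And>n. XI \<subseteq> (\<Union>x\<in>K n. ball x (1 / Suc n))" "\<And>n. K n \<subseteq> XI" by metis
  define D where "D = (\<Union>n. K n)"
  have D: "countable D" unfolding D_def using K(1) by (intro countable_UN) (auto intro: countable_finite)
  define Q where "Q = (\<lambda>(k::nat, u, v). real k *\<^sub>R (f u - f v)) ` (UNIV \<times> D \<times> D)"
  have Q: "countable Q" unfolding Q_def using D by (intro countable_image countable_SIGMA) auto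
  have approx: "\<exists>q\<in>Q. norm (real k *\<^sub>R (f x - f y) - q) < \<epsilon>" if x: "x \<in> XI" and y: "y \<in> XI" and e: "\<epsilon> > 0" for x y k \<epsilon>
  proof -
    define c where "c = \<epsilon> / (2 * (real k + 1) * (C + 1))"
    have c: "c > 0" using e C_nonneg by (simp add: c_def)
    then obtain n where n: "1 / real (Suc n) < c" by (metis nat_approx_posE)
    have near: "\<exists>u\<in>K n. dist u z < 1 / Suc n" if "z \<in> XI" for z using K(2)[of n] that by (auto simp: subset_iff)
    obtain u where u: "u \<in> K n" "dist u x < 1 / Suc n" using near[OF x] by blast
    obtain v where v: "v \<in> K n" "dist v y < 1 / Suc n" using near[OF y] by blast
    have uv: "u \<in> XI" "v \<in> XI" using K(3) u v by auto
    have fu: "norm (f x - f u) \<le> C * c"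
      using order_trans[OF f_dist[OF x uv(1)] mult_left_mono[OF _ C_nonneg, of "dist x u" c]] u(2) n by (simp add: dist_commute)
    have fv: "norm (f y - f v) \<le> C * c"
      using order_trans[OF f_dist[OF y uv(2)] mult_left_mono[OF _ C_nonneg, of "dist y v" c]] v(2) n by (simp add: dist_commute)
    have "real k *\<^sub>R (f x - f y) - real k *\<^sub>R (f u - f v) = real k *\<^sub>R ((f x - f u) - (f y - f v))"
      by (simp add: algebra_simps)
    then have "norm (real k *\<^sub>R (f x - f y) - real k *\<^sub>R (f u - f v)) = k * norm ((f x - f u) - (f y - f v))" by simp
    also have "\<dots> \<le> k * (2 * (C * c))"
      using fu fv norm_triangle_ineq4[of "f x - f u" "f y - f v"] by (intro mult_left_mono) auto
    also have "\<dots> \<le> (real k + 1) * (2 * (C * c))" using C_nonneg c by (intro mult_right_mono) auto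
    also have "\<dots> < (real k + 1) * (2 * ((C + 1) * c))" using c by (intro mult_strict_left_mono) auto
    also have "\<dots> = c * (2 * (real k + 1) * (C + 1))" by (simp only: mult_ac)
    also have "\<dots> = \<epsilon>" using C_nonneg unfolding c_def by (intro nonzero_eq_divide_eq[THEN iffD1]) auto
    finally have "norm (real k *\<^sub>R (f x - f y) - real k *\<^sub>R (f u - f v)) < \<epsilon>" .
    moreover have "real k *\<^sub>R (f u - f v) \<in> Q" using u v by (auto simp: Q_def D_def intro!: image_eqI[of _ _ "(k, u, v)"])
    ultimately show ?thesis by blast
  qed
  have "countable Q \<and> (\<forall>x\<in>XI. \<forall>y\<in>XI. \<forall>k::nat. \<forall>\<epsilon>>0. \<exists>q\<in>Q. norm (real k *\<^sub>R (f x - f y) - q) < \<epsilon>)"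
    using Q approx by blast
  then have "countable quots \<and> (\<forall>x\<in>XI. \<forall>y\<in>XI. \<forall>k::nat. \<forall>\<epsilon>>0. \<exists>q\<in>quots. norm (real k *\<^sub>R (f x - f y) - q) < \<epsilon>)"
    unfolding quots_def by (rule someI[where P="\<lambda>Q. countable Q \<and> (\<forall>x\<in>XI. \<forall>y\<in>XI. \<forall>k::nat. \<forall>\<epsilon>>0. \<exists>q\<in>Q. norm (real k *\<^sub>R (f x - f y) - q) < \<epsilon>)"])
  then show "countable quots" "x \<in> XI \<Longrightarrow> y \<in> XI \<Longrightarrow> \<epsilon> > 0 \<Longrightarrow> \<exists>q\<in>quots. norm (real k *\<^sub>R (f x - f y) - q) < \<epsilon>"
    by auto
qed

text \<open>The derivative is within \<epsilon> of a quotient at scale 1/(k+1), and that quotient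
  within \<epsilon> of some \<open>q\<close>. With the error \<epsilon> of the derivative itself
  this makes 3 \<epsilon>, and \<epsilon> is a quarter of the accuracy 1/(m+1).\<close>

lemma differentiable_quot_near:
  assumes d: "(\<lambda>s. f (curve_inf (bits \<omega>) s)) differentiable (at (\<omega> 0))" and w: "\<omega> 0 \<in> {0<..<1}"
  shows "\<exists>q\<in>quots. \<exists>N. \<omega> \<in> quot_near q N m"
proof -
  define g where "g = (\<lambda>s. f (curve_inf (bits \<omega>) s))"
  have t: "tau \<omega> = \<omega> 0" using w by (simp add: tau_def cl_id)
  obtain b where b: "(g has_vector_derivative b) (at (tau \<omega>))"
    using d unfolding g_def t by (metis vector_derivative_works)
  define \<epsilon> where "\<epsilon> = 1 / (4 * real (Suc m))"
  have e: "\<epsilon> > 0" by (simp add: \<epsilon>_def)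
  obtain d1 where d1: "d1 > 0" "\<And>s. \<bar>s - tau \<omega>\<bar> < d1 \<Longrightarrow> norm (g s - g (tau \<omega>) - (s - tau \<omega>) *\<^sub>R b) \<le> \<epsilon> * \<bar>s - tau \<omega>\<bar>"
    by (rule has_vector_derivative_bound[OF b e]) blast
  obtain k where k: "1 / real (Suc k) < d1" using d1(1) by (metis nat_approx_posE)
  let ?s = "tau \<omega> + 1 / real (Suc k)"
  have "norm (g ?s - g (tau \<omega>) - (1 / real (Suc k)) *\<^sub>R b) \<le> \<epsilon> * (1 / real (Suc k))" using d1(2)[of ?s] k by simp
  then have "real (Suc k) * norm (g ?s - g (tau \<omega>) - (1 / real (Suc k)) *\<^sub>R b) \<le> real (Suc k) * (\<epsilon> * (1 / real (Suc k)))"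
    by (intro mult_left_mono) auto
  moreover have "real (Suc k) *\<^sub>R (g ?s - g (tau \<omega>)) - b = real (Suc k) *\<^sub>R (g ?s - g (tau \<omega>) - (1 / real (Suc k)) *\<^sub>R b)"
    by (simp add: scaleR_diff_right del: of_nat_Suc)
  ultimately have kb: "norm (real (Suc k) *\<^sub>R (g ?s - g (tau \<omega>)) - b) \<le> \<epsilon>" by (simp del: of_nat_Suc)
  obtain q where q: "q \<in> quots" "norm (real (Suc k) *\<^sub>R (g ?s - g (tau \<omega>)) - q) < \<epsilon>"
    using quots(2)[OF curve_inf_XI curve_inf_XI e] unfolding g_def by blast
  have qb: "norm (b - q) \<le> 2 * \<epsilon>"
    using kb q(2) norm_triangle_ineq4[of "real (Suc k) *\<^sub>R (g ?s - g (tau \<omega>)) - q" "real (Suc k) *\<^sub>R (g ?s - g (tau \<omega>)) - b"] by simp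
  obtain N where N: "1 / real (Suc N) < d1" using d1(1) by (metis nat_approx_posE)
  have "\<omega> \<in> quot_near q N m"
    unfolding quot_near_def
  proof (intro CollectI allI impI)
    fix s assume s: "\<bar>s - tau \<omega>\<bar> < 1 / real (Suc N)"
    have "g s - g (tau \<omega>) - (s - tau \<omega>) *\<^sub>R q = (g s - g (tau \<omega>) - (s - tau \<omega>) *\<^sub>R b) + (s - tau \<omega>) *\<^sub>R (b - q)"
      by (simp add: algebra_simps)
    then have "norm (g s - g (tau \<omega>) - (s - tau \<omega>) *\<^sub>R q) \<le> norm (g s - g (tau \<omega>) - (s - tau \<omega>) *\<^sub>R b) + \<bar>s - tau \<omega>\<bar> * norm (b - q)"
      by (metis norm_scaleR norm_triangle_ineq)
    also have "\<dots> \<le> \<epsilon> * \<bar>s - tau \<omega>\<bar> + \<bar>s - tau \<omega>\<bar> * (2 * \<epsilon>)"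
      using d1(2)[of s] s N qb by (intro add_mono mult_left_mono) auto
    also have "\<dots> = 3 / 4 * (1 / real (Suc m) * \<bar>s - tau \<omega>\<bar>)"
    proof -
      have "1 / (4 * n) * x + x * (2 * (1 / (4 * n))) = 3 / 4 * (1 / n * x)" for n x :: real
        by (cases "n = 0") (auto simp: field_simps)
      then show ?thesis unfolding \<epsilon>_def .
    qed
    also have "\<dots> \<le> 1 / real (Suc m) * \<bar>s - tau \<omega>\<bar>" by (rule mult_left_le_one_le) auto
    finally show "norm (f (curve_inf (bits \<omega>) s) - f (Gam \<omega>) - (s - tau \<omega>) *\<^sub>R q) \<le> 1 / real (Suc m) * \<bar>s - tau \<omega>\<bar>"
      by (simp add: g_def Gam_tau)
  qed
  then show ?thesis using q(1) by blast
qed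

text \<open>Fubini: \<open>mix 1\<close> takes the parameter from \<open>\<omega>\<close> and the
  coins from \<open>\<omega>'\<close>. For fixed coins, \<open>f\<close> along the curve is a
  Lipschitz function of the parameter, to which the Radon-Nikodym property applies. The event
  \<open>A\<close>, used in place of differentiability, is measurable since \<open>quots\<close> is
  countable.\<close>

lemma AE_quot_near:
  assumes rnp: "has_RNP TYPE('b)"
  shows "AE \<omega> in Omega. \<forall>m. \<exists>q\<in>quots. \<exists>N. \<omega> \<in> quot_near q N m"
proof -
  interpret PP: pair_prob_space Omega Omega ..
  define A where "A = (\<Inter>m. \<Union>q\<in>quots. \<Union>N. quot_near q N m)"
  have A: "A \<in> sets Omega" unfolding A_def using quots(1) quot_near_measurable UNIV_Omega by (intro sets.countable_INT'' sets.countable_UN') auto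
  have inner: "AE \<omega> in Omega. mix 1 \<omega> \<omega>' \<in> A" for \<omega>'
  proof -
    have m0: "mix 1 \<omega> \<omega>' 0 = \<omega> 0" for \<omega> by (simp add: mix_def)
    have bm: "bits (mix 1 \<omega> \<omega>') = bits \<omega>'" for \<omega> by (auto simp: bits_def mix_def fun_eq_iff)
    have "\<exists>C. C-lipschitz_on UNIV (\<lambda>s. f (curve_inf (bits \<omega>') s))" using f_curve_lipschitz by blast
    then have "AE t in lborel. (\<lambda>s. f (curve_inf (bits \<omega>') s)) differentiable (at t)"
      using rnp unfolding has_RNP_def by blast
    then have "AE \<omega> in Omega. (\<lambda>s. f (curve_inf (bits \<omega>') s)) differentiable (at (\<omega> 0))"
      by (intro AE_coins_0) auto
    with AE_coord_01 show ?thesis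
    proof eventually_elim
      case (elim \<omega>)
      have "\<exists>q\<in>quots. \<exists>N. mix 1 \<omega> \<omega>' \<in> quot_near q N m" for m
        by (rule differentiable_quot_near) (use elim in \<open>simp_all only: bm m0\<close>)
      then show ?case by (auto simp: A_def)
    qed
  qed
  have Qm: "{x\<in>space (Omega \<Otimes>\<^sub>M Omega). mix 1 (fst x) (snd x) \<in> A} \<in> sets (Omega \<Otimes>\<^sub>M Omega)"
    using measurable_sets[OF coins.measurable_mix A, of 1] by (simp add: vimage_def Int_def split_beta' conj_commute)
  have "AE \<omega>' in Omega. AE \<omega> in Omega. mix 1 \<omega> \<omega>' \<in> A" using inner by simp
  then have "AE \<omega> in Omega. AE \<omega>' in Omega. mix 1 \<omega> \<omega>' \<in> A"
    using PP.AE_commute[of "\<lambda>\<omega> \<omega>'. mix 1 \<omega> \<omega>' \<in> A"] Qm by simp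
  then have "AE x in Omega \<Otimes>\<^sub>M Omega. mix 1 (fst x) (snd x) \<in> A"
    by (intro PP.AE_pair_measure Qm) simp
  then have "AE x in Omega \<Otimes>\<^sub>M Omega. (\<lambda>(\<omega>, \<omega>'). mix 1 \<omega> \<omega>') x \<in> A" by (simp add: split_beta')
  then have "AE \<omega> in distr (Omega \<Otimes>\<^sub>M Omega) Omega (\<lambda>(\<omega>, \<omega>'). mix 1 \<omega> \<omega>'). \<omega> \<in> A"
    by (subst AE_distr_iff[OF coins.measurable_mix]) (use A in auto)
  then have "AE \<omega> in Omega. \<omega> \<in> A" by (simp only: coins.distr_mix)
  then show ?thesis by (simp add: A_def)
qed


section \<open>Convergence of the derivatives along good coin sequences\<close>

definition stage_prob :: "(nat \<Rightarrow> real) set \<Rightarrow> nat \<Rightarrow> (nat \<Rightarrow> real) \<Rightarrow> real" where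
  "stage_prob A i \<omega> = coins.P.prob {\<omega>'. mix i \<omega> \<omega>' \<in> A}"

text \<open>The last condition does not mention the curve: it is required for every edge whose
  height interval contains the parameter, which leaves countably many exceptional null sets of
  parameters.\<close>

definition good :: "(nat \<Rightarrow> real) \<Rightarrow> bool" where
  "good \<omega> \<longleftrightarrow> \<omega> 0 \<in> {0<..<1} \<and> (\<forall>i. cur i \<omega> \<notin> V i) \<and>
     (\<forall>m. \<exists>q N. \<omega> \<in> quot_near q N m \<and> (\<lambda>i. stage_prob (quot_near q N m) i \<omega>) \<longlonglongrightarrow> 1) \<and>
     (\<forall>i. \<forall>e\<in>E i. lo i e < \<omega> 0 \<and> \<omega> 0 < hi i e \<longrightarrow>
        (\<lambda>s. ce i (epoint (gr S i) e s)) differentiable (at (\<omega> 0 - lo i e)))"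

lemma ht_epoint: "e \<in> E i \<Longrightarrow> s \<in> {0..elen (gr S i) e} \<Longrightarrow> epoint (gr S i) e s \<in> e \<and> ht (epoint (gr S i) e s) = s + lo i e"
  using epoint_in[OF G, of e i s] ecoord_ht[of e i "epoint (gr S i) e s"] by simp

text \<open>Clamping the parameter extends the function on the edge to a Lipschitz function on the
  line, to which the Radon-Nikodym property applies; a translation by \<open>lo i e\<close> returns
  to the coordinate of the edge.\<close>

lemma AE_ce_differentiable:
  assumes rnp: "has_RNP TYPE('b)" and e: "e \<in> E i"
  shows "AE \<omega> in Omega. lo i e < \<omega> 0 \<and> \<omega> 0 < hi i e \<longrightarrow>
     (\<lambda>s. ce i (epoint (gr S i) e s)) differentiable (at (\<omega> 0 - lo i e))"
proof -
  define l where "l = elen (gr S i) e"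
  have l: "l > 0" "hi i e = lo i e + l" using elen_pos[OF G e] elen_ht[OF e] by (auto simp: l_def)
  define k where "k = (\<lambda>s. max 0 (min l (s - lo i e)))"
  define g where "g = (\<lambda>s. ce i (epoint (gr S i) e (k s)))"
  have k: "k s \<in> {0..elen (gr S i) e}" for s using l by (auto simp: k_def l_def)
  have kd: "\<bar>k s - k t\<bar> \<le> \<bar>s - t\<bar>" for s t by (auto simp: k_def)
  have "C-lipschitz_on UNIV g"
  proof (rule lipschitz_onI[OF _ C_nonneg])
    fix s t :: real
    have "norm (g s - g t) \<le> C * \<bar>k s - k t\<bar>"
      using ce_dist_edge[OF e, of "epoint (gr S i) e (k s)" "epoint (gr S i) e (k t)"] ht_epoint[OF e k] by (simp add: g_def)
    also have "\<dots> \<le> C * \<bar>s - t\<bar>" by (rule mult_left_mono[OF kd C_nonneg])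
    finally show "dist (g s) (g t) \<le> C * dist s t" by (simp add: dist_norm)
  qed
  then have "AE t in lborel. g differentiable (at t)" using rnp unfolding has_RNP_def by blast
  then have "AE \<omega> in Omega. g differentiable (at (\<omega> 0))" by (intro AE_coins_0) auto
  then show ?thesis
  proof eventually_elim
    case (elim \<omega>)
    show ?case
    proof
      assume w: "lo i e < \<omega> 0 \<and> \<omega> 0 < hi i e"
      let ?t = "\<omega> 0 - lo i e"
      have a: "((\<lambda>s. lo i e + s) has_vector_derivative 1) (at ?t)"
        by (rule derivative_eq_intros refl | simp)+
      obtain d where "(g has_vector_derivative d) (at (lo i e + ?t))" using elim by (auto simp: vector_derivative_works)
      then have "(g \<circ> (\<lambda>s. lo i e + s) has_vector_derivative 1 *\<^sub>R d) (at ?t)"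
        by (rule vector_diff_chain_at[OF a])
      then have "((\<lambda>s. ce i (epoint (gr S i) e s)) has_vector_derivative 1 *\<^sub>R d) (at ?t)"
        by (rule has_vector_derivative_transform_within_open[where S="{0<..<l}"])
          (use w l in \<open>auto simp: g_def k_def\<close>)
      then show "(\<lambda>s. ce i (epoint (gr S i) e s)) differentiable (at ?t)" by (rule differentiableI_vector)
    qed
  qed
qed

lemma AE_good:
  assumes rnp: "has_RNP TYPE('b)"
  shows "AE \<omega> in Omega. good \<omega>"
proof -
  have nv: "AE \<omega> in Omega. \<forall>i. cur i \<omega> \<notin> V i"
    by (subst AE_all_countable) (intro allI AE_cur_nonvertex)
  have df: "AE \<omega> in Omega. \<forall>i. \<forall>e\<in>E i. lo i e < \<omega> 0 \<and> \<omega> 0 < hi i e \<longrightarrow>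
     (\<lambda>s. ce i (epoint (gr S i) e s)) differentiable (at (\<omega> 0 - lo i e))"
    by (subst AE_all_countable, rule allI, rule AE_ball_countable')
      (use AE_ce_differentiable[OF rnp] countable_finite[OF finite_E] in auto)
  have lv: "AE \<omega> in Omega. \<forall>q\<in>quots. \<forall>N m. \<omega> \<in> quot_near q N m \<longrightarrow> (\<lambda>i. stage_prob (quot_near q N m) i \<omega>) \<longlonglongrightarrow> 1"
  proof (rule AE_ball_countable'[OF _ quots(1)])
    fix q
    show "AE \<omega> in Omega. \<forall>N m. \<omega> \<in> quot_near q N m \<longrightarrow> (\<lambda>i. stage_prob (quot_near q N m) i \<omega>) \<longlonglongrightarrow> 1"
      unfolding AE_all_countable stage_prob_def
      using coins.levy_zero_one[OF quot_near_measurable] by simp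
  qed
  show ?thesis
    using nv df lv AE_quot_near[OF rnp] AE_coord_01
  proof eventually_elim
    case (elim \<omega>)
    then show ?case unfolding good_def by blast
  qed
qed

definition dquot :: "nat \<Rightarrow> 'm \<Rightarrow> 'b" where
  "dquot i p = edge_derivative (gr S i) (lipschitz_cond_exp S \<mu> \<pi> \<nu> i f) p"

context
  fixes \<omega>
  assumes good: "good \<omega>"
begin

lemma good_01: "\<omega> 0 \<in> {0<..<1}" and good_nonvertex: "cur i \<omega> \<notin> V i"
  using good by (auto simp: good_def)

lemma good_tau: "tau \<omega> = \<omega> 0" and ht_cur: "ht (cur i \<omega>) = \<omega> 0"
  using good_01 by (auto simp: tau_def cl_id cur_def ht_curve)

lemma good_edge:
  assumes e: "e \<in> E i" "cur i \<omega> \<in> e"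
  shows "lo i e < \<omega> 0" "\<omega> 0 < hi i e" "containing_edge (gr S i) (cur i \<omega>) = e"
    "ecoord (gr S i) e (cur i \<omega>) = \<omega> 0 - lo i e"
  using ht_bounds[OF e] vert_iff_ht[OF e] good_nonvertex[of i] ht_cur[of i] containing_edge_eq[OF G e good_nonvertex] ecoord_ht[OF e]
  by auto

lemma curve_eq:
  assumes e: "e \<in> E i" "cur i \<omega> \<in> e" and y: "y \<in> e"
  shows "curve (bits \<omega>) i (ht y) = y"
proof (rule section_cover_eq[OF curve_section _ e(1) _ _ y])
  show "\<omega> 0 \<in> {0..1}" using good_01 by auto
  show "curve (bits \<omega>) i (\<omega> 0) \<in> e" "curve (bits \<omega>) i (\<omega> 0) \<notin> V i"
    using e(2) good_nonvertex[of i] by (auto simp: cur_def)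
  show "ht y \<in> {0..1}" by (rule ht_01[OF subsetD[OF X_XI subsetD[OF edge_X[OF e(1)] y]]])
qed

lemma dquot_has_derivative:
  assumes e: "e \<in> E i" "cur i \<omega> \<in> e"
  shows "((\<lambda>s. ce i (epoint (gr S i) e s)) has_vector_derivative dquot i (cur i \<omega>)) (at (\<omega> 0 - lo i e))"
proof -
  let ?t = "\<omega> 0 - lo i e"
  have "(\<lambda>s. ce i (epoint (gr S i) e s)) differentiable (at ?t)"
    using good e(1) good_edge(1,2)[OF e] unfolding good_def by blast
  then obtain d where d: "((\<lambda>s. ce i (epoint (gr S i) e s)) has_vector_derivative d) (at ?t)"
    by (auto simp: vector_derivative_works)
  have "((\<lambda>s. lipschitz_cond_exp S \<mu> \<pi> \<nu> i f (epoint (gr S i) e s)) has_vector_derivative d) (at ?t)"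
  proof (rule has_vector_derivative_transform_within_open[OF d, where S="{0<..<elen (gr S i) e}"])
    show "?t \<in> {0<..<elen (gr S i) e}" using good_edge(1,2)[OF e] elen_ht[OF e(1)] by simp
    fix s assume "s \<in> {0<..<elen (gr S i) e}"
    then have "epoint (gr S i) e s \<in> X i" using ht_epoint[OF e(1), of s] edge_X[OF e(1)] by auto
    then show "ce i (epoint (gr S i) e s) = lipschitz_cond_exp S \<mu> \<pi> \<nu> i f (epoint (gr S i) e s)"
      by (simp add: lipschitz_cond_exp_eq)
  qed simp
  then have "vector_derivative (\<lambda>s. lipschitz_cond_exp S \<mu> \<pi> \<nu> i f (epoint (gr S i) e s)) (at ?t) = d"
    by (rule vector_derivative_at)
  then have "dquot i (cur i \<omega>) = d"
    unfolding dquot_def edge_derivative_def Let_def good_edge(3)[OF e] good_edge(4)[OF e] .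
  then show ?thesis using d by simp
qed

text \<open>Increments of \<open>ce i\<close> along the edge are averages, over continuations, of
  increments of \<open>f\<close> along the curves of \<open>mix (Suc i) \<omega> \<omega>'\<close>.
  Continuations in the event deviate from slope \<open>q\<close> by at most 1/(m+1), the others by
  at most \<open>C + norm q\<close>, and the probability of the latter tends to 0.\<close>

lemma dquot_near:
  assumes w: "\<omega> \<in> quot_near q N m" and lim: "(\<lambda>i. stage_prob (quot_near q N m) i \<omega>) \<longlonglongrightarrow> 1"
  shows "\<forall>\<^sub>F i in sequentially. norm (dquot i (cur i \<omega>) - q) \<le> 2 / Suc m"
proof -
  let ?A = "quot_near q N m"
  have "(\<lambda>i. (C + norm q) * (1 - stage_prob ?A (Suc i) \<omega>)) \<longlonglongrightarrow> (C + norm q) * (1 - 1)"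
    by (intro tendsto_intros LIMSEQ_Suc[OF lim])
  then have "\<forall>\<^sub>F i in sequentially. (C + norm q) * (1 - stage_prob ?A (Suc i) \<omega>) < 1 / Suc m"
    by (rule order_tendstoD) simp
  then show ?thesis
  proof eventually_elim
    case (elim i)
    obtain e where e: "e \<in> E i" "cur i \<omega> \<in> e" using in_E[OF cur_X] by blast
    define B where "B = {\<omega>'. mix (Suc i) \<omega> \<omega>' \<in> ?A}"
    have B: "B \<in> sets Omega" unfolding B_def using coins.mix_section_sets[OF quot_near_measurable, of \<omega>] by simp
    have pB: "coins.P.prob B = stage_prob ?A (Suc i) \<omega>" by (simp add: B_def stage_prob_def)
    let ?t = "\<omega> 0 - lo i e"
    \<comment> \<open>The neighbourhood may shrink as \<open>i\<close> grows, because only the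
      derivative at one point is estimated.\<close>
    define r where "r = min (1 / Suc N) (min ?t (elen (gr S i) e - ?t))"
    have r: "r > 0" using good_edge(1,2)[OF e] elen_ht[OF e(1)] by (simp add: r_def)
    have pt: "epoint (gr S i) e ?t = cur i \<omega>"
      using epoint_ecoord[OF G e] good_edge(4)[OF e] by simp
    have bound: "norm (ce i (epoint (gr S i) e s) - ce i (epoint (gr S i) e ?t) - (s - ?t) *\<^sub>R q) \<le> 2 / Suc m * \<bar>s - ?t\<bar>"
      if s: "\<bar>s - ?t\<bar> < r" for s
    proof -
      define u where "u = lo i e + s"
      have us: "u - \<omega> 0 = s - ?t" by (simp add: u_def)
      have se: "s \<in> {0..elen (gr S i) e}" using s by (auto simp: r_def)
      have p: "epoint (gr S i) e s \<in> e" "ht (epoint (gr S i) e s) = u" using ht_epoint[OF e(1) se] by (auto simp: u_def)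
      have ps: "epoint (gr S i) e s = curve (bits \<omega>) i u" using curve_eq[OF e p(1)] p(2) by simp
      have p0: "cur i \<omega> = curve (bits \<omega>) i (\<omega> 0)" by (simp add: cur_def)
      have X: "epoint (gr S i) e s \<in> X i" using p(1) edge_X[OF e(1)] by blast
      have L: "lift_inf (bits \<omega>') i (epoint (gr S i) e s) = curve_inf (bits (mix (Suc i) \<omega> \<omega>')) u"
        "lift_inf (bits \<omega>') i (cur i \<omega>) = curve_inf (bits (mix (Suc i) \<omega> \<omega>')) (\<omega> 0)" for \<omega>'
        unfolding ps p0 by (rule lift_inf_mix)+
      have "norm (ce i (epoint (gr S i) e s) - ce i (cur i \<omega>) - (s - ?t) *\<^sub>R q)
          \<le> 1 / Suc m * \<bar>s - ?t\<bar> + (C + norm q) * \<bar>s - ?t\<bar> * (1 - coins.P.prob B)"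
      proof (rule ce_diff_bound[OF X cur_X B])
        fix \<omega>' assume "\<omega>' \<in> B"
        then have m: "mix (Suc i) \<omega> \<omega>' \<in> ?A" by (simp add: B_def)
        have G0: "Gam (mix (Suc i) \<omega> \<omega>') = curve_inf (bits (mix (Suc i) \<omega> \<omega>')) (\<omega> 0)"
          unfolding Gam_tau tau_mix good_tau ..
        show "norm (f (lift_inf (bits \<omega>') i (epoint (gr S i) e s)) - f (lift_inf (bits \<omega>') i (cur i \<omega>)) - (s - ?t) *\<^sub>R q)
            \<le> 1 / Suc m * \<bar>s - ?t\<bar>"
          using m[unfolded quot_near_def mem_Collect_eq tau_mix good_tau G0, rule_format, of u] s
          unfolding L us by (simp add: r_def)
      next
        fix \<omega>'
        have "norm (f (lift_inf (bits \<omega>') i (epoint (gr S i) e s)) - f (lift_inf (bits \<omega>') i (cur i \<omega>)) - (s - ?t) *\<^sub>R q)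
            \<le> norm (f (lift_inf (bits \<omega>') i (epoint (gr S i) e s)) - f (lift_inf (bits \<omega>') i (cur i \<omega>))) + norm ((s - ?t) *\<^sub>R q)"
          by (rule norm_triangle_ineq4)
        also have "\<dots> \<le> C * \<bar>s - ?t\<bar> + norm ((s - ?t) *\<^sub>R q)"
          unfolding L us[symmetric] by (intro add_right_mono f_curve_dist)
        finally show "norm (f (lift_inf (bits \<omega>') i (epoint (gr S i) e s)) - f (lift_inf (bits \<omega>') i (cur i \<omega>)) - (s - ?t) *\<^sub>R q)
            \<le> (C + norm q) * \<bar>s - ?t\<bar>" by (simp only: norm_scaleR distrib_right mult.commute)
      qed simp
      also have "\<dots> = \<bar>s - ?t\<bar> * (1 / Suc m + (C + norm q) * (1 - coins.P.prob B))" by (simp add: algebra_simps)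
      also have "\<dots> \<le> \<bar>s - ?t\<bar> * (1 / Suc m + 1 / Suc m)"
        using elim pB by (intro mult_left_mono) auto
      finally show ?thesis unfolding pt by (simp add: mult.commute)
    qed
    show ?case by (rule vector_derivative_close[OF dquot_has_derivative[OF e] r bound])
  qed
qed

text \<open>For every \<open>m\<close> the derivatives are eventually within 2/(m+1) of a fixed
  vector, hence form a Cauchy sequence; this is what gives the limit defining f' a meaning. The
  vectors are returned as well, since the zero-one law is available for them and not for
  \<open>b\<close>.\<close>

lemma dquot_limit:
  obtains b where "(\<lambda>i. dquot i (cur i \<omega>)) \<longlonglongrightarrow> b"
    "\<And>m. \<exists>q N. \<omega> \<in> quot_near q N m \<and> (\<lambda>i. stage_prob (quot_near q N m) i \<omega>) \<longlonglongrightarrow> 1 \<and> norm (b - q) \<le> 2 / Suc m"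
proof -
  let ?d = "\<lambda>i. dquot i (cur i \<omega>)"
  have ex: "\<exists>q N. \<omega> \<in> quot_near q N m \<and> (\<lambda>i. stage_prob (quot_near q N m) i \<omega>) \<longlonglongrightarrow> 1" for m
    using good unfolding good_def by blast
  have "Cauchy ?d"
  proof (rule metric_CauchyI)
    fix \<epsilon> :: real assume "\<epsilon> > 0"
    then obtain m where m: "1 / real (Suc m) < \<epsilon> / 4" by (metis nat_approx_posE divide_pos_pos zero_less_numeral)
    obtain q N where "\<omega> \<in> quot_near q N m" "(\<lambda>i. stage_prob (quot_near q N m) i \<omega>) \<longlonglongrightarrow> 1" using ex by blast
    from dquot_near[OF this] obtain M where M: "\<And>i. i \<ge> M \<Longrightarrow> norm (?d i - q) \<le> 2 / Suc m"
      by (auto simp: eventually_sequentially)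
    have M': "dist (?d i) q < \<epsilon> / 2" if "i \<ge> M" for i
    proof -
      have "2 / real (Suc m) = 2 * (1 / real (Suc m))" by simp
      then show ?thesis using M[OF that] m unfolding dist_norm by linarith
    qed
    show "\<exists>M. \<forall>i\<ge>M. \<forall>j\<ge>M. dist (?d i) (?d j) < \<epsilon>"
      using M' dist_triangle_half_l by blast
  qed
  then obtain b where b: "?d \<longlonglongrightarrow> b" by (metis Cauchy_convergent convergent_def)
  have "\<exists>q N. \<omega> \<in> quot_near q N m \<and> (\<lambda>i. stage_prob (quot_near q N m) i \<omega>) \<longlonglongrightarrow> 1 \<and> norm (b - q) \<le> 2 / Suc m" for m
  proof -
    obtain q N where qN: "\<omega> \<in> quot_near q N m" "(\<lambda>i. stage_prob (quot_near q N m) i \<omega>) \<longlonglongrightarrow> 1" using ex by blast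
    have "norm (b - q) \<le> 2 / Suc m"
    proof (rule tendsto_upperbound[OF tendsto_norm[OF tendsto_diff[OF b tendsto_const]] dquot_near[OF qN]])
    qed simp
    then show ?thesis using qN by blast
  qed
  with b show thesis by (rule that)
qed

end

end

lemma limsup_eq_0I:
  fixes u :: "nat \<Rightarrow> ereal"
  assumes "\<forall>\<^sub>F i in sequentially. 0 \<le> u i" "\<And>\<epsilon>. \<epsilon> > 0 \<Longrightarrow> \<forall>\<^sub>F i in sequentially. u i \<le> ereal \<epsilon>"
  shows "limsup u = 0"
proof (rule antisym)
  show "limsup u \<le> 0"
  proof (rule ereal_le_epsilon2)
    fix \<epsilon> :: real assume "\<epsilon> > 0"
    then show "limsup u \<le> 0 + ereal \<epsilon>" using Limsup_bounded[OF assms(2)] by simp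
  qed
  show "0 \<le> limsup u"
    using le_Limsup[OF sequentially_bot assms(1)] .
qed

lemma prob_coin: "coins.P.prob {\<omega>. (\<omega> (Suc i) = 1) = b} = 1/2"
proof -
  let ?B = "\<lambda>b. {\<omega>::nat\<Rightarrow>real. (\<omega> (Suc i) = 1) = b}"
  have m: "?B b \<in> sets Omega" for b
    using measurable_coord[of "Suc i"] measurable_sets[of "\<lambda>\<omega>. (\<omega> (Suc i) = 1) = b" Omega "count_space UNIV" "{True}"]
    by (simp add: vimage_def)
  have "{\<omega>. flip i \<omega> \<in> ?B b} = ?B (\<not> b)" by (auto simp: flip_def)
  then have eq: "coins.P.prob (?B (\<not> b)) = coins.P.prob (?B b)" using prob_flip[OF m[of b], of i] by simp
  have "UNIV = ?B b \<union> ?B (\<not> b)" "?B b \<inter> ?B (\<not> b) = {}" by auto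
  then have "coins.P.prob UNIV = coins.P.prob (?B b) + coins.P.prob (?B (\<not> b))"
    using coins.P.finite_measure_Union[OF m m, of b "\<not> b"] by simp
  then show ?thesis using eq coins.P.prob_space by simp
qed

section \<open>From increments along curves to increments over balls\<close>

context thick_lip
begin

context
  fixes \<omega>
  assumes good: "good \<omega>"
begin

lemma nonvertex_sub: "cur i \<omega> \<notin> V' i"
proof
  assume v: "cur i \<omega> \<in> V' i"
  have "cur (Suc i) \<omega> = cur i \<omega>" using v lift_vert by (simp add: cur_Suc)
  then show False using good_nonvertex[OF good, of "Suc i"] v V'_V[of i] by auto
qed

lemma scale_Suc:
  assumes e': "e' \<in> E' i" "cur i \<omega> \<in> e'"
  shows "scale S \<pi> (Suc i) (Gam \<omega>) = elen (sub S i) e'"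
proof -
  have "bond S i (cur (Suc i) \<omega>) = cur i \<omega>" using pi_step[OF Gam_XI, of i \<omega>] by (simp add: pi_Gam)
  then have "cur (Suc i) \<omega> \<in> e' \<or> cur (Suc i) \<omega> \<in> opp S i e'"
    using preimage_in[OF e'(1) cur_X] e'(2) by simp
  then show ?thesis
    using containing_edge_eq[OF G sub_edge(1)[OF e'(1)] _ good_nonvertex[OF good]]
      containing_edge_eq[OF G opp_edge(1)[OF e'(1)] _ good_nonvertex[OF good]]
      sub_edge(4)[OF e'(1)] opp_edge(4)[OF e'(1)]
    by (auto simp: scale_def pi_Gam)
qed

text \<open>A point \<open>y\<close> near \<open>Gam \<omega>\<close> lies close to the curve of a good coin sequence that agrees with
  \<open>\<omega>\<close> up to stage \<open>i\<close>; the increments along this curve and along that of \<open>\<omega>\<close> are compared at a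
  vertex through which both pass.\<close>

lemma increment_bound:
  assumes w: "\<omega> \<in> quot_near q N m" and half: "stage_prob (quot_near q N m) (Suc i) \<omega> > 1/2"
    and e': "e' \<in> E' i" "cur i \<omega> \<in> e'" "\<not> terminal S i e'"
    and R: "R \<ge> 1" "\<delta> i \<le> 1/32" "2 * R * \<delta> i < 1" "R * elen (sub S i) e' < 1 / Suc N"
    and y: "y \<in> XI" "dist (Gam \<omega>) y < R * elen (sub S i) e'"
  shows "norm (f y - f (Gam \<omega>) - (ht y - ht (Gam \<omega>)) *\<^sub>R q)
    \<le> (8 * C * \<delta> (Suc i) + (R + 2) / Suc m) * elen (sub S i) e'"
    and "\<bar>ht y - ht (Gam \<omega>)\<bar> \<le> R * elen (sub S i) e'"
proof -
  let ?A = "quot_near q N m" and ?r = "elen (sub S i) e'"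
  have r: "?r > 0" by (rule elen_pos[OF H e'(1)])
  obtain e where e: "e \<in> E i" "e' \<subseteq> e" by (rule sub_parent[OF e'(1)])
  have ce: "cur i \<omega> \<in> e" using e' e by blast
  have px: "\<pi> i (Gam \<omega>) \<in> e'" using e'(2) by (simp add: pi_Gam)
  have py: "\<pi> i y \<in> e"
  proof (rule ccontr)
    assume "\<pi> i y \<notin> e"
    then have "?r \<le> 2 * \<delta> i * dist (Gam \<omega>) y"
      by (rule localization[OF Gam_XI y(1) e(1) e'(1) e(2) e'(3) px _ R(2)])
    also have "\<dots> \<le> 2 * \<delta> i * (R * ?r)" using y(2) \<delta>_pos[of i] by (intro mult_left_mono) auto
    also have "\<dots> = (2 * R * \<delta> i) * ?r" by simp
    also have "\<dots> < 1 * ?r" using R(3) r by (rule mult_strict_right_mono)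
    finally show False by simp
  qed
  define s t where "s = ht y" and "t = ht (Gam \<omega>)"
  have t: "t = \<omega> 0" using ht_cur[OF good, of i] ht_pi[OF Gam_XI, of i \<omega>] by (simp add: t_def pi_Gam)
  have "\<bar>t - s\<bar> \<le> max ?r (dist (Gam \<omega>) y)"
    unfolding s_def t_def
    by (rule ht_dist_le[OF Gam_XI y(1) e(1) _ py e'(1) px]) (use ce nonvertex_sub[of i] in \<open>simp_all add: pi_Gam\<close>)
  also have "\<dots> \<le> R * ?r" using y(2) R(1) r by simp
  finally have st: "\<bar>s - t\<bar> \<le> R * ?r" by simp
  then show "\<bar>ht y - ht (Gam \<omega>)\<bar> \<le> R * ?r" by (simp add: s_def t_def)
  obtain c where c: "\<And>\<xi>. (\<And>e'. e' \<in> E' i \<Longrightarrow> \<pi> i y \<in> e' \<Longrightarrow> \<xi> e' = c) \<Longrightarrow> lift i \<xi> (\<pi> i y) = \<pi> (Suc i) y"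
    using lift_choice[OF pi_in[OF y(1), of "Suc i"]] pi_step[OF y(1), of i] by metis
  \<comment> \<open>The continuations with the wrong next coin have probability 1/2 altogether,
    which is too little to contain the event.\<close>
  obtain \<omega>' where \<omega>': "mix (Suc i) \<omega> \<omega>' \<in> ?A" "(\<omega>' (Suc i) = 1) = c"
  proof (rule ccontr)
    assume no: "\<not> thesis"
    define B where "B = {\<omega>'. mix (Suc i) \<omega> \<omega>' \<in> ?A}"
    have B: "B \<in> sets Omega" unfolding B_def using coins.mix_section_sets[OF quot_near_measurable, of \<omega>] by simp
    have "B \<subseteq> {\<omega>'. (\<omega>' (Suc i) = 1) = (\<not> c)}" using no that by (auto simp: B_def)
    \<comment> \<open>\<open>measure\<close> is 0 on nonmeasurable sets, so a set of measure 1/2 is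
      measurable.\<close>
    moreover have "{\<omega>'. (\<omega>' (Suc i) = 1) = (\<not> c)} \<in> sets Omega"
      using prob_coin[of i "\<not> c"] by (metis measure_notin_sets zero_neq_one divide_eq_0_iff zero_neq_numeral)
    ultimately have "coins.P.prob B \<le> 1/2" using coins.P.finite_measure_mono prob_coin by metis
    then show False using half by (simp add: B_def stage_prob_def)
  qed
  define \<eta> where "\<eta> = mix (Suc i) \<omega> \<omega>'"
  have eta_tau: "tau \<eta> = \<omega> 0" by (simp add: \<eta>_def tau_mix good_tau[OF good])
  have eta_curve: "curve (bits \<eta>) i z = curve (bits \<omega>) i z" for z
    by (rule curve_cong) (simp add: \<eta>_def bits_mix)
  have eta_i: "bits \<eta> i = (\<lambda>_. c)" using \<omega>'(2) by (simp add: \<eta>_def bits_mix) (simp add: bits_def)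
  have "curve (bits \<omega>) i s = \<pi> i y"
    using curve_eq[OF good e(1) ce py] ht_pi[OF y(1), of i] by (simp add: s_def)
  then have cy: "curve (bits \<eta>) (Suc i) s = \<pi> (Suc i) y"
    unfolding curve_Suc eta_curve eta_i by (simp add: c)
  have mesh: "mesh (Suc i) \<le> \<delta> (Suc i) * ?r"
    using mesh_le[OF sub_edge(1)[OF e'(1)]] sub_edge(4)[OF e'(1)] by simp
  \<comment> \<open>Both points have the same projection to stage \<open>Suc i\<close>, and each is
    within four times the mesh of it.\<close>
  have "dist y (curve_inf (bits \<eta>) s) \<le> 8 * mesh (Suc i)"
    using dist_pi_mesh[OF y(1), of "Suc i"] dist_curve_inf_mesh[of "bits \<eta>" s "Suc i"] cy
      dist_triangle[of y "curve_inf (bits \<eta>) s" "\<pi> (Suc i) y"] by (simp add: dist_commute)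
  then have "norm (f y - f (curve_inf (bits \<eta>) s)) \<le> C * (8 * (\<delta> (Suc i) * ?r))"
    using f_dist[OF y(1) curve_inf_XI, of "bits \<eta>" s] mult_left_mono[OF _ C_nonneg, of "dist y (curve_inf (bits \<eta>) s)" "8 * (\<delta> (Suc i) * ?r)"] mesh
    by linarith
  then have n1: "norm (f y - f (curve_inf (bits \<eta>) s)) \<le> 8 * C * \<delta> (Suc i) * ?r" by (simp add: mult_ac)
  \<comment> \<open>All later lifts fix the vertices of the subdivision, so the curves of
    \<open>\<omega>\<close> and \<open>\<eta>\<close> both pass through \<open>u\<close>.\<close>
  define u where "u = src (sub S i) e'"
  have u: "u \<in> e'" "u \<in> V' i" using edge_ends[OF H e'(1)] by (auto simp: u_def)
  have "\<bar>ht u - t\<bar> = dist u (cur i \<omega>)"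
    using dist_ht[OF e(1), of u "cur i \<omega>"] u e(2) ce ht_cur[OF good, of i] t by auto
  also have "\<dots> \<le> ?r" using ecoord_bounds[OF H e'(1,2)] by (simp add: ecoord_def u_def)
  finally have ut: "\<bar>ht u - t\<bar> \<le> ?r" .
  have "curve (bits \<omega>) i (ht u) = u" by (rule curve_eq[OF good e(1) ce]) (use u e(2) in auto)
  then have cu: "curve_inf (bits \<omega>) (ht u) = u" "curve_inf (bits \<eta>) (ht u) = u"
    using curve_inf_lift[of "bits \<omega>" "ht u" i] curve_inf_lift[of "bits \<eta>" "ht u" i] eta_curve lift_inf_vert[OF u(2)] by auto
  have near_eta: "norm (f (curve_inf (bits \<eta>) z) - f (Gam \<eta>) - (z - t) *\<^sub>R q) \<le> 1 / Suc m * \<bar>z - t\<bar>" if "\<bar>z - t\<bar> < 1 / Suc N" for z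
    using \<omega>'(1) that unfolding \<eta>_def[symmetric] quot_near_def mem_Collect_eq eta_tau t by blast
  have near_om: "norm (f (curve_inf (bits \<omega>) z) - f (Gam \<omega>) - (z - t) *\<^sub>R q) \<le> 1 / Suc m * \<bar>z - t\<bar>" if "\<bar>z - t\<bar> < 1 / Suc N" for z
    using w that unfolding quot_near_def mem_Collect_eq good_tau[OF good] t by blast
  have rR: "?r \<le> R * ?r" using R(1) r by simp
  have small: "\<bar>s - t\<bar> < 1 / Suc N" "\<bar>ht u - t\<bar> < 1 / Suc N" using st ut rR R(4) by linarith+
  have n2: "norm (f (curve_inf (bits \<eta>) s) - f (Gam \<eta>) - (s - t) *\<^sub>R q) \<le> 1 / Suc m * (R * ?r)"
    by (rule order_trans[OF near_eta[OF small(1)] mult_left_mono[OF st]]) simp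
  have n3: "norm (f u - f (Gam \<eta>) - (ht u - t) *\<^sub>R q) \<le> 1 / Suc m * ?r"
    using order_trans[OF near_eta[OF small(2)] mult_left_mono[OF ut]] cu by simp
  have n4: "norm (f u - f (Gam \<omega>) - (ht u - t) *\<^sub>R q) \<le> 1 / Suc m * ?r"
    using order_trans[OF near_om[OF small(2)] mult_left_mono[OF ut]] cu by simp
  let ?a = "f y - f (curve_inf (bits \<eta>) s)" and ?b = "f (curve_inf (bits \<eta>) s) - f (Gam \<eta>) - (s - t) *\<^sub>R q"
  let ?c = "f u - f (Gam \<eta>) - (ht u - t) *\<^sub>R q" and ?d = "f u - f (Gam \<omega>) - (ht u - t) *\<^sub>R q"
  \<comment> \<open>The base point changes from \<open>Gam \<eta>\<close> to
    \<open>Gam \<omega>\<close> by way of \<open>u\<close>: the terms in \<open>ht u - t\<close>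
    cancel in \<open>?c - ?d\<close>.\<close>
  have "f y - f (Gam \<omega>) - (s - t) *\<^sub>R q = (?a + ?b) - (?c - ?d)" by simp
  then have "norm (f y - f (Gam \<omega>) - (s - t) *\<^sub>R q) \<le> norm (?a + ?b) + norm (?c - ?d)"
    by (metis norm_triangle_ineq4)
  also have "\<dots> \<le> (norm ?a + norm ?b) + (norm ?c + norm ?d)"
    by (intro add_mono norm_triangle_ineq norm_triangle_ineq4)
  also have "\<dots> \<le> (8 * C * \<delta> (Suc i) * ?r + 1 / Suc m * (R * ?r)) + (1 / Suc m * ?r + 1 / Suc m * ?r)"
    by (intro add_mono n1 n2 n3 n4)
  also have "\<dots> = (8 * C * \<delta> (Suc i) + (R + 2) / Suc m) * ?r"
  proof -
    have "(a * x + 1 / n * (R * x)) + (1 / n * x + 1 / n * x) = (a + (R + 2) / n) * x" for a x n :: real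
      by (simp add: divide_inverse algebra_simps)
    then show ?thesis .
  qed
  finally show "norm (f y - f (Gam \<omega>) - (ht y - ht (Gam \<omega>)) *\<^sub>R q)
    \<le> (8 * C * \<delta> (Suc i) + (R + 2) / Suc m) * ?r" by (simp add: s_def t_def)
qed

lemma good_derivative:
  assumes deep: "Gam \<omega> \<in> deep_points S \<pi>" and \<delta>0: "\<delta> \<longlonglongrightarrow> 0"
  shows "has_derivative_along XI ht (\<lambda>i. scale S \<pi> i (Gam \<omega>)) f (lim (\<lambda>i. dquot i (\<pi> i (Gam \<omega>)))) (Gam \<omega>)"
proof -
  let ?x = "Gam \<omega>"
  obtain b where b: "(\<lambda>i. dquot i (cur i \<omega>)) \<longlonglongrightarrow> b"
    "\<And>m. \<exists>q N. \<omega> \<in> quot_near q N m \<and> (\<lambda>i. stage_prob (quot_near q N m) i \<omega>) \<longlonglongrightarrow> 1 \<and> norm (b - q) \<le> 2 / Suc m"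
    by (rule dquot_limit[OF good]) blast
  have lim: "lim (\<lambda>i. dquot i (\<pi> i ?x)) = b" using b(1) by (simp add: pi_Gam limI)
  define r where "r = (\<lambda>i. scale S \<pi> i ?x)"
  have r_pos: "r i > 0" for i
  proof -
    obtain e where e: "e \<in> E i" "cur i \<omega> \<in> e" using in_E[OF cur_X] by blast
    then show ?thesis using good_edge(3)[OF good e] elen_pos[OF G e(1)] by (simp add: r_def scale_def pi_Gam)
  qed
  have main: "\<forall>\<^sub>F i in sequentially. \<forall>y\<in>XI \<inter> ball ?x (R * r i). norm (f y - f ?x - (ht y - ht ?x) *\<^sub>R b) \<le> \<epsilon> * r i"
    if R: "R \<ge> 1" and eps: "\<epsilon> > 0" for R \<epsilon> :: real
  proof -
    \<comment> \<open>The increment bound costs (R+2)/(m+1) and the replacement of \<open>q\<close>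
      by \<open>b\<close> costs 2R/(m+1); together they get \<epsilon>/2. The other half is for the
      term in \<open>\<delta> (Suc i)\<close>.\<close>
    have "\<epsilon> / (2 * (3 * R + 2)) > 0" using R eps by simp
    then obtain m where m: "1 / real (Suc m) < \<epsilon> / (2 * (3 * R + 2))" by (metis nat_approx_posE)
    obtain q N where q: "\<omega> \<in> quot_near q N m" "(\<lambda>i. stage_prob (quot_near q N m) i \<omega>) \<longlonglongrightarrow> 1" "norm (b - q) \<le> 2 / Suc m"
      using b(2) by blast
    have e1: "\<forall>\<^sub>F i in sequentially. \<delta> i < 1/32" by (rule order_tendstoD(2)[OF \<delta>0]) simp
    have "(\<lambda>i. 2 * R * \<delta> i) \<longlonglongrightarrow> 2 * R * 0" by (intro tendsto_intros \<delta>0)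
    then have e2: "\<forall>\<^sub>F i in sequentially. 2 * R * \<delta> i < 1" by (rule order_tendstoD) simp
    have "(\<lambda>i. R * mesh i) \<longlonglongrightarrow> R * 0" by (intro tendsto_intros mesh_lim)
    then have e3: "\<forall>\<^sub>F i in sequentially. R * mesh i < 1 / Suc N" by (rule order_tendstoD) simp
    have "(\<lambda>i. 8 * C * \<delta> (Suc i)) \<longlonglongrightarrow> 8 * C * 0" by (intro tendsto_intros LIMSEQ_Suc[OF \<delta>0])
    then have e4: "\<forall>\<^sub>F i in sequentially. 8 * C * \<delta> (Suc i) < \<epsilon> / 2" by (rule order_tendstoD) (use eps in simp)
    have e5: "\<forall>\<^sub>F i in sequentially. stage_prob (quot_near q N m) (Suc i) \<omega> > 1/2"
      by (rule order_tendstoD(1)[OF LIMSEQ_Suc[OF q(2)]]) simp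
    have e6: "\<forall>\<^sub>F i in sequentially. \<forall>e'. terminal S i e' \<longrightarrow> \<pi> (Suc i) ?x \<notin> bond_preimage S i e'"
      using deep by (simp add: deep_points_def)
    have "\<forall>\<^sub>F i in sequentially. \<forall>y\<in>XI \<inter> ball ?x (R * r (Suc i)). norm (f y - f ?x - (ht y - ht ?x) *\<^sub>R b) \<le> \<epsilon> * r (Suc i)"
      using e1 e2 e3 e4 e5 e6
    proof eventually_elim
      case (elim i)
      obtain e' where e': "e' \<in> E' i" "cur i \<omega> \<in> e'" using in_E'[OF cur_X] by blast
      have nt: "\<not> terminal S i e'" using elim(6) preimage_iff[OF Gam_XI, of i \<omega> e'] e'(2) by (auto simp: pi_Gam)
      \<comment> \<open>The subedge at stage \<open>i\<close> gives the scale of stage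
        \<open>Suc i\<close>; the shift of the index is undone at the end.\<close>
      have rS: "r (Suc i) = elen (sub S i) e'" unfolding r_def by (rule scale_Suc[OF e'])
      have R4: "R * elen (sub S i) e' < 1 / Suc N"
        using elim(3) mult_left_mono[OF elen_le_mesh[OF e'(1)], of R] R by linarith
      show ?case
      proof
        fix y assume "y \<in> XI \<inter> ball ?x (R * r (Suc i))"
        then have y: "y \<in> XI" "dist ?x y < R * elen (sub S i) e'" by (auto simp: rS)
        note inc = increment_bound[OF q(1) elim(5) e' nt R _ elim(2) R4 y]
        let ?r = "elen (sub S i) e'"
        have rp: "?r > 0" by (rule elen_pos[OF H e'(1)])
        have "f y - f ?x - (ht y - ht ?x) *\<^sub>R b = (f y - f ?x - (ht y - ht ?x) *\<^sub>R q) - (ht y - ht ?x) *\<^sub>R (b - q)"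
          by (simp add: algebra_simps)
        then have "norm (f y - f ?x - (ht y - ht ?x) *\<^sub>R b) \<le> norm (f y - f ?x - (ht y - ht ?x) *\<^sub>R q) + \<bar>ht y - ht ?x\<bar> * norm (b - q)"
          by (metis norm_scaleR norm_triangle_ineq4)
        also have "\<dots> \<le> (8 * C * \<delta> (Suc i) + (R + 2) / Suc m) * ?r + (R * ?r) * (2 / Suc m)"
          using inc elim(1) q(3) R rp by (intro add_mono mult_mono) auto
        also have "\<dots> = (8 * C * \<delta> (Suc i) + (3 * R + 2) * (1 / Suc m)) * ?r"
        proof -
          have "(a + (R + 2) / n) * x + (R * x) * (2 / n) = (a + (3 * R + 2) * (1 / n)) * x" for a x n :: real
            by (simp add: divide_inverse algebra_simps)
          then show ?thesis .
        qed
        also have "\<dots> \<le> (\<epsilon> / 2 + \<epsilon> / 2) * ?r"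
        proof (intro mult_right_mono add_mono)
          have "(3 * R + 2) * (1 / Suc m) \<le> (3 * R + 2) * (\<epsilon> / (2 * (3 * R + 2)))"
            using m R by (intro mult_left_mono) auto
          also have "\<dots> = \<epsilon> / 2" using R by (simp add: field_simps)
          finally show "(3 * R + 2) * (1 / Suc m) \<le> \<epsilon> / 2" .
        qed (use elim(4) rp in auto)
        finally show "norm (f y - f ?x - (ht y - ht ?x) *\<^sub>R b) \<le> \<epsilon> * r (Suc i)" by (simp add: rS)
      qed
    qed
    then show ?thesis
      by (rule eventually_sequentially_Suc[of "\<lambda>i. \<forall>y\<in>XI \<inter> ball ?x (R * r i). norm (f y - f ?x - (ht y - ht ?x) *\<^sub>R b) \<le> \<epsilon> * r i", THEN iffD1])
  qed
  show ?thesis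
    unfolding has_derivative_along_def lim r_def[symmetric]
  proof (intro allI impI limsup_eq_0I)
    fix R :: real assume R: "R \<ge> 1"
    let ?u = "\<lambda>i. SUP y\<in>XI \<inter> ball ?x (R * r i). ereal (norm (f y - f ?x - (ht y - ht ?x) *\<^sub>R b) / r i)"
    \<comment> \<open>The centre belongs to the ball, so the supremum is not over the empty set,
      where it would be minus infinity.\<close>
    have "0 \<le> ?u i" for i
    proof (rule SUP_upper2[of ?x])
      show "?x \<in> XI \<inter> ball ?x (R * r i)" using Gam_XI R r_pos[of i] by simp
    qed simp
    then show "\<forall>\<^sub>F i in sequentially. 0 \<le> ?u i" by simp
    fix \<epsilon> :: real assume "\<epsilon> > 0"
    from main[OF R this] show "\<forall>\<^sub>F i in sequentially. ?u i \<le> ereal \<epsilon>"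
    proof eventually_elim
      case (elim i)
      show ?case
        by (rule SUP_least) (use elim r_pos[of i] in \<open>auto simp: pos_divide_le_eq\<close>)
    qed
  qed
qed

end

theorem AE_has_derivative_along:
  assumes rnp: "has_RNP TYPE('b)" and \<delta>0: "\<delta> \<longlonglongrightarrow> 0"
  shows "AE x in \<nu>. x \<in> deep_points S \<pi> \<longrightarrow>
    has_derivative_along XI ht (\<lambda>i. scale S \<pi> i x) f (lim (\<lambda>i. dquot i (\<pi> i x))) x"
proof (rule AE_nu_transfer)
  show "AE \<omega> in Omega. Gam \<omega> \<in> deep_points S \<pi> \<longrightarrow>
    has_derivative_along XI ht (\<lambda>i. scale S \<pi> i (Gam \<omega>)) f (lim (\<lambda>i. dquot i (\<pi> i (Gam \<omega>)))) (Gam \<omega>)"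
    using AE_good[OF rnp] by eventually_elim (intro impI good_derivative \<delta>0)
qed

end

text \<open>Each factor exceeds 1 by \<open>2 * \<delta> i / (1 - 2 * \<delta> i)\<close>, so
  convergence of the product is absolute convergence, and this excess dominates
  \<open>\<delta> i\<close>.\<close>

lemma summable_of_convergent_prod:
  fixes \<delta> :: "nat \<Rightarrow> real"
  assumes pos: "\<And>i. \<delta> i > 0" and half: "\<And>i. \<delta> i < 1/2" and c: "convergent_prod (\<lambda>i. 1 / (1 - 2 * \<delta> i))"
  shows "summable \<delta>"
proof -
  let ?f = "\<lambda>i. 1 / (1 - 2 * \<delta> i)"
  have n: "norm (?f i - 1) = 2 * \<delta> i / (1 - 2 * \<delta> i)" for i
  proof -
    have "?f i - 1 = 2 * \<delta> i / (1 - 2 * \<delta> i)" using half[of i] by (simp add: field_simps)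
    moreover have "2 * \<delta> i / (1 - 2 * \<delta> i) \<ge> 0" using pos[of i] half[of i] by simp
    ultimately show ?thesis by (metis abs_of_nonneg real_norm_def)
  qed
  have "1 + norm (?f i - 1) = ?f i" for i unfolding n using half[of i] by (simp add: field_simps)
  then have "abs_convergent_prod ?f" using c unfolding abs_convergent_prod_def by simp
  from abs_convergent_prod_imp_summable[OF this] have "summable (\<lambda>i. 2 * \<delta> i / (1 - 2 * \<delta> i))"
    by (simp only: n)
  then show ?thesis
  proof (rule summable_comparison_test'[where N=0])
    fix i
    have "\<delta> i * (1 - 2 * \<delta> i) \<le> 2 * \<delta> i" using pos[of i] half[of i] by (simp add: algebra_simps)
    then show "norm (\<delta> i) \<le> 2 * \<delta> i / (1 - 2 * \<delta> i)" using pos[of i] half[of i] by (simp add: pos_le_divide_eq)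
  qed
qed

theorem theorem7p1:
  fixes S :: "'m::complete_space inv_system"
    and \<mu> :: "nat \<Rightarrow> 'm measure"
    and \<pi> :: "nat \<Rightarrow> 'm \<Rightarrow> 'm"
    and \<nu> :: "'m measure"
    and \<delta> :: "nat \<Rightarrow> real"
    and L :: real
    and f :: "'m \<Rightarrow> 'b::banach"
  assumes "\<exists>p q a b (\<Gamma> :: (real \<Rightarrow> 'm) set). thick_family p q a b \<Gamma>"
    and "\<And>i. \<delta> i > 0" and "decseq \<delta>" and "\<delta> \<longlonglongrightarrow> 0" and "\<delta> 0 < 1/2"
    and "convergent_prod (\<lambda>i. 1 / (1 - 2 * \<delta> i))"
    and "prodinf (\<lambda>i. 1 / (1 - 2 * \<delta> i)) \<le> L"
    and "thick_inverse_system S"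
    and "system_measures S \<mu>"
    and "\<And>i. delta_E S i \<le> \<delta> i" and "\<And>i. delta_d S i \<le> ennreal (\<delta> i)"
    and "limit_projections S \<pi>"
    and "limit_measure S \<mu> \<pi> \<nu>"
    and "has_RNP TYPE('b)"
    and "\<exists>C. C-lipschitz_on (X_inf S) f"
  shows "(AE x in \<nu>. x \<in> deep_points S \<pi> \<and>
            has_derivative_along (X_inf S) (\<lambda>y. unit_coord S (\<pi> 0 y)) (\<lambda>i. scale S \<pi> i x)
              f (deriv_inf S \<mu> \<pi> \<nu> f x) x) \<and>
         (AE x in \<nu>. x \<in> deep_points S \<pi> \<longrightarrow> (\<forall>R\<ge>1.
            limsup (\<lambda>i. SUP y\<in>X_inf S \<inter> ball x (R * scale S \<pi> i x).
              ereal (norm (f y - f x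
                           - (unit_coord S (\<pi> 0 y) - unit_coord S (\<pi> 0 x)) *\<^sub>R deriv_inf S \<mu> \<pi> \<nu> f x)
                     / scale S \<pi> i x)) = 0))"
proof -
  interpret ts: thick_system S \<pi> \<delta>
    by standard (fact assms)+
  have sum: "summable \<delta>"
    by (rule summable_of_convergent_prod[OF assms(2) ts.\<delta>_half assms(6)])
  interpret tm: thick_measure S \<pi> \<delta> \<mu> \<nu>
    by standard (fact assms sum)+
  obtain C where C: "C-lipschitz_on (X_inf S) f" using assms(15) by blast
  \<comment> \<open>Subtracting the value at the basepoint leaves all increments unchanged and
    matches the normalisation in \<open>deriv_inf\<close>.\<close>
  define g where "g = (\<lambda>y. f y - f (zero_pt S))"
  have g: "C-lipschitz_on (X_inf S) g"
    using C by (simp add: g_def lipschitz_on_def dist_norm)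
  interpret tl: thick_lip S \<pi> \<delta> \<mu> \<nu> g C
    by standard (rule g)
  have D: "deriv_inf S \<mu> \<pi> \<nu> f x = lim (\<lambda>i. tl.dquot i (\<pi> i x))" for x
    unfolding deriv_inf_def tl.dquot_def unfolding g_def ..
  have "AE x in \<nu>. x \<in> deep_points S \<pi> \<longrightarrow>
    has_derivative_along (X_inf S) (\<lambda>y. unit_coord S (\<pi> 0 y)) (\<lambda>i. scale S \<pi> i x) f (deriv_inf S \<mu> \<pi> \<nu> f x) x"
    using tl.AE_has_derivative_along[OF assms(14,4)]
    by (simp add: D has_derivative_along_def g_def ts.ht_def)
  with tm.AE_deep show ?thesis
    unfolding has_derivative_along_def by (auto elim: eventually_mono eventually_elim2)
qed

end
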